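(* Let $\eta\in\mathbb{N}$, $\gamma\in(0,\tfrac12]$, $\varepsilon>0$, set $\delta:=2+\tfrac{4}{\varepsilon}$, and let $p>\max\{\tfrac1\gamma,\delta\}$ with $p\ge\eta$. Let $q:=\tfrac{p}{p-1}$ and $\tilde q:=\tfrac{p}{p-2}$. Suppose that the pairs of kernels $(K_b,K_\sigma)$ and $(\tilde K_b,\tilde K_\sigma)$ are both admissible (in the sense defined in the context) for the constants $\gamma,\varepsilon$ and some $L>0$. Let $b,\tilde b\colon[0,T]\times\mathbb{R}^d\times\mathcal{P}_\eta(\mathbb{R}^d)\to\mathbb{R}^d$ and $\sigma,\tilde\sigma\colon[0,T]\times\mathbb{R}^d\times\mathcal{P}_\eta(\mathbb{R}^d)\to\mathbb{R}^{d\times m}$ be measurable functions such that: (i) for every bounded set $\mathcal{K}\subset\mathcal{P}_\delta(\mathbb{R}^d)$ there is a constant $C_{\mathcal K}>0$ such that $$|b(t,x,\rho)|+|\tilde b(t,x,\rho)|+|\sigma(t,x,\rho)|+|\tilde\sigma(t,x,\rho)|\le C_{\mathcal K}(1+|x|)$$ for all $\rho\in\mathcal{K}\cap\mathcal{P}_\eta(\mathbb{R}^d)$, $t\in[0,T]$, $x\in\mathbb{R}^d$; (ii) there is a constant $C_{b,\sigma}>0$ such that $$|b(t,x,\rho)-b(t,y,\nu)|+|\sigma(t,x,\rho)-\sigma(t,y,\nu)|\le C_{b,\sigma}\big(|x-y|+W_\eta(\rho,\nu)\big),$$ $$|\tilde b(t,x,\rho)-\tilde b(t,y,\nu)|+|\tilde\sigma(t,x,\rho)-\tilde\sigma(t,y,\nu)|\le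 C_{b,\sigma}\big(|x-y|+W_\eta(\rho,\nu)\big)$$ for all $t\in[0,T]$, $x,y\in\mathbb{R}^d$, $\rho,\nu\in\mathcal{P}_\eta(\mathbb{R}^d)$. Let $X_0,\tilde X_0$ be $\mathcal{F}_0$-measurable $\mathbb{R}^d$-valued random variables in $L^p(\Omega)$. Let $(X_t)_{t\in[0,T]}$ and $(\tilde X_t)_{t\in[0,T]}$ be the strong $L^p$-solutions of $$X_t=X_0+\int_0^tK_b(s,t)\,b(s,X_s,\mathcal{L}(X_s))\,ds+\int_0^tK_\sigma(s,t)\,\sigma(s,X_s,\mathcal{L}(X_s))\,dB_s,\quad t\in[0,T],$$ $$\tilde X_t=\tilde X_0+\int_0^t\tilde K_b(s,t)\,\tilde b(s,\tilde X_s,\mathcal{L}(\tilde X_s))\,ds+\int_0^t\tilde K_\sigma(s,t)\,\tilde\sigma(s,\tilde X_s,\mathcal{L}(\tilde X_s))\,dB_s,\quad t\in[0,T],$$ respectively. Then there is some constant $C>0$, depending on $b,\sigma,\tilde b,\tilde\sigma,K_b,K_\sigma,\tilde K_b,\tilde K_\sigma$ and $p$, such that $$\sup_{t\in[0,T]}\mathbb{E}\big[|X_t-\tilde X_t|^p\big]\le C\Big(\mathbb{E}\big[|X_0-\tilde X_0|^p\big]+\|b-\tilde b\|_\infty^p+\|\sigma-\tilde\sigma\|_\infty^p+\|K_b-\tilde K_b\|_q^p+\|K_\sigma-\tilde K_\sigma\|_{2\tilde q}^p\Big).$$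
   Context: Fix $T\in(0,\infty)$, $d,m\in\mathbb{N}$ and a filtered probability space $(\Omega,\mathcal{F},(\mathcal{F}_t)_{t\in[0,T]},\mathbb{P})$ satisfying the usual conditions, with an $m$-dimensional $(\mathcal{F}_t)$-Brownian motion $B$. $\mathcal{L}(X)$ denotes the law of a random variable $X$. $\mathbb{R}^d$ carries the Euclidean norm $|\cdot|$. For $r\ge1$, $\mathcal{P}_r(\mathbb{R}^d)$ is the set of Borel probability measures on $\mathbb{R}^d$ with finite $r$-th moment, and $W_r$ is the $r$-Wasserstein distance on it, $W_r(\rho,\tilde\rho)=\inf_{\pi}\big(\int|x-y|^r\,\pi(dx,dy)\big)^{1/r}$, the infimum being over all couplings $\pi$ of $\rho$ and $\tilde\rho$; bounded subsets of $\mathcal{P}_r(\mathbb{R}^d)$ are those bounded with respect to $W_r$. Set $\Delta_T:=\{(s,t)\in[0,T]^2: 0\le s\le t\le T\}$. Admissible kernels: a pair $(K_b,K_\sigma)$ of measurable functions $K_b,K_\sigma\colon\Delta_T\to\mathbb{R}$ is admissible for the constants $(\gamma,\varepsilon,L)$, where $\gamma\in(0,\frac12]$, $\varepsilon>0$, $L>0$, if for all $(t,t')\in\Delta_T$ $$\int_0^t|K_b(s,t')-K_b(s,t)|^{1+\varepsilon}ds+\int_t^{t'}|K_b(s,t')|^{1+\varepsilon}ds\le L|t'-t|^{\gamma(1+\varepsilon)},$$ $$\int_0^t|K_\sigma(s,t')-K_\sigma(s,t)|^{2+\varepsilon}ds+\int_t^{t'}|K_\sigma(s,t')|^{2+\varepsilon}ds\le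 L|t'-t|^{\gamma(2+\varepsilon)}.$$ Strong $L^p$-solution: an $(\mathcal{F}_t)$-progressively measurable process $X\in L^p(\Omega\times[0,T];\mathbb{R}^d)$ on the given probability space such that $\int_0^t\big(|K_b(s,t)b(s,X_s,\mathcal{L}(X_s))|+|K_\sigma(s,t)\sigma(s,X_s,\mathcal{L}(X_s))|^2\big)ds<\infty$ for all $t\in[0,T]$ and the integral equation holds $\mathbb{P}$-almost surely (stochastic integrals are Itô integrals). Norms: for $h\colon\Delta_T\to\mathbb{R}$ and $r\ge1$, $\|h\|_r:=\big(\sup_{t\in[0,T]}\int_0^t|h(s,t)|^r\,ds\big)^{1/r}$; for functions on $[0,T]\times\mathbb{R}^d\times\mathcal{P}_\eta(\mathbb{R}^d)$, $\|\cdot\|_\infty$ is the supremum norm (possibly $+\infty$).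
   Formalization: The constant C depends, besides the listed data, on a bound R for the p-th moments of the initial values X_0 and its tilde version; uniformity over all initial values is false (b=x, σ=0, K_b=1 against 1+a, equal deterministic initial value x_0 tending to infinity). *)

theory Defs
  imports "HOL-Probability.Probability"
begin

section \<open>Filtered probability spaces and Brownian motion\<close>

locale usual_filtered_prob_space = prob_space M
  for M :: "'w measure" and T :: real and F :: "real \<Rightarrow> 'w measure" +
  assumes T_pos: "0 < T"
    and subalgebra_F: "\<And>t. t \<in> {0..T} \<Longrightarrow> subalgebra M (F t)"
    and F_mono: "\<And>s t. 0 \<le> s \<Longrightarrow> s \<le> t \<Longrightarrow> t \<le> T \<Longrightarrow> sets (F s) \<subseteq> sets (F t)"
    and F_right_continuous: "\<And>t. t \<in> {0..<T} \<Longrightarrow> sets (F t) = (\<Inter>u\<in>{t<..T}. sets (F u))"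
    and F_complete: "\<And>N A. N \<in> null_sets M \<Longrightarrow> A \<subseteq> N \<Longrightarrow> A \<in> sets (F 0)"

text \<open>
  Only the times in \<open>{0..T}\<close> matter for \<open>F\<close>, \<open>B\<close> and all other processes below. The increment
  \<open>B t - B s\<close> has law N(0, (t - s) I), given by its density, a product of one-dimensional
  centred normal densities (whose second parameter is the standard deviation).
\<close>

locale brownian_motion = usual_filtered_prob_space M T F
  for M :: "'w measure" and T :: real and F :: "real \<Rightarrow> 'w measure" +
  fixes B :: "real \<Rightarrow> 'w \<Rightarrow> real ^ 'm"
  assumes B_adapted: "\<And>t. t \<in> {0..T} \<Longrightarrow> B t \<in> borel_measurable (F t)"
    and B_start: "AE \<omega> in M. B 0 \<omega> = 0"
    and B_continuous: "AE \<omega> in M. continuous_on {0..T} (\<lambda>t. B t \<omega>)"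
    and B_increment_indep: "\<And>s t. 0 \<le> s \<Longrightarrow> s < t \<Longrightarrow> t \<le> T \<Longrightarrow>
          indep_set (sets (F s)) {(\<lambda>\<omega>. B t \<omega> - B s \<omega>) -` A \<inter> space M | A. A \<in> sets borel}"
    and B_increment_normal: "\<And>s t. 0 \<le> s \<Longrightarrow> s < t \<Longrightarrow> t \<le> T \<Longrightarrow>
          distributed M lborel (\<lambda>\<omega>. B t \<omega> - B s \<omega>)
            (\<lambda>x. ennreal (\<Prod>i\<in>UNIV. normal_density 0 (sqrt (t - s)) (x $ i)))"

definition progressive ::
  "real \<Rightarrow> (real \<Rightarrow> 'w measure) \<Rightarrow> (real \<Rightarrow> 'w \<Rightarrow> 'a::topological_space) \<Rightarrow> bool" where
  "progressive T F X \<longleftrightarrow>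
     (\<forall>t\<in>{0..T}. (\<lambda>(s, \<omega>). X s \<omega>) \<in> borel_measurable (restrict_space borel {0..t} \<Otimes>\<^sub>M F t))"


section \<open>The It\^o integral\<close>

text \<open>
  A simple integrand is given by \<open>n\<close>, a partition \<open>\<tau> 0 \<le> \<dots> \<le> \<tau> n\<close> of a part of \<open>{0..t}\<close> and bounded
  \<open>F (\<tau> i)\<close>-measurable coefficients \<open>\<xi> i\<close>. The integral of a progressively measurable
  \<open>\<Phi>\<close> with almost surely square-integrable paths is the limit in probability of the integrals of
  simple integrands that converge to \<open>\<Phi>\<close> in \<open>L\<^sup>2(0,t)\<close> in probability. It is determined up to
  almost sure equality, so it is rendered as a relation (as \<open>has_integral\<close> is).
\<close>

definition simple_integrand :: "(real \<Rightarrow> 'w measure) \<Rightarrow> real \<Rightarrow>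
    nat \<Rightarrow> (nat \<Rightarrow> real) \<Rightarrow> (nat \<Rightarrow> 'w \<Rightarrow> real ^ 'm ^ 'd) \<Rightarrow> bool" where
  "simple_integrand F t n \<tau> \<xi> \<longleftrightarrow>
     (\<forall>i\<le>n. \<tau> i \<in> {0..t}) \<and> (\<forall>i<n. \<tau> i \<le> \<tau> (Suc i)) \<and>
     (\<forall>i<n. \<xi> i \<in> borel_measurable (F (\<tau> i)) \<and> (\<exists>c. \<forall>\<omega>\<in>space (F (\<tau> i)). norm (\<xi> i \<omega>) \<le> c))"

definition simple_process ::
  "nat \<Rightarrow> (nat \<Rightarrow> real) \<Rightarrow> (nat \<Rightarrow> 'w \<Rightarrow> real ^ 'm ^ 'd) \<Rightarrow> real \<Rightarrow> 'w \<Rightarrow> real ^ 'm ^ 'd" where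
  "simple_process n \<tau> \<xi> s \<omega> = (\<Sum>i<n. indicator {\<tau> i<..\<tau> (Suc i)} s *\<^sub>R \<xi> i \<omega>)"

definition simple_ito_integral :: "(real \<Rightarrow> 'w \<Rightarrow> real ^ 'm) \<Rightarrow>
    nat \<Rightarrow> (nat \<Rightarrow> real) \<Rightarrow> (nat \<Rightarrow> 'w \<Rightarrow> real ^ 'm ^ 'd) \<Rightarrow> 'w \<Rightarrow> real ^ 'd" where
  "simple_ito_integral B n \<tau> \<xi> \<omega> = (\<Sum>i<n. \<xi> i \<omega> *v (B (\<tau> (Suc i)) \<omega> - B (\<tau> i) \<omega>))"

definition has_ito_integral :: "'w measure \<Rightarrow> (real \<Rightarrow> 'w measure) \<Rightarrow> (real \<Rightarrow> 'w \<Rightarrow> real ^ 'm) \<Rightarrow>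
    real \<Rightarrow> (real \<Rightarrow> 'w \<Rightarrow> real ^ 'm ^ 'd) \<Rightarrow> ('w \<Rightarrow> real ^ 'd) \<Rightarrow> bool" where
  "has_ito_integral M F B t \<Phi> Y \<longleftrightarrow>
     progressive t F \<Phi> \<and>
     (AE \<omega> in M. (\<integral>\<^sup>+s\<in>{0..t}. ennreal ((norm (\<Phi> s \<omega>))\<^sup>2) \<partial>lborel) < \<infinity>) \<and>
     Y \<in> borel_measurable M \<and>
     (\<exists>n \<tau> \<xi>. (\<forall>k. simple_integrand F t (n k) (\<tau> k) (\<xi> k)) \<and>
        (\<forall>e>0. (\<lambda>k. measure M {\<omega>\<in>space M.
            (\<integral>\<^sup>+s\<in>{0..t}. ennreal ((norm (simple_process (n k) (\<tau> k) (\<xi> k) s \<omega> - \<Phi> s \<omega>))\<^sup>2) \<partial>lborel)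
              > ennreal e}) \<longlonglongrightarrow> 0) \<and>
        (\<forall>e>0. (\<lambda>k. measure M {\<omega>\<in>space M.
            norm (simple_ito_integral B (n k) (\<tau> k) (\<xi> k) \<omega> - Y \<omega>) > e}) \<longlonglongrightarrow> 0))"


section \<open>Wasserstein spaces\<close>

definition wasserstein_space :: "real \<Rightarrow> 'a::euclidean_space measure set" where
  "wasserstein_space r =
     {\<rho>. prob_space \<rho> \<and> sets \<rho> = sets borel \<and> integrable \<rho> (\<lambda>x. norm x powr r)}"

definition couplings :: "'a::euclidean_space measure \<Rightarrow> 'a measure \<Rightarrow> ('a \<times> 'a) measure set" where
  "couplings \<rho> \<nu> = {\<pi>. prob_space \<pi> \<and> sets \<pi> = sets (borel \<Otimes>\<^sub>M borel) \<and>
     distr \<pi> borel fst = \<rho> \<and> distr \<pi> borel snd = \<nu>}"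

text \<open>Meaningful only for \<open>\<rho>, \<nu> \<in> wasserstein_space r\<close>, where all the integrals are finite.\<close>

definition wasserstein :: "real \<Rightarrow> 'a::euclidean_space measure \<Rightarrow> 'a measure \<Rightarrow> real" where
  "wasserstein r \<rho> \<nu> =
     (INF \<pi>\<in>couplings \<rho> \<nu>. (\<integral>z. norm (fst z - snd z) powr r \<partial>\<pi>) powr (1 / r))"

definition wasserstein_bounded :: "real \<Rightarrow> 'a::euclidean_space measure set \<Rightarrow> bool" where
  "wasserstein_bounded r K \<longleftrightarrow> K \<subseteq> wasserstein_space r \<and>
     (\<exists>\<rho>\<^sub>0\<in>wasserstein_space r. \<exists>c. \<forall>\<rho>\<in>K. wasserstein r \<rho>\<^sub>0 \<rho> \<le> c)"

text \<open>The Borel \<open>\<sigma>\<close>-algebra of the metric space \<open>(wasserstein_space r, wasserstein r)\<close>.\<close>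

definition wasserstein_borel :: "real \<Rightarrow> 'a::euclidean_space measure measure" where
  "wasserstein_borel r = sigma (wasserstein_space r)
     {U. U \<subseteq> wasserstein_space r \<and>
         (\<forall>\<rho>\<in>U. \<exists>e>0. \<forall>\<nu>\<in>wasserstein_space r. wasserstein r \<rho> \<nu> < e \<longrightarrow> \<nu> \<in> U)}"


section \<open>Kernels, coefficients and their norms\<close>

text \<open>
  A kernel \<open>K s t\<close> is only relevant for \<open>0 \<le> s \<le> t \<le> T\<close>, and a coefficient \<open>f t x \<rho>\<close> only for
  \<open>t \<in> {0..T}\<close> and \<open>\<rho> \<in> wasserstein_space \<eta>\<close>. The norm of \<open>real ^ 'm ^ 'd\<close> is the
  Frobenius norm.
\<close>

definition Delta :: "real \<Rightarrow> (real \<times> real) set" where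
  "Delta T = {(s, t). 0 \<le> s \<and> s \<le> t \<and> t \<le> T}"

definition measurable_kernel :: "real \<Rightarrow> (real \<Rightarrow> real \<Rightarrow> real) \<Rightarrow> bool" where
  "measurable_kernel T K \<longleftrightarrow> (\<lambda>(s, t). K s t) \<in> borel_measurable (restrict_space borel (Delta T))"

definition kernel_regularity ::
  "real \<Rightarrow> real \<Rightarrow> real \<Rightarrow> real \<Rightarrow> (real \<Rightarrow> real \<Rightarrow> real) \<Rightarrow> bool" where
  "kernel_regularity T \<gamma> L r K \<longleftrightarrow>
     (\<forall>(t, t') \<in> Delta T.
        (\<integral>\<^sup>+s\<in>{0..t}. ennreal (\<bar>K s t' - K s t\<bar> powr r) \<partial>lborel) +
        (\<integral>\<^sup>+s\<in>{t..t'}. ennreal (\<bar>K s t'\<bar> powr r) \<partial>lborel)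
          \<le> ennreal (L * \<bar>t' - t\<bar> powr (\<gamma> * r)))"

definition admissible_kernels :: "real \<Rightarrow> real \<Rightarrow> real \<Rightarrow> real \<Rightarrow>
    (real \<Rightarrow> real \<Rightarrow> real) \<Rightarrow> (real \<Rightarrow> real \<Rightarrow> real) \<Rightarrow> bool" where
  "admissible_kernels T \<gamma> \<epsilon> L Kb K\<sigma> \<longleftrightarrow>
     measurable_kernel T Kb \<and> measurable_kernel T K\<sigma> \<and>
     kernel_regularity T \<gamma> L (1 + \<epsilon>) Kb \<and> kernel_regularity T \<gamma> L (2 + \<epsilon>) K\<sigma>"

definition measurable_coeff :: "real \<Rightarrow> nat \<Rightarrow>
    (real \<Rightarrow> 'a::euclidean_space \<Rightarrow> 'a measure \<Rightarrow> 'b::real_normed_vector) \<Rightarrow> bool" where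
  "measurable_coeff T \<eta> f \<longleftrightarrow> (\<lambda>(t, x, \<rho>). f t x \<rho>) \<in>
     borel_measurable (restrict_space borel {0..T} \<Otimes>\<^sub>M borel \<Otimes>\<^sub>M wasserstein_borel (real \<eta>))"

text \<open>For \<open>a > 0\<close>, the power with \<open>\<infinity>\<close> to the power \<open>a\<close> being \<open>\<infinity>\<close>.\<close>

definition ennreal_powr :: "ennreal \<Rightarrow> real \<Rightarrow> ennreal" where
  "ennreal_powr x a = (if x = \<infinity> then \<infinity> else ennreal (enn2real x powr a))"

definition kernel_norm :: "real \<Rightarrow> real \<Rightarrow> (real \<Rightarrow> real \<Rightarrow> real) \<Rightarrow> ennreal" where
  "kernel_norm T r h =
     ennreal_powr (SUP t\<in>{0..T}. \<integral>\<^sup>+s\<in>{0..t}. ennreal (\<bar>h s t\<bar> powr r) \<partial>lborel) (1 / r)"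

definition coeff_sup_norm :: "real \<Rightarrow> nat \<Rightarrow>
    (real \<Rightarrow> 'a::euclidean_space \<Rightarrow> 'a measure \<Rightarrow> 'b::real_normed_vector) \<Rightarrow> ennreal" where
  "coeff_sup_norm T \<eta> f =
     (SUP (t, x, \<rho>) \<in> {0..T} \<times> UNIV \<times> wasserstein_space (real \<eta>). ennreal (norm (f t x \<rho>)))"


section \<open>Strong solutions\<close>

text \<open>
  The integrability condition and the equation are required for each \<open>t\<close> almost surely: the
  integrands depend on \<open>t\<close>, so the stochastic integral is defined for each \<open>t\<close> separately, up to a
  null set. Since \<open>X \<in> L\<^sup>p\<close> and \<open>p \<ge> \<eta>\<close>, the law of \<open>X s\<close> lies in \<open>wasserstein_space \<eta>\<close> for
  almost every \<open>s\<close>, so the values of the coefficients outside that set do not affect the integrals.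
\<close>

definition law :: "'w measure \<Rightarrow> ('w \<Rightarrow> 'a::euclidean_space) \<Rightarrow> 'a measure" where
  "law M X = distr M borel X"

definition strong_Lp_solution :: "'w measure \<Rightarrow> real \<Rightarrow> (real \<Rightarrow> 'w measure) \<Rightarrow>
    (real \<Rightarrow> 'w \<Rightarrow> real ^ 'm) \<Rightarrow> real \<Rightarrow>
    (real \<Rightarrow> real \<Rightarrow> real) \<Rightarrow> (real \<Rightarrow> real \<Rightarrow> real) \<Rightarrow>
    (real \<Rightarrow> real ^ 'd \<Rightarrow> (real ^ 'd) measure \<Rightarrow> real ^ 'd) \<Rightarrow>
    (real \<Rightarrow> real ^ 'd \<Rightarrow> (real ^ 'd) measure \<Rightarrow> real ^ 'm ^ 'd) \<Rightarrow>
    ('w \<Rightarrow> real ^ 'd) \<Rightarrow> (real \<Rightarrow> 'w \<Rightarrow> real ^ 'd) \<Rightarrow> bool" where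
  "strong_Lp_solution M T F B p Kb K\<sigma> b \<sigma> X0 X \<longleftrightarrow>
     progressive T F X \<and>
     integrable (M \<Otimes>\<^sub>M restrict_space lborel {0..T}) (\<lambda>(\<omega>, s). norm (X s \<omega>) powr p) \<and>
     (\<forall>t\<in>{0..T}.
        (AE \<omega> in M.
           set_integrable lborel {0..t} (\<lambda>s. Kb s t *\<^sub>R b s (X s \<omega>) (law M (X s))) \<and>
           set_integrable lborel {0..t} (\<lambda>s. (norm (K\<sigma> s t *\<^sub>R \<sigma> s (X s \<omega>) (law M (X s))))\<^sup>2)) \<and>
        (\<exists>Y. has_ito_integral M F B t (\<lambda>s \<omega>. K\<sigma> s t *\<^sub>R \<sigma> s (X s \<omega>) (law M (X s))) Y \<and>
           (AE \<omega> in M. X t \<omega> =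
              X0 \<omega> + (LINT s:{0..t}|lborel. Kb s t *\<^sub>R b s (X s \<omega>) (law M (X s))) + Y \<omega>)))"

text \<open>
  On the constant of the stability estimate: it cannot be uniform over all initial values. For
  \<open>b = b' = x\<close>, \<open>Kb = 1\<close>, \<open>Kb' = 1 + a\<close> with \<open>a > 0\<close>, \<open>\<sigma> = \<sigma>' = 0\<close>, \<open>K\<sigma> = K\<sigma>'\<close> and
  \<open>X0 = X0' = x\<^sub>0\<close>, the difference of the solutions at time \<open>t\<close> is \<open>x\<^sub>0 (exp t - exp ((1 + a) t))\<close>,
  while the right-hand side does not depend on \<open>x\<^sub>0\<close>. So in the theorem the constant depends,
  besides the data, on a bound \<open>R\<close> for the \<open>p\<close>-th moments of the initial values, but not on the initial
  values and solutions themselves.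
\<close>

end

theory Submission
  imports Defs
begin

text \<open>
  Two facts about \<open>L\<^sup>p\<close>-norms with \<open>p \<ge> 2\<close> carry the proof. First, the inequality
  \<open>|a + d|\<^sup>p \<le> |a|\<^sup>p + p |a|\<^sup>p\<^sup>-\<^sup>2 \<langle>a, d\<rangle> + c (|a|\<^sup>p\<^sup>-\<^sup>2 |d|\<^sup>2 + |d|\<^sup>p)\<close>
  and the independence of Brownian increments give
  \<open>\<parallel>S\<parallel>\<^sup>2 \<le> K \<Sum>\<^sub>i \<parallel>\<xi>\<^sub>i\<parallel>\<^sup>2 (\<tau>\<^sub>i\<^sub>+\<^sub>1 - \<tau>\<^sub>i)\<close> for simple stochastic integrals \<open>S\<close>,
  without any maximal inequality. A general Ito integral is a limit in probability, so the bound
  is passed to it by approximating the truncated integrand by lagged step processes and comparing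
  the two integrals through a Lenglart estimate. Second, the \<open>W\<^sub>\<eta>\<close>-distance of two laws is at most
  the \<open>L\<^sup>p\<close>-distance of the random variables.

  Hoelder's inequality with the kernels in \<open>L\<^sup>q\<close> and \<open>L\<^sup>2\<^sup>q\<^sup>'\<close> then bounds \<open>E|X\<^sub>t|\<^sup>p\<close>, respectively
  \<open>E|X\<^sub>t - X'\<^sub>t|\<^sup>p\<close>, by the data plus a multiple of its own time integral over \<open>[0, t]\<close>, so that no
  singular Gronwall lemma is needed.
\<close>

subsection \<open>Power inequalities\<close>

text \<open>The simple integrands that witness an Ito integral converge in probability only and
  carry no moment bounds, so the estimate for simple integrals says nothing about their limit.
  Approximants that inherit the moments of the integrand have to be built separately. Means keep the
  bound of a truncated integrand and converge in L^1, and the lag keeps them adapted.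

  Hoelder in time bounds the squared L^p-size of the stochastic term by a multiple of
  \<open>A powr (2 / p)\<close>, where \<open>A\<close> is the time integral of p-th moments. Its
  power \<open>p / 2\<close> is linear in \<open>A\<close>, which is what a plain Gronwall argument
  asks for. The kernel exponents that occur, q and 2 q', stay below 1 + \<epsilon> and 2 +
  \<epsilon> precisely because p exceeds \<delta>.

  A difference of drift terms splits as K (b(X) - b'(X')) + (K - K') b'(X'). The last factor has the
  size of X' itself, so moments of the solutions must be bounded before they are compared. This is
  where the bound on the initial moments enters the constant.\<close>

lemma young_powr:
  fixes x y a b :: real
  assumes "0 \<le> x" "0 \<le> y" "1 < a" "1 < b" "1 / a + 1 / b = 1"
  shows "x * y \<le> x powr a / a + y powr b / b"
proof (cases "x = 0 \<or> y = 0")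
  case True
  then show ?thesis using assms by auto
next
  case False
  then have pos: "x > 0" "y > 0" using assms by auto
  have b: "1 - 1 / b = 1 / a" using assms by linarith
  have "exp ((1 - 1/b) *\<^sub>R (a * ln x) + (1/b) *\<^sub>R (b * ln y))
      \<le> (1 - 1/b) * exp (a * ln x) + (1/b) * exp (b * ln y)"
    by (rule convex_onD[OF exp_convex]) (use assms in auto)
  also have "(1 - 1/b) *\<^sub>R (a * ln x) + (1/b) *\<^sub>R (b * ln y) = ln x + ln y"
    unfolding b using assms by simp
  finally show ?thesis using pos unfolding b by (simp add: exp_add powr_def)
qed

text \<open>Bernoulli's inequality for real exponents: Young's inequality with second factor 1 and
  conjugate exponents \<open>r\<close> and \<open>r / (r - 1)\<close>, multiplied by
  \<open>r\<close>.\<close>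

lemma bernoulli_powr:
  fixes w r :: real
  assumes "0 \<le> w" "1 \<le> r"
  shows "1 + r * (w - 1) \<le> w powr r"
proof (cases "r = 1")
  case True
  then show ?thesis using assms by simp
next
  case False
  then have r: "1 < r" using assms by simp
  have "w * 1 \<le> w powr r / r + 1 powr (r / (r - 1)) / (r / (r - 1))"
    by (rule young_powr) (use r assms in \<open>auto simp: field_simps\<close>)
  then have "r * w \<le> r * (w powr r / r + (r - 1) / r)" using r by (intro mult_left_mono) auto
  also have "\<dots> = w powr r + (r - 1)" using r by (simp add: field_simps)
  finally show ?thesis by (simp add: algebra_simps)
qed

text \<open>Bernoulli at the point \<open>1 / y\<close>, scaled by \<open>y powr r\<close>.
  Geometrically, the tangent of the convex power at \<open>y\<close> lies below its value at 1,
  whereas Bernoulli uses the tangent at 1.\<close>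

lemma powr_tangent:
  fixes y r :: real
  assumes "0 \<le> y" "1 \<le> r"
  shows "y powr r - 1 \<le> r * y powr (r - 1) * (y - 1)"
proof (cases "y = 0")
  case True
  then show ?thesis by simp
next
  case False
  then have y: "y > 0" using assms by simp
  have "1 + r * (1/y - 1) \<le> (1/y) powr r"
    by (rule bernoulli_powr) (use y assms in auto)
  then have "(1 + r * (1/y - 1)) * y powr r \<le> (1/y) powr r * y powr r"
    by (intro mult_right_mono) auto
  also have "(1/y) powr r * y powr r = 1"
    using y by (simp flip: powr_mult)
  also have "(1 + r * (1/y - 1)) * y powr r = y powr r - r * (y powr r / y) * (y - 1)"
    using y by (simp add: field_simps)
  also have "y powr r / y = y powr (r - 1)"
    using y by (simp add: powr_diff)
  finally show ?thesis by simp
qed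

text \<open>For s < 1 the derivative of \<open>y powr s\<close> blows up at 0, so the mean value
  theorem gives no uniform constant. Passing to the exponent \<open>s + 1\<close>, where the tangent
  inequalities apply, avoids this on both sides of 1, at the price of the factor
  \<open>s + 1\<close>.\<close>

lemma powr_diff_one_bound:
  fixes y s K :: real
  assumes "0 \<le> y" "y \<le> K" "1 \<le> K" "0 \<le> s"
  shows "\<bar>y powr s - 1\<bar> \<le> (s + 1) * K powr s * \<bar>y - 1\<bar>"
proof -
  have K: "1 \<le> K powr s" using assms by (simp add: ge_one_powr_ge_zero)
  show ?thesis
  proof (cases "y \<ge> 1")
    case True
    have "y powr s - 1 \<le> y powr (s + 1) - 1" using True by (simp add: powr_mono)
    also have "\<dots> \<le> (s + 1) * y powr (s + 1 - 1) * (y - 1)"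
      by (rule powr_tangent) (use assms in auto)
    also have "\<dots> \<le> (s + 1) * K powr s * (y - 1)"
      using True assms by (intro mult_right_mono mult_left_mono) (auto intro: powr_mono2)
    finally show ?thesis using True assms by (simp add: ge_one_powr_ge_zero)
  next
    case False
    have "1 + (s + 1) * (y - 1) \<le> y powr (s + 1)"
      by (rule bernoulli_powr) (use assms in auto)
    also have "\<dots> \<le> y powr s" using False assms by (intro powr_mono') auto
    finally have "1 - y powr s \<le> (s + 1) * 1 * \<bar>y - 1\<bar>" using False
      by (simp add: algebra_simps)
    also have "\<dots> \<le> (s + 1) * K powr s * \<bar>y - 1\<bar>"
      using K assms by (intro mult_right_mono mult_left_mono) auto
    finally have "1 - y powr s \<le> (s + 1) * K powr s * \<bar>y - 1\<bar>" .
    moreover have "y powr s \<le> 1" using False assms by (intro powr_le1) auto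
    ultimately show ?thesis by simp
  qed
qed

text \<open>A second-order Taylor bound that also covers 1 \<le> r < 2, where the second derivative
  is singular at z = -1. The tangent at \<open>1 + z\<close> gives a first-order term with factor
  \<open>(1 + z) powr (r - 1)\<close>, and replacing this factor by 1 costs a multiple of
  |z|.\<close>

lemma one_plus_powr_le:
  fixes r z K :: real
  assumes "1 \<le> r" "-1 \<le> z" "1 + z \<le> K" "1 \<le> K"
  shows "(1 + z) powr r \<le> 1 + r * z + r * r * K powr (r - 1) * z\<^sup>2"
proof -
  have "(1 + z) powr r - 1 \<le> r * (1 + z) powr (r - 1) * (1 + z - 1)"
    by (rule powr_tangent) (use assms in auto)
  also have "\<dots> = r * z + r * (((1 + z) powr (r - 1) - 1) * z)"
    by (simp add: algebra_simps)
  also have "((1 + z) powr (r - 1) - 1) * z \<le> \<bar>(1 + z) powr (r - 1) - 1\<bar> * \<bar>z\<bar>"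
    by (simp flip: abs_mult)
  also have "\<dots> \<le> ((r - 1 + 1) * K powr (r - 1) * \<bar>1 + z - 1\<bar>) * \<bar>z\<bar>"
    by (intro mult_right_mono powr_diff_one_bound) (use assms in auto)
  also have "\<dots> = r * K powr (r - 1) * z\<^sup>2"
    by (simp add: power2_eq_square)
  finally show ?thesis using assms by (simp add: algebra_simps)
qed

text \<open>If \<open>a\<close> is at most twice as long as \<open>d\<close>, every term is
  dominated by a multiple of \<open>norm d powr p\<close>; this accounts for the first two summands
  of \<open>c\<close>. Otherwise the squared norm is expanded and its power \<open>p / 2\<close> is
  replaced by a Taylor polynomial, which accounts for the other two.\<close>

lemma norm_add_powr_le:
  fixes a d :: "'a::real_inner" and p :: real
  assumes p: "2 \<le> p"
  defines "c \<equiv> 3 powr p + p * 2 powr p + p + 7 * (p * p * 3 powr p)"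
  shows "norm (a + d) powr p \<le> norm a powr p + p * norm a powr (p - 2) * (a \<bullet> d)
      + c * (norm a powr (p - 2) * (norm d)\<^sup>2 + norm d powr p)"
proof (cases "norm a \<le> 2 * norm d")
  case True
  have "norm (a + d) powr p \<le> (3 * norm d) powr p"
    using True p norm_triangle_ineq[of a d] by (intro powr_mono2) auto
  then have 1: "norm (a + d) powr p \<le> 3 powr p * norm d powr p"
    by (simp add: powr_mult)
  have "- (norm a powr (p - 2) * (a \<bullet> d)) \<le> norm a powr (p - 2) * (norm a * norm d)"
    using Cauchy_Schwarz_ineq2[of a d]
    by (metis abs_ge_minus_self minus_mult_right mult_left_mono order_trans powr_ge_zero)
  also have "\<dots> = norm a powr (p - 1) * norm d"
    by (cases "a = 0") (simp_all add: powr_diff field_simps power2_eq_square)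
  also have "\<dots> \<le> (2 * norm d) powr (p - 1) * norm d"
    using True p by (intro mult_right_mono powr_mono2) auto
  also have "\<dots> = 2 powr (p - 1) * norm d powr p"
    by (cases "d = 0") (simp_all add: powr_mult powr_diff)
  also have "\<dots> \<le> 2 powr p * norm d powr p"
    by (intro mult_right_mono powr_mono) auto
  finally have 2: "- (p * (norm a powr (p - 2) * (a \<bullet> d))) \<le> p * (2 powr p * norm d powr p)"
    using p by (metis mult_left_mono minus_mult_right order_trans zero_le_numeral)
  have "(3 powr p + p * 2 powr p) * norm d powr p
      \<le> c * (norm a powr (p - 2) * (norm d)\<^sup>2 + norm d powr p)"
    using p by (intro mult_mono) (auto simp: c_def)
  then have 3: "3 powr p * norm d powr p + p * (2 powr p * norm d powr p)
      \<le> c * (norm a powr (p - 2) * (norm d)\<^sup>2 + norm d powr p)"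
    by (simp add: distrib_right)
  show ?thesis using 1 2 3 powr_ge_zero[of "norm a" p] unfolding mult.assoc by linarith
next
  case False
  then have da: "2 * norm d < norm a" by simp
  have a: "norm a > 0" using da norm_ge_zero[of d] by linarith
  define N where "N = norm a"
  have N: "N > 0" using a N_def by simp
  \<comment> \<open>The relative change of the squared norm. In this case |z| is at most 5/4, so
    \<open>1 + z\<close> stays below 3, and (5/2)^2 \<le> 7 explains the factor 7.\<close>
  define z where "z = (2 * (a \<bullet> d) + (norm d)\<^sup>2) / N\<^sup>2"
  have sq: "(norm (a + d))\<^sup>2 = N\<^sup>2 * (1 + z)"
    using N unfolding z_def N_def
    by (simp add: power2_norm_eq_inner inner_add_left inner_add_right inner_commute field_simps)
  have z1: "1 + z \<ge> 0"
    using sq N by (metis zero_le_mult_iff zero_le_power2 zero_less_power2 less_irrefl not_less)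
  have z_abs: "\<bar>z\<bar> \<le> (5/2) * norm d / N"
  proof -
    have "\<bar>2 * (a \<bullet> d) + (norm d)\<^sup>2\<bar> \<le> 2 * \<bar>a \<bullet> d\<bar> + (norm d)\<^sup>2"
      using abs_triangle_ineq[of "2 * (a \<bullet> d)" "(norm d)\<^sup>2"] by (simp add: abs_mult)
    also have "\<dots> \<le> 2 * (norm a * norm d) + (norm d)\<^sup>2"
      using Cauchy_Schwarz_ineq2[of a d] by simp
    also have "(norm d)\<^sup>2 \<le> (N / 2) * norm d"
      using da unfolding power2_eq_square N_def by (intro mult_right_mono) auto
    finally have "\<bar>2 * (a \<bullet> d) + (norm d)\<^sup>2\<bar> \<le> (5/2) * norm d * N"
      by (simp add: N_def mult.commute)
    then have "\<bar>2 * (a \<bullet> d) + (norm d)\<^sup>2\<bar> / N\<^sup>2 \<le> (5/2) * norm d * N / N\<^sup>2"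
      by (intro divide_right_mono) auto
    then show ?thesis using N by (simp add: z_def power2_eq_square)
  qed
  have "(5/2) * norm d / N \<le> 5/4" using da N by (simp add: N_def field_simps)
  then have z3: "1 + z \<le> 3" using z_abs by linarith
  have zsq: "z\<^sup>2 \<le> 7 * (norm d)\<^sup>2 / N\<^sup>2"
  proof -
    have "z\<^sup>2 = \<bar>z\<bar>\<^sup>2" by simp
    also have "\<dots> \<le> ((5/2) * norm d / N)\<^sup>2" by (intro power_mono z_abs) auto
    also have "\<dots> = (25/4) * (norm d)\<^sup>2 / N\<^sup>2" by (simp add: power2_eq_square)
    also have "\<dots> \<le> 7 * (norm d)\<^sup>2 / N\<^sup>2"
      by (intro divide_right_mono mult_right_mono) auto
    finally show ?thesis .
  qed
  define r where "r = p / 2"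
  have r: "1 \<le> r" "r \<le> p" using p by (auto simp: r_def)
  have Nr: "(N\<^sup>2) powr r = N powr p"
    using N by (simp add: r_def powr_powr flip: powr_numeral)
  have N2: "N powr p / N\<^sup>2 = N powr (p - 2)"
    using N by (simp add: powr_diff)
  \<comment> \<open>The coefficient of the quadratic term in the Taylor bound with upper bound 3 for
    \<open>1 + z\<close>.\<close>
  define k where "k = r * r * 3 powr (r - 1)"
  have k: "0 \<le> k" "k \<le> p * p * 3 powr p"
    unfolding k_def using r by (auto intro!: mult_mono)
  have "norm (a + d) powr p = ((norm (a + d))\<^sup>2) powr r"
    by (cases "norm (a + d) = 0") (simp_all add: r_def powr_powr flip: powr_numeral)
  also have "\<dots> = N powr p * (1 + z) powr r"
    unfolding sq using z1 N by (subst powr_mult) (auto simp: Nr)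
  also have "\<dots> \<le> N powr p * (1 + r * z + k * z\<^sup>2)"
    unfolding k_def using r z1 z3 by (intro mult_left_mono one_plus_powr_le) auto
  also have "\<dots> \<le> N powr p * (1 + r * z + k * (7 * (norm d)\<^sup>2 / N\<^sup>2))"
    using zsq k by (intro mult_left_mono add_left_mono) auto
  \<comment> \<open>The linear term \<open>r * z\<close> contains both the inner product and (norm
    d)^2; the second part moves to the remainder and produces the summand \<open>r\<close> in
    \<open>r + 7 * k\<close>.\<close>
  also have "\<dots> = N powr p + p * (N powr p / N\<^sup>2) * (a \<bullet> d) + (r + 7 * k) * ((N powr p / N\<^sup>2) * (norm
      d)\<^sup>2)"
    using N by (simp add: z_def r_def field_simps)
  also have "\<dots> = N powr p + p * N powr (p - 2) * (a \<bullet> d) + (r + 7 * k) * (N powr (p - 2) * (norm d)\<^sup>2)"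
    unfolding N2 ..
  also have "(r + 7 * k) * (N powr (p - 2) * (norm d)\<^sup>2)
      \<le> c * (N powr (p - 2) * (norm d)\<^sup>2 + norm d powr p)"
  proof (intro mult_mono)
    have "3 powr p + p * 2 powr p \<ge> 0" using p by auto
    then show "r + 7 * k \<le> c" using r(2) k(2) unfolding c_def by linarith
    show "0 \<le> c" using p by (auto simp: c_def)
  qed auto
  finally show ?thesis by (simp add: N_def)
qed

lemma powr_superadd:
  fixes x y r :: real
  assumes "0 \<le> x" "0 \<le> y" "1 \<le> r"
  shows "x powr r + y powr r \<le> (x + y) powr r"
proof -
  have e: "u powr r = u * u powr (r - 1)" if "u \<ge> 0" for u
    using that by (cases "u = 0") (simp_all add: powr_diff)
  have "x powr r + y powr r \<le> x * (x + y) powr (r - 1) + y * (x + y) powr (r - 1)"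
    unfolding e[OF assms(1)] e[OF assms(2)]
    using assms by (intro add_mono mult_left_mono powr_mono2) auto
  also have "\<dots> = (x + y) powr r"
    using e[of "x + y"] assms by (simp add: distrib_right)
  finally show ?thesis .
qed

text \<open>With r = p / 2, x the squared L^p-norm of a martingale and y that of its increment, the
  moment after one step is turned into a pure power. Its root is additive in y, so the steps can be
  summed. The claim is the average of two lower bounds for \<open>(x + h) powr r\<close>, Bernoulli
  for the mixed term and superadditivity for the pure term.\<close>

lemma powr_absorb:
  fixes x y r c :: real
  assumes "0 \<le> x" "0 \<le> y" "1 \<le> r" "0 \<le> c"
  shows "x powr r + c * (x powr (r - 1) * y + y powr r) \<le> (x + (2 * c + 2) * y) powr r"
proof -
  define h where "h = (2 * c + 2) * y"
  have h: "h \<ge> 0" using assms by (simp add: h_def)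
  have 1: "x powr r + x powr (r - 1) * h \<le> (x + h) powr r"
  proof (cases "x = 0")
    case True
    then show ?thesis by simp
  next
    case False
    then have x: "x > 0" using assms by simp
    have "1 + 1 * (h / x) \<le> 1 + r * ((1 + h / x) - 1)"
      using assms x h mult_right_mono[of 1 r "h / x"] by simp
    also have "\<dots> \<le> (1 + h / x) powr r"
      by (rule bernoulli_powr) (use assms x h in auto)
    finally have "x powr r * (1 + h / x) \<le> x powr r * (1 + h / x) powr r"
      by (intro mult_left_mono) auto
    also have "\<dots> = (x * (1 + h / x)) powr r"
      using x h by (subst powr_mult) auto
    also have "x * (1 + h / x) = x + h" using x by (simp add: field_simps)
    also have "x powr r * (1 + h / x) = x powr r + x powr (r - 1) * h"
      using x by (simp add: powr_diff field_simps)
    finally show ?thesis .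
  qed
  have 2: "x powr r + h powr r \<le> (x + h) powr r"
    by (rule powr_superadd) (use assms h in auto)
  \<comment> \<open>The added 2 makes the base at least 1, so that raising it to the power
    \<open>r\<close> does not decrease it.\<close>
  have "(2 * c + 2) powr 1 \<le> (2 * c + 2) powr r"
    using assms by (intro powr_mono) auto
  then have 3: "(2 * c) * y powr r \<le> h powr r"
    using assms unfolding h_def
    by (subst powr_mult) (auto intro!: mult_right_mono)
  have 4: "(2 * c) * (x powr (r - 1) * y) \<le> x powr (r - 1) * h"
    using assms by (simp add: h_def algebra_simps)
  show ?thesis using 1 2 3 4 unfolding h_def[symmetric] by (simp add: algebra_simps)
qed

lemma powr_add_le:
  fixes x y r :: real
  assumes "0 \<le> x" "0 \<le> y" "0 \<le> r"
  shows "(x + y) powr r \<le> 2 powr r * (x powr r + y powr r)"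
proof -
  have "(x + y) powr r \<le> (2 * max x y) powr r"
    using assms by (intro powr_mono2) auto
  also have "\<dots> = 2 powr r * max x y powr r" using assms by (subst powr_mult) auto
  also have "max x y powr r \<le> x powr r + y powr r"
    by (auto simp: max_def)
  finally show ?thesis by simp
qed

subsection \<open>Hoelder's inequality and Gronwall's lemma for nonnegative integrals\<close>

text \<open>Young's inequality for the normalised functions. The data are real upper bounds instead
  of the integrals themselves, which keeps infinite values out of the conclusion; bound 0 is treated
  separately because the normalisation divides by it.\<close>

lemma nn_integral_holder:
  fixes f g :: "'a \<Rightarrow> real"
  assumes [measurable]: "f \<in> borel_measurable M" "g \<in> borel_measurable M"
    and nonneg: "\<And>x. 0 \<le> f x" "\<And>x. 0 \<le> g x"
    and ab: "1 < a" "1 < b" "1 / a + 1 / b = 1"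
    and A: "(\<integral>\<^sup>+x. ennreal (f x powr a) \<partial>M) \<le> ennreal A" "0 \<le> A"
    and B: "(\<integral>\<^sup>+x. ennreal (g x powr b) \<partial>M) \<le> ennreal B" "0 \<le> B"
  shows "(\<integral>\<^sup>+x. ennreal (f x * g x) \<partial>M) \<le> ennreal (A powr (1 / a) * B powr (1 / b))"
proof (cases "A = 0 \<or> B = 0")
  case True
  have "AE x in M. f x * g x = 0"
  proof (cases "A = 0")
    case True
    then have "(\<integral>\<^sup>+x. ennreal (f x powr a) \<partial>M) = 0" using A by simp
    then have "AE x in M. ennreal (f x powr a) = 0" by (subst (asm) nn_integral_0_iff_AE) auto
    then show ?thesis by eventually_elim (use nonneg ab in auto)
  next
    case False
    then have "(\<integral>\<^sup>+x. ennreal (g x powr b) \<partial>M) = 0" using B \<open>A = 0 \<or> B = 0\<close> by simp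
    then have "AE x in M. ennreal (g x powr b) = 0" by (subst (asm) nn_integral_0_iff_AE) auto
    then show ?thesis by eventually_elim (use nonneg ab in auto)
  qed
  then have "AE x in M. ennreal (f x * g x) = 0" by eventually_elim auto
  then have "(\<integral>\<^sup>+x. ennreal (f x * g x) \<partial>M) = 0" by (subst nn_integral_0_iff_AE) auto
  then show ?thesis by simp
next
  case False
  then have pos: "A > 0" "B > 0" using A B by auto
  define \<alpha> \<beta> where "\<alpha> = A powr (1 / a)" and "\<beta> = B powr (1 / b)"
  have ab0: "\<alpha> > 0" "\<beta> > 0" using pos by (auto simp: \<alpha>_def \<beta>_def)
  have pw: "\<alpha> powr a = A" "\<beta> powr b = B" using pos ab by (auto simp: \<alpha>_def \<beta>_def powr_powr)
  have "f x * g x \<le> (\<alpha> * \<beta> / (a * A)) * f x powr a + (\<alpha> * \<beta> / (b * B)) * g x powr b" for x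
  proof -
    have "f x / \<alpha> * (g x / \<beta>) \<le> (f x / \<alpha>) powr a / a + (g x / \<beta>) powr b / b"
      by (rule young_powr) (use nonneg ab ab0 in auto)
    also have "\<dots> = f x powr a / (a * A) + g x powr b / (b * B)"
      using nonneg ab0 by (simp add: powr_divide pw mult.commute)
    finally have "\<alpha> * \<beta> * (f x / \<alpha> * (g x / \<beta>)) \<le> \<alpha> * \<beta> * (f x powr a / (a * A) + g x powr b / (b * B))"
      using ab0 by (intro mult_left_mono) auto
    then show ?thesis using ab0 by (simp add: distrib_left)
  qed
  then have "(\<integral>\<^sup>+x. ennreal (f x * g x) \<partial>M) \<le>
      (\<integral>\<^sup>+x. ennreal (\<alpha> * \<beta> / (a * A)) * ennreal (f x powr a) + ennreal (\<alpha> * \<beta> / (b * B)) * ennreal (g x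
          powr b) \<partial>M)"
    using pos ab ab0 by (intro nn_integral_mono) (simp flip: ennreal_mult ennreal_plus add: ennreal_leI)
  also have "\<dots> = ennreal (\<alpha> * \<beta> / (a * A)) * (\<integral>\<^sup>+x. ennreal (f x powr a) \<partial>M)
      + ennreal (\<alpha> * \<beta> / (b * B)) * (\<integral>\<^sup>+x. ennreal (g x powr b) \<partial>M)"
    by (subst nn_integral_add) (auto simp: nn_integral_cmult)
  also have "\<dots> \<le> ennreal (\<alpha> * \<beta> / (a * A)) * ennreal A + ennreal (\<alpha> * \<beta> / (b * B)) * ennreal B"
    by (intro add_mono mult_left_mono A B) auto
  also have "\<dots> = ennreal (\<alpha> * \<beta> / (a * A) * A + \<alpha> * \<beta> / (b * B) * B)"
    using pos ab ab0 by (simp flip: ennreal_mult ennreal_plus)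
  also have "\<alpha> * \<beta> / (a * A) * A + \<alpha> * \<beta> / (b * B) * B = \<alpha> * \<beta> * (1 / a + 1 / b)"
    using pos by (simp add: field_simps)
  finally show ?thesis unfolding ab by (simp add: \<alpha>_def \<beta>_def)
qed

lemma nn_integral_exp_Icc:
  fixes c t :: real
  assumes "0 < c" "0 \<le> t"
  shows "(\<integral>\<^sup>+s\<in>{0..t}. ennreal (exp (c * s)) \<partial>lborel) = ennreal ((exp (c * t) - 1) / c)"
proof -
  have "(\<integral>\<^sup>+s. ennreal (exp (c * s)) * indicator {0..t} s \<partial>lborel)
      = ennreal (exp (c * t) / c - exp (c * 0) / c)"
    by (rule nn_integral_FTC_Icc[where F = "\<lambda>s. exp (c * s) / c"])
      (use assms in \<open>auto intro!: derivative_eq_intros\<close>)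
  then show ?thesis by (simp add: diff_divide_distrib)
qed

text \<open>With the weight \<open>exp (- 2 * c * s)\<close> the integral term is at most half of
  the weighted supremum \<open>G\<close>, so that G \<le> a + G / 2.\<close>

lemma gronwall_ennreal:
  fixes g :: "real \<Rightarrow> ennreal"
  assumes T: "0 \<le> T" and c: "0 < c" and a: "0 \<le> a"
    and g: "\<And>t. t \<in> {0..T} \<Longrightarrow> g t \<le> ennreal a + ennreal c * (\<integral>\<^sup>+s\<in>{0..t}. g s \<partial>lborel)"
    and fin: "(\<integral>\<^sup>+s\<in>{0..T}. g s \<partial>lborel) < \<infinity>"
    and t: "t \<in> {0..T}"
  shows "g t \<le> ennreal (2 * a * exp (2 * c * T))"
proof -
  define G where "G = (SUP s\<in>{0..T}. g s * ennreal (exp (- 2 * c * s)))"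
  \<comment> \<open>Half of \<open>G\<close> can be subtracted only once \<open>G\<close> is known
    to be finite. The hypothesis with the full integral over \<open>{0..T}\<close> gives a crude
    finite bound.\<close>
  have "G \<le> ennreal a + ennreal c * (\<integral>\<^sup>+s\<in>{0..T}. g s \<partial>lborel)"
    unfolding G_def
  proof (rule SUP_least)
    fix s assume s: "s \<in> {0..T}"
    have "g s * ennreal (exp (- 2 * c * s)) \<le> g s * 1"
      using s c by (intro mult_left_mono) auto
    also have "\<dots> \<le> ennreal a + ennreal c * (\<integral>\<^sup>+u\<in>{0..s}. g u \<partial>lborel)"
      using g[OF s] by simp
    also have "(\<integral>\<^sup>+u\<in>{0..s}. g u \<partial>lborel) \<le> (\<integral>\<^sup>+u\<in>{0..T}. g u \<partial>lborel)"
      using s by (intro nn_integral_mono) (auto simp: indicator_def)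
    finally show "g s * ennreal (exp (- 2 * c * s))
        \<le> ennreal a + ennreal c * (\<integral>\<^sup>+s\<in>{0..T}. g s \<partial>lborel)"
      by (simp add: mult_left_mono)
  qed
  also have "\<dots> < \<infinity>" using fin by (simp add: ennreal_mult_less_top)
  finally have Gfin: "G < \<infinity>" .
  define H where "H = enn2real G"
  have GH: "G = ennreal H" and H: "H \<ge> 0" using Gfin by (simp_all add: H_def)
  have gs: "g s \<le> ennreal H * ennreal (exp (2 * c * s))" if s: "s \<in> {0..T}" for s
  proof -
    have "g s * ennreal (exp (- 2 * c * s)) \<le> G"
      unfolding G_def using s by (rule SUP_upper)
    then have "g s * ennreal (exp (- 2 * c * s)) * ennreal (exp (2 * c * s))
        \<le> G * ennreal (exp (2 * c * s))"
      by (intro mult_right_mono) auto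
    then show ?thesis
      by (simp add: GH mult.assoc flip: ennreal_mult exp_add)
  qed
  \<comment> \<open>Integrating \<open>exp (2 * c * s)\<close> yields the factor
    \<open>1 / (2 * c)\<close>, which cancels \<open>c\<close> and leaves \<open>H / 2\<close>. This
    is the reason for the rate 2 c in the weight.\<close>
  have bound: "g t * ennreal (exp (- 2 * c * t)) \<le> ennreal (a + H / 2)" if t: "t \<in> {0..T}" for t
  proof -
    have "(\<integral>\<^sup>+s\<in>{0..t}. g s \<partial>lborel) \<le> (\<integral>\<^sup>+s. ennreal H * (ennreal (exp (2 * c * s)) * indicator {0..t}
        s) \<partial>lborel)"
      using gs t by (intro nn_integral_mono) (auto simp: indicator_def)
    also have "\<dots> = ennreal H * ennreal ((exp (2 * c * t) - 1) / (2 * c))"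
      using nn_integral_exp_Icc[of "2 * c" t] c t by (subst nn_integral_cmult) auto
    also have "\<dots> \<le> ennreal (H * exp (2 * c * t) / (2 * c))"
      using c H by (subst ennreal_mult[symmetric]) (auto intro!: ennreal_leI simp: field_simps
        t[simplified] mult_left_mono)
    finally have "g t \<le> ennreal a + ennreal c * ennreal (H * exp (2 * c * t) / (2 * c))"
      using g[OF t] by (meson add_left_mono mult_left_mono order_trans zero_le)
    also have "\<dots> = ennreal (a + H * exp (2 * c * t) / 2)"
      using a c H by (simp flip: ennreal_mult ennreal_plus)
    finally have "g t * ennreal (exp (- 2 * c * t))
        \<le> ennreal (a + H * exp (2 * c * t) / 2) * ennreal (exp (- 2 * c * t))"
      by (intro mult_right_mono) auto
    also have "\<dots> = ennreal (a * exp (- 2 * c * t) + H / 2)"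
      using a H by (simp add: distrib_right flip: ennreal_mult exp_add)
    also have "\<dots> \<le> ennreal (a + H / 2)"
      using a c t by (intro ennreal_leI add_right_mono) (auto intro!: mult_left_le)
    finally show ?thesis .
  qed
  then have "G \<le> ennreal (a + H / 2)" unfolding G_def by (rule SUP_least)
  then have "H \<le> 2 * a" using a H unfolding GH by (subst (asm) ennreal_le_iff) auto
  have "g t \<le> ennreal H * ennreal (exp (2 * c * t))" using gs[OF t] .
  also have "\<dots> \<le> ennreal (2 * a) * ennreal (exp (2 * c * T))"
    using \<open>H \<le> 2 * a\<close> t c by (intro mult_mono ennreal_leI) auto
  finally show ?thesis using a by (simp flip: ennreal_mult)
qed

subsection \<open>Moments of Brownian increments\<close>

lemma norm_matrix_vector_le:
  fixes A :: "real ^ 'm ^ 'd" and x :: "real ^ 'm"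
  shows "norm (A *v x) \<le> norm A * norm x"
proof -
  have "norm (A *v x) = L2_set (\<lambda>i. \<bar>A $ i \<bullet> x\<bar>) UNIV"
    by (simp add: norm_vec_def matrix_mult_dot)
  also have "\<dots> \<le> L2_set (\<lambda>i. norm x * norm (A $ i)) UNIV"
    by (intro L2_set_mono) (simp_all add: Cauchy_Schwarz_ineq2 mult.commute[of "norm x"])
  also have "\<dots> = norm A * norm x"
    by (simp add: L2_set_right_distrib[symmetric] norm_vec_def)
  finally show ?thesis .
qed

lemma bounded_bilinear_matrix_vector:
  "bounded_bilinear ((*v) :: real ^ 'm ^ 'd \<Rightarrow> real ^ 'm \<Rightarrow> real ^ 'd)"
  by (rule bounded_bilinear.intro)
    (auto simp: matrix_vector_mult_add_rdistrib matrix_vector_right_distrib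
      scaleR_matrix_vector_assoc matrix_vector_mult_scaleR intro!: exI[of _ 1] norm_matrix_vector_le)

lemma borel_measurable_matrix_vector [measurable (raw)]:
  fixes f :: "'a \<Rightarrow> real ^ 'm ^ 'd" and g :: "'a \<Rightarrow> real ^ 'm"
  assumes "f \<in> borel_measurable N" "g \<in> borel_measurable N"
  shows "(\<lambda>x. f x *v g x) \<in> borel_measurable N"
  using assms
  by (rule borel_measurable_continuous_Pair)
    (intro bounded_bilinear.continuous_on[OF bounded_bilinear_matrix_vector] continuous_intros)

lemma sum_powr_le:
  fixes a :: "'i \<Rightarrow> real"
  assumes "finite I" "\<And>i. i \<in> I \<Longrightarrow> 0 \<le> a i" "0 \<le> p"
  shows "(\<Sum>i\<in>I. a i) powr p \<le> real (card I) powr p * (\<Sum>i\<in>I. a i powr p)"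
proof (cases "I = {}")
  case True
  then show ?thesis by simp
next
  case False
  define m where "m = Max (a ` I)"
  have "m \<in> a ` I" unfolding m_def using False assms by (intro Max_in) auto
  then obtain j where j: "j \<in> I" "m = a j" by auto
  have "(\<Sum>i\<in>I. a i) \<le> real (card I) * a j"
    using assms(1) unfolding j(2)[symmetric] by (intro sum_bounded_above) (auto simp: m_def)
  then have "(\<Sum>i\<in>I. a i) powr p \<le> (real (card I) * a j) powr p"
    using assms by (intro powr_mono2 sum_nonneg) auto
  also have "\<dots> = real (card I) powr p * a j powr p"
    using assms j by (intro powr_mult)
  also have "a j powr p \<le> (\<Sum>i\<in>I. a i powr p)"
    using assms j by (intro member_le_sum) auto
  finally show ?thesis by (simp add: mult_left_mono)
qed

lemma powr_mix_le:
  fixes x y p \<alpha> :: real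
  assumes "0 \<le> x" "0 \<le> y" "0 \<le> \<alpha>" "\<alpha> \<le> p"
  shows "x powr (p - \<alpha>) * y powr \<alpha> \<le> x powr p + y powr p"
proof -
  have "x powr (p - \<alpha>) * y powr \<alpha> \<le> max x y powr (p - \<alpha>) * max x y powr \<alpha>"
    using assms by (intro mult_mono powr_mono2) auto
  also have "\<dots> = max x y powr p" by (simp flip: powr_add)
  also have "\<dots> \<le> x powr p + y powr p" by (auto simp: max_def)
  finally show ?thesis .
qed

text \<open>The library moments have integer exponents; |x|^p is dominated by the sum of the moments
  of order 0 and ceiling p.\<close>

lemma integrable_std_normal_abs_powr:
  assumes "0 \<le> p"
  shows "integrable lborel (\<lambda>x. std_normal_density x * \<bar>x\<bar> powr p)"
proof -
  define k where "k = nat \<lceil>p\<rceil>"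
  have k: "p \<le> real k" by (simp add: k_def) linarith
  have "integrable lborel (\<lambda>x. std_normal_density x * \<bar>x\<bar> ^ 0 + std_normal_density x * \<bar>x\<bar> ^ k)"
    by (intro Bochner_Integration.integrable_add integrable_std_normal_moment_abs)
  then show ?thesis
  proof (rule Bochner_Integration.integrable_bound)
    have "\<bar>x\<bar> powr p \<le> \<bar>x\<bar> ^ 0 + \<bar>x\<bar> ^ k" for x :: real
    proof (cases "\<bar>x\<bar> \<le> 1")
      case True
      then have "\<bar>x\<bar> powr p \<le> 1" using assms by (intro powr_le1) auto
      then show ?thesis by (simp add: add_increasing2)
    next
      case False
      then have "\<bar>x\<bar> powr p \<le> \<bar>x\<bar> powr real k" using k by (intro powr_mono) auto
      then show ?thesis using False by (simp add: powr_realpow)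
    qed
    then have "std_normal_density x * \<bar>x\<bar> powr p
        \<le> std_normal_density x * \<bar>x\<bar> ^ 0 + std_normal_density x * \<bar>x\<bar> ^ k" for x
      by (metis distrib_left mult_left_mono normal_density_nonneg)
    then show "AE x in lborel. norm (std_normal_density x * \<bar>x\<bar> powr p)
        \<le> norm (std_normal_density x * \<bar>x\<bar> ^ 0 + std_normal_density x * \<bar>x\<bar> ^ k)"
      by (intro AE_I2) (smt (verit) norm_ge_zero normal_density_nonneg powr_ge_zero real_norm_def
        mult_nonneg_nonneg)
  qed simp
qed

definition gauss_abs_moment :: "real \<Rightarrow> real" where
  "gauss_abs_moment p = (\<integral>x. std_normal_density x * \<bar>x\<bar> powr p \<partial>lborel)"

lemma gauss_abs_moment_nonneg: "0 \<le> gauss_abs_moment p"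
  unfolding gauss_abs_moment_def by (intro integral_nonneg_AE AE_I2) auto

lemma (in prob_space) normal_abs_moment:
  assumes X: "distributed M lborel X (normal_density 0 s)" and s: "0 < s" and p: "0 \<le> p"
  shows "integrable M (\<lambda>\<omega>. \<bar>X \<omega>\<bar> powr p)"
    and "expectation (\<lambda>\<omega>. \<bar>X \<omega>\<bar> powr p) = s powr p * gauss_abs_moment p"
proof -
  have Z: "distributed M lborel (\<lambda>x. (X x - 0) / s) std_normal_density"
    using X normal_standard_normal_convert[OF s, of X 0] by simp
  have eq: "\<bar>X \<omega>\<bar> powr p = s powr p * \<bar>(X \<omega> - 0) / s\<bar> powr p" for \<omega>
    using s by (simp add: abs_divide powr_divide)
  have "integrable M (\<lambda>\<omega>. \<bar>(X \<omega> - 0) / s\<bar> powr p)"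
    using distributed_integrable[OF Z, of "\<lambda>x. \<bar>x\<bar> powr p"] integrable_std_normal_abs_powr[OF p]
    by simp
  then show "integrable M (\<lambda>\<omega>. \<bar>X \<omega>\<bar> powr p)" unfolding eq by (rule integrable_mult_right)
  have "expectation (\<lambda>\<omega>. \<bar>(X \<omega> - 0) / s\<bar> powr p) = gauss_abs_moment p"
    using distributed_integral[OF Z, of "\<lambda>x. \<bar>x\<bar> powr p"] by (simp add: gauss_abs_moment_def)
  then show "expectation (\<lambda>\<omega>. \<bar>X \<omega>\<bar> powr p) = s powr p * gauss_abs_moment p"
    unfolding eq by simp
qed

lemma Basis_real_vec: "(Basis :: (real ^ 'n) set) = (\<lambda>i. axis i 1) ` UNIV"
  by (auto simp: Basis_vec_def)

context usual_filtered_prob_space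
begin

lemma space_F: "t \<in> {0..T} \<Longrightarrow> space (F t) = space M"
  using subalgebra_F by (auto simp: subalgebra_def)

lemma measurable_F_mono:
  assumes "0 \<le> s" "s \<le> t" "t \<le> T" "f \<in> measurable (F s) N"
  shows "f \<in> measurable (F t) N"
proof (rule measurable_from_subalg[OF _ assms(4)])
  show "subalgebra (F t) (F s)"
    using F_mono[OF assms(1-3)] space_F[of s] space_F[of t] assms by (auto simp: subalgebra_def)
qed

lemma measurable_F_M:
  assumes "t \<in> {0..T}" "f \<in> measurable (F t) N"
  shows "f \<in> measurable M N"
  by (rule measurable_from_subalg[OF subalgebra_F[OF assms(1)] assms(2)])

end

section \<open>Law, moments and independence of the increments\<close>

context brownian_motion
begin

text \<open>Marginal of a product density. The event only restricts coordinate \<open>j\<close>, so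
  the integral over the space factorises over the basis and all other factors are 1.\<close>

lemma increment_component_normal:
  assumes st: "0 \<le> s" "s < t" "t \<le> T"
  shows "distributed M lborel (\<lambda>\<omega>. (B t \<omega> - B s \<omega>) $ j) (normal_density 0 (sqrt (t - s)))"
proof -
  define \<sigma> where "\<sigma> = sqrt (t - s)"
  have \<sigma>: "\<sigma> > 0" using st by (simp add: \<sigma>_def)
  note D = B_increment_normal[OF st, folded \<sigma>_def]
  have meas: "(\<lambda>\<omega>. B t \<omega> - B s \<omega>) \<in> measurable M lborel"
    using D by (simp add: distributed_def)
  then have mB: "(\<lambda>\<omega>. B t \<omega> - B s \<omega>) \<in> borel_measurable M" by simp
  have mX: "(\<lambda>\<omega>. (B t \<omega> - B s \<omega>) $ j) \<in> borel_measurable M"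
    by (rule measurable_compose[OF mB borel_measurable_nth])
  have one: "(\<integral>\<^sup>+x. ennreal (normal_density 0 \<sigma> x) \<partial>lborel) = 1"
    using \<sigma> by (subst nn_integral_eq_integral) auto
  have "distr M lborel (\<lambda>\<omega>. (B t \<omega> - B s \<omega>) $ j) = density lborel (normal_density 0 \<sigma>)"
  proof (rule measure_eqI)
    fix A assume "A \<in> sets (distr M lborel (\<lambda>\<omega>. (B t \<omega> - B s \<omega>) $ j))"
    then have A [measurable]: "A \<in> sets borel" by simp
    \<comment> \<open>The indicator is attached to the factor of the basis vector
      \<open>axis j 1\<close>; thus the whole integrand is a product of functions of one coordinate
      each.\<close>
    define h where "h b y = ennreal (normal_density 0 \<sigma> y) * (if b
        = (axis j 1 :: real ^ 'm) then indicator A y else 1)" for b y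
    have [measurable]: "h b \<in> borel_measurable borel" for b unfolding h_def by auto
    have "emeasure (distr M lborel (\<lambda>\<omega>. (B t \<omega> - B s \<omega>) $ j)) A
        = (\<integral>\<^sup>+\<omega>. indicator A ((B t \<omega> - B s \<omega>) $ j) \<partial>M)"
      using mX by (subst emeasure_distr)
        (auto simp: nn_integral_indicator[symmetric] simp del: nn_integral_indicator
          intro!: nn_integral_cong split: split_indicator)
    also have "\<dots> = (\<integral>\<^sup>+x. ennreal (\<Prod>i\<in>UNIV. normal_density 0 \<sigma> (x $ i)) * indicator A (x $ j) \<partial>lborel)"
      by (rule distributed_nn_integral[OF D, symmetric]) measurable
    also have "\<dots> = (\<integral>\<^sup>+x. (\<Prod>b\<in>Basis. h b (x \<bullet> b)) \<partial>lborel)"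
    proof (intro nn_integral_cong)
      fix x :: "real ^ 'm"
      have "(\<Prod>b\<in>Basis. h b (x \<bullet> b)) = (\<Prod>i\<in>UNIV. h (axis i 1) (x $ i))"
        unfolding Basis_real_vec
        by (subst prod.reindex) (auto simp: inj_on_def axis_eq_axis inner_axis)
      also have "\<dots> = (\<Prod>i\<in>UNIV. ennreal (normal_density 0 \<sigma> (x $ i))) * (\<Prod>i\<in>UNIV. if i
          = j then indicator A (x $ i) else 1)"
        unfolding h_def prod.distrib by (simp add: axis_eq_axis)
      also have "\<dots> = ennreal (\<Prod>i\<in>UNIV. normal_density 0 \<sigma> (x $ i)) * indicator A (x $ j)"
        by (subst prod_ennreal) auto
      finally show "ennreal (\<Prod>i\<in>UNIV. normal_density 0 \<sigma> (x $ i)) * indicator A (x $ j)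
          = (\<Prod>b\<in>Basis. h b (x \<bullet> b))" ..
    qed
    also have "\<dots> = (\<Prod>b\<in>Basis. \<integral>\<^sup>+x. h b x \<partial>lborel)"
      by (rule nn_integral_lborel_prod) auto
    also have "\<dots> = (\<Prod>i\<in>UNIV. \<integral>\<^sup>+x. h (axis i 1) x \<partial>lborel)"
      unfolding Basis_real_vec by (subst prod.reindex) (auto simp: inj_on_def axis_eq_axis)
    also have "\<dots> = (\<Prod>i\<in>UNIV. if i = j then \<integral>\<^sup>+x. ennreal (normal_density 0 \<sigma> x) * indicator A x \<partial>lborel
        else 1)"
      by (intro prod.cong) (auto simp: h_def axis_eq_axis one)
    also have "\<dots> = emeasure (density lborel (normal_density 0 \<sigma>)) A"
      by (simp add: emeasure_density)
    finally show "emeasure (distr M lborel (\<lambda>\<omega>. (B t \<omega> - B s \<omega>) $ j)) A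
      = emeasure (density lborel (normal_density 0 \<sigma>)) A" .
  qed simp
  then show ?thesis using mX by (auto simp: distributed_def \<sigma>_def)
qed

lemma increment_measurable:
  assumes "0 \<le> s" "s \<le> t" "t \<le> T"
  shows "(\<lambda>\<omega>. B t \<omega> - B s \<omega>) \<in> borel_measurable (F t)"
  using B_adapted[of t] measurable_F_mono[OF assms B_adapted[of s]] assms
  by (intro borel_measurable_diff) auto

text \<open>The Euclidean norm is at most the sum of the absolute coordinates. The power of that sum
  costs \<open>CARD('m) powr p\<close>, and the number of equal coordinate moments gives one more
  factor \<open>CARD('m)\<close>.\<close>

lemma increment_norm_moment:
  assumes st: "0 \<le> s" "s < t" "t \<le> T" and p: "0 \<le> p"
  shows "integrable M (\<lambda>\<omega>. norm (B t \<omega> - B s \<omega>) powr p)"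
    and "expectation (\<lambda>\<omega>. norm (B t \<omega> - B s \<omega>) powr p)
      \<le> real CARD('m) powr (p + 1) * gauss_abs_moment p * (t - s) powr (p / 2)"
proof -
  let ?D = "\<lambda>\<omega>. B t \<omega> - B s \<omega>"
  have m: "?D \<in> borel_measurable M"
    by (rule measurable_F_M[of t]) (use st increment_measurable in auto)
  note N = increment_component_normal[OF st]
  have pos: "0 < sqrt (t - s)" using st by simp
  note I = normal_abs_moment(1)[OF N pos p] and E = normal_abs_moment(2)[OF N pos p]
  have le: "norm (?D \<omega>) powr p \<le> real CARD('m) powr p * (\<Sum>j\<in>UNIV. \<bar>?D \<omega> $ j\<bar> powr p)" for \<omega>
  proof -
    have "norm (?D \<omega>) powr p \<le> (\<Sum>j\<in>UNIV. \<bar>?D \<omega> $ j\<bar>) powr p"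
      using p by (intro powr_mono2 norm_le_l1_cart) auto
    also have "\<dots> \<le> real CARD('m) powr p * (\<Sum>j\<in>UNIV. \<bar>?D \<omega> $ j\<bar> powr p)"
      using p by (intro sum_powr_le) auto
    finally show ?thesis .
  qed
  have IS: "integrable M (\<lambda>\<omega>. real CARD('m) powr p * (\<Sum>j\<in>UNIV. \<bar>?D \<omega> $ j\<bar> powr p))"
    by (intro integrable_mult_right Bochner_Integration.integrable_sum I)
  show int: "integrable M (\<lambda>\<omega>. norm (?D \<omega>) powr p)"
    by (rule Bochner_Integration.integrable_bound[OF IS])
      (use m le in \<open>auto intro!: AE_I2 order_trans[OF le]\<close>)
  have "expectation (\<lambda>\<omega>. norm (?D \<omega>) powr p) \<le> expectation (\<lambda>\<omega>. real CARD('m) powr p * (\<Sum>j\<in>UNIV. \<bar>?D \<omega> $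
      j\<bar> powr p))"
    by (intro integral_mono int IS le)
  also have "\<dots> = real CARD('m) powr p * (\<Sum>j\<in>(UNIV :: 'm set). sqrt (t - s) powr p * gauss_abs_moment p)"
    by (subst integral_mult_right_zero, subst Bochner_Integration.integral_sum) (simp_all only: I E)
  also have "\<dots> = real CARD('m) powr (p + 1) * gauss_abs_moment p * (t - s) powr (p / 2)"
  proof -
    have "sqrt (t - s) powr p = (t - s) powr (p / 2)"
      using st by (subst powr_half_sqrt[symmetric]) (auto simp: powr_powr)
    then show ?thesis by (simp add: powr_add)
  qed
  finally show "expectation (\<lambda>\<omega>. norm (?D \<omega>) powr p)
      \<le> real CARD('m) powr (p + 1) * gauss_abs_moment p * (t - s) powr (p / 2)" .
qed

text \<open>Turns the set-theoretic independence of the past and the increment into independence of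
  random variables: \<open>U\<close> generates a subalgebra of \<open>F s\<close>, and a Borel
  function of the increment generates nothing beyond the preimages under the increment.\<close>

lemma increment_indep_var:
  assumes st: "0 \<le> s" "s < t" "t \<le> T"
    and U: "U \<in> borel_measurable (F s)" and g: "g \<in> borel_measurable borel"
  shows "indep_var borel (U :: 'w \<Rightarrow> real) borel (\<lambda>\<omega>. g (B t \<omega> - B s \<omega>) :: real)"
proof -
  let ?D = "\<lambda>\<omega>. B t \<omega> - B s \<omega>"
  have s: "s \<in> {0..T}" using st by auto
  have mD: "?D \<in> borel_measurable M"
    by (rule measurable_F_M[of t]) (use st increment_measurable in auto)
  have mU: "U \<in> borel_measurable M" by (rule measurable_F_M[OF s U])
  have mg: "(\<lambda>\<omega>. g (?D \<omega>)) \<in> borel_measurable M" using measurable_compose[OF mD g] .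
  have "sigma_sets (space M) {U -` A \<inter> space M |A. A \<in> sets borel} \<subseteq> sets (F s)"
    using measurable_sets[OF U] unfolding space_F[OF s, symmetric]
    by (intro sets.sigma_sets_subset) auto
  moreover have "sigma_sets (space M) {(\<lambda>\<omega>. g (?D \<omega>)) -` A \<inter> space M |A. A \<in> sets borel}
      \<subseteq> {?D -` A \<inter> space M |A. A \<in> sets borel}"
  proof -
    have e: "{?D -` A \<inter> space M |A. A \<in> sets borel} = sets (vimage_algebra (space M) ?D borel)"
      by (subst sets_vimage_algebra2) auto
    have "{(\<lambda>\<omega>. g (?D \<omega>)) -` A \<inter> space M |A. A \<in> sets borel} \<subseteq> {?D -` A \<inter> space M |A. A \<in> sets borel}"
    proof clarify
      fix A :: "real set" assume "A \<in> sets borel"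
      then have "g -` A \<in> sets borel" using measurable_sets[OF g, of A] by simp
      then show "\<exists>A'. (\<lambda>\<omega>. g (?D \<omega>)) -` A \<inter> space M = ?D -` A' \<inter> space M \<and> A' \<in> sets borel"
        by (intro exI[of _ "g -` A"]) auto
    qed
    then show ?thesis unfolding e
      using sets.sigma_sets_subset[of _ "vimage_algebra (space M) ?D borel"] by simp
  qed
  ultimately have "indep_set (sigma_sets (space M) {U -` A \<inter> space M |A. A \<in> sets borel})
      (sigma_sets (space M) {(\<lambda>\<omega>. g (?D \<omega>)) -` A \<inter> space M |A. A \<in> sets borel})"
    using B_increment_indep[OF st] unfolding indep_sets2_eq by (meson order_trans subsetD)
  then show ?thesis using mU mg unfolding indep_var_eq by blast
qed

lemma increment_expectation_zero:
  assumes st: "0 \<le> s" "s < t" "t \<le> T"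
  shows "integrable M (\<lambda>\<omega>. (B t \<omega> - B s \<omega>) $ j)"
    and "expectation (\<lambda>\<omega>. (B t \<omega> - B s \<omega>) $ j) = 0"
proof -
  have pos: "0 < sqrt (t - s)" using st by simp
  note N = increment_component_normal[OF st, of j]
  show "expectation (\<lambda>\<omega>. (B t \<omega> - B s \<omega>) $ j) = 0"
    by (rule normal_distributed_expectation[OF pos N])
  show "integrable M (\<lambda>\<omega>. (B t \<omega> - B s \<omega>) $ j)"
    by (rule distributed_integrable_var[OF N])
      (use integrable_normal_moment_nz_1[OF pos] in auto)
qed

end

subsection \<open>Moments of simple stochastic integrals\<close>

text \<open>Hoelder with the exponents \<open>p / (p - 2)\<close> and \<open>p / 2\<close>. For p =
  2 the first exponent degenerates, and the bound is checked by hand.\<close>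

lemma integral_powr_mix:
  fixes U V :: "'a \<Rightarrow> real"
  assumes p: "2 \<le> p" and [measurable]: "U \<in> borel_measurable N" "V \<in> borel_measurable N"
    and nn: "\<And>x. 0 \<le> U x" "\<And>x. 0 \<le> V x"
    and iU: "integrable N (\<lambda>x. U x powr p)" and iV: "integrable N (\<lambda>x. V x powr p)"
  shows "integrable N (\<lambda>x. U x powr (p - 2) * (V x)\<^sup>2)"
    and "(\<integral>x. U x powr (p - 2) * (V x)\<^sup>2 \<partial>N)
      \<le> (\<integral>x. U x powr p \<partial>N) powr ((p - 2) / p) * (\<integral>x. V x powr p \<partial>N) powr (2 / p)"
proof -
  have sq: "(V x)\<^sup>2 = V x powr 2" for x using nn by simp
  show int: "integrable N (\<lambda>x. U x powr (p - 2) * (V x)\<^sup>2)"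
  proof (rule Bochner_Integration.integrable_bound[OF Bochner_Integration.integrable_add[OF iU iV]])
    show "AE x in N. norm (U x powr (p - 2) * (V x)\<^sup>2) \<le> norm (U x powr p + V x powr p)"
      unfolding sq using powr_mix_le[of "U _" "V _" 2 p] nn p by (intro AE_I2) simp
  qed simp
  define A B where "A = (\<integral>x. U x powr p \<partial>N)" and "B = (\<integral>x. V x powr p \<partial>N)"
  have AB: "0 \<le> A" "0 \<le> B" unfolding A_def B_def by simp_all
  have nA: "(\<integral>\<^sup>+x. ennreal (U x powr p) \<partial>N) = ennreal A"
    unfolding A_def by (rule nn_integral_eq_integral[OF iU]) simp
  have nB: "(\<integral>\<^sup>+x. ennreal (V x powr p) \<partial>N) = ennreal B"
    unfolding B_def by (rule nn_integral_eq_integral[OF iV]) simp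
  have "(\<integral>x. U x powr (p - 2) * (V x)\<^sup>2 \<partial>N) \<le> A powr ((p - 2) / p) * B powr (2 / p)"
  proof (cases "p = 2")
    case True
    \<comment> \<open>By convention \<open>0 powr 0 = 0\<close>, so for p = 2 and A = 0 the
      right-hand side is 0. The left-hand side vanishes by the same convention, since
      \<open>U\<close> is 0 almost everywhere.\<close>
    show ?thesis
    proof (cases "A = 0")
      case True
      have "AE x in N. ennreal (U x powr p) = 0"
        using nA unfolding True ennreal_0 by (subst (asm) nn_integral_0_iff_AE) auto
      then have "AE x in N. U x powr (p - 2) * (V x)\<^sup>2 = 0"
        by eventually_elim (use nn in auto)
      then have "(\<integral>x. U x powr (p - 2) * (V x)\<^sup>2 \<partial>N) = 0" by (rule integral_eq_zero_AE)
      then show ?thesis by simp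
    next
      case False
      have "(\<integral>x. U x powr (p - 2) * (V x)\<^sup>2 \<partial>N) \<le> B"
        unfolding B_def by (rule integral_mono[OF int iV]) (simp add: True sq)
      then show ?thesis using False AB True by simp
    qed
  next
    case False
    then have p2: "p > 2" using p by simp
    have "(\<integral>\<^sup>+x. ennreal (U x powr (p - 2) * (V x)\<^sup>2) \<partial>N)
       \<le> ennreal (A powr (1 / (p / (p - 2))) * B powr (1 / (p / 2)))"
    proof (rule nn_integral_holder)
      show "(\<integral>\<^sup>+x. ennreal ((U x powr (p - 2)) powr (p / (p - 2))) \<partial>N) \<le> ennreal A"
        using p2 nA by (simp add: powr_powr)
      show "(\<integral>\<^sup>+x. ennreal ((V x)\<^sup>2 powr (p / 2)) \<partial>N) \<le> ennreal B"
        unfolding sq using p2 nB by (simp add: powr_powr)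
      show "1 / (p / (p - 2)) + 1 / (p / 2) = 1" using p2 by (simp add: field_simps)
    qed (use p2 AB in auto)
    then show ?thesis using int
      by (subst (asm) nn_integral_eq_integral) (auto simp: AB)
  qed
  then show "(\<integral>x. U x powr (p - 2) * (V x)\<^sup>2 \<partial>N)
      \<le> (\<integral>x. U x powr p \<partial>N) powr ((p - 2) / p) * (\<integral>x. V x powr p \<partial>N) powr (2 / p)"
    by (simp add: A_def B_def)
qed

lemma simple_integrandD:
  assumes "simple_integrand F t n \<tau> \<xi>"
  shows "\<And>i. i \<le> n \<Longrightarrow> \<tau> i \<in> {0..t}" "\<And>i. i < n \<Longrightarrow> \<tau> i \<le> \<tau> (Suc i)"
    "\<And>i. i < n \<Longrightarrow> \<xi> i \<in> borel_measurable (F (\<tau> i))"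
    "\<And>i. i < n \<Longrightarrow> \<exists>c. \<forall>\<omega>\<in>space (F (\<tau> i)). norm (\<xi> i \<omega>) \<le> c"
  using assms unfolding simple_integrand_def by blast+

context brownian_motion
begin

text \<open>In terms of the squared L^p-norm, one increment adds at most a constant times the
  squared norm of \<xi> times \<open>t - s\<close>. The first-order term of the power expansion has
  expectation 0, the mixed second-order term is split by Hoelder, and both remainders are absorbed
  into one power.\<close>

lemma martingale_step:
  fixes X :: "'w \<Rightarrow> real ^ 'd" and \<xi> :: "'w \<Rightarrow> real ^ 'm ^ 'd"
  assumes st: "0 \<le> s" "s < t" "t \<le> T" and p: "2 \<le> p"
    and X: "X \<in> borel_measurable (F s)" "integrable M (\<lambda>\<omega>. norm (X \<omega>) powr p)"
    and \<xi>: "\<xi> \<in> borel_measurable (F s)" "integrable M (\<lambda>\<omega>. norm (\<xi> \<omega>) powr p)"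
    and k: "\<And>r. r \<in> {2, p} \<Longrightarrow> expectation (\<lambda>\<omega>. norm (B t \<omega> - B s \<omega>) powr r) \<le> k * (t - s) powr (r / 2)"
    and c: "c = 3 powr p + p * 2 powr p + p + 7 * (p * p * 3 powr p)"
  shows "integrable M (\<lambda>\<omega>. norm (X \<omega> + \<xi> \<omega> *v (B t \<omega> - B s \<omega>)) powr p)"
    and "expectation (\<lambda>\<omega>. norm (X \<omega> + \<xi> \<omega> *v (B t \<omega> - B s \<omega>)) powr p)
      \<le> (expectation (\<lambda>\<omega>. norm (X \<omega>) powr p) powr (2 / p)
          + (2 * (c * k) + 2) * (expectation (\<lambda>\<omega>. norm (\<xi> \<omega>) powr p) powr (2 / p) * (t - s))) powr (p /
              2)"
proof -
  let ?D = "\<lambda>\<omega>. B t \<omega> - B s \<omega>"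
  let ?Y = "\<lambda>\<omega>. \<xi> \<omega> *v ?D \<omega>"
  have s: "s \<in> {0..T}" using st by auto
  have [measurable]: "?D \<in> borel_measurable M"
    by (rule measurable_F_M[of t]) (use st increment_measurable in auto)
  note [measurable] = measurable_F_M[OF s X(1)] measurable_F_M[OF s \<xi>(1)]
  have c0: "0 \<le> c" unfolding c using p by auto
  have "0 \<le> expectation (\<lambda>\<omega>. norm (?D \<omega>) powr 2)" by (intro integral_nonneg_AE AE_I2) auto
  from order_trans[OF this k[of 2]] st have "0 \<le> k * (t - s)" by simp
  with st have k0: "0 \<le> k" by (simp add: zero_le_mult_iff)
  define x where "x = expectation (\<lambda>\<omega>. norm (X \<omega>) powr p)"
  define e where "e = expectation (\<lambda>\<omega>. norm (\<xi> \<omega>) powr p)"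
  have xe: "0 \<le> x" "0 \<le> e" unfolding x_def e_def by simp_all
  \<comment> \<open>A nonnegative weight known at time \<open>s\<close> factors out of the
    expectation, and only the moment of the increment remains.\<close>
  have indep: "integrable M (\<lambda>\<omega>. u \<omega> * norm (?D \<omega>) powr r)"
      "expectation (\<lambda>\<omega>. u \<omega> * norm (?D \<omega>) powr r) \<le> expectation u * (k * (t - s) powr (r / 2))"
    if u: "u \<in> borel_measurable (F s)" "integrable M u" "\<And>\<omega>. 0 \<le> u \<omega>" and r: "r \<in> {2, p}"
        for u :: "'w \<Rightarrow> real" and r
  proof -
    have iD: "integrable M (\<lambda>\<omega>. norm (?D \<omega>) powr r)"
      by (rule increment_norm_moment(1)[OF st]) (use r p in auto)
    have iv: "indep_var borel u borel (\<lambda>\<omega>. norm (?D \<omega>) powr r)"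
      by (rule increment_indep_var[OF st u(1), where g = "\<lambda>x. norm x powr r"]) measurable
    show "integrable M (\<lambda>\<omega>. u \<omega> * norm (?D \<omega>) powr r)"
      by (rule indep_var_integrable[OF iv u(2) iD])
    have "expectation (\<lambda>\<omega>. u \<omega> * norm (?D \<omega>) powr r)
        = expectation u * expectation (\<lambda>\<omega>. norm (?D \<omega>) powr r)"
      by (rule indep_var_lebesgue_integral[OF iv u(2) iD])
    also have "\<dots> \<le> expectation u * (k * (t - s) powr (r / 2))"
      by (intro mult_left_mono k r integral_nonneg_AE AE_I2 u(3))
    finally show "expectation (\<lambda>\<omega>. u \<omega> * norm (?D \<omega>) powr r)
        \<le> expectation u * (k * (t - s) powr (r / 2))" .
  qed
  have Y_le: "norm (?Y \<omega>) powr r \<le> norm (\<xi> \<omega>) powr r * norm (?D \<omega>) powr r" if "0 \<le> r" for \<omega> r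
  proof -
    have "norm (?Y \<omega>) powr r \<le> (norm (\<xi> \<omega>) * norm (?D \<omega>)) powr r"
      using that by (intro powr_mono2 norm_matrix_vector_le) auto
    then show ?thesis by (simp add: powr_mult)
  qed
  have m\<xi>p: "(\<lambda>\<omega>. norm (\<xi> \<omega>) powr p) \<in> borel_measurable (F s)" using \<xi>(1) by measurable
  note ip = indep[OF m\<xi>p \<xi>(2), of p]
  have iY: "integrable M (\<lambda>\<omega>. norm (?Y \<omega>) powr p)"
    by (rule Bochner_Integration.integrable_bound[OF ip(1)]) (use Y_le[of p] p in simp_all)
  have EY: "expectation (\<lambda>\<omega>. norm (?Y \<omega>) powr p) \<le> e * (k * (t - s) powr (p / 2))"
    using integral_mono[OF iY ip(1)] Y_le[of p] p ip(2) by (force simp: e_def)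
  let ?u = "\<lambda>\<omega>. norm (X \<omega>) powr (p - 2) * (norm (\<xi> \<omega>))\<^sup>2"
  have mu: "?u \<in> borel_measurable (F s)" using X(1) \<xi>(1) by measurable
  have iu: "integrable M ?u" and Eu: "expectation ?u \<le> x powr ((p - 2) / p) * e powr (2 / p)"
    unfolding x_def e_def by (rule integral_powr_mix[OF p]; use X \<xi> in simp)+
  note i2 = indep[OF mu iu, of 2]
  have sq: "(norm v)\<^sup>2 = norm v powr 2" for v :: "'z::real_normed_vector" by simp
  let ?v = "\<lambda>\<omega>. norm (X \<omega>) powr (p - 2) * (norm (?Y \<omega>))\<^sup>2"
  have iv: "integrable M ?v"
    by (rule integral_powr_mix(1)[OF p]) (use X iY in auto)
  have "expectation ?v \<le> expectation (\<lambda>\<omega>. ?u \<omega> * norm (?D \<omega>) powr 2)"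
    using i2(1) iv Y_le[of 2] by (intro integral_mono) (auto simp: mult.assoc intro!: mult_left_mono)
  also have "\<dots> \<le> expectation ?u * (k * (t - s) powr (2 / 2))"
    using i2(2) by simp
  also have "\<dots> \<le> (x powr ((p - 2) / p) * e powr (2 / p)) * (k * (t - s) powr (2 / 2))"
    using k0 by (intro mult_right_mono Eu) auto
  finally have Ev: "expectation ?v \<le> (x powr ((p - 2) / p) * e powr (2 / p)) * (k * (t - s))"
    using st by simp
  \<comment> \<open>The inner product with the increment is written through the transposed matrix as
    a sum over the coordinates of the increment. Each weight \<open>?U j\<close> is known at time
    \<open>s\<close>, and the coordinate it multiplies is centred and independent of it.\<close>
  let ?U = "\<lambda>j \<omega>. norm (X \<omega>) powr (p - 2) * (X \<omega> v* \<xi> \<omega>) $ j"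
  have U_eq: "(X \<omega> v* \<xi> \<omega>) $ j = (\<Sum>i\<in>UNIV. X \<omega> $ i * \<xi> \<omega> $ i $ j)" for \<omega> j
    by (simp add: vector_matrix_mult_def mult.commute)
  have mX: "(\<lambda>\<omega>. X \<omega> $ i) \<in> borel_measurable (F s)" for i
    by (rule measurable_compose[OF X(1)], intro borel_measurable_continuous_onI continuous_intros)
  have m\<xi>: "(\<lambda>\<omega>. \<xi> \<omega> $ i $ j) \<in> borel_measurable (F s)" for i j
    by (rule measurable_compose[OF \<xi>(1)], intro borel_measurable_continuous_onI continuous_intros)
  have mU: "?U j \<in> borel_measurable (F s)" for j
    unfolding U_eq using X(1) mX m\<xi> by measurable
  have split: "norm (X \<omega>) powr (p - 2) * (X \<omega> \<bullet> ?Y \<omega>) = (\<Sum>j\<in>UNIV. ?U j \<omega> * ?D \<omega> $ j)" for \<omega>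
  proof -
    have "X \<omega> \<bullet> ?Y \<omega> = (\<Sum>j\<in>UNIV. (X \<omega> v* \<xi> \<omega>) $ j * ?D \<omega> $ j)"
      unfolding dot_lmul_matrix[symmetric] by (simp only: inner_vec_def inner_real_def)
    then show ?thesis by (simp only: sum_distrib_left mult.assoc)
  qed
  have iU: "integrable M (?U j)" for j
  proof (rule Bochner_Integration.integrable_bound[of M "\<lambda>\<omega>. real CARD('d) * (norm (X \<omega>) powr p + norm
      (\<xi> \<omega>) powr p)"])
    show "integrable M (\<lambda>\<omega>. real CARD('d) * (norm (X \<omega>) powr p + norm (\<xi> \<omega>) powr p))"
      using X \<xi> by auto
    show "?U j \<in> borel_measurable M" by (rule measurable_F_M[OF s mU])
    have "\<bar>?U j \<omega>\<bar> \<le> real CARD('d) * (norm (X \<omega>) powr p + norm (\<xi> \<omega>) powr p)" for \<omega>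
    proof -
      have "\<bar>(X \<omega> v* \<xi> \<omega>) $ j\<bar> \<le> (\<Sum>i\<in>UNIV. \<bar>X \<omega> $ i * \<xi> \<omega> $ i $ j\<bar>)"
        unfolding U_eq by (rule sum_abs)
      also have "\<dots> \<le> of_nat CARD('d) * (norm (X \<omega>) * norm (\<xi> \<omega>))"
        unfolding abs_mult
        by (intro sum_bounded_above mult_mono component_le_norm_cart
            order_trans[OF component_le_norm_cart Finite_Cartesian_Product.norm_nth_le]) auto
      finally have "\<bar>?U j \<omega>\<bar> \<le> norm (X \<omega>) powr (p - 2) * (of_nat CARD('d) * (norm (X \<omega>) * norm (\<xi> \<omega>)))"
        unfolding abs_mult by (intro mult_mono) auto
      also have "\<dots> = real CARD('d) * (norm (X \<omega>) powr (p - 1) * norm (\<xi> \<omega>) powr 1)"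
        by (cases "X \<omega> = 0") (simp_all add: powr_diff power2_eq_square)
      also have "\<dots> \<le> real CARD('d) * (norm (X \<omega>) powr p + norm (\<xi> \<omega>) powr p)"
        using p by (intro mult_left_mono powr_mix_le) auto
      finally show ?thesis .
    qed
    then show "AE \<omega> in M. norm (?U j \<omega>) \<le> norm (real CARD('d) * (norm (X \<omega>) powr p + norm (\<xi> \<omega>) powr
        p))"
      by (intro AE_I2) (simp add: order_trans[OF _ abs_ge_self])
  qed
  have UD: "integrable M (\<lambda>\<omega>. ?U j \<omega> * ?D \<omega> $ j)" "expectation (\<lambda>\<omega>. ?U j \<omega> * ?D \<omega> $ j) = 0" for j
  proof -
    have iv: "indep_var borel (?U j) borel (\<lambda>\<omega>. ?D \<omega> $ j)"
      by (rule increment_indep_var[OF st mU, where g = "\<lambda>x. x $ j"]) measurable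
    note z = increment_expectation_zero[OF st, of j]
    show "integrable M (\<lambda>\<omega>. ?U j \<omega> * ?D \<omega> $ j)" by (rule indep_var_integrable[OF iv iU z(1)])
    show "expectation (\<lambda>\<omega>. ?U j \<omega> * ?D \<omega> $ j) = 0"
      using indep_var_lebesgue_integral[OF iv iU z(1)] z(2) by simp
  qed
  have iL: "integrable M (\<lambda>\<omega>. norm (X \<omega>) powr (p - 2) * (X \<omega> \<bullet> ?Y \<omega>))"
    unfolding split by (intro Bochner_Integration.integrable_sum UD)
  have EL: "expectation (\<lambda>\<omega>. norm (X \<omega>) powr (p - 2) * (X \<omega> \<bullet> ?Y \<omega>)) = 0"
    unfolding split by (subst Bochner_Integration.integral_sum) (simp_all only: UD sum.neutral_const)
  have iXY: "integrable M (\<lambda>\<omega>. 2 powr p * (norm (X \<omega>) powr p + norm (?Y \<omega>) powr p))"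
    using X iY by auto
  show int: "integrable M (\<lambda>\<omega>. norm (X \<omega> + ?Y \<omega>) powr p)"
  proof (rule Bochner_Integration.integrable_bound[OF iXY])
    have "norm (X \<omega> + ?Y \<omega>) powr p \<le> 2 powr p * (norm (X \<omega>) powr p + norm (?Y \<omega>) powr p)" for \<omega>
    proof -
      have "norm (X \<omega> + ?Y \<omega>) powr p \<le> (norm (X \<omega>) + norm (?Y \<omega>)) powr p"
        using p by (intro powr_mono2 norm_triangle_ineq) auto
      also have "\<dots> \<le> 2 powr p * (norm (X \<omega>) powr p + norm (?Y \<omega>) powr p)"
        using p by (intro powr_add_le) auto
      finally show ?thesis .
    qed
    then show "AE \<omega> in M. norm (norm (X \<omega> + ?Y \<omega>) powr p)
        \<le> norm (2 powr p * (norm (X \<omega>) powr p + norm (?Y \<omega>) powr p))"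
      by (intro AE_I2) (simp add: order_trans[OF _ abs_ge_self])
  qed measurable
  have "expectation (\<lambda>\<omega>. norm (X \<omega> + ?Y \<omega>) powr p)
    \<le> expectation (\<lambda>\<omega>. norm (X \<omega>) powr p + p * (norm (X \<omega>) powr (p - 2) * (X \<omega> \<bullet> ?Y \<omega>)) + c * (?v \<omega> +
        norm (?Y \<omega>) powr p))"
  proof (rule integral_mono[OF int])
    show "integrable M (\<lambda>\<omega>. norm (X \<omega>) powr p + p * (norm (X \<omega>) powr (p - 2) * (X \<omega> \<bullet> ?Y \<omega>)) + c * (?v \<omega>
        + norm (?Y \<omega>) powr p))"
      by (intro Bochner_Integration.integrable_add integrable_mult_right X(2) iL iv iY)
    show "norm (X \<omega> + ?Y \<omega>) powr p \<le> norm (X \<omega>) powr p + p * (norm (X \<omega>) powr (p - 2) * (X \<omega> \<bullet> ?Y \<omega>)) +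
        c * (?v \<omega> + norm (?Y \<omega>) powr p)" for \<omega>
      using norm_add_powr_le[OF p, of "X \<omega>" "?Y \<omega>"] unfolding c by (simp add: mult.assoc)
  qed
  also have "\<dots> = x + p * 0 + c * (expectation ?v + expectation (\<lambda>\<omega>. norm (?Y \<omega>) powr p))"
    using X(2) iL iv iY by (simp add: x_def EL)
  also have "\<dots> \<le> x + p * 0 + c * ((x powr ((p - 2) / p) * e powr (2 / p)) * (k * (t - s)) + e * (k * (t
      - s) powr (p / 2)))"
    using c0 by (intro add_left_mono mult_left_mono add_mono Ev EY) auto
  \<comment> \<open>Rewritten with the squared norms \<open>x powr (2 / p)\<close> and
    \<open>e powr (2 / p)\<close> as variables, which is the shape that \<open>powr_absorb\<close>
    accepts with exponent \<open>p / 2\<close>.\<close>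
  also have "\<dots> = (x powr (2 / p)) powr (p / 2)
     + (c * k) * ((x powr (2 / p)) powr (p / 2 - 1) * (e powr (2 / p) * (t - s)) + (e powr (2 / p) * (t
         - s)) powr (p / 2))"
  proof -
    have "2 / p * (p / 2 - 1) = (p - 2) / p" using p by (simp add: field_simps)
    then have 1: "(x powr (2 / p)) powr (p / 2 - 1) = x powr ((p - 2) / p)"
      by (simp only: powr_powr)
    have 2: "(x powr (2 / p)) powr (p / 2) = x" using p xe by (simp add: powr_powr)
    have 3: "(e powr (2 / p) * (t - s)) powr (p / 2) = e * (t - s) powr (p / 2)"
      using p xe st by (subst powr_mult) (auto simp: powr_powr)
    show ?thesis unfolding 1 2 3 by (simp add: algebra_simps)
  qed
  also have "\<dots> \<le> (x powr (2 / p) + (2 * (c * k) + 2) * (e powr (2 / p) * (t - s))) powr (p / 2)"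
    using p xe st c0 k0 by (intro powr_absorb) auto
  finally show "expectation (\<lambda>\<omega>. norm (X \<omega> + ?Y \<omega>) powr p)
      \<le> (expectation (\<lambda>\<omega>. norm (X \<omega>) powr p) powr (2 / p)
          + (2 * (c * k) + 2) * (expectation (\<lambda>\<omega>. norm (\<xi> \<omega>) powr p) powr (2 / p) * (t - s))) powr (p /
              2)"
    unfolding x_def e_def .
qed


lemma simple_integrand_bounded:
  assumes "t \<in> {0..T}" "simple_integrand F t n \<tau> \<xi>" "i < n"
  shows "\<exists>b. \<forall>\<omega>\<in>space M. norm (\<xi> i \<omega>) \<le> b"
proof -
  have "\<tau> i \<in> {0..T}" using simple_integrandD(1)[OF assms(2), of i] assms(1,3) by auto
  then show ?thesis
    using simple_integrandD(4)[OF assms(2,3)] space_F[of "\<tau> i"] by simp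
qed

text \<open>Induction over the number of intervals. Measurability of the partial sum at the current
  grid point is carried along, since the next step needs the past to be known there. The constant
  depends on p and the dimensions only through the expansion constant and the Gaussian moments of
  order 2 and p.\<close>

lemma simple_ito_moment:
  fixes p :: real
  assumes p: "2 \<le> p"
  obtains K where "0 \<le> K"
    and "\<And>t n \<tau> (\<xi> :: nat \<Rightarrow> 'w \<Rightarrow> real ^ 'm ^ 'd). t \<in> {0..T} \<Longrightarrow> simple_integrand F t n \<tau> \<xi> \<Longrightarrow>
      integrable M (\<lambda>\<omega>. norm (simple_ito_integral B n \<tau> \<xi> \<omega>) powr p) \<and>
      expectation (\<lambda>\<omega>. norm (simple_ito_integral B n \<tau> \<xi> \<omega>) powr p)
        \<le> (K * (\<Sum>i<n. expectation (\<lambda>\<omega>. norm (\<xi> i \<omega>) powr p) powr (2 / p) * (\<tau> (Suc i) - \<tau> i))) powr (p /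
            2)"
proof -
  define c where "c = 3 powr p + p * 2 powr p + p + 7 * (p * p * 3 powr p)"
  define k where "k = max (real CARD('m) powr (2 + 1) * gauss_abs_moment 2) (real CARD('m) powr (p + 1)
      * gauss_abs_moment p)"
  define K where "K = 2 * (c * k) + 2"
  have c0: "0 \<le> c" unfolding c_def using p by auto
  have k0: "0 \<le> k" unfolding k_def using gauss_abs_moment_nonneg[of 2] by (simp add: le_max_iff_disj)
  have k: "expectation (\<lambda>\<omega>. norm (B t \<omega> - B s \<omega>) powr r) \<le> k * (t - s) powr (r / 2)"
    if st: "0 \<le> s" "s < t" "t \<le> T" and r: "r \<in> {2, p}" for s t r
  proof -
    have "expectation (\<lambda>\<omega>. norm (B t \<omega> - B s \<omega>) powr r)
        \<le> real CARD('m) powr (r + 1) * gauss_abs_moment r * (t - s) powr (r / 2)"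
      by (rule increment_norm_moment(2)[OF st]) (use r p in auto)
    also have "\<dots> \<le> k * (t - s) powr (r / 2)"
      using r by (intro mult_right_mono) (auto simp: k_def)
    finally show ?thesis .
  qed
  show thesis
  proof (rule that[of K])
    show K0: "0 \<le> K" using c0 k0 by (simp add: K_def)
    fix t n \<tau> and \<xi> :: "nat \<Rightarrow> 'w \<Rightarrow> real ^ 'm ^ 'd"
    assume t: "t \<in> {0..T}" and s: "simple_integrand F t n \<tau> \<xi>"
    have \<tau>: "\<tau> i \<in> {0..T}" if "i \<le> n" for i using simple_integrandD(1)[OF s that] t by auto
    have \<tau>': "\<tau> i \<le> \<tau> (Suc i)" if "i < n" for i using simple_integrandD[OF s] that by blast
    have m\<xi>: "\<xi> i \<in> borel_measurable (F (\<tau> i))" if "i < n" for i using simple_integrandD[OF s] that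
        by blast
    have i\<xi>: "integrable M (\<lambda>\<omega>. norm (\<xi> i \<omega>) powr p)" if i: "i < n" for i
    proof -
      obtain b where b: "\<And>\<omega>. \<omega> \<in> space M \<Longrightarrow> norm (\<xi> i \<omega>) \<le> b"
        using simple_integrand_bounded[OF t s i] by blast
      have m: "\<xi> i \<in> borel_measurable M" by (rule measurable_F_M[OF \<tau> m\<xi>]) (use i in auto)
      show ?thesis
        by (rule integrable_const_bound[where B = "b powr p"])
          (use b m p in \<open>auto intro!: AE_I2 powr_mono2\<close>)
    qed
    let ?S = "\<lambda>k \<omega>. simple_ito_integral B k \<tau> \<xi> \<omega>"
    let ?e = "\<lambda>i. expectation (\<lambda>\<omega>. norm (\<xi> i \<omega>) powr p) powr (2 / p) * (\<tau> (Suc i) - \<tau> i)"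
    have "?S k \<in> borel_measurable (F (\<tau> k)) \<and> integrable M (\<lambda>\<omega>. norm (?S k \<omega>) powr p) \<and>
      expectation (\<lambda>\<omega>. norm (?S k \<omega>) powr p) \<le> (K * (\<Sum>i<k. ?e i)) powr (p / 2)" if "k \<le> n" for k
      using that
    proof (induction k)
      case 0
      then show ?case by (simp add: simple_ito_integral_def)
    next
      case (Suc k)
      then have IH: "?S k \<in> borel_measurable (F (\<tau> k))" "integrable M (\<lambda>\<omega>. norm (?S k \<omega>) powr p)"
        "expectation (\<lambda>\<omega>. norm (?S k \<omega>) powr p) \<le> (K * (\<Sum>i<k. ?e i)) powr (p / 2)" and k': "k < n"
            by auto
      have le: "0 \<le> \<tau> k" "\<tau> k \<le> \<tau> (Suc k)" "\<tau> (Suc k) \<le> T"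
        using \<tau>[of k] \<tau>[of "Suc k"] \<tau>'[of k] k' by auto
      have S: "?S (Suc k) \<omega> = ?S k \<omega> + \<xi> k \<omega> *v (B (\<tau> (Suc k)) \<omega> - B (\<tau> k) \<omega>)" for \<omega>
        by (simp add: simple_ito_integral_def)
      note m1 = measurable_F_mono[OF le IH(1)] and m2 = measurable_F_mono[OF le m\<xi>[OF k']]
        and m3 = increment_measurable[OF le]
      have m: "?S (Suc k) \<in> borel_measurable (F (\<tau> (Suc k)))"
        unfolding S using m1 m2 m3 by measurable
      \<comment> \<open>Simple integrands may contain empty intervals, on which the increment is 0;
        the martingale step requires a strictly later time.\<close>
      show ?case
      proof (cases "\<tau> k = \<tau> (Suc k)")
        case True
        then have "?S (Suc k) \<omega> = ?S k \<omega>" for \<omega> unfolding S by simp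
        then show ?thesis using IH m True by simp
      next
        case False
        with le have lt: "\<tau> k < \<tau> (Suc k)" by simp
        note step = martingale_step[OF le(1) lt le(3) p IH(1,2) m\<xi>[OF k'] i\<xi>[OF k'] k[OF le(1) lt le(3)]
            c_def, folded K_def]
        have sum0: "0 \<le> (\<Sum>i<k. ?e i)" using k' \<tau>' by (intro sum_nonneg mult_nonneg_nonneg) auto
        \<comment> \<open>The root of order \<open>p / 2\<close> turns the induction hypothesis into
          a linear bound, to which the new summand is added before the power is restored.\<close>
        have "expectation (\<lambda>\<omega>. norm (?S k \<omega>) powr p) powr (2 / p)
            \<le> ((K * (\<Sum>i<k. ?e i)) powr (p / 2)) powr (2 / p)"
          using p by (intro powr_mono2 IH(3)) auto
        also have "\<dots> = K * (\<Sum>i<k. ?e i)" using p K0 sum0 by (simp add: powr_powr)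
        finally have *: "expectation (\<lambda>\<omega>. norm (?S k \<omega>) powr p) powr (2 / p) \<le> K * (\<Sum>i<k. ?e i)" .
        have "expectation (\<lambda>\<omega>. norm (?S (Suc k) \<omega>) powr p)
            \<le> (expectation (\<lambda>\<omega>. norm (?S k \<omega>) powr p) powr (2 / p) + K * ?e k) powr (p / 2)"
          unfolding S by (rule step(2))
        also have "\<dots> \<le> (K * (\<Sum>i<k. ?e i) + K * ?e k) powr (p / 2)"
          using p K0 le * by (intro powr_mono2 add_right_mono) auto
        finally show ?thesis using m step(1) unfolding S by (simp add: distrib_left)
      qed
    qed
    from this[of n] show "integrable M (\<lambda>\<omega>. norm (?S n \<omega>) powr p) \<and>
      expectation (\<lambda>\<omega>. norm (?S n \<omega>) powr p) \<le> (K * (\<Sum>i<n. ?e i)) powr (p / 2)" by blast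
  qed
qed

lemma simple_ito_measurable:
  assumes t: "t \<in> {0..T}" and s: "simple_integrand F t n \<tau> \<xi>"
  shows "simple_ito_integral B n \<tau> \<xi> \<in> borel_measurable M"
proof -
  have \<tau>: "\<tau> i \<in> {0..T}" if "i \<le> n" for i using simple_integrandD(1)[OF s that] t by auto
  have [measurable]: "B (\<tau> i) \<in> borel_measurable M" if "i \<le> n" for i
    by (rule measurable_F_M[OF \<tau> B_adapted[OF \<tau>]]) (use that in auto)
  have [measurable]: "\<xi> i \<in> borel_measurable M" if "i < n" for i
    by (rule measurable_F_M[OF \<tau>, of i]) (use that simple_integrandD(3)[OF s] in auto)
  show ?thesis unfolding simple_ito_integral_def[abs_def]
    by (intro borel_measurable_sum borel_measurable_matrix_vector borel_measurable_diff) auto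
qed

end

subsection \<open>Refinement of grids and the Lenglart estimate\<close>

text \<open>The induction needs the stronger bound by the minimum of \<open>d\<close> and the full
  sum: as long as terms are accepted, the truncated sum is controlled by the full partial sum, and
  that is still at most \<open>d\<close>.\<close>

lemma truncated_sum_le:
  fixes a :: "nat \<Rightarrow> real"
  assumes "\<And>i. i < n \<Longrightarrow> 0 \<le> a i" "0 \<le> d"
  shows "(\<Sum>i<n. if (\<Sum>j<Suc i. a j) \<le> d then a i else 0) \<le> d"
proof -
  have "(\<Sum>i<n. if (\<Sum>j<Suc i. a j) \<le> d then a i else 0) \<le> min d (\<Sum>j<n. a j)"
    using assms
  proof (induction n)
    case (Suc n)
    then have "(\<Sum>i<n. if (\<Sum>j<Suc i. a j) \<le> d then a i else 0) \<le> min d (\<Sum>j<n. a j)"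
      and "0 \<le> a n" by auto
    then show ?case by (auto simp: min_def split: if_splits)
  qed simp
  then show ?thesis by simp
qed

lemma strictly_increasing_enumeration:
  fixes P :: "real set"
  assumes "finite P" "P \<noteq> {}"
  obtains N :: nat and \<rho> :: "nat \<Rightarrow> real" where "\<And>i j. i < j \<Longrightarrow> j \<le> N \<Longrightarrow> \<rho> i < \<rho> j" "\<rho> ` {..N} = P"
proof -
  let ?l = "sorted_list_of_set P"
  have l: "length ?l = card P" "sorted_wrt (<) ?l" "set ?l = P" using assms by auto
  have c: "card P > 0" using assms by (simp add: card_gt_0_iff)
  show thesis
  proof (rule that[of "card P - 1" "\<lambda>i. ?l ! i"])
    show "?l ! i < ?l ! j" if "i < j" "j \<le> card P - 1" for i j
      using sorted_wrt_nth_less[OF l(2), of i j] that c l(1) by auto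
    have "{..card P - 1} = {0..<length ?l}" using c l(1) by auto
    then show "(!) ?l ` {..card P - 1} = P" using l(3) by (metis list.set_map map_nth set_upt)
  qed
qed

text \<open>Stated for an arbitrary \<open>h\<close> because it serves twice: with step functions it
  shows that refinement preserves the simple process, with Brownian paths that it preserves the
  integral.\<close>

lemma grid_telescope:
  fixes h :: "real \<Rightarrow> 'b::real_normed_vector"
  assumes \<rho>: "\<And>i j. i < j \<Longrightarrow> j \<le> N \<Longrightarrow> (\<rho> i :: real) < \<rho> j"
    and ab: "a \<in> \<rho> ` {..N}" "b \<in> \<rho> ` {..N}" "a \<le> b"
  shows "(\<Sum>j<N. if a \<le> \<rho> j \<and> \<rho> (Suc j) \<le> b then h (\<rho> (Suc j)) - h (\<rho> j) else 0) = h b - h a"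
proof -
  obtain u v where uv: "u \<le> N" "v \<le> N" "a = \<rho> u" "b = \<rho> v" using ab by auto
  have le: "\<rho> i \<le> \<rho> j \<longleftrightarrow> i \<le> j" if "i \<le> N" "j \<le> N" for i j
    using \<rho>[of i j] \<rho>[of j i] that by (metis less_eq_real_def linorder_neqE_nat not_less)
  have "u \<le> v" using ab uv le by auto
  have "(\<Sum>j<N. if a \<le> \<rho> j \<and> \<rho> (Suc j) \<le> b then h (\<rho> (Suc j)) - h (\<rho> j) else 0)
      = (\<Sum>j<N. if j \<in> {u..<v} then h (\<rho> (Suc j)) - h (\<rho> j) else 0)"
    using uv le by (intro sum.cong) auto
  also have "\<dots> = (\<Sum>j\<in>{..<N} \<inter> {u..<v}. h (\<rho> (Suc j)) - h (\<rho> j))"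
    by (simp add: sum.inter_restrict)
  also have "{..<N} \<inter> {u..<v} = {u..<v}" using uv by auto
  also have "(\<Sum>j\<in>{u..<v}. h (\<rho> (Suc j)) - h (\<rho> j)) = h b - h a"
    using sum_Suc_diff'[OF \<open>u \<le> v\<close>, of "\<lambda>j. h (\<rho> j)"] uv by simp
  finally show ?thesis .
qed

lemma simple_process_at:
  fixes \<xi> :: "nat \<Rightarrow> 'w \<Rightarrow> real ^ 'm ^ 'd"
  assumes \<tau>: "\<And>i. i < n \<Longrightarrow> \<tau> i \<le> \<tau> (Suc i)" and i: "i < n" "s \<in> {\<tau> i<..\<tau> (Suc i)}"
  shows "\<And>j. j < n \<Longrightarrow> indicator {\<tau> j<..\<tau> (Suc j)} s = (if j = i then 1 else 0 :: real)"
    and "simple_process n \<tau> \<xi> s \<omega> = \<xi> i \<omega>"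
proof -
  have mono: "\<tau> i \<le> \<tau> j" if "i \<le> j" "j \<le> n" for i j
    using that by (induction rule: dec_induct) (auto intro!: order_trans[OF _ \<tau>])
  show ind: "indicator {\<tau> j<..\<tau> (Suc j)} s = (if j = i then 1 else 0 :: real)" if "j < n" for j
    using mono[of "Suc i" j] mono[of "Suc j" i] that i
    by (cases "i < j"; cases "j < i") (auto simp: indicator_def)
  have "simple_process n \<tau> \<xi> s \<omega> = (\<Sum>j<n. if j = i then \<xi> j \<omega> else 0)"
    unfolding simple_process_def by (intro sum.cong) (auto simp: ind)
  then show "simple_process n \<tau> \<xi> s \<omega> = \<xi> i \<omega>" using i by simp
qed

text \<open>The partition may cover only a part of \<open>{0..t}\<close>, and the process is 0 on
  the rest; hence the condition on \<open>h 0\<close>. It is applied to the squared norm (energy)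
  and to the norm (L^1-distance).\<close>

lemma nn_integral_simple_process:
  fixes \<xi> :: "nat \<Rightarrow> 'w \<Rightarrow> real ^ 'm ^ 'd" and h :: "real ^ 'm ^ 'd \<Rightarrow> ennreal"
  assumes \<tau>: "\<And>i. i \<le> n \<Longrightarrow> \<tau> i \<in> {0..t}" "\<And>i. i < n \<Longrightarrow> \<tau> i \<le> \<tau> (Suc i)"
    and h: "h 0 = 0"
  shows "(\<integral>\<^sup>+s\<in>{0..t}. h (simple_process n \<tau> \<xi> s \<omega>) \<partial>lborel)
      = (\<Sum>i<n. h (\<xi> i \<omega>) * ennreal (\<tau> (Suc i) - \<tau> i))"
proof -
  have eq: "h (simple_process n \<tau> \<xi> s \<omega>) * indicator {0..t} s
      = (\<Sum>i<n. h (\<xi> i \<omega>) * indicator {\<tau> i<..\<tau> (Suc i)} s)" for s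
  proof (cases "\<exists>i<n. s \<in> {\<tau> i<..\<tau> (Suc i)}")
    case True
    then obtain i where i: "i < n" "s \<in> {\<tau> i<..\<tau> (Suc i)}" by auto
    have at: "indicator {\<tau> j<..\<tau> (Suc j)} s = (if j = i then 1 else 0 :: real)" if "j < n" for j
      by (rule simple_process_at(1)[OF _ i that]) (rule \<tau>(2))
    have at': "simple_process n \<tau> \<xi> s \<omega> = \<xi> i \<omega>"
      by (rule simple_process_at(2)[OF _ i]) (rule \<tau>(2))
    have "indicator {\<tau> j<..\<tau> (Suc j)} s = (if j = i then 1 else 0 :: ennreal)" if "j < n" for j
      using at[OF that] by (auto simp: indicator_def split: if_splits)
    then have "(\<Sum>j<n. h (\<xi> j \<omega>) * indicator {\<tau> j<..\<tau> (Suc j)} s) = (\<Sum>j<n. if j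
        = i then h (\<xi> j \<omega>) else 0)"
      by (intro sum.cong) auto
    also have "\<dots> = h (\<xi> i \<omega>)" using i by simp
    moreover have "s \<in> {0..t}" using i \<tau>(1)[of i] \<tau>(1)[of "Suc i"] by auto
    ultimately show ?thesis unfolding at' by simp
  next
    case False
    then have "simple_process n \<tau> \<xi> s \<omega> = 0"
      unfolding simple_process_def by (intro sum.neutral) auto
    moreover have "(\<Sum>i<n. h (\<xi> i \<omega>) * indicator {\<tau> i<..\<tau> (Suc i)} s) = 0"
      using False by (intro sum.neutral) auto
    ultimately show ?thesis using h by simp
  qed
  have "(\<integral>\<^sup>+s\<in>{0..t}. h (simple_process n \<tau> \<xi> s \<omega>) \<partial>lborel)
      = (\<Sum>i<n. \<integral>\<^sup>+s. h (\<xi> i \<omega>) * indicator {\<tau> i<..\<tau> (Suc i)} s \<partial>lborel)"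
    unfolding eq by (rule nn_integral_sum) auto
  also have "\<dots> = (\<Sum>i<n. h (\<xi> i \<omega>) * ennreal (\<tau> (Suc i) - \<tau> i))"
    by (intro sum.cong) (auto simp: nn_integral_cmult_indicator \<tau>)
  finally show ?thesis .
qed

context usual_filtered_prob_space
begin

text \<open>A new interval inherits the coefficient of the old interval that contains it. That
  coefficient is known at the old left end point and so also at the new one, which lies
  later.\<close>

lemma simple_integrand_refine:
  fixes \<xi> :: "nat \<Rightarrow> 'w \<Rightarrow> real ^ 'm ^ 'd" and B :: "real \<Rightarrow> 'w \<Rightarrow> real ^ 'm"
  assumes t: "t \<in> {0..T}" and s: "simple_integrand F t n \<tau> \<xi>"
    and \<rho>: "\<And>i j. i < j \<Longrightarrow> j \<le> N \<Longrightarrow> \<rho> i < \<rho> j" "\<rho> ` {..N} \<subseteq> {0..t}" "\<tau> ` {..n} \<subseteq> \<rho> ` {..N}"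
  obtains \<zeta> where "simple_integrand F t N \<rho> \<zeta>"
    "\<And>s \<omega>. simple_process N \<rho> \<zeta> s \<omega> = simple_process n \<tau> \<xi> s \<omega>"
    "\<And>\<omega>. simple_ito_integral B N \<rho> \<zeta> \<omega> = simple_ito_integral B n \<tau> \<xi> \<omega>"
proof -
  note sD = simple_integrandD[OF s]
  have \<rho>t: "\<rho> j \<in> {0..t}" if "j \<le> N" for j using \<rho>(2) that by auto
  have \<rho>m: "\<rho> j \<le> \<rho> (Suc j)" if "j < N" for j using \<rho>(1)[of j "Suc j"] that by auto
  define C where "C i j \<longleftrightarrow> \<tau> i \<le> \<rho> j \<and> \<rho> (Suc j) \<le> \<tau> (Suc i)" for i j
  \<comment> \<open>The sum has at most one nonzero term and replaces a choice of the containing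
    interval; it gives 0 on new intervals outside the old partition.\<close>
  define \<zeta> where "\<zeta> j \<omega> = (\<Sum>i<n. if C i j then \<xi> i \<omega> else 0)" for j \<omega>
  have tel: "(\<Sum>j<N. if C i j then h (\<rho> (Suc j)) - h (\<rho> j) else 0) = h (\<tau> (Suc i)) - h (\<tau> i)"
    if "i < n" for i and h :: "real \<Rightarrow> 'b::real_normed_vector"
    unfolding C_def by (rule grid_telescope[OF \<rho>(1)]) (use \<rho>(3) sD(2) that in auto)
  show thesis
  proof (rule that[of \<zeta>])
    show "simple_integrand F t N \<rho> \<zeta>"
      unfolding simple_integrand_def
    proof (intro conjI allI impI)
      fix j assume j: "j < N"
      have tj: "\<rho> j \<in> {0..T}" using \<rho>t[of j] j t by auto
      have "(\<lambda>\<omega>. if C i j then \<xi> i \<omega> else 0) \<in> borel_measurable (F (\<rho> j))" if i: "i < n" for i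
      proof (cases "C i j")
        case True
        have "\<xi> i \<in> borel_measurable (F (\<rho> j))"
          by (rule measurable_F_mono[OF _ _ _ sD(3)[OF i]])
            (use True tj sD(1)[of i] i in \<open>auto simp: C_def\<close>)
        then show ?thesis using True by simp
      qed simp
      then show "\<zeta> j \<in> borel_measurable (F (\<rho> j))"
        unfolding \<zeta>_def[abs_def] by (intro borel_measurable_sum) auto
      have "\<forall>i<n. \<exists>b. \<forall>\<omega>\<in>space M. norm (\<xi> i \<omega>) \<le> b"
      proof (intro allI impI)
        fix i assume i: "i < n"
        have "\<tau> i \<in> {0..T}" using sD(1)[of i] i t by auto
        then show "\<exists>b. \<forall>\<omega>\<in>space M. norm (\<xi> i \<omega>) \<le> b" using sD(4)[OF i] space_F by simp
      qed
      then obtain b where b: "\<And>i \<omega>. i < n \<Longrightarrow> \<omega> \<in> space M \<Longrightarrow> norm (\<xi> i \<omega>) \<le> b i" by metis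
      have "norm (\<zeta> j \<omega>) \<le> (\<Sum>i<n. \<bar>b i\<bar>)" if "\<omega> \<in> space M" for \<omega>
        unfolding \<zeta>_def using b[OF _ that] by (intro sum_norm_le) (auto intro: order_trans[OF _
          abs_ge_self])
      then show "\<exists>c. \<forall>\<omega>\<in>space (F (\<rho> j)). norm (\<zeta> j \<omega>) \<le> c"
        unfolding space_F[OF tj] by blast
    qed (use \<rho>t \<rho>m in auto)
    \<comment> \<open>Writing the indicator of a half-open interval as an increment of a step
      function makes it telescope over the refined grid.\<close>
    have ind: "indicator {a<..b} s = (of_bool (s \<le> b) - of_bool (s \<le> a) :: real)" if "a \<le> b"
        for a b s :: real
      using that by (auto simp: indicator_def)
    show "simple_process N \<rho> \<zeta> s \<omega> = simple_process n \<tau> \<xi> s \<omega>" for s \<omega>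
    proof -
      have "simple_process N \<rho> \<zeta> s \<omega> = (\<Sum>j<N. \<Sum>i<n. (if C i j then of_bool (s \<le> \<rho> (Suc j)) - of_bool (s
          \<le> \<rho> j) else 0 :: real) *\<^sub>R \<xi> i \<omega>)"
        unfolding simple_process_def \<zeta>_def scaleR_sum_right
        by (intro sum.cong refl) (auto simp: ind \<rho>m)
      also have "\<dots> = (\<Sum>i<n. (\<Sum>j<N. if C i j then of_bool (s \<le> \<rho> (Suc j)) - of_bool (s
          \<le> \<rho> j) else 0 :: real) *\<^sub>R \<xi> i \<omega>)"
        by (subst sum.swap) (simp only: scaleR_sum_left)
      also have "\<dots> = simple_process n \<tau> \<xi> s \<omega>"
        unfolding simple_process_def using tel[of _ "\<lambda>x. of_bool (s \<le> x) :: real"] sD(2)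
        by (intro sum.cong refl) (auto simp: ind)
      finally show ?thesis .
    qed
    show "simple_ito_integral B N \<rho> \<zeta> \<omega> = simple_ito_integral B n \<tau> \<xi> \<omega>" for \<omega>
    proof -
      note mv_sum_left = linear_sum[OF bounded_linear.linear[OF bounded_bilinear.bounded_linear_left[OF
          bounded_bilinear_matrix_vector]]]
        and mv_sum_right = linear_sum[OF bounded_linear.linear[OF
            bounded_bilinear.bounded_linear_right[OF bounded_bilinear_matrix_vector]]]
      have "simple_ito_integral B N \<rho> \<zeta> \<omega>
          = (\<Sum>j<N. \<Sum>i<n. (if C i j then \<xi> i \<omega> else 0) *v (B (\<rho> (Suc j)) \<omega> - B (\<rho> j) \<omega>))"
        unfolding simple_ito_integral_def \<zeta>_def by (subst mv_sum_left) (rule refl)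
      also have "\<dots> = (\<Sum>j<N. \<Sum>i<n. \<xi> i \<omega> *v (if C i j then B (\<rho> (Suc j)) \<omega> - B (\<rho> j) \<omega> else 0))"
        by (intro sum.cong refl) auto
      also have "\<dots> = (\<Sum>i<n. \<xi> i \<omega> *v (\<Sum>j<N. if C i j then B (\<rho> (Suc j)) \<omega> - B (\<rho> j) \<omega> else 0))"
        by (subst sum.swap) (simp only: mv_sum_right)
      also have "\<dots> = simple_ito_integral B n \<tau> \<xi> \<omega>"
        unfolding simple_ito_integral_def using tel[of _ "\<lambda>x. B x \<omega>"] by (intro sum.cong refl) auto
      finally show ?thesis .
    qed
  qed
qed

text \<open>Both integrands are moved to the union of their grids. The Lenglart estimate for this
  single integrand then compares the two integrals.\<close>

lemma simple_integrand_diff: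
  fixes \<xi> \<xi>' :: "nat \<Rightarrow> 'w \<Rightarrow> real ^ 'm ^ 'd" and B :: "real \<Rightarrow> 'w \<Rightarrow> real ^ 'm"
  assumes t: "t \<in> {0..T}" and s: "simple_integrand F t n \<tau> \<xi>" and s': "simple_integrand F t n' \<tau>' \<xi>'"
  obtains N \<rho> \<zeta> where "simple_integrand F t N \<rho> \<zeta>"
    "\<And>s \<omega>. simple_process N \<rho> \<zeta> s \<omega> = simple_process n \<tau> \<xi> s \<omega> - simple_process n' \<tau>' \<xi>' s \<omega>"
    "\<And>\<omega>. simple_ito_integral B N \<rho> \<zeta> \<omega> = simple_ito_integral B n \<tau> \<xi> \<omega> - simple_ito_integral B n' \<tau>' \<xi>'
        \<omega>"
proof -
  let ?P = "\<tau> ` {..n} \<union> \<tau>' ` {..n'}"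
  obtain N :: nat and \<rho> :: "nat \<Rightarrow> real" where \<rho>: "\<And>i j. i < j \<Longrightarrow> j \<le> N \<Longrightarrow> \<rho> i < \<rho> j" "\<rho> ` {..N} = ?P"
    using strictly_increasing_enumeration[of ?P]
      by (metis UnI1 empty_iff finite_Un finite_atMost finite_imageI atMost_iff imageI le_refl)
  have P: "?P \<subseteq> {0..t}" using simple_integrandD(1)[OF s] simple_integrandD(1)[OF s'] by auto
  have sub: "\<rho> ` {..N} \<subseteq> {0..t}" "\<tau> ` {..n} \<subseteq> \<rho> ` {..N}" "\<tau>' ` {..n'} \<subseteq> \<rho> ` {..N}"
    using \<rho>(2) P by simp_all
  obtain \<zeta> where \<zeta>: "simple_integrand F t N \<rho> \<zeta>"
    "\<And>s \<omega>. simple_process N \<rho> \<zeta> s \<omega> = simple_process n \<tau> \<xi> s \<omega>"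
    "\<And>\<omega>. simple_ito_integral B N \<rho> \<zeta> \<omega> = simple_ito_integral B n \<tau> \<xi> \<omega>"
    by (rule simple_integrand_refine[OF t s \<rho>(1) sub(1,2), where B = B]) (assumption | rule that)+
  obtain \<zeta>' where \<zeta>': "simple_integrand F t N \<rho> \<zeta>'"
    "\<And>s \<omega>. simple_process N \<rho> \<zeta>' s \<omega> = simple_process n' \<tau>' \<xi>' s \<omega>"
    "\<And>\<omega>. simple_ito_integral B N \<rho> \<zeta>' \<omega> = simple_ito_integral B n' \<tau>' \<xi>' \<omega>"
    by (rule simple_integrand_refine[OF t s' \<rho>(1) sub(1,3), where B = B]) (assumption | rule that)+
  show thesis
  proof (rule that[of N \<rho> "\<lambda>j \<omega>. \<zeta> j \<omega> - \<zeta>' j \<omega>"])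
    note d = simple_integrandD[OF \<zeta>(1)] and d' = simple_integrandD[OF \<zeta>'(1)]
    show "simple_integrand F t N \<rho> (\<lambda>j \<omega>. \<zeta> j \<omega> - \<zeta>' j \<omega>)"
      unfolding simple_integrand_def
    proof (intro conjI allI impI)
      fix j assume j: "j < N"
      show "(\<lambda>\<omega>. \<zeta> j \<omega> - \<zeta>' j \<omega>) \<in> borel_measurable (F (\<rho> j))"
        using d(3)[OF j] d'(3)[OF j] by measurable
      obtain c c' where "\<forall>\<omega>\<in>space (F (\<rho> j)). norm (\<zeta> j \<omega>) \<le> c" "\<forall>\<omega>\<in>space (F (\<rho> j)). norm (\<zeta>' j \<omega>) \<le> c'"
        using d(4)[OF j] d'(4)[OF j] by blast
      then show "\<exists>c. \<forall>\<omega>\<in>space (F (\<rho> j)). norm (\<zeta> j \<omega> - \<zeta>' j \<omega>) \<le> c"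
        by (intro exI[of _ "c + c'"]) (auto intro!: order_trans[OF norm_triangle_ineq4] add_mono)
    qed (use d in auto)
    show "simple_process N \<rho> (\<lambda>j \<omega>. \<zeta> j \<omega> - \<zeta>' j \<omega>) s \<omega>
        = simple_process n \<tau> \<xi> s \<omega> - simple_process n' \<tau>' \<xi>' s \<omega>" for s \<omega>
      unfolding \<zeta>(2)[symmetric] \<zeta>'(2)[symmetric] unfolding simple_process_def
      by (simp only: sum_subtractf scaleR_diff_right)
    show "simple_ito_integral B N \<rho> (\<lambda>j \<omega>. \<zeta> j \<omega> - \<zeta>' j \<omega>) \<omega>
        = simple_ito_integral B n \<tau> \<xi> \<omega> - simple_ito_integral B n' \<tau>' \<xi>' \<omega>" for \<omega>
      unfolding \<zeta>(3)[symmetric] \<zeta>'(3)[symmetric] unfolding simple_ito_integral_def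
      by (simp only: sum_subtractf matrix_vector_mult_diff_rdistrib)
  qed
qed

end

context brownian_motion
begin

text \<open>
  The coefficients are stopped before the energy exceeds \<open>d\<close>; since the energy of the
  coefficient \<open>\<xi> i\<close> on its interval is known at time \<open>\<tau> i\<close>, there is no overshoot.
\<close>

lemma simple_ito_lenglart:
  obtains K where "0 \<le> K"
    and "\<And>t n \<tau> (\<xi> :: nat \<Rightarrow> 'w \<Rightarrow> real ^ 'm ^ 'd) d e. t \<in> {0..T} \<Longrightarrow> simple_integrand F t n \<tau> \<xi> \<Longrightarrow>
      0 \<le> d \<Longrightarrow> 0 < e \<Longrightarrow>
      prob {\<omega>\<in>space M. e < norm (simple_ito_integral B n \<tau> \<xi> \<omega>)}
        \<le> prob {\<omega>\<in>space M. d < (\<Sum>i<n. (norm (\<xi> i \<omega>))\<^sup>2 * (\<tau> (Suc i) - \<tau> i))} + K * d / e\<^sup>2"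
proof -
  obtain K where K0: "0 \<le> K"
    and K: "\<And>t n \<tau> (\<xi> :: nat \<Rightarrow> 'w \<Rightarrow> real ^ 'm ^ 'd). t \<in> {0..T} \<Longrightarrow> simple_integrand F t n \<tau> \<xi> \<Longrightarrow>
      integrable M (\<lambda>\<omega>. norm (simple_ito_integral B n \<tau> \<xi> \<omega>) powr 2) \<and>
      expectation (\<lambda>\<omega>. norm (simple_ito_integral B n \<tau> \<xi> \<omega>) powr 2)
        \<le> (K * (\<Sum>i<n. expectation (\<lambda>\<omega>. norm (\<xi> i \<omega>) powr 2) powr (2 / 2) * (\<tau> (Suc i) - \<tau> i))) powr (2 /
            2)"
    using simple_ito_moment[of 2] by auto
  show thesis
  proof (rule that[OF K0])
    fix t n \<tau> d e and \<xi> :: "nat \<Rightarrow> 'w \<Rightarrow> real ^ 'm ^ 'd"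
    assume t: "t \<in> {0..T}" and s: "simple_integrand F t n \<tau> \<xi>" and d: "0 \<le> (d::real)"
        and e: "0 < (e::real)"
    note sD = simple_integrandD[OF s]
    have \<tau>: "\<tau> i \<in> {0..T}" if "i \<le> n" for i using sD(1)[OF that] t by auto
    have mono: "\<tau> i \<le> \<tau> j" if "i \<le> j" "j \<le> n" for i j
      using that by (induction rule: dec_induct) (auto intro!: order_trans[OF _ sD(2)])
    define a where "a i \<omega> = (norm (\<xi> i \<omega>))\<^sup>2 * (\<tau> (Suc i) - \<tau> i)" for i \<omega>
    have a0: "0 \<le> a i \<omega>" if "i < n" for i \<omega> using sD(2)[OF that] by (simp add: a_def)
    define \<xi>' where "\<xi>' i \<omega> = (if (\<Sum>j<Suc i. a j \<omega>) \<le> d then \<xi> i \<omega> else 0)" for i \<omega>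
    have s': "simple_integrand F t n \<tau> \<xi>'"
      unfolding simple_integrand_def
    proof (intro conjI allI impI)
      fix i assume i: "i < n"
      have "(\<lambda>\<omega>. a j \<omega>) \<in> borel_measurable (F (\<tau> i))" if "j < Suc i" for j
      proof -
        have "\<xi> j \<in> borel_measurable (F (\<tau> i))"
          by (rule measurable_F_mono[OF _ mono _ sD(3)]) (use that i \<tau>[of j] \<tau>[of i] in auto)
        then show ?thesis unfolding a_def by measurable
      qed
      then have [measurable]: "(\<lambda>\<omega>. \<Sum>j<Suc i. a j \<omega>) \<in> borel_measurable (F (\<tau> i))"
        by (intro borel_measurable_sum) auto
      note [measurable] = sD(3)[OF i]
      show "\<xi>' i \<in> borel_measurable (F (\<tau> i))" unfolding \<xi>'_def[abs_def] by measurable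
      obtain c where c: "\<forall>\<omega>\<in>space (F (\<tau> i)). norm (\<xi> i \<omega>) \<le> c" using sD(4)[OF i] by blast
      then show "\<exists>c. \<forall>\<omega>\<in>space (F (\<tau> i)). norm (\<xi>' i \<omega>) \<le> c"
        by (intro exI[of _ "\<bar>c\<bar>"]) (auto simp: \<xi>'_def intro: order_trans)
    qed (use sD in auto)
    have m\<xi>: "\<xi> i \<in> borel_measurable M" if "i < n" for i
      by (rule measurable_F_M[OF \<tau> sD(3)]) (use that in auto)
    have m\<xi>': "\<xi>' i \<in> borel_measurable M" if "i < n" for i
      by (rule measurable_F_M[OF \<tau> simple_integrandD(3)[OF s']]) (use that in auto)
    have int: "integrable M (\<lambda>\<omega>. (norm (\<xi>' i \<omega>))\<^sup>2)" if i: "i < n" for i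
    proof -
      obtain b where "\<forall>\<omega>\<in>space M. norm (\<xi>' i \<omega>) \<le> b" using simple_integrand_bounded[OF t s' i] by blast
      then show ?thesis
        by (intro integrable_const_bound[where B
          = "b\<^sup>2"]) (use m\<xi>' i in \<open>auto intro!: AE_I2 power_mono\<close>)
    qed
    let ?S = "simple_ito_integral B n \<tau> \<xi>" and ?S' = "simple_ito_integral B n \<tau> \<xi>'"
    let ?A = "\<lambda>\<omega>. \<Sum>i<n. a i \<omega>"
    have mA [measurable]: "?A \<in> borel_measurable M"
      unfolding a_def using m\<xi> by (intro borel_measurable_sum) auto
    have mS [measurable]: "?S \<in> borel_measurable M" "?S' \<in> borel_measurable M"
      using simple_ito_measurable[OF t s] simple_ito_measurable[OF t s'] by auto
    have "expectation (\<lambda>\<omega>. (norm (?S' \<omega>))\<^sup>2) = expectation (\<lambda>\<omega>. norm (?S' \<omega>) powr 2)" by simp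
    also have "\<dots> \<le> (K * (\<Sum>i<n. expectation (\<lambda>\<omega>. norm (\<xi>' i \<omega>) powr 2) powr (2 / 2) * (\<tau> (Suc i) - \<tau> i)))
        powr (2 / 2)"
      using K[OF t s'] by blast
    also have "\<dots> = K * (\<Sum>i<n. expectation (\<lambda>\<omega>. (norm (\<xi>' i \<omega>))\<^sup>2) * (\<tau> (Suc i) - \<tau> i))"
    proof -
      have "0 \<le> (\<Sum>i<n. expectation (\<lambda>\<omega>. (norm (\<xi>' i \<omega>))\<^sup>2) * (\<tau> (Suc i) - \<tau> i))"
        using sD(2) by (intro sum_nonneg mult_nonneg_nonneg) auto
      then show ?thesis using K0 by simp
    qed
    also have "(\<Sum>i<n. expectation (\<lambda>\<omega>. (norm (\<xi>' i \<omega>))\<^sup>2) * (\<tau> (Suc i) - \<tau> i))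
        = expectation (\<lambda>\<omega>. \<Sum>i<n. (norm (\<xi>' i \<omega>))\<^sup>2 * (\<tau> (Suc i) - \<tau> i))"
      using int by (subst Bochner_Integration.integral_sum) auto
    also have "\<dots> \<le> expectation (\<lambda>\<omega>. d)"
    proof (rule integral_mono)
      show "integrable M (\<lambda>\<omega>. \<Sum>i<n. (norm (\<xi>' i \<omega>))\<^sup>2 * (\<tau> (Suc i) - \<tau> i))"
        using int by (intro Bochner_Integration.integrable_sum integrable_mult_left) auto
      show "(\<Sum>i<n. (norm (\<xi>' i \<omega>))\<^sup>2 * (\<tau> (Suc i) - \<tau> i)) \<le> d" for \<omega>
      proof -
        have "(\<Sum>i<n. (norm (\<xi>' i \<omega>))\<^sup>2 * (\<tau> (Suc i) - \<tau> i))
            = (\<Sum>i<n. if (\<Sum>j<Suc i. a j \<omega>) \<le> d then a i \<omega> else 0)"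
          by (intro sum.cong) (auto simp: \<xi>'_def a_def)
        also have "\<dots> \<le> d" by (rule truncated_sum_le[OF a0 d])
        finally show ?thesis .
      qed
    qed simp
    also have "expectation (\<lambda>\<omega>. d) = d" by (simp add: prob_space)
    finally have E: "expectation (\<lambda>\<omega>. (norm (?S' \<omega>))\<^sup>2) \<le> K * d" using K0 by (simp add: mult_left_mono)
    have iS: "integrable M (\<lambda>\<omega>. (norm (?S' \<omega>))\<^sup>2)" using K[OF t s'] by simp
    have "prob {\<omega>\<in>space M. e < norm (?S' \<omega>)} \<le> prob {\<omega>\<in>space M. e\<^sup>2 \<le> (norm (?S' \<omega>))\<^sup>2}"
      using e by (intro finite_measure_mono) (auto intro!: power_mono)
    also have "\<dots> \<le> expectation (\<lambda>\<omega>. (norm (?S' \<omega>))\<^sup>2) / e\<^sup>2"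
      using integral_Markov_inequality_measure[OF iS, of "space M" "e\<^sup>2"] e by simp
    also have "\<dots> \<le> K * d / e\<^sup>2" using E by (intro divide_right_mono) auto
    finally have P: "prob {\<omega>\<in>space M. e < norm (?S' \<omega>)} \<le> K * d / e\<^sup>2" .
    \<comment> \<open>When the total energy is at most \<open>d\<close>, so is every partial sum; no
      coefficient is cut off and the two integrals agree. Thus stopping costs only the probability
      of a large energy, and Markov's inequality handles the stopped integral.\<close>
    have eq: "?S \<omega> = ?S' \<omega>" if "?A \<omega> \<le> d" for \<omega>
    proof -
      have "(\<Sum>j<Suc i. a j \<omega>) \<le> d" if "i < n" for i
        using that a0 by (intro order_trans[OF sum_mono2 \<open>?A \<omega> \<le> d\<close>]) auto
      then show ?thesis unfolding simple_ito_integral_def \<xi>'_def by (intro sum.cong) auto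
    qed
    have "prob {\<omega>\<in>space M. e < norm (?S \<omega>)} \<le> prob ({\<omega>\<in>space M. d < ?A \<omega>} \<union> {\<omega>\<in>space M. e < norm (?S'
        \<omega>)})"
    proof (rule finite_measure_mono)
      show "{\<omega>\<in>space M. e < norm (?S \<omega>)} \<subseteq> {\<omega>\<in>space M. d < ?A \<omega>} \<union> {\<omega>\<in>space M. e < norm (?S' \<omega>)}"
      proof
        fix \<omega> assume "\<omega> \<in> {\<omega>\<in>space M. e < norm (?S \<omega>)}"
        then show "\<omega> \<in> {\<omega>\<in>space M. d < ?A \<omega>} \<union> {\<omega>\<in>space M. e < norm (?S' \<omega>)}"
          using eq[of \<omega>] by (cases "?A \<omega> \<le> d") auto
      qed
    qed measurable
    also have "\<dots> \<le> prob {\<omega>\<in>space M. d < ?A \<omega>} + prob {\<omega>\<in>space M. e < norm (?S' \<omega>)}"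
      by (intro measure_Un_le) auto
    finally show "prob {\<omega>\<in>space M. e < norm (?S \<omega>)}
        \<le> prob {\<omega>\<in>space M. d < (\<Sum>i<n. (norm (\<xi> i \<omega>))\<^sup>2 * (\<tau> (Suc i) - \<tau> i))} + K * d / e\<^sup>2"
      using P by (simp add: a_def)
  qed
qed

end

subsection \<open>Progressive integrands\<close>

definition path_energy :: "real \<Rightarrow> (real \<Rightarrow> 'w \<Rightarrow> 'b::real_normed_vector) \<Rightarrow> 'w \<Rightarrow> ennreal" where
  "path_energy t \<Phi> \<omega> = (\<integral>\<^sup>+s\<in>{0..t}. ennreal ((norm (\<Phi> s \<omega>))\<^sup>2) \<partial>lborel)"

text \<open>The indicator extends the process by 0 to all times, so that Tonelli and sections can be
  used on the unrestricted product with \<open>lborel\<close>; values outside \<open>{0..t}\<close>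
  are irrelevant.\<close>

definition jointly_measurable ::
  "'w measure \<Rightarrow> real \<Rightarrow> (real \<Rightarrow> 'w \<Rightarrow> 'b::real_normed_vector) \<Rightarrow> bool" where
  "jointly_measurable N t \<Phi> \<longleftrightarrow>
     (\<lambda>(\<omega>, s). indicator {0..t} s *\<^sub>R \<Phi> s \<omega>) \<in> borel_measurable (N \<Otimes>\<^sub>M lborel)"

text \<open>The algebra \<open>F r\<close> is kept for every intermediate time \<open>r\<close>.
  Integrals of the process up to \<open>r\<close> are then known at time \<open>r\<close>, which
  makes the later step approximations adapted.\<close>

lemma progressive_jointly_measurable:
  fixes \<Phi> :: "real \<Rightarrow> 'w \<Rightarrow> 'b::{second_countable_topology, real_normed_vector}"
  assumes "progressive t F \<Phi>" "r \<in> {0..t}"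
  shows "jointly_measurable (F r) r \<Phi>"
proof -
  let ?P = "F r \<Otimes>\<^sub>M (lborel :: real measure)" and ?\<Omega> = "space (F r) \<times> {0..r}"
  have \<Omega>: "?\<Omega> \<inter> space ?P \<in> sets ?P"
  proof -
    have "?\<Omega> \<in> sets ?P" by (intro pair_measureI) auto
    then show ?thesis by (simp add: sets.Int_space_eq2)
  qed
  have "(\<lambda>x. (snd x, fst x)) \<in> measurable (restrict_space ?P ?\<Omega>) (restrict_space borel {0..r} \<Otimes>\<^sub>M F r)"
  proof (rule measurable_Pair)
    have "(\<lambda>x. snd x) \<in> restrict_space ?P ?\<Omega> \<rightarrow>\<^sub>M restrict_space borel {0..r}"
    proof (rule measurable_restrict_space2)
      show "(\<lambda>x. snd x) \<in> space (restrict_space ?P ?\<Omega>) \<rightarrow> {0..r}"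
        by (auto simp: space_restrict_space)
      show "(\<lambda>x. snd x) \<in> borel_measurable (restrict_space ?P ?\<Omega>)"
        by (rule measurable_restrict_space1) simp
    qed
    then show "(\<lambda>x. snd x) \<in> restrict_space ?P ?\<Omega> \<rightarrow>\<^sub>M restrict_space borel {0..r}" .
    show "(\<lambda>x. fst x) \<in> restrict_space ?P ?\<Omega> \<rightarrow>\<^sub>M F r"
      by (auto intro!: measurable_restrict_space1)
  qed
  moreover have "(\<lambda>(s, \<omega>). \<Phi> s \<omega>) \<in> borel_measurable (restrict_space borel {0..r} \<Otimes>\<^sub>M F r)"
    using assms by (auto simp: progressive_def)
  ultimately have "(\<lambda>x. \<Phi> (snd x) (fst x)) \<in> borel_measurable (restrict_space ?P ?\<Omega>)"
    using measurable_compose[of "\<lambda>x. (snd x, fst x)" _ _ "\<lambda>(s, \<omega>). \<Phi> s \<omega>"] by simp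
  then have "(\<lambda>x. if x \<in> ?\<Omega> then \<Phi> (snd x) (fst x) else 0) \<in> borel_measurable ?P"
    by (rule measurable_restrict_space_iff[OF \<Omega>, of 0 borel, THEN iffD1, rotated]) simp
  then show ?thesis
    unfolding jointly_measurable_def
    by (rule measurable_cong[THEN iffD1, rotated]) (auto simp: space_pair_measure indicator_def split:
      if_splits)
qed

lemma jointly_measurable_diff:
  fixes \<Phi> \<Psi> :: "real \<Rightarrow> 'w \<Rightarrow> 'b::{second_countable_topology, real_normed_vector}"
  assumes "jointly_measurable N t \<Phi>" "jointly_measurable N t \<Psi>"
  shows "jointly_measurable N t (\<lambda>s \<omega>. \<Phi> s \<omega> - \<Psi> s \<omega>)"
  using borel_measurable_diff[OF assms[unfolded jointly_measurable_def]]
  by (simp add: jointly_measurable_def case_prod_unfold scaleR_diff_right)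

lemma jointly_measurable_energy:
  fixes \<Phi> :: "real \<Rightarrow> 'w \<Rightarrow> 'b::{second_countable_topology, real_normed_vector}"
  assumes "jointly_measurable N t \<Phi>"
  shows "path_energy t \<Phi> \<in> borel_measurable N"
proof -
  note [measurable] = assms[unfolded jointly_measurable_def]
  have "path_energy t \<Phi> = (\<lambda>\<omega>. \<integral>\<^sup>+s. ennreal ((norm (indicator {0..t} s *\<^sub>R \<Phi> s \<omega>))\<^sup>2) \<partial>lborel)"
    unfolding path_energy_def[abs_def]
    by (intro ext nn_integral_cong) (auto simp: indicator_def)
  also have "\<dots> \<in> borel_measurable N"
    by (rule lborel.borel_measurable_nn_integral) measurable
  finally show ?thesis .
qed

lemma jointly_measurable_section:
  assumes "jointly_measurable N t \<Phi>" "\<omega> \<in> space N"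
  shows "(\<lambda>s. indicator {0..t} s *\<^sub>R \<Phi> s \<omega>) \<in> borel_measurable lborel"
  using measurable_compose[OF measurable_Pair1'[OF assms(2)] assms(1)[unfolded jointly_measurable_def]]
  by simp

lemma path_energy_diff_le:
  fixes \<Phi> \<Psi> :: "real \<Rightarrow> 'w \<Rightarrow> 'b::{second_countable_topology, real_normed_vector}"
  assumes "jointly_measurable N t \<Phi>" "jointly_measurable N t \<Psi>" "\<omega> \<in> space N"
  shows "path_energy t (\<lambda>s \<omega>. \<Phi> s \<omega> - \<Psi> s \<omega>) \<omega> \<le> 2 * path_energy t \<Phi> \<omega> + 2 * path_energy t \<Psi> \<omega>"
proof -
  note [measurable] = jointly_measurable_section[OF assms(1,3)] jointly_measurable_section[OF
      assms(2,3)]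
  have e: "path_energy t X \<omega> = (\<integral>\<^sup>+s. ennreal ((norm (indicator {0..t} s *\<^sub>R X s \<omega>))\<^sup>2) \<partial>lborel)"
      for X :: "real \<Rightarrow> 'w \<Rightarrow> 'b"
    unfolding path_energy_def by (intro nn_integral_cong) (auto simp: indicator_def)
  have "(norm (a - b))\<^sup>2 \<le> 2 * (norm a)\<^sup>2 + 2 * (norm b)\<^sup>2" for a b :: 'b
  proof -
    have "(norm (a - b))\<^sup>2 \<le> (norm a + norm b)\<^sup>2" by (intro power_mono norm_triangle_ineq4) auto
    also have "\<dots> \<le> 2 * (norm a)\<^sup>2 + 2 * (norm b)\<^sup>2"
      using zero_le_power2[of "norm a - norm b"] by (simp add: power2_eq_square algebra_simps)
    finally show ?thesis .
  qed
  then have "path_energy t (\<lambda>s \<omega>. \<Phi> s \<omega> - \<Psi> s \<omega>) \<omega>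
      \<le> (\<integral>\<^sup>+s. 2 * ennreal ((norm (indicator {0..t} s *\<^sub>R \<Phi> s \<omega>))\<^sup>2) + 2 * ennreal ((norm (indicator
          {0..t} s *\<^sub>R \<Psi> s \<omega>))\<^sup>2) \<partial>lborel)"
    unfolding e scaleR_diff_right
    by (intro nn_integral_mono)
      (simp flip: ennreal_numeral ennreal_mult ennreal_plus add: ennreal_leI del: norm_scaleR)
  also have "\<dots> = 2 * path_energy t \<Phi> \<omega> + 2 * path_energy t \<Psi> \<omega>"
    unfolding e by (simp add: nn_integral_add nn_integral_cmult del: norm_scaleR)
  finally show ?thesis .
qed

context usual_filtered_prob_space
begin

lemma progressive_jointly_measurable_M:
  fixes \<Phi> :: "real \<Rightarrow> 'w \<Rightarrow> 'b::{second_countable_topology, real_normed_vector}"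
  assumes "progressive t F \<Phi>" "r \<in> {0..t}" "r \<le> T"
  shows "jointly_measurable M r \<Phi>"
proof -
  have r: "r \<in> {0..T}" using assms by auto
  have "(\<lambda>\<omega>. \<omega>) \<in> measurable M (F r)"
    by (rule measurable_from_subalg[OF subalgebra_F[OF r]]) simp
  then have "(\<lambda>x. (fst x, snd x)) \<in> measurable (M \<Otimes>\<^sub>M lborel) (F r \<Otimes>\<^sub>M (lborel :: real measure))"
    by (intro measurable_Pair measurable_compose[OF measurable_fst]) auto
  from measurable_compose[OF this progressive_jointly_measurable[OF assms(1,2), unfolded
      jointly_measurable_def]]
  show ?thesis by (simp add: jointly_measurable_def case_prod_unfold)
qed

lemma simple_process_jointly_measurable:
  assumes t: "t \<in> {0..T}" and s: "simple_integrand F t n \<tau> \<xi>"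
  shows "jointly_measurable M t (simple_process n \<tau> \<xi>)"
proof -
  have \<tau>: "\<tau> i \<in> {0..T}" if "i \<le> n" for i using simple_integrandD(1)[OF s that] t by auto
  have [measurable]: "\<xi> i \<in> borel_measurable M" if "i < n" for i
    by (rule measurable_F_M[OF \<tau> simple_integrandD(3)[OF s]]) (use that in auto)
  have "(\<lambda>x. \<Sum>i<n. indicator {\<tau> i<..\<tau> (Suc i)} (snd x) *\<^sub>R \<xi> i (fst x)) \<in> borel_measurable (M \<Otimes>\<^sub>M
      lborel)"
    by (intro borel_measurable_sum) measurable
  then show ?thesis
    unfolding jointly_measurable_def simple_process_def case_prod_unfold
    by (intro borel_measurable_scaleR) auto
qed

lemma prob_le_of_cover:
  assumes [measurable]: "{\<omega>\<in>space M. Q \<omega>} \<in> events" "{\<omega>\<in>space M. R \<omega>} \<in> events"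
    and "\<And>\<omega>. \<omega> \<in> space M \<Longrightarrow> P \<omega> \<Longrightarrow> Q \<omega> \<or> R \<omega>"
  shows "prob {\<omega>\<in>space M. P \<omega>} \<le> prob {\<omega>\<in>space M. Q \<omega>} + prob {\<omega>\<in>space M. R \<omega>}"
proof -
  have "prob {\<omega>\<in>space M. P \<omega>} \<le> prob ({\<omega>\<in>space M. Q \<omega>} \<union> {\<omega>\<in>space M. R \<omega>})"
    using assms by (intro finite_measure_mono) auto
  also have "\<dots> \<le> prob {\<omega>\<in>space M. Q \<omega>} + prob {\<omega>\<in>space M. R \<omega>}"
    by (intro measure_Un_le) auto
  finally show ?thesis .
qed

lemma ennreal_quarters:
  assumes "0 < e" "a \<le> ennreal (e / 4)" "b \<le> ennreal (e / 4)"
  shows "2 * a + 2 * b \<le> ennreal e"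
proof -
  have "2 * a + 2 * b \<le> 2 * ennreal (e / 4) + 2 * ennreal (e / 4)"
    using assms by (intro add_mono mult_left_mono) auto
  also have "\<dots> = ennreal e"
    using assms by (simp flip: ennreal_numeral ennreal_mult ennreal_plus)
  finally show ?thesis .
qed

text \<open>The energy of a difference is at most twice the sum of the energies; if it exceeds
  \<open>e\<close>, one of the two energies exceeds \<open>e / 4\<close>.\<close>

lemma prob_energy_diff_le:
  fixes \<Phi> \<Psi> :: "real \<Rightarrow> 'w \<Rightarrow> 'b::{second_countable_topology, real_normed_vector}"
  assumes j: "jointly_measurable M t \<Phi>" "jointly_measurable M t \<Psi>" and e: "0 < e"
  shows "prob {\<omega>\<in>space M. ennreal e < path_energy t (\<lambda>s \<omega>. \<Phi> s \<omega> - \<Psi> s \<omega>) \<omega>}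
    \<le> prob {\<omega>\<in>space M. ennreal (e / 4) < path_energy t \<Phi> \<omega>}
      + prob {\<omega>\<in>space M. ennreal (e / 4) < path_energy t \<Psi> \<omega>}"
proof (rule prob_le_of_cover)
  note [measurable] = jointly_measurable_energy[OF j(1)] jointly_measurable_energy[OF j(2)]
  show "{\<omega>\<in>space M. ennreal (e / 4) < path_energy t \<Phi> \<omega>} \<in> events"
    "{\<omega>\<in>space M. ennreal (e / 4) < path_energy t \<Psi> \<omega>} \<in> events" by measurable
  fix \<omega> assume \<omega>: "\<omega> \<in> space M" "ennreal e < path_energy t (\<lambda>s \<omega>. \<Phi> s \<omega> - \<Psi> s \<omega>) \<omega>"
  show "ennreal (e / 4) < path_energy t \<Phi> \<omega> \<or> ennreal (e / 4) < path_energy t \<Psi> \<omega>"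
  proof (rule ccontr)
    assume "\<not> ?thesis"
    then have "2 * path_energy t \<Phi> \<omega> + 2 * path_energy t \<Psi> \<omega> \<le> ennreal e"
      using e by (intro ennreal_quarters) auto
    with path_energy_diff_le[OF j \<omega>(1)] \<omega>(2) show False by (meson leD order_trans)
  qed
qed

text \<open>Linearity of the relation is not immediate, because the approximating sequences of the
  two integrals live on unrelated grids. They are merged for each index \<open>k\<close> separately,
  and both convergences in probability pass to the difference.\<close>

lemma has_ito_integral_diff:
  fixes \<Phi> \<Phi>' :: "real \<Rightarrow> 'w \<Rightarrow> real ^ 'm ^ 'd" and B :: "real \<Rightarrow> 'w \<Rightarrow> real ^ 'm"
  assumes t: "t \<in> {0..T}" and B: "\<And>s. s \<in> {0..T} \<Longrightarrow> B s \<in> borel_measurable M"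
    and I: "has_ito_integral M F B t \<Phi> Y" and I': "has_ito_integral M F B t \<Phi>' Y'"
  shows "has_ito_integral M F B t (\<lambda>s \<omega>. \<Phi> s \<omega> - \<Phi>' s \<omega>) (\<lambda>\<omega>. Y \<omega> - Y' \<omega>)"
proof -
  have t0: "t \<in> {0..t}" and tT: "t \<le> T" using t by auto
  have pr: "progressive t F \<Phi>" "progressive t F \<Phi>'"
    and fin: "AE \<omega> in M. path_energy t \<Phi> \<omega> < \<infinity>" "AE \<omega> in M. path_energy t \<Phi>' \<omega> < \<infinity>"
    and [measurable]: "Y \<in> borel_measurable M" "Y' \<in> borel_measurable M"
    using I I' by (auto simp: has_ito_integral_def path_energy_def)
  note j = progressive_jointly_measurable_M[OF pr(1) t0 tT] and j'
      = progressive_jointly_measurable_M[OF pr(2) t0 tT]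
  obtain n \<tau> \<xi> where s: "\<And>k. simple_integrand F t (n k) (\<tau> k) (\<xi> k)"
    and c1: "\<And>e. e > 0 \<Longrightarrow> (\<lambda>k. prob {\<omega>\<in>space M. ennreal e <
        path_energy t (\<lambda>s \<omega>. simple_process (n k) (\<tau> k) (\<xi> k) s \<omega> - \<Phi> s \<omega>) \<omega>}) \<longlonglongrightarrow> 0"
    and c2: "\<And>e. e > 0 \<Longrightarrow> (\<lambda>k. prob {\<omega>\<in>space M.
        e < norm (simple_ito_integral B (n k) (\<tau> k) (\<xi> k) \<omega> - Y \<omega>)}) \<longlonglongrightarrow> 0"
    using I unfolding has_ito_integral_def path_energy_def by blast
  obtain n' \<tau>' \<xi>' where s': "\<And>k. simple_integrand F t (n' k) (\<tau>' k) (\<xi>' k)"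
    and c1': "\<And>e. e > 0 \<Longrightarrow> (\<lambda>k. prob {\<omega>\<in>space M. ennreal e <
        path_energy t (\<lambda>s \<omega>. simple_process (n' k) (\<tau>' k) (\<xi>' k) s \<omega> - \<Phi>' s \<omega>) \<omega>}) \<longlonglongrightarrow> 0"
    and c2': "\<And>e. e > 0 \<Longrightarrow> (\<lambda>k. prob {\<omega>\<in>space M.
        e < norm (simple_ito_integral B (n' k) (\<tau>' k) (\<xi>' k) \<omega> - Y' \<omega>)}) \<longlonglongrightarrow> 0"
    using I' unfolding has_ito_integral_def path_energy_def by blast
  have "\<forall>k. \<exists>N \<rho> \<zeta>. simple_integrand F t N \<rho> \<zeta> \<and>
    (\<forall>s \<omega>. simple_process N \<rho> \<zeta> s \<omega> = simple_process (n k) (\<tau> k) (\<xi> k) s \<omega> - simple_process (n' k) (\<tau>'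
        k) (\<xi>' k) s \<omega>) \<and>
    (\<forall>\<omega>. simple_ito_integral B N \<rho> \<zeta> \<omega> = simple_ito_integral B (n k) (\<tau> k) (\<xi> k) \<omega> - simple_ito_integral
        B (n' k) (\<tau>' k) (\<xi>' k) \<omega>)"
    by (rule allI, rule simple_integrand_diff[OF t s s', where B = B]) blast
  then obtain N \<rho> \<zeta> where z: "\<And>k. simple_integrand F t (N k) (\<rho> k) (\<zeta> k)"
    and z1: "\<And>k s \<omega>. simple_process (N k) (\<rho> k) (\<zeta> k) s \<omega>
        = simple_process (n k) (\<tau> k) (\<xi> k) s \<omega> - simple_process (n' k) (\<tau>' k) (\<xi>' k) s \<omega>"
    and z2: "\<And>k \<omega>. simple_ito_integral B (N k) (\<rho> k) (\<zeta> k) \<omega>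
        = simple_ito_integral B (n k) (\<tau> k) (\<xi> k) \<omega> - simple_ito_integral B (n' k) (\<tau>' k) (\<xi>' k) \<omega>"
    by metis
  note js = simple_process_jointly_measurable[OF t s] and js'
      = simple_process_jointly_measurable[OF t s']
  have mS: "simple_ito_integral B n \<tau> \<xi> \<in> borel_measurable M" if "simple_integrand F t n \<tau> \<xi>" for n \<tau>
      and \<xi> :: "nat \<Rightarrow> 'w \<Rightarrow> real ^ 'm ^ 'd"
  proof -
    have \<tau>: "\<tau> i \<in> {0..T}" if "i \<le> n" for i using simple_integrandD(1)[OF \<open>simple_integrand F t n \<tau> \<xi>\<close>
        that] t by auto
    have [measurable]: "\<xi> i \<in> borel_measurable M" if "i < n" for i
      by (rule measurable_F_M[OF \<tau> simple_integrandD(3)[OF \<open>simple_integrand F t n \<tau> \<xi>\<close>]]) (use that in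
        auto)
    show ?thesis unfolding simple_ito_integral_def[abs_def]
      by (intro borel_measurable_sum borel_measurable_matrix_vector borel_measurable_diff B \<tau>) auto
  qed
  note [measurable] = mS[OF s] mS[OF s']
    have P: "progressive t F (\<lambda>s \<omega>. \<Phi> s \<omega> - \<Phi>' s \<omega>)"
      using pr unfolding progressive_def case_prod_unfold
      by (intro ballI borel_measurable_diff) auto
    have A: "AE \<omega> in M. path_energy t (\<lambda>s \<omega>. \<Phi> s \<omega> - \<Phi>' s \<omega>) \<omega> < \<infinity>"
      using fin AE_space
    proof eventually_elim
      case (elim \<omega>)
      then have "2 * path_energy t \<Phi> \<omega> + 2 * path_energy t \<Phi>' \<omega> < \<infinity>"
        by (simp add: ennreal_mult_less_top)
      then show ?case using path_energy_diff_le[OF j j' elim(3)] by (rule order.strict_trans1[rotated])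
    qed
    have C1: "(\<lambda>k. prob {\<omega>\<in>space M. ennreal e <
        path_energy t (\<lambda>s \<omega>. simple_process (N k) (\<rho> k) (\<zeta> k) s \<omega> - (\<Phi> s \<omega> - \<Phi>' s \<omega>)) \<omega>}) \<longlonglongrightarrow> 0"
      if e: "e > 0" for e
    proof -
    have "(\<lambda>k. prob {\<omega>\<in>space M. ennreal (e / 4) < path_energy t (\<lambda>s \<omega>. simple_process (n k) (\<tau> k) (\<xi> k)
        s \<omega> - \<Phi> s \<omega>) \<omega>}
      + prob {\<omega>\<in>space M. ennreal (e / 4) < path_energy t (\<lambda>s \<omega>. simple_process (n' k) (\<tau>' k) (\<xi>' k) s \<omega>
          - \<Phi>' s \<omega>) \<omega>}) \<longlonglongrightarrow> 0 + 0"
      using e by (intro tendsto_add c1 c1') auto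
    then show "(\<lambda>k. prob {\<omega>\<in>space M. ennreal e <
        path_energy t (\<lambda>s \<omega>. simple_process (N k) (\<rho> k) (\<zeta> k) s \<omega> - (\<Phi> s \<omega> - \<Phi>' s \<omega>)) \<omega>}) \<longlonglongrightarrow> 0"
    unfolding add_0_left
    proof (rule Lim_null_comparison[rotated])
      have eq: "simple_process (N k) (\<rho> k) (\<zeta> k) s \<omega> - (\<Phi> s \<omega> - \<Phi>' s \<omega>)
        = (simple_process (n k) (\<tau> k) (\<xi> k) s \<omega> - \<Phi> s \<omega>) - (simple_process (n' k) (\<tau>' k) (\<xi>' k) s \<omega> - \<Phi>'
            s \<omega>)" for k s \<omega>
        by (simp add: z1)
      show "\<forall>\<^sub>F k in sequentially. norm (prob {\<omega>\<in>space M. ennreal e <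
          path_energy t (\<lambda>s \<omega>. simple_process (N k) (\<rho> k) (\<zeta> k) s \<omega> - (\<Phi> s \<omega> - \<Phi>' s \<omega>)) \<omega>})
        \<le> prob {\<omega>\<in>space M. ennreal (e / 4) < path_energy t (\<lambda>s \<omega>. simple_process (n k) (\<tau> k) (\<xi> k) s \<omega> -
            \<Phi> s \<omega>) \<omega>}
      + prob {\<omega>\<in>space M. ennreal (e / 4) < path_energy t (\<lambda>s \<omega>. simple_process (n' k) (\<tau>' k) (\<xi>' k) s \<omega>
          - \<Phi>' s \<omega>) \<omega>}"
        using prob_energy_diff_le[OF jointly_measurable_diff[OF js j] jointly_measurable_diff[OF js' j']
          e]
        unfolding eq real_norm_def abs_of_nonneg[OF measure_nonneg]
        by (intro always_eventually allI)
    qed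
    qed
    have C2: "(\<lambda>k. prob {\<omega>\<in>space M. e < norm (simple_ito_integral B (N k) (\<rho> k) (\<zeta> k) \<omega> - (Y \<omega> - Y'
        \<omega>))}) \<longlonglongrightarrow> 0"
      if e: "e > 0" for e
    proof -
    have "(\<lambda>k. prob {\<omega>\<in>space M. e / 2 < norm (simple_ito_integral B (n k) (\<tau> k) (\<xi> k) \<omega> - Y \<omega>)}
        + prob {\<omega>\<in>space M. e / 2 < norm (simple_ito_integral B (n' k) (\<tau>' k) (\<xi>' k) \<omega> - Y' \<omega>)}) \<longlonglongrightarrow> 0 + 0"
      using e by (intro tendsto_add c2 c2') auto
    then show "(\<lambda>k. prob {\<omega>\<in>space M. e < norm (simple_ito_integral B (N k) (\<rho> k) (\<zeta> k) \<omega> - (Y \<omega> - Y'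
        \<omega>))}) \<longlonglongrightarrow> 0"
    unfolding add_0_left
    proof (rule Lim_null_comparison[rotated])
      have "e / 2 < norm (a - y) \<or> e / 2 < norm (a' - y')" if "e < norm (a - a' - (y - y'))"
          for a a' y y' :: "real ^ 'd"
        using that norm_triangle_ineq4[of "a - y" "a' - y'"] by (auto simp: algebra_simps)
      then show "\<forall>\<^sub>F k in sequentially. norm (prob {\<omega>\<in>space M. e < norm (simple_ito_integral B (N k) (\<rho>
          k) (\<zeta> k) \<omega> - (Y \<omega> - Y' \<omega>))})
          \<le> prob {\<omega>\<in>space M. e / 2 < norm (simple_ito_integral B (n k) (\<tau> k) (\<xi> k) \<omega> - Y \<omega>)}
        + prob {\<omega>\<in>space M. e / 2 < norm (simple_ito_integral B (n' k) (\<tau>' k) (\<xi>' k) \<omega> - Y' \<omega>)}"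
        unfolding z2 real_norm_def abs_of_nonneg[OF measure_nonneg]
        by (intro always_eventually allI prob_le_of_cover) auto
    qed
    qed
    have m: "(\<lambda>\<omega>. Y \<omega> - Y' \<omega>) \<in> borel_measurable M" by measurable
    show ?thesis
      unfolding has_ito_integral_def
      using P A[unfolded path_energy_def] m z C1[unfolded path_energy_def] C2
      by (intro conjI exI[of _ N] exI[of _ \<rho>] exI[of _ \<zeta>] allI impI) blast+
qed

end

subsection \<open>Lagged step approximation\<close>

text \<open>A measurable function is an almost everywhere limit of continuous ones. Clipping these
  to the ball of radius \<open>N\<close> provides the bound needed for dominated
  convergence.\<close>

lemma continuous_approx_L1:
  fixes f :: "real \<Rightarrow> 'b::euclidean_space"
  assumes f: "f \<in> borel_measurable borel" and N: "0 < N" "\<And>s. norm (f s) \<le> N"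
  obtains g where "\<And>n. continuous_on UNIV (g n :: real \<Rightarrow> 'b)" "\<And>n s. norm (g n s) \<le> N"
    "(\<lambda>n. \<integral>\<^sup>+s\<in>{0..t}. ennreal (norm (g n s - f s)) \<partial>lborel) \<longlonglongrightarrow> 0"
proof -
  have "f measurable_on UNIV"
    using f by (intro lebesgue_measurable_imp_measurable_on) (auto intro: measurable_completion)
  then obtain Z h where Z: "negligible Z" and h: "\<And>n. continuous_on UNIV (h n)"
    and lim: "\<And>x. x \<notin> Z \<Longrightarrow> (\<lambda>n. h n x) \<longlonglongrightarrow> f x"
    by (auto simp: measurable_on_def)
  \<comment> \<open>The radial retraction onto the closed ball of radius \<open>N\<close>:
    continuous, and the identity on the values of \<open>f\<close>, so the limit is
    unchanged.\<close>
  define c where "c x = (N / max N (norm x)) *\<^sub>R x" for x :: 'b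
  have cN: "norm (c x) \<le> N" for x
    using N(1) by (auto simp: c_def max_def field_simps)
  have cid: "c x = x" if "norm x \<le> N" for x
    using that N(1) by (simp add: c_def max_def)
  have ccont: "continuous_on UNIV c"
    unfolding c_def[abs_def] using N(1) by (intro continuous_intros) auto
  define g where "g n s = c (h n s)" for n s
  have gc: "continuous_on UNIV (g n)" for n
    unfolding g_def[abs_def] by (rule continuous_on_compose2[OF ccont h]) auto
  have [measurable]: "g n \<in> borel_measurable borel" for n
    using gc by (rule borel_measurable_continuous_onI)
  note [measurable] = f
  have AE: "AE s in lborel. (\<lambda>n. g n s) \<longlonglongrightarrow> f s"
  proof -
    have "Z \<in> null_sets lebesgue" using Z by (simp add: negligible_iff_null_sets)
    then have "AE s in lebesgue. s \<notin> Z" by (rule AE_not_in)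
    then have "AE s in lebesgue. (\<lambda>n. g n s) \<longlonglongrightarrow> f s"
    proof eventually_elim
      case (elim s)
      have "(\<lambda>n. c (h n s)) \<longlonglongrightarrow> c (f s)"
        using ccont lim[OF elim] by (intro continuous_on_tendsto_compose[of UNIV c]) auto
      then show ?case by (simp add: g_def cid N)
    qed
    then show ?thesis by (subst AE_completion_iff[symmetric])
  qed
  have "(\<lambda>n. \<integral>\<^sup>+s. ennreal (norm (g n s - f s)) * indicator {0..t} s \<partial>lborel) \<longlonglongrightarrow> (\<integral>\<^sup>+s. 0 \<partial>(lborel ::
      real measure))"
  proof (rule nn_integral_dominated_convergence[where w = "\<lambda>s. ennreal (2 * N) * indicator {0..t} s"])
    have "norm (g n s - f s) \<le> 2 * N" for n s
      using norm_triangle_ineq4[of "g n s" "f s"] cN[of "h n s"] N(2)[of s] by (simp add: g_def)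
    then show "AE s in lborel. ennreal (norm (g n s - f s)) * indicator {0..t} s
        \<le> ennreal (2 * N) * indicator {0..t} s" for n
      by (intro AE_I2 mult_right_mono ennreal_leI) auto
    show "(\<integral>\<^sup>+s. ennreal (2 * N) * indicator {0..t} s \<partial>lborel) < \<infinity>"
      by (subst nn_integral_cmult_indicator) (auto simp: ennreal_mult_less_top emeasure_lborel_Icc_eq)
    show "AE s in lborel. (\<lambda>n. ennreal (norm (g n s - f s)) * indicator {0..t} s) \<longlonglongrightarrow> 0"
      using AE
    proof eventually_elim
      case (elim s)
      then have "(\<lambda>n. norm (g n s - f s)) \<longlonglongrightarrow> 0" by (simp add: LIM_zero_iff tendsto_norm_zero_iff)
      then show ?case by (auto simp: indicator_def ennreal_tendsto_0_iff)
    qed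
  qed auto
  then show thesis using that[of g] gc cN by (simp add: g_def)
qed

text \<open>The point before index \<open>i\<close> uses real subtraction. For i = 0 it is -t / n,
  so the interval preceding the first one lies to the left of 0, up to the point 0 itself.\<close>

lemma uniform_grid:
  assumes "0 < t" "0 < n"
  shows "i \<le> n \<Longrightarrow> t * real i / real n \<in> {0..t}"
    and "t * real (Suc i) / real n - t * real i / real n = t / real n"
    and "t * real i / real n - t * (real i - 1) / real n = t / real n"
    and "t * real i / real n \<le> t * real (Suc i) / real n"
    and "t * (real i - 1) / real n \<le> t * real i / real n"
proof -
  show "t * real i / real n \<in> {0..t}" if "i \<le> n"
  proof -
    have "t * real i \<le> t * real n" using assms that by (intro mult_left_mono) auto
    then show ?thesis using assms by (simp add: divide_le_eq)
  qed
  show "t * real (Suc i) / real n - t * real i / real n = t / real n"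
    "t * real i / real n - t * (real i - 1) / real n = t / real n"
    by (simp_all add: diff_divide_distrib[symmetric] algebra_simps)
  show "t * real i / real n \<le> t * real (Suc i) / real n" "t * (real i - 1) / real n
      \<le> t * real i / real n"
    using assms by (intro divide_right_mono mult_left_mono; simp)+
qed

text \<open>
  The value of the step approximation on an interval is the mean over the preceding
  interval, so that it is known at the left end point.
\<close>

definition lagged_mean :: "real \<Rightarrow> nat \<Rightarrow> (real \<Rightarrow> 'b::euclidean_space) \<Rightarrow> nat \<Rightarrow> 'b" where
  "lagged_mean t n f i = (real n / t) *\<^sub>R
     (\<integral>s. indicator {t * (real i - 1) / real n<..t * real i / real n} s *\<^sub>R f s \<partial>lborel)"

text \<open>The step function of a single path is a simple process over the one-point space. This
  makes the evaluation and integration lemmas for simple processes available pathwise.\<close>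

abbreviation lagged_step :: "real \<Rightarrow> nat \<Rightarrow> (real \<Rightarrow> real ^ 'm ^ 'd) \<Rightarrow> real \<Rightarrow> real ^ 'm ^ 'd" where
  "lagged_step t n f s \<equiv> simple_process n (\<lambda>i. t * real i / real n) (\<lambda>i _. lagged_mean t n f i) s ()"

lemma integrable_indicator_Ioc: "integrable lborel (indicator {a<..b :: real} :: real \<Rightarrow> real)"
  by (rule integrable_real_indicator, simp) (cases "a \<le> b"; simp)

lemma integrable_indicator_bounded:
  fixes f :: "real \<Rightarrow> 'b::euclidean_space"
  assumes "f \<in> borel_measurable borel" "\<And>s. norm (f s) \<le> N"
  shows "integrable lborel (\<lambda>s. indicator {a<..b} s *\<^sub>R f s)"
proof (rule Bochner_Integration.integrable_bound)
  show "integrable lborel (\<lambda>s. N * indicator {a<..b} s)"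
    by (intro integrable_mult_right integrable_indicator_Ioc)
  show "AE s in lborel. norm (indicator {a<..b} s *\<^sub>R f s) \<le> norm (N * indicator {a<..b} s)"
    using assms(2) by (intro AE_I2) (auto simp: indicator_def intro: order_trans[OF _ abs_ge_self])
qed (use assms in auto)

lemma lagged_mean_norm_le:
  fixes f :: "real \<Rightarrow> 'b::euclidean_space"
  assumes t: "0 < t" "0 < n" and f: "f \<in> borel_measurable borel" "\<And>s. norm (f s) \<le> N"
  shows "norm (lagged_mean t n f i) \<le> N"
proof -
  let ?a = "t * (real i - 1) / real n" and ?b = "t * real i / real n"
  have ab: "?b - ?a = t / real n" "?a \<le> ?b" using uniform_grid[OF t] by simp_all
  have "norm (\<integral>s. indicator {?a<..?b} s *\<^sub>R f s \<partial>lborel) \<le> (\<integral>s. N * indicator {?a<..?b} s \<partial>lborel)"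
  proof (rule Bochner_Integration.integral_norm_bound_integral)
    show "integrable lborel (\<lambda>s. indicator {?a<..?b} s *\<^sub>R f s)"
      by (rule integrable_indicator_bounded[OF f])
    show "integrable lborel (\<lambda>s. N * indicator {?a<..?b} s)"
      by (intro integrable_mult_right integrable_indicator_Ioc)
    show "norm (indicator {?a<..?b} s *\<^sub>R f s) \<le> N * indicator {?a<..?b} s" for s
      using f(2)[of s] by (auto simp: indicator_def)
  qed
  also have "\<dots> = N * (t / real n)" using ab by (simp add: measure_lborel_Ioc)
  finally have "(real n / t) * norm (\<integral>s. indicator {?a<..?b} s *\<^sub>R f s \<partial>lborel)
      \<le> (real n / t) * (N * (t / real n))"
    using t by (intro mult_left_mono) auto
  then show ?thesis using t by (simp add: lagged_mean_def)
qed

lemma lagged_mean_diff: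
  fixes f g :: "real \<Rightarrow> 'b::euclidean_space"
  assumes "f \<in> borel_measurable borel" "\<And>s. norm (f s) \<le> N" "g \<in> borel_measurable borel" "\<And>s. norm (g s)
      \<le> N"
  shows "lagged_mean t n (\<lambda>s. f s - g s) i = lagged_mean t n f i - lagged_mean t n g i"
  unfolding lagged_mean_def scaleR_diff_right
  by (subst Bochner_Integration.integral_diff[OF integrable_indicator_bounded[OF assms(1,2)]
    integrable_indicator_bounded[OF assms(3,4)]])
    (simp add: scaleR_diff_right)

text \<open>On each interval the step function integrates to at most the integral of the norm of
  \<open>f\<close> over the preceding interval, and the preceding intervals are disjoint. The bound
  is uniform in \<open>n\<close>, so convergence for continuous functions extends to their
  L^1-limits.\<close>

lemma lagged_step_contraction:
  fixes f :: "real \<Rightarrow> real ^ 'm ^ 'd"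
  assumes t: "0 < t" "0 < n" and f: "f \<in> borel_measurable borel" "\<And>s. norm (f s) \<le> N"
    and supp: "\<And>s. s \<notin> {0..t} \<Longrightarrow> f s = 0"
  shows "(\<integral>\<^sup>+s\<in>{0..t}. ennreal (norm (lagged_step t n f s)) \<partial>lborel)
      \<le> (\<integral>\<^sup>+s\<in>{0..t}. ennreal (norm (f s)) \<partial>lborel)"
proof -
  define I where "I i = {t * (real i - 1) / real n<..t * real i / real n}" for i :: nat
  note [measurable] = f(1)
  have "(\<integral>\<^sup>+s\<in>{0..t}. ennreal (norm (lagged_step t n f s)) \<partial>lborel)
      = (\<Sum>i<n. ennreal (norm (lagged_mean t n f i)) * ennreal (t * real (Suc i) / real n - t * real i /
          real n))"
    by (rule nn_integral_simple_process) (use uniform_grid[OF t] in simp_all)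
  also have "\<dots> \<le> (\<Sum>i<n. \<integral>\<^sup>+s. indicator (I i) s * ennreal (norm (f s)) \<partial>lborel)"
  proof (rule sum_mono)
    fix i assume "i \<in> {..<n}"
    have "ennreal (norm (lagged_mean t n f i)) * ennreal (t * real (Suc i) / real n - t * real i / real
        n)
        = ennreal (norm (lagged_mean t n f i) * (t / real n))"
      unfolding uniform_grid(2)[OF t] using t by (intro ennreal_mult[symmetric]) auto
    also have "norm (lagged_mean t n f i) * (t / real n) = norm (\<integral>s. indicator (I i) s *\<^sub>R f s \<partial>lborel)"
      using t by (simp add: lagged_mean_def I_def)
    also have "ennreal \<dots> \<le> (\<integral>\<^sup>+s. ennreal (norm (indicator (I i) s *\<^sub>R f s)) \<partial>lborel)"
      unfolding I_def by (intro integral_norm_bound_ennreal integrable_indicator_bounded[OF f])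
    also have "\<dots> = (\<integral>\<^sup>+s. indicator (I i) s * ennreal (norm (f s)) \<partial>lborel)"
      by (intro nn_integral_cong) (auto simp: indicator_def)
    finally show "ennreal (norm (lagged_mean t n f i)) * ennreal (t * real (Suc i) / real n - t * real i
        / real n)
        \<le> (\<integral>\<^sup>+s. indicator (I i) s * ennreal (norm (f s)) \<partial>lborel)" .
  qed
  also have "\<dots> = (\<integral>\<^sup>+s. (\<Sum>i<n. indicator (I i) s * ennreal (norm (f s))) \<partial>lborel)"
    by (subst nn_integral_sum) (auto simp: I_def)
  also have "\<dots> \<le> (\<integral>\<^sup>+s\<in>{0..t}. ennreal (norm (f s)) \<partial>lborel)"
  proof (intro nn_integral_mono)
    fix s :: real
    have ind: "indicator (I i) s = ((of_bool (s \<le> t * (real (Suc i) - 1) / real n) - of_bool (s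
        \<le> t * (real i - 1) / real n)) :: real)" for i
    proof -
      have "t * (real i - 1) / real n \<le> t * real i / real n" by (rule uniform_grid(5)[OF t])
      then show ?thesis by (auto simp: I_def indicator_def)
    qed
    have "(\<Sum>i<n. indicator (I i) s :: real) = of_bool (s \<le> t * (real n - 1) / real n) - of_bool (s
        \<le> t * (real 0 - 1) / real n)"
      unfolding ind by (rule sum_lessThan_telescope)
    also have "\<dots> \<le> 1" by auto
    finally have "(\<Sum>i<n. indicator (I i) s :: real) \<le> 1" .
    then have "(\<Sum>i<n. indicator (I i) s :: ennreal) \<le> 1"
      by (subst ennreal_indicator[symmetric], subst sum_ennreal) (auto simp: ennreal_le_1)
    then have "(\<Sum>i<n. indicator (I i) s * ennreal (norm (f s))) \<le> 1 * ennreal (norm (f s))"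
      unfolding sum_distrib_right[symmetric] by (rule mult_right_mono) simp
    then show "(\<Sum>i<n. indicator (I i) s * ennreal (norm (f s)))
        \<le> ennreal (norm (f s)) * indicator {0..t} s"
      using supp[of s] by (auto simp: indicator_def)
  qed
  finally show ?thesis .
qed

text \<open>The preceding interval, over which the mean is taken, lies within distance 2 t / n of
  the point, so continuity there suffices.\<close>

lemma lagged_step_tendsto:
  fixes g :: "real \<Rightarrow> real ^ 'm ^ 'd"
  assumes t: "0 < s" "s < t" and g: "g \<in> borel_measurable borel" "\<And>s. norm (g s) \<le> N"
      and c: "isCont g s"
  shows "(\<lambda>n. lagged_step t n g s) \<longlonglongrightarrow> g s"
proof (rule LIMSEQ_I)
  fix e :: real assume e: "e > 0"
  obtain d where d: "d > 0" "\<And>u. \<bar>u - s\<bar> < d \<Longrightarrow> norm (g u - g s) < e / 2"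
    using c e unfolding continuous_at_eps_delta dist_norm by (metis half_gt_zero real_norm_def)
  obtain n0 where n0: "2 * t / d < real n0" using reals_Archimedean2 by blast
  have "norm (lagged_step t n g s - g s) < e" if n: "n0 \<le> n" for n
  proof -
    have nd: "2 * t / d < real n" using n0 n by linarith
    moreover have "0 < 2 * t / d" using t d by simp
    ultimately have np: "0 < n" by linarith
    have w: "2 * t / real n < d" using nd np d by (simp add: field_simps)
    \<comment> \<open>The ceiling selects the right end point of the interval containing the point,
      open on the left and closed on the right; the interval itself has index
      \<open>k - 1\<close>.\<close>
    define k where "k = nat \<lceil>s * real n / t\<rceil>"
    have sp: "0 < s * real n / t" using t np by simp
    have k: "real k - 1 < s * real n / t" "s * real n / t \<le> real k"
    proof -
      have "real k = of_int \<lceil>s * real n / t\<rceil>" unfolding k_def using sp by (subst of_nat_nat) auto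
      then show "real k - 1 < s * real n / t" "s * real n / t \<le> real k"
        using ceiling_correct[of "s * real n / t"] by linarith+
    qed
    have k1: "k \<ge> 1" using sp k by linarith
    have "s * real n / t \<le> real n" using t np by (simp add: field_simps mult_right_mono)
    then have kn: "k \<le> n" unfolding k_def using sp by (simp add: nat_le_iff ceiling_le_iff)
    define i where "i = k - 1"
    have i: "i < n" "real i = real k - 1" "k = Suc i" using k1 kn by (auto simp: i_def)
    have t0: "0 < t" using t by linarith
    have s: "s \<in> {t * real i / real n<..t * real (Suc i) / real n}"
    proof -
      have "t * (real k - 1) < t * (s * real n / t)" "t * (s * real n / t) \<le> t * real k"
        using k t0 by (auto intro!: mult_strict_left_mono mult_left_mono simp del: times_divide_eq_right
          times_divide_eq_left)
      then have 1: "t * real i < s * real n" and 2: "s * real n \<le> t * real k"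
        using t0 i(2) by simp_all
      have "t * real i / real n < s" using 1 np by (simp only: pos_divide_less_eq of_nat_0_less_iff)
      moreover have "s \<le> t * real k / real n" using 2 np
          by (simp only: pos_le_divide_eq of_nat_0_less_iff)
      ultimately show ?thesis by (simp add: i(3))
    qed
    have st: "lagged_step t n g s = lagged_mean t n g i"
      by (rule simple_process_at(2)) (use s i(1) uniform_grid(4)[OF t0 np] in simp_all)
    let ?a = "t * (real i - 1) / real n" and ?b = "t * real i / real n"
    have ab: "?b - ?a = t / real n" "?a \<le> ?b" using uniform_grid(3,5)[OF t0 np] by simp_all
    have near: "\<bar>u - s\<bar> < d" if "u \<in> {?a<..?b}" for u
    proof -
      have "t * real (Suc i) / real n = ?a + 2 * (t / real n)"
        using uniform_grid(2,3)[OF t0 np, of i] by linarith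
      then show ?thesis using that s w unfolding greaterThanAtMost_iff times_divide_eq_right[symmetric]
          by linarith
    qed
    have int1: "integrable lborel (\<lambda>u. indicator {?a<..?b} u *\<^sub>R g u)"
      by (rule integrable_indicator_bounded[OF g])
    have int2: "integrable lborel (\<lambda>u. indicator {?a<..?b} u *\<^sub>R g s)"
      by (rule integrable_indicator_bounded[where N = "norm (g s)"]) simp_all
    have "(\<integral>u. indicator {?a<..?b} u *\<^sub>R g s \<partial>lborel) = (\<integral>u. indicator {?a<..?b} u \<partial>lborel) *\<^sub>R g s"
      by (rule integral_scaleR_left) (intro integrable_indicator_Ioc)
    also have "(\<integral>u. indicator {?a<..?b} u \<partial>lborel) = t / real n"
      using ab by (simp add: measure_lborel_Ioc)
    finally have Y: "(real n / t) *\<^sub>R (\<integral>u. indicator {?a<..?b} u *\<^sub>R g s \<partial>lborel) = g s"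
      using np t0 by simp
    have "lagged_mean t n g i - g s
        = (real n / t) *\<^sub>R (\<integral>u. indicator {?a<..?b} u *\<^sub>R g u \<partial>lborel) - (real n / t) *\<^sub>R (\<integral>u. indicator
            {?a<..?b} u *\<^sub>R g s \<partial>lborel)"
      unfolding Y lagged_mean_def by (rule refl)
    also have "\<dots> = (real n / t) *\<^sub>R ((\<integral>u. indicator {?a<..?b} u *\<^sub>R g u \<partial>lborel) - (\<integral>u. indicator
        {?a<..?b} u *\<^sub>R g s \<partial>lborel))"
      by (rule scaleR_diff_right[symmetric])
    also have "(\<integral>u. indicator {?a<..?b} u *\<^sub>R g u \<partial>lborel) - (\<integral>u. indicator {?a<..?b} u *\<^sub>R g s \<partial>lborel)
        = (\<integral>u. indicator {?a<..?b} u *\<^sub>R g u - indicator {?a<..?b} u *\<^sub>R g s \<partial>lborel)"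
      by (rule Bochner_Integration.integral_diff[OF int1 int2, symmetric])
    also have "\<dots> = (\<integral>u. indicator {?a<..?b} u *\<^sub>R (g u - g s) \<partial>lborel)"
      by (simp only: scaleR_diff_right)
    finally have eq: "lagged_mean t n g i - g s
        = (real n / t) *\<^sub>R (\<integral>u. indicator {?a<..?b} u *\<^sub>R (g u - g s) \<partial>lborel)" .
    have "norm (\<integral>u. indicator {?a<..?b} u *\<^sub>R (g u - g s) \<partial>lborel)
        \<le> (\<integral>u. (e / 2) * indicator {?a<..?b} u \<partial>lborel)"
    proof (rule Bochner_Integration.integral_norm_bound_integral)
      show "integrable lborel (\<lambda>u. indicator {?a<..?b} u *\<^sub>R (g u - g s))"
        using Bochner_Integration.integrable_diff[OF int1 int2] by (simp only: scaleR_diff_right)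
      show "integrable lborel (\<lambda>u. (e / 2) * indicator {?a<..?b} u)"
        by (intro integrable_mult_right integrable_indicator_Ioc)
      show "norm (indicator {?a<..?b} u *\<^sub>R (g u - g s)) \<le> (e / 2) * indicator {?a<..?b} u" for u
      proof (cases "u \<in> {?a<..?b}")
        case True
        have "norm (g u - g s) \<le> e / 2" using d(2)[OF near[OF True]] by (rule less_imp_le)
        with True show ?thesis by (simp only: indicator_simps scaleR_one mult_1_right)
      next
        case False
        then show ?thesis by simp
      qed
    qed
    also have "(\<integral>u. (e / 2) * indicator {?a<..?b} u \<partial>lborel) = (e / 2) * (t / real n)"
      using ab by (simp add: measure_lborel_Ioc)
    finally have I: "norm (\<integral>u. indicator {?a<..?b} u *\<^sub>R (g u - g s) \<partial>lborel)
        \<le> (e / 2) * (t / real n)" .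
    have nt: "0 \<le> real n / t" using t0 by (intro divide_nonneg_nonneg) auto
    have "norm (lagged_mean t n g i - g s) \<le> (real n / t) * ((e / 2) * (t / real n))"
      unfolding eq norm_scaleR abs_of_nonneg[OF nt] by (rule mult_left_mono[OF I nt])
    also have "\<dots> = e / 2" using t0 np by simp
    finally show ?thesis unfolding st using e by linarith
  qed
  then show "\<exists>n0. \<forall>n\<ge>n0. norm (lagged_step t n g s - g s) < e" by blast
qed


lemma lagged_step_measurable: "lagged_step t n f \<in> borel_measurable borel"
  unfolding simple_process_def by measurable

lemma lagged_step_norm_le:
  fixes f :: "real \<Rightarrow> real ^ 'm ^ 'd"
  assumes t: "0 < t" and f: "f \<in> borel_measurable borel" "\<And>s. norm (f s) \<le> N"
  shows "norm (lagged_step t n f s) \<le> N"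
proof (cases "\<exists>i<n. s \<in> {t * real i / real n<..t * real (Suc i) / real n}")
  case True
  then obtain i where i: "i < n" "s \<in> {t * real i / real n<..t * real (Suc i) / real n}" by blast
  have n: "0 < n" using i(1) by simp
  have "lagged_step t n f s = lagged_mean t n f i"
    by (rule simple_process_at(2)[OF uniform_grid(4)[OF t n] i])
  then show ?thesis using lagged_mean_norm_le[OF t n f] by simp
next
  case False
  then have "lagged_step t n f s = 0"
    unfolding simple_process_def by (intro sum.neutral) auto
  then show ?thesis using order_trans[OF norm_ge_zero f(2)] by simp
qed

lemma lagged_step_diff:
  fixes f g :: "real \<Rightarrow> real ^ 'm ^ 'd"
  assumes "f \<in> borel_measurable borel" "\<And>s. norm (f s) \<le> N" "g \<in> borel_measurable borel" "\<And>s. norm (g s)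
      \<le> N"
  shows "lagged_step t n (\<lambda>s. f s - g s) s = lagged_step t n f s - lagged_step t n g s"
  unfolding simple_process_def lagged_mean_diff[OF assms]
    by (simp only: scaleR_diff_right sum_subtractf)

text \<open>A three-term argument: \<open>f\<close> is replaced by a nearly continuous
  \<open>g\<close>, the step function of \<open>f - g\<close> is controlled by the contraction
  property, and the step functions of \<open>g\<close> converge by dominated convergence.\<close>

lemma lagged_step_L1_tendsto:
  fixes f :: "real \<Rightarrow> real ^ 'm ^ 'd"
  assumes t: "0 < t" and f: "f \<in> borel_measurable borel" "\<And>s. norm (f s) \<le> N" and N: "0 < N"
    and supp: "\<And>s. s \<notin> {0..t} \<Longrightarrow> f s = 0"
  shows "(\<lambda>n. (\<integral>\<^sup>+s\<in>{0..t}. ennreal (norm (lagged_step t n f s - f s)) \<partial>lborel)) \<longlonglongrightarrow> 0"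
proof (rule tendsto_zero_ennreal)
  fix r :: real assume r: "0 < r"
  obtain h where h: "\<And>n. continuous_on UNIV (h n :: real \<Rightarrow> real ^ 'm ^ 'd)" "\<And>n s. norm (h n s) \<le> N"
    "(\<lambda>n. \<integral>\<^sup>+s\<in>{0..t}. ennreal (norm (h n s - f s)) \<partial>lborel) \<longlonglongrightarrow> 0"
    using continuous_approx_L1[OF f(1) N f(2)] by blast
  have "0 < ennreal (r / 3)" using r by simp
  from order_tendstoD(2)[OF h(3) this]
  obtain m where m: "(\<integral>\<^sup>+s\<in>{0..t}. ennreal (norm (h m s - f s)) \<partial>lborel) < ennreal (r / 3)"
    by (auto simp: eventually_sequentially)
  \<comment> \<open>The contraction needs support in \<open>{0..t}\<close>. The cut-off destroys
    continuity only at 0 and t, which form a null set.\<close>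
  define g where "g s = indicator {0..t} s *\<^sub>R h m s" for s
  have [measurable]: "h m \<in> borel_measurable borel" using h(1) by (rule borel_measurable_continuous_onI)
  have g: "g \<in> borel_measurable borel" "norm (g s) \<le> N" "s \<notin> {0..t} \<Longrightarrow> g s = 0" for s
    unfolding g_def[abs_def] using h(2)[of m s] N by (auto simp: indicator_def)
  note [measurable] = f(1) g(1) lagged_step_measurable
  have gf: "(\<integral>\<^sup>+s\<in>{0..t}. ennreal (norm (g s - f s)) \<partial>lborel) < ennreal (r / 3)"
  proof -
    have "(\<integral>\<^sup>+s\<in>{0..t}. ennreal (norm (g s - f s)) \<partial>lborel)
        = (\<integral>\<^sup>+s\<in>{0..t}. ennreal (norm (h m s - f s)) \<partial>lborel)"
      by (intro nn_integral_cong) (auto simp: g_def indicator_def)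
    then show ?thesis using m by simp
  qed
  have "(\<lambda>n. \<integral>\<^sup>+s. ennreal (norm (lagged_step t n g s - g s)) * indicator {0..t} s \<partial>lborel) \<longlonglongrightarrow> (\<integral>\<^sup>+s. 0
      \<partial>(lborel :: real measure))"
  proof (rule nn_integral_dominated_convergence[where w = "\<lambda>s. ennreal (2 * N) * indicator {0..t} s"])
    have "norm (lagged_step t n g s - g s) \<le> 2 * N" for n s
      using norm_triangle_ineq4[of "lagged_step t n g s" "g s"] lagged_step_norm_le[OF t g(1,2), of n s]
        g(2)[of s] by linarith
    then show "AE s in lborel. ennreal (norm (lagged_step t n g s - g s)) * indicator {0..t} s
        \<le> ennreal (2 * N) * indicator {0..t} s" for n
      by (intro AE_I2 mult_right_mono ennreal_leI) auto
    show "(\<integral>\<^sup>+s. ennreal (2 * N) * indicator {0..t} s \<partial>lborel) < \<infinity>"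
      by (subst nn_integral_cmult_indicator) (auto simp: ennreal_mult_less_top emeasure_lborel_Icc_eq)
    show "AE s in lborel. (\<lambda>n. ennreal (norm (lagged_step t n g s - g s)) * indicator {0..t} s) \<longlonglongrightarrow> 0"
      using AE_lborel_singleton[of 0] AE_lborel_singleton[of t]
    proof eventually_elim
      case (elim s)
      show ?case
      proof (cases "s \<in> {0<..<t}")
        case True
        have "continuous_on {0<..<t} g"
          by (rule continuous_on_eq[OF continuous_on_subset[OF h(1)]]) (auto simp: g_def)
        then have "isCont g s" using True by (simp add: continuous_on_eq_continuous_at)
        then have "(\<lambda>n. lagged_step t n g s) \<longlonglongrightarrow> g s"
          using True g(1,2) by (intro lagged_step_tendsto) auto
        then have "(\<lambda>n. norm (lagged_step t n g s - g s)) \<longlonglongrightarrow> 0"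
          by (simp add: LIM_zero_iff tendsto_norm_zero_iff)
        then show ?thesis using True by (simp add: ennreal_tendsto_0_iff)
      next
        case False
        then have "s \<notin> {0..t}" using elim by auto
        then show ?thesis by simp
      qed
    qed
  qed auto
  then have lim: "(\<lambda>n. (\<integral>\<^sup>+s\<in>{0..t}. ennreal (norm (lagged_step t n g s - g s)) \<partial>lborel)) \<longlonglongrightarrow> 0" by simp
  have "0 < ennreal (r / 3)" using r by simp
  from order_tendstoD(2)[OF lim this] eventually_gt_at_top[of "0::nat"]
  show "\<forall>\<^sub>F n in sequentially. (\<integral>\<^sup>+s\<in>{0..t}. ennreal (norm (lagged_step t n f s - f s)) \<partial>lborel) <
      ennreal r"
  proof eventually_elim
    case (elim n)
    let ?d = "\<lambda>s. f s - g s"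
    have d: "?d \<in> borel_measurable borel" "norm (?d s) \<le> N + N" "s \<notin> {0..t} \<Longrightarrow> ?d s = 0" for s
      using order_trans[OF norm_triangle_ineq4 add_mono[OF f(2) g(2)]] supp g(3) by auto
    have "(\<integral>\<^sup>+s\<in>{0..t}. ennreal (norm (lagged_step t n f s - f s)) \<partial>lborel)
        \<le> (\<integral>\<^sup>+s. ennreal (norm (lagged_step t n ?d s)) * indicator {0..t} s
          + (ennreal (norm (lagged_step t n g s - g s)) * indicator {0..t} s
          + ennreal (norm (g s - f s)) * indicator {0..t} s) \<partial>lborel)"
    proof (intro nn_integral_mono)
      fix s
      have eq: "lagged_step t n f s - f s = lagged_step t n ?d s + ((lagged_step t n g s - g s) + (g s -
          f s))"
        unfolding lagged_step_diff[OF f g(1,2)] by simp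
      have "norm (lagged_step t n f s - f s)
          \<le> norm (lagged_step t n ?d s) + (norm (lagged_step t n g s - g s) + norm (g s - f s))"
        unfolding eq by (intro order_trans[OF norm_triangle_ineq] add_mono norm_triangle_ineq
          order_refl)
      then show "ennreal (norm (lagged_step t n f s - f s)) * indicator {0..t} s
          \<le> ennreal (norm (lagged_step t n ?d s)) * indicator {0..t} s
          + (ennreal (norm (lagged_step t n g s - g s)) * indicator {0..t} s
          + ennreal (norm (g s - f s)) * indicator {0..t} s)"
        unfolding distrib_right[symmetric]
        by (intro mult_right_mono) (simp_all add: ennreal_leI flip: ennreal_plus)
    qed
    also have "\<dots> = (\<integral>\<^sup>+s\<in>{0..t}. ennreal (norm (lagged_step t n ?d s)) \<partial>lborel)
        + ((\<integral>\<^sup>+s\<in>{0..t}. ennreal (norm (lagged_step t n g s - g s)) \<partial>lborel)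
        + (\<integral>\<^sup>+s\<in>{0..t}. ennreal (norm (g s - f s)) \<partial>lborel))"
      by (subst nn_integral_add; (subst nn_integral_add)?) auto
    also have "(\<integral>\<^sup>+s\<in>{0..t}. ennreal (norm (lagged_step t n ?d s)) \<partial>lborel)
        \<le> (\<integral>\<^sup>+s\<in>{0..t}. ennreal (norm (?d s)) \<partial>lborel)"
      by (rule lagged_step_contraction[OF t elim(2) d])
    also have "(\<integral>\<^sup>+s\<in>{0..t}. ennreal (norm (?d s)) \<partial>lborel)
        = (\<integral>\<^sup>+s\<in>{0..t}. ennreal (norm (g s - f s)) \<partial>lborel)"
      by (simp only: norm_minus_commute)
    finally have "(\<integral>\<^sup>+s\<in>{0..t}. ennreal (norm (lagged_step t n f s - f s)) \<partial>lborel)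
      \<le> (\<integral>\<^sup>+s\<in>{0..t}. ennreal (norm (g s - f s)) \<partial>lborel)
        + ((\<integral>\<^sup>+s\<in>{0..t}. ennreal (norm (lagged_step t n g s - g s)) \<partial>lborel)
        + (\<integral>\<^sup>+s\<in>{0..t}. ennreal (norm (g s - f s)) \<partial>lborel))" by (simp add: add_right_mono)
    also have "\<dots> < ennreal (r / 3) + (ennreal (r / 3) + ennreal (r / 3))"
      by (intro add_strict_mono gf elim(1))
    also have "\<dots> = ennreal r" using r by (simp flip: ennreal_plus)
    finally show ?case .
  qed
qed

lemma jointly_measurable_L1:
  fixes \<Phi> :: "real \<Rightarrow> 'w \<Rightarrow> 'b::{second_countable_topology, real_normed_vector}"
  assumes "jointly_measurable N t \<Phi>"
  shows "(\<lambda>\<omega>. \<integral>\<^sup>+s\<in>{0..t}. ennreal (norm (\<Phi> s \<omega>)) \<partial>lborel) \<in> borel_measurable N"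
proof -
  note [measurable] = assms[unfolded jointly_measurable_def]
  have "(\<lambda>\<omega>. \<integral>\<^sup>+s\<in>{0..t}. ennreal (norm (\<Phi> s \<omega>)) \<partial>lborel)
      = (\<lambda>\<omega>. \<integral>\<^sup>+s. ennreal (norm (indicator {0..t} s *\<^sub>R \<Phi> s \<omega>)) \<partial>lborel)"
    by (intro ext nn_integral_cong) (auto simp: indicator_def)
  also have "\<dots> \<in> borel_measurable N"
    by (rule lborel.borel_measurable_nn_integral) measurable
  finally show ?thesis .
qed

text \<open>Dominated convergence in the random parameter turns the pathwise L^1-convergence of
  lagged step functions into convergence of the expected L^1-distance. The coefficients keep the
  bound \<open>N\<close> because they are means.\<close>

lemma (in usual_filtered_prob_space) bounded_progressive_approx:
  fixes \<Phi> :: "real \<Rightarrow> 'w \<Rightarrow> real ^ 'm ^ 'd"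
  assumes t: "t \<in> {0..T}" "0 < t" and pr: "progressive t F \<Phi>"
    and bd: "\<And>s \<omega>. s \<in> {0..t} \<Longrightarrow> \<omega> \<in> space M \<Longrightarrow> norm (\<Phi> s \<omega>) \<le> N" and N: "0 < N" and \<eta>: "0 < \<eta>"
  obtains n \<tau> \<xi> where "simple_integrand F t n \<tau> \<xi>" "\<And>i \<omega>. i < n \<Longrightarrow> \<omega> \<in> space M \<Longrightarrow> norm (\<xi> i \<omega>) \<le> N"
    "(\<integral>\<^sup>+\<omega>. (\<integral>\<^sup>+s\<in>{0..t}. ennreal (norm (simple_process n \<tau> \<xi> s \<omega> - \<Phi> s \<omega>)) \<partial>lborel) \<partial>M) < ennreal \<eta>"
proof -
  have tt: "t \<in> {0..t}" "t \<le> T" using t by auto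
  note j = progressive_jointly_measurable_M[OF pr tt]
  define f where "f \<omega> s = indicator {0..t} s *\<^sub>R \<Phi> s \<omega>" for \<omega> s
  have f: "f \<omega> \<in> borel_measurable borel" "norm (f \<omega> s) \<le> N" "s \<notin> {0..t} \<Longrightarrow> f \<omega> s = 0" if "\<omega> \<in> space M"
      for \<omega> s
    using jointly_measurable_section[OF j that] bd[OF _ that, of s] N
      by (auto simp: f_def[abs_def] indicator_def)
  define \<tau> where "\<tau> n i = t * real i / real n" for n i :: nat
  define \<xi> where "\<xi> n i \<omega> = lagged_mean t n (f \<omega>) i" for n i \<omega>
  have sp: "simple_process n (\<tau> n) (\<xi> n) s \<omega> = lagged_step t n (f \<omega>) s" for n s \<omega>
    unfolding simple_process_def \<tau>_def \<xi>_def ..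
  have \<tau>t: "\<tau> n i \<in> {0..t}" if "0 < n" "i \<le> n" for n i
    unfolding \<tau>_def by (rule uniform_grid(1)[OF t(2) that])
  have simple: "simple_integrand F t n (\<tau> n) (\<xi> n)" if n: "0 < n" for n
    unfolding simple_integrand_def
  proof (intro conjI allI impI)
    show "\<tau> n i \<in> {0..t}" if "i \<le> n" for i by (rule \<tau>t[OF n that])
    show "\<tau> n i \<le> \<tau> n (Suc i)" for i unfolding \<tau>_def by (rule uniform_grid(4)[OF t(2) n])
    fix i assume i: "i < n"
    have r: "\<tau> n i \<in> {0..t}" "\<tau> n i \<in> {0..T}" using \<tau>t[OF n, of i] i t by auto
    let ?I = "{t * (real i - 1) / real n<..\<tau> n i}"
    note [measurable] = progressive_jointly_measurable[OF pr r(1), unfolded jointly_measurable_def]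
    \<comment> \<open>The mean runs over times up to \<open>\<tau> n i\<close> only. There the
      cut-off at \<open>t\<close> equals the cut-off at \<open>\<tau> n i\<close>, and the latter
      process is measurable with respect to the algebra at that time.\<close>
    have "\<xi> n i = (\<lambda>\<omega>. (real n / t) *\<^sub>R (\<integral>s. indicator ?I s *\<^sub>R (indicator {0..\<tau> n i} s *\<^sub>R \<Phi> s \<omega>)
        \<partial>lborel))"
    proof
      fix \<omega>
      have "indicator ?I s *\<^sub>R f \<omega> s = indicator ?I s *\<^sub>R (indicator {0..\<tau> n i} s *\<^sub>R \<Phi> s \<omega>)" for s
        using r(1) by (auto simp: f_def indicator_def)
      then show "\<xi> n i \<omega> = (real n / t) *\<^sub>R (\<integral>s. indicator ?I s *\<^sub>R (indicator {0..\<tau> n i} s *\<^sub>R \<Phi> s \<omega>)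
          \<partial>lborel)"
        by (simp add: \<xi>_def lagged_mean_def \<tau>_def)
    qed
    also have "\<dots> \<in> borel_measurable (F (\<tau> n i))"
      by (intro borel_measurable_scaleR borel_measurable_const
        lborel.borel_measurable_lebesgue_integral) measurable
    finally show "\<xi> n i \<in> borel_measurable (F (\<tau> n i))" .
    show "\<exists>c. \<forall>\<omega>\<in>space (F (\<tau> n i)). norm (\<xi> n i \<omega>) \<le> c"
      unfolding space_F[OF r(2)] \<xi>_def using lagged_mean_norm_le[OF t(2) n f(1,2)] by blast
  qed
  let ?G = "\<lambda>n \<omega>. (\<integral>\<^sup>+s\<in>{0..t}. ennreal (norm (simple_process n (\<tau> n) (\<xi> n) s \<omega> - \<Phi> s \<omega>)) \<partial>lborel)"
  \<comment> \<open>The index is shifted because the grid with 0 intervals is not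
    admissible.\<close>
  have "(\<lambda>n. \<integral>\<^sup>+\<omega>. ?G (Suc n) \<omega> \<partial>M) \<longlonglongrightarrow> (\<integral>\<^sup>+\<omega>. 0 \<partial>M)"
  proof (rule nn_integral_dominated_convergence[where w = "\<lambda>\<omega>. ennreal (2 * N * t)"])
    show "?G (Suc n) \<in> borel_measurable M" for n
      using simple[of "Suc n"]
      by (intro jointly_measurable_L1 jointly_measurable_diff simple_process_jointly_measurable[OF t(1)]
        j) auto
    show "(\<integral>\<^sup>+\<omega>. ennreal (2 * N * t) \<partial>M) < \<infinity>" by (simp add: emeasure_space_1)
    show "AE \<omega> in M. ?G (Suc n) \<omega> \<le> ennreal (2 * N * t)" for n
    proof (rule AE_I2)
      fix \<omega> assume \<omega>: "\<omega> \<in> space M"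
      have "norm (simple_process (Suc n) (\<tau> (Suc n)) (\<xi> (Suc n)) s \<omega> - \<Phi> s \<omega>) \<le> 2 * N" if "s \<in> {0..t}"
          for s
        unfolding sp using norm_triangle_ineq4[of "lagged_step t (Suc n) (f \<omega>) s" "\<Phi> s \<omega>"]
          lagged_step_norm_le[OF t(2) f(1,2)[OF \<omega>], of "Suc n" s] bd[OF that \<omega>] by linarith
      then have "?G (Suc n) \<omega> \<le> (\<integral>\<^sup>+s. ennreal (2 * N) * indicator {0..t} s \<partial>lborel)"
        by (intro nn_integral_mono) (auto simp: indicator_def intro: ennreal_leI)
      also have "\<dots> = ennreal (2 * N * t)"
        using t N by (subst nn_integral_cmult_indicator) (auto simp: ennreal_mult)
      finally show "?G (Suc n) \<omega> \<le> ennreal (2 * N * t)" .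
    qed
    show "AE \<omega> in M. (\<lambda>n. ?G (Suc n) \<omega>) \<longlonglongrightarrow> 0"
    proof (rule AE_I2)
      fix \<omega> assume \<omega>: "\<omega> \<in> space M"
      have "?G n \<omega> = (\<integral>\<^sup>+s\<in>{0..t}. ennreal (norm (lagged_step t n (f \<omega>) s - f \<omega> s)) \<partial>lborel)" for n
        unfolding sp by (intro nn_integral_cong) (auto simp: f_def indicator_def)
      then have "(\<lambda>n. ?G n \<omega>) \<longlonglongrightarrow> 0"
        using lagged_step_L1_tendsto[OF t(2) f(1,2)[OF \<omega>] N f(3)[OF \<omega>]] by simp
      then show "(\<lambda>n. ?G (Suc n) \<omega>) \<longlonglongrightarrow> 0" by (rule LIMSEQ_Suc)
    qed
  qed auto
  then have "(\<lambda>n. \<integral>\<^sup>+\<omega>. ?G (Suc n) \<omega> \<partial>M) \<longlonglongrightarrow> 0" by simp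
  moreover have "0 < ennreal \<eta>" using \<eta> by simp
  ultimately obtain n where "(\<integral>\<^sup>+\<omega>. ?G (Suc n) \<omega> \<partial>M) < ennreal \<eta>"
    by (metis (no_types, lifting) order_tendstoD(2) eventually_sequentially order_refl)
  then show thesis
    using that[OF simple[of "Suc n"]] lagged_mean_norm_le[OF t(2) _ f(1,2)] by (simp add: \<xi>_def)
qed

subsection \<open>Moments of the Ito integral\<close>

lemma powr_subadd:
  fixes u v r :: real
  assumes "0 \<le> u" "0 \<le> v" "0 < r" "r \<le> 1"
  shows "(u + v) powr r \<le> u powr r + v powr r"
proof -
  have "(u powr r) powr (1 / r) + (v powr r) powr (1 / r) \<le> (u powr r + v powr r) powr (1 / r)"
    using assms by (intro powr_superadd) auto
  then have "u + v \<le> (u powr r + v powr r) powr (1 / r)"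
    using assms by (simp add: powr_powr)
  then have "(u + v) powr r \<le> ((u powr r + v powr r) powr (1 / r)) powr r"
    using assms by (intro powr_mono2) auto
  then show ?thesis using assms by (simp add: powr_powr)
qed

text \<open>A concave power is dominated by an affine function whose constant \<open>h\<close> is as
  small as desired. It is needed because an error moment occurs under the power 2 / p, while only
  the time integral of its first power can be made small.\<close>

lemma powr_le_linear:
  fixes y h r :: real
  assumes "0 \<le> y" "0 < h" "0 < r" "r \<le> 1"
  shows "y powr r \<le> h + h powr (1 - 1 / r) * y"
proof (cases "y powr r \<le> h")
  case True
  then show ?thesis using assms by (simp add: add_increasing2)
next
  case False
  then have y: "y > 0" using assms by (cases "y = 0") auto
  have "h powr (1 / r - 1) \<le> (y powr r) powr (1 / r - 1)"
    using False assms by (intro powr_mono2) (auto simp: field_simps)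
  also have "\<dots> = y powr (1 - r)" using assms by (simp add: powr_powr algebra_simps)
  finally have "h powr (1 / r - 1) \<le> y powr (1 - r)" .
  then have "h powr (1 - 1 / r) * h powr (1 / r - 1) * y powr r
      \<le> h powr (1 - 1 / r) * y powr (1 - r) * y powr r"
    by (intro mult_right_mono mult_left_mono) auto
  also have "h powr (1 - 1 / r) * h powr (1 / r - 1) = 1"
    using assms by (simp flip: powr_add)
  also have "h powr (1 - 1 / r) * y powr (1 - r) * y powr r = h powr (1 - 1 / r) * y"
    using y by (simp add: mult.assoc flip: powr_add)
  finally show ?thesis using assms by simp
qed

text \<open>Here \<open>x\<close> is the p-th moment of a coefficient, \<open>a\<close> the target
  size of the integrand and \<open>b\<close> an error. The factor 4 is
  \<open>(2 powr p) powr (2 / p)\<close>, and the exponent of \<open>h\<close> is 1 - 1 / (2 /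
  p).\<close>

lemma moment_perturbation:
  fixes x a b h p :: real
  assumes "0 \<le> x" "x \<le> 2 powr p * (a powr p + b)" "0 \<le> a" "0 \<le> b" "2 \<le> p" "0 < h"
  shows "x powr (2 / p) \<le> 4 * (a\<^sup>2 + (h + h powr (1 - p / 2) * b))"
proof -
  have p: "0 < 2 / p" "2 / p \<le> 1" using assms by auto
  have "x powr (2 / p) \<le> (2 powr p * (a powr p + b)) powr (2 / p)"
    using assms by (intro powr_mono2) auto
  also have "\<dots> = (2 powr p) powr (2 / p) * (a powr p + b) powr (2 / p)"
    using assms by (subst powr_mult) auto
  also have "(2 powr p :: real) powr (2 / p) = 4" using assms by (simp add: powr_powr)
  also have "(a powr p + b) powr (2 / p) \<le> (a powr p) powr (2 / p) + b powr (2 / p)"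
    using assms p by (intro powr_subadd) auto
  also have "(a powr p) powr (2 / p) = a\<^sup>2" using assms by (simp add: powr_powr)
  also have "b powr (2 / p) \<le> h + h powr (1 - 1 / (2 / p)) * b"
    using assms p by (intro powr_le_linear) auto
  finally show ?thesis by simp
qed

lemma sum_indicator_Ioc_le_1:
  fixes \<tau> :: "nat \<Rightarrow> real"
  assumes "\<And>i. i < n \<Longrightarrow> \<tau> i \<le> \<tau> (Suc i)"
  shows "(\<Sum>i<n. indicator {\<tau> i<..\<tau> (Suc i)} s :: ennreal) \<le> 1"
proof -
  have "(\<Sum>i<n. indicator {\<tau> i<..\<tau> (Suc i)} s :: real) = (\<Sum>i<n. of_bool (s \<le> \<tau> (Suc i)) - of_bool (s
      \<le> \<tau> i))"
    using assms by (intro sum.cong refl) (force simp: indicator_def)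
  also have "\<dots> = of_bool (s \<le> \<tau> n) - of_bool (s \<le> \<tau> 0)"
    by (rule sum_lessThan_telescope)
  also have "\<dots> \<le> 1" by auto
  finally show ?thesis
    by (subst ennreal_indicator[symmetric], subst sum_ennreal) (auto simp: ennreal_le_1)
qed

lemma sum_nn_integral_Ioc_le:
  fixes \<tau> :: "nat \<Rightarrow> real" and H :: "real \<Rightarrow> ennreal"
  assumes \<tau>: "\<And>i. i \<le> n \<Longrightarrow> \<tau> i \<in> {0..t}" "\<And>i. i < n \<Longrightarrow> \<tau> i \<le> \<tau> (Suc i)"
    and H: "(\<lambda>s. H s * indicator {0..t} s) \<in> borel_measurable lborel"
  shows "(\<Sum>i<n. \<integral>\<^sup>+s. H s * indicator {\<tau> i<..\<tau> (Suc i)} s \<partial>lborel) \<le> (\<integral>\<^sup>+s\<in>{0..t}. H s \<partial>lborel)"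
proof -
  note [measurable] = H
  have eq: "H s * indicator {\<tau> i<..\<tau> (Suc i)} s
      = (H s * indicator {0..t} s) * indicator {\<tau> i<..\<tau> (Suc i)} s"
    if "i < n" for i s
    using \<tau>(1)[of i] \<tau>(1)[of "Suc i"] that by (auto simp: indicator_def)
  have "(\<Sum>i<n. \<integral>\<^sup>+s. H s * indicator {\<tau> i<..\<tau> (Suc i)} s \<partial>lborel)
      = (\<Sum>i<n. \<integral>\<^sup>+s. (H s * indicator {0..t} s) * indicator {\<tau> i<..\<tau> (Suc i)} s \<partial>lborel)"
    using eq by (intro sum.cong refl nn_integral_cong) auto
  also have "\<dots> = (\<integral>\<^sup>+s. (\<Sum>i<n. (H s * indicator {0..t} s) * indicator {\<tau> i<..\<tau> (Suc i)} s) \<partial>lborel)"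
    by (subst nn_integral_sum) auto
  also have "\<dots> \<le> (\<integral>\<^sup>+s. (H s * indicator {0..t} s) * 1 \<partial>lborel)"
    unfolding sum_distrib_left[symmetric]
    by (intro nn_integral_mono mult_left_mono sum_indicator_Ioc_le_1 \<tau>(2)) auto
  finally show ?thesis by simp
qed

text \<open>Dominated convergence for the indicators of the exceptional events.\<close>

lemma prob_tendsto_0_of_AE:
  fixes X :: "nat \<Rightarrow> 'w \<Rightarrow> ennreal"
  assumes "finite_measure N" and [measurable]: "\<And>n. X n \<in> borel_measurable N"
    and lim: "AE \<omega> in N. (\<lambda>n. X n \<omega>) \<longlonglongrightarrow> 0" and e: "0 < e"
  shows "(\<lambda>n. measure N {\<omega>\<in>space N. e < X n \<omega>}) \<longlonglongrightarrow> 0"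
proof -
  interpret finite_measure N by fact
  have "(\<lambda>n. \<integral>\<^sup>+\<omega>. indicator {\<omega>\<in>space N. e < X n \<omega>} \<omega> \<partial>N) \<longlonglongrightarrow> (\<integral>\<^sup>+\<omega>. 0 \<partial>N)"
  proof (rule nn_integral_dominated_convergence[where w = "\<lambda>_. 1"])
    show "AE \<omega> in N. indicator {\<omega>\<in>space N. e < X n \<omega>} \<omega> \<le> (1::ennreal)" for n
      by (auto simp: indicator_def)
    show "(\<integral>\<^sup>+\<omega>. 1 \<partial>N) < \<infinity>" by (simp add: less_top[symmetric])
    show "AE \<omega> in N. (\<lambda>n. indicator {\<omega>\<in>space N. e < X n \<omega>} \<omega> :: ennreal) \<longlonglongrightarrow> 0"
      using lim
    proof eventually_elim
      case (elim \<omega>)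
      have "\<forall>\<^sub>F n in sequentially. X n \<omega> < e" using order_tendstoD(2)[OF elim e] .
      then have "\<forall>\<^sub>F n in sequentially. indicator {\<omega>\<in>space N. e < X n \<omega>} \<omega> = (0::ennreal)"
        by eventually_elim (simp add: indicator_def less_imp_not_less)
      then show ?case by (rule tendsto_eventually)
    qed
  qed auto
  then have "(\<lambda>n. emeasure N {\<omega>\<in>space N. e < X n \<omega>}) \<longlonglongrightarrow> 0" by simp
  then show ?thesis
    by (simp add: emeasure_eq_measure ennreal_tendsto_0_iff)
qed

context usual_filtered_prob_space
begin

text \<open>Large values are set to 0 instead of being clipped. The residual is therefore either 0
  or the process itself, its square is dominated by the finite energy, and at a fixed time it is
  eventually 0.\<close>

lemma truncation_approx:
  fixes \<Phi> :: "real \<Rightarrow> 'w \<Rightarrow> 'b::{second_countable_topology, real_normed_vector}"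
  assumes j: "jointly_measurable M t \<Phi>" and fin: "AE \<omega> in M. path_energy t \<Phi> \<omega> < \<infinity>" and d: "0 < d"
  shows "(\<lambda>n. prob {\<omega>\<in>space M. ennreal d <
    path_energy t (\<lambda>s \<omega>. \<Phi> s \<omega> - (if norm (\<Phi> s \<omega>) \<le> real n then \<Phi> s \<omega> else 0)) \<omega>}) \<longlonglongrightarrow> 0"
proof (rule prob_tendsto_0_of_AE)
  let ?R = "\<lambda>n s \<omega>. \<Phi> s \<omega> - (if norm (\<Phi> s \<omega>) \<le> real n then \<Phi> s \<omega> else 0)"
  note [measurable] = j[unfolded jointly_measurable_def]
  have jR: "jointly_measurable M t (?R n)" for n
  proof -
    have "(\<lambda>(\<omega>, s). indicator {0..t} s *\<^sub>R ?R n s \<omega>)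
      = (\<lambda>x. let y = (case x of (\<omega>, s) \<Rightarrow> indicator {0..t} s *\<^sub>R \<Phi> s \<omega>) in y - (if norm y
          \<le> real n then y else 0))"
      by (auto simp: fun_eq_iff Let_def indicator_def)
    then show ?thesis unfolding jointly_measurable_def Let_def by simp
  qed
  show "path_energy t (?R n) \<in> borel_measurable M" for n by (rule jointly_measurable_energy[OF jR])
  show "AE \<omega> in M. (\<lambda>n. path_energy t (?R n) \<omega>) \<longlonglongrightarrow> 0"
    using fin AE_space
  proof eventually_elim
    case (elim \<omega>)
    note [measurable] = jointly_measurable_section[OF j elim(2)] jointly_measurable_section[OF jR
        elim(2)]
    have eq: "ennreal ((norm (indicator {0..t} s *\<^sub>R v))\<^sup>2) = ennreal ((norm v)\<^sup>2) * indicator {0..t} s"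
      for v :: 'b and s by (auto simp: indicator_def)
    have "(\<lambda>n. \<integral>\<^sup>+s. ennreal ((norm (indicator {0..t} s *\<^sub>R ?R n s \<omega>))\<^sup>2) \<partial>lborel) \<longlonglongrightarrow> (\<integral>\<^sup>+s. 0 \<partial>(lborel
        :: real measure))"
    proof (rule nn_integral_dominated_convergence[where w
        = "\<lambda>s. ennreal ((norm (indicator {0..t} s *\<^sub>R \<Phi> s \<omega>))\<^sup>2)"])
      show "(\<integral>\<^sup>+s. ennreal ((norm (indicator {0..t} s *\<^sub>R \<Phi> s \<omega>))\<^sup>2) \<partial>lborel) < \<infinity>"
        using elim(1) unfolding path_energy_def eq .
      show "AE s in lborel. ennreal ((norm (indicator {0..t} s *\<^sub>R ?R n s \<omega>))\<^sup>2)
          \<le> ennreal ((norm (indicator {0..t} s *\<^sub>R \<Phi> s \<omega>))\<^sup>2)" for n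
        by (intro AE_I2 ennreal_leI power_mono) (auto simp: indicator_def)
      show "AE s in lborel. (\<lambda>n. ennreal ((norm (indicator {0..t} s *\<^sub>R ?R n s \<omega>))\<^sup>2)) \<longlonglongrightarrow> 0"
      proof (rule AE_I2)
        fix s
        obtain k where k: "norm (\<Phi> s \<omega>) \<le> real k" using real_arch_simple by blast
        have "\<forall>\<^sub>F n in sequentially. ennreal ((norm (indicator {0..t} s *\<^sub>R ?R n s \<omega>))\<^sup>2) = 0"
          using eventually_ge_at_top[of k]
        proof eventually_elim
          case (elim n)
          then have "norm (\<Phi> s \<omega>) \<le> real n" using k by linarith
          then show ?case by simp
        qed
        then show "(\<lambda>n. ennreal ((norm (indicator {0..t} s *\<^sub>R ?R n s \<omega>))\<^sup>2)) \<longlonglongrightarrow> 0"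
          by (rule tendsto_eventually)
      qed
    qed measurable
    then show ?case by (simp only: path_energy_def eq nn_integral_const mult_zero_left)
  qed
qed (use d finite_measure_axioms in auto)

text \<open>On its interval the simple process is constant, so every time \<open>s\<close> there
  bounds the same coefficient moment by the moment of the integrand at \<open>s\<close> plus an
  error at \<open>s\<close>. Integrating over the interval and summing yields an integral over
  \<open>{0..t}\<close>; Tonelli identifies the error with the expected L^1-distance. The parameter
  \<open>h\<close> stays free until the distance can be chosen.\<close>

lemma bounded_progressive_moment:
  fixes \<Phi> :: "real \<Rightarrow> 'w \<Rightarrow> real ^ 'm ^ 'd"
  assumes t: "t \<in> {0..T}" "0 < t" and p: "2 \<le> p"
    and pr: "progressive t F \<Phi>" and bd: "\<And>s \<omega>. s \<in> {0..t} \<Longrightarrow> \<omega> \<in> space M \<Longrightarrow> norm (\<Phi> s \<omega>) \<le> N"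
        and N: "0 < N"
    and \<phi>: "\<phi> \<in> borel_measurable borel" "\<And>s. 0 \<le> \<phi> s"
    and m: "AE s in lborel. s \<in> {0..t} \<longrightarrow> (\<integral>\<^sup>+\<omega>. ennreal (norm (\<Phi> s \<omega>) powr p) \<partial>M)
        \<le> ennreal (\<phi> s powr p)"
    and s: "simple_integrand F t n \<tau> \<xi>" and s_bd: "\<And>i \<omega>. i < n \<Longrightarrow> \<omega> \<in> space M \<Longrightarrow> norm (\<xi> i \<omega>) \<le> N"
    and h: "0 < h"
  shows "(\<Sum>i<n. ennreal (expectation (\<lambda>\<omega>. norm (\<xi> i \<omega>) powr p) powr (2 / p)) * ennreal (\<tau> (Suc i) - \<tau>
      i))
    \<le> 4 * ((\<integral>\<^sup>+s\<in>{0..t}. ennreal ((\<phi> s)\<^sup>2) \<partial>lborel) + (ennreal (h * t)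
        + ennreal (h powr (1 - p / 2) * (2 * N) powr (p - 1))
          * (\<integral>\<^sup>+\<omega>. (\<integral>\<^sup>+s\<in>{0..t}. ennreal (norm (simple_process n \<tau> \<xi> s \<omega> - \<Phi> s \<omega>)) \<partial>lborel) \<partial>M)))"
proof -
  have tt: "t \<in> {0..t}" "t \<le> T" using t by auto
  note sD = simple_integrandD[OF s]
  note j = jointly_measurable_diff[OF simple_process_jointly_measurable[OF t(1) s]
      progressive_jointly_measurable_M[OF pr tt]]
  let ?D = "\<lambda>s \<omega>. simple_process n \<tau> \<xi> s \<omega> - \<Phi> s \<omega>"
  define e where "e s = (\<integral>\<^sup>+\<omega>. ennreal (norm (?D s \<omega>)) \<partial>M)" for s
  have e_ind: "e s * indicator {0..t} s = (\<integral>\<^sup>+\<omega>. ennreal (norm (indicator {0..t} s *\<^sub>R ?D s \<omega>)) \<partial>M)"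
      for s
    by (auto simp: e_def indicator_def)
  have mj: "(\<lambda>(s, \<omega>). indicator {0..t} s *\<^sub>R ?D s \<omega>) \<in> borel_measurable (lborel \<Otimes>\<^sub>M M)"
    using measurable_pair_swap[OF j[unfolded jointly_measurable_def]] by simp
  have me: "(\<lambda>s. e s * indicator {0..t} s) \<in> borel_measurable lborel"
  proof -
    note [measurable] = mj
    have "(\<lambda>x. ennreal (norm (case x of (s, \<omega>) \<Rightarrow> indicator {0..t} s *\<^sub>R ?D s \<omega>))) \<in> borel_measurable
        (lborel \<Otimes>\<^sub>M M)"
      by measurable
    then show ?thesis
      unfolding e_ind by (intro borel_measurable_nn_integral) (simp only: case_prod_unfold)
  qed
  \<comment> \<open>Both processes are bounded by \<open>N\<close>, so the p-th power of their
    difference is at most this constant times its first power.\<close>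
  define b where "b = (2 * N) powr (p - 1)"
  have b0: "0 \<le> b" by (simp add: b_def)
  define c where "c = h powr (1 - p / 2)"
  have c0: "0 \<le> c" by (simp add: c_def)
  let ?H = "\<lambda>s. 4 * (ennreal ((\<phi> s)\<^sup>2) + (ennreal h + ennreal (c * b) * e s))"
  have mH: "(\<lambda>s. ?H s * indicator {0..t} s) \<in> borel_measurable lborel"
  proof -
    have "(\<lambda>s. ?H s * indicator {0..t} s) = (\<lambda>s. 4 * (ennreal ((\<phi> s)\<^sup>2) * indicator {0..t} s + (ennreal
        h * indicator {0..t} s + ennreal (c * b) * (e s * indicator {0..t} s))))"
      by (auto simp: indicator_def)
    also have "\<dots> \<in> borel_measurable lborel" using me \<phi>(1) by measurable
    finally show ?thesis .
  qed
  have step: "ennreal (expectation (\<lambda>\<omega>. norm (\<xi> i \<omega>) powr p) powr (2 / p)) * ennreal (\<tau> (Suc i) - \<tau> i)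
      \<le> (\<integral>\<^sup>+s. ?H s * indicator {\<tau> i<..\<tau> (Suc i)} s \<partial>lborel)" if i: "i < n" for i
  proof -
    define x where "x = expectation (\<lambda>\<omega>. norm (\<xi> i \<omega>) powr p)"
    have x0: "0 \<le> x" unfolding x_def by simp
    have \<tau>i: "\<tau> i \<in> {0..T}" using sD(1)[of i] i t by auto
    have m\<xi> [measurable]: "\<xi> i \<in> borel_measurable M" by (rule measurable_F_M[OF \<tau>i sD(3)[OF i]])
    have i\<xi>: "integrable M (\<lambda>\<omega>. norm (\<xi> i \<omega>) powr p)"
      by (rule integrable_const_bound[where B = "N powr p"]) (use s_bd[OF i] p in \<open>auto intro!: AE_I2
        powr_mono2\<close>)
    have nx: "ennreal x = (\<integral>\<^sup>+\<omega>. ennreal (norm (\<xi> i \<omega>) powr p) \<partial>M)"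
      unfolding x_def by (rule nn_integral_eq_integral[OF i\<xi>, symmetric]) simp
    have "AE s in lborel. ennreal (x powr (2 / p)) * indicator {\<tau> i<..\<tau> (Suc i)} s
        \<le> ?H s * indicator {\<tau> i<..\<tau> (Suc i)} s"
      using m
    proof eventually_elim
      case (elim s)
      show ?case
      proof (cases "s \<in> {\<tau> i<..\<tau> (Suc i)}")
        case True
        have st: "s \<in> {0..t}" using True sD(1)[of i] sD(1)[of "Suc i"] i by auto
        have at: "simple_process n \<tau> \<xi> s \<omega> = \<xi> i \<omega>" for \<omega>
          by (rule simple_process_at(2)[OF _ i True]) (rule sD(2))
        have [measurable]: "\<Phi> s \<in> borel_measurable M"
          using measurable_compose[OF measurable_Pair2'[of s lborel M]
            progressive_jointly_measurable_M[OF pr tt, unfolded jointly_measurable_def]] st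
          by simp
        have le2: "norm (?D s \<omega>) \<le> 2 * N" if "\<omega> \<in> space M" for \<omega>
          unfolding at using norm_triangle_ineq4[of "\<xi> i \<omega>" "\<Phi> s \<omega>"] s_bd[OF i that] bd[OF st that]
            by linarith
        have "e s \<le> (\<integral>\<^sup>+\<omega>. ennreal (2 * N) \<partial>M)"
          unfolding e_def by (intro nn_integral_mono ennreal_leI le2)
        also have "\<dots> < \<infinity>" by (simp add: emeasure_space_1)
        finally have "e s < \<infinity>" .
        then have er: "e s = ennreal (enn2real (e s))" by (simp add: less_top)
        have pt: "norm (\<xi> i \<omega>) powr p \<le> 2 powr p * (norm (\<Phi> s \<omega>) powr p + b * norm (?D s \<omega>))"
            if \<omega>: "\<omega> \<in> space M" for \<omega>
        proof -
          have "norm (\<xi> i \<omega>) \<le> norm (\<Phi> s \<omega>) + norm (?D s \<omega>)"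
            unfolding at using norm_triangle_sub[of "\<xi> i \<omega>" "\<Phi> s \<omega>"] by simp
          then have "norm (\<xi> i \<omega>) powr p \<le> (norm (\<Phi> s \<omega>) + norm (?D s \<omega>)) powr p"
            using p by (intro powr_mono2) auto
          also have "\<dots> \<le> 2 powr p * (norm (\<Phi> s \<omega>) powr p + norm (?D s \<omega>) powr p)"
            using p by (intro powr_add_le) auto
          also have "norm (?D s \<omega>) powr p = norm (?D s \<omega>) powr (p - 1) * norm (?D s \<omega>)"
            by (cases "norm (?D s \<omega>) = 0") (simp_all add: powr_diff)
          also have "\<dots> \<le> b * norm (?D s \<omega>)"
            unfolding b_def using p le2[OF \<omega>] by (intro mult_right_mono powr_mono2) auto
          finally show ?thesis by simp
        qed
        have "ennreal x \<le> (\<integral>\<^sup>+\<omega>. ennreal (2 powr p) * (ennreal (norm (\<Phi> s \<omega>) powr p) + ennreal b *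
            ennreal (norm (?D s \<omega>))) \<partial>M)"
          unfolding nx using pt b0
          by (intro nn_integral_mono) (simp flip: ennreal_mult ennreal_plus add: ennreal_leI)
        also have "\<dots> = ennreal (2 powr p) * ((\<integral>\<^sup>+\<omega>. ennreal (norm (\<Phi> s \<omega>) powr p) \<partial>M) + ennreal b * e
            s)"
          unfolding e_def at by (simp add: nn_integral_cmult nn_integral_add)
        also have "\<dots> \<le> ennreal (2 powr p) * (ennreal (\<phi> s powr p) + ennreal b * ennreal (enn2real (e
            s)))"
          unfolding er[symmetric] using elim st by (intro mult_left_mono add_right_mono) auto
        also have "\<dots> = ennreal (2 powr p * (\<phi> s powr p + b * enn2real (e s)))"
          using b0 by (simp flip: ennreal_mult ennreal_plus)
        finally have "x \<le> 2 powr p * (\<phi> s powr p + b * enn2real (e s))"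
          using b0 by (subst (asm) ennreal_le_iff) auto
        then have "x powr (2 / p) \<le> 4 * ((\<phi> s)\<^sup>2 + (h + c * (b * enn2real (e s))))"
          unfolding c_def using x0 \<phi>(2) b0 p h by (intro moment_perturbation) auto
        then have "ennreal (x powr (2 / p)) \<le> ennreal (4 * ((\<phi> s)\<^sup>2 + (h + c * b * enn2real (e s))))"
          by (intro ennreal_leI) (simp add: mult.assoc)
        also have "\<dots> = 4 * (ennreal ((\<phi> s)\<^sup>2) + (ennreal h + ennreal (c * b) * ennreal (enn2real (e
            s))))"
          using b0 c0 h by (simp add: ennreal_mult ennreal_plus)
        finally show ?thesis using True unfolding er[symmetric] by simp
      qed simp
    qed
    then have "(\<integral>\<^sup>+s. ennreal (x powr (2 / p)) * indicator {\<tau> i<..\<tau> (Suc i)} s \<partial>lborel)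
        \<le> (\<integral>\<^sup>+s. ?H s * indicator {\<tau> i<..\<tau> (Suc i)} s \<partial>lborel)"
      by (rule nn_integral_mono_AE)
    moreover have "(\<integral>\<^sup>+s. ennreal (x powr (2 / p)) * indicator {\<tau> i<..\<tau> (Suc i)} s \<partial>lborel)
        = ennreal (x powr (2 / p)) * ennreal (\<tau> (Suc i) - \<tau> i)"
      using sD(2)[OF i] by (subst nn_integral_cmult_indicator) auto
    ultimately show ?thesis by (simp add: x_def)
  qed
  have "(\<Sum>i<n. ennreal (expectation (\<lambda>\<omega>. norm (\<xi> i \<omega>) powr p) powr (2 / p)) * ennreal (\<tau> (Suc i) - \<tau> i))
      \<le> (\<Sum>i<n. \<integral>\<^sup>+s. ?H s * indicator {\<tau> i<..\<tau> (Suc i)} s \<partial>lborel)"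
    by (intro sum_mono step) simp
  also have "\<dots> \<le> (\<integral>\<^sup>+s\<in>{0..t}. ?H s \<partial>lborel)"
    using sD(1,2) mH by (rule sum_nn_integral_Ioc_le[where H = ?H])
  also have "\<dots> = (\<integral>\<^sup>+s. 4 * (ennreal ((\<phi> s)\<^sup>2) * indicator {0..t} s + (ennreal h * indicator {0..t} s +
      ennreal (c * b) * (e s * indicator {0..t} s))) \<partial>lborel)"
    by (intro nn_integral_cong) (auto simp: indicator_def)
  also have "\<dots> = 4 * ((\<integral>\<^sup>+s\<in>{0..t}. ennreal ((\<phi> s)\<^sup>2) \<partial>lborel) + (ennreal (h * t) + ennreal (c * b) *
      (\<integral>\<^sup>+s\<in>{0..t}. e s \<partial>lborel)))"
    using me \<phi>(1) t h by (simp add: nn_integral_cmult nn_integral_add nn_integral_cmult_indicator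
      ennreal_mult)
  also have "(\<integral>\<^sup>+s\<in>{0..t}. e s \<partial>lborel) = (\<integral>\<^sup>+\<omega>. (\<integral>\<^sup>+s\<in>{0..t}. ennreal (norm (?D s \<omega>)) \<partial>lborel) \<partial>M)"
  proof -
    interpret P: pair_sigma_finite M "lborel :: real measure" ..
    have "(\<integral>\<^sup>+s\<in>{0..t}. e s \<partial>lborel) = (\<integral>\<^sup>+s. (\<integral>\<^sup>+\<omega>. ennreal (norm (indicator {0..t} s *\<^sub>R ?D s \<omega>)) \<partial>M)
        \<partial>lborel)"
      unfolding e_ind ..
    also have "\<dots> = (\<integral>\<^sup>+\<omega>. (\<integral>\<^sup>+s. ennreal (norm (indicator {0..t} s *\<^sub>R ?D s \<omega>)) \<partial>lborel) \<partial>M)"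
    proof (rule P.Fubini')
      note [measurable] = j[unfolded jointly_measurable_def]
      have "(\<lambda>x. ennreal (norm (case x of (\<omega>, s) \<Rightarrow> indicator {0..t} s *\<^sub>R ?D s \<omega>))) \<in> borel_measurable
          (M \<Otimes>\<^sub>M lborel)"
        by measurable
      then show "(\<lambda>(\<omega>, s). ennreal (norm (indicator {0..t} s *\<^sub>R ?D s \<omega>))) \<in> borel_measurable (M \<Otimes>\<^sub>M
          lborel)"
        by (simp only: case_prod_unfold)
    qed
    also have "\<dots> = (\<integral>\<^sup>+\<omega>. (\<integral>\<^sup>+s\<in>{0..t}. ennreal (norm (?D s \<omega>)) \<partial>lborel) \<partial>M)"
      by (intro nn_integral_cong) (auto simp: indicator_def)
    finally show ?thesis .
  qed
  finally show ?thesis unfolding c_def b_def .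
qed

text \<open>The order of choices matters: the truncation level is fixed first by the energy of the
  residual, and only then is the accuracy of the step approximation, because its constants grow with
  the level. Truncation does not increase moments, so \<phi> remains a valid majorant.\<close>

lemma simple_approx_moment:
  fixes \<Phi> :: "real \<Rightarrow> 'w \<Rightarrow> real ^ 'm ^ 'd"
  assumes t: "t \<in> {0..T}" and p: "2 \<le> p"
    and pr: "progressive t F \<Phi>" and fin: "AE \<omega> in M. path_energy t \<Phi> \<omega> < \<infinity>"
    and \<phi>: "\<phi> \<in> borel_measurable borel" "\<And>s. 0 \<le> \<phi> s"
    and m: "AE s in lborel. s \<in> {0..t} \<longrightarrow> (\<integral>\<^sup>+\<omega>. ennreal (norm (\<Phi> s \<omega>) powr p) \<partial>M)
        \<le> ennreal (\<phi> s powr p)"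
    and A: "(\<integral>\<^sup>+s\<in>{0..t}. ennreal ((\<phi> s)\<^sup>2) \<partial>lborel) \<le> ennreal A" "0 \<le> A"
    and d: "0 < d" and \<epsilon>: "0 < \<epsilon>"
  obtains n \<tau> \<xi> where "simple_integrand F t n \<tau> \<xi>"
    "prob {\<omega>\<in>space M. ennreal d < path_energy t (\<lambda>s \<omega>. simple_process n \<tau> \<xi> s \<omega> - \<Phi> s \<omega>) \<omega>} < \<epsilon>"
    "(\<Sum>i<n. expectation (\<lambda>\<omega>. norm (\<xi> i \<omega>) powr p) powr (2 / p) * (\<tau> (Suc i) - \<tau> i)) \<le> 4 * (A + \<epsilon>)"
proof (cases "t = 0")
  case True
  have "simple_integrand F t 0 (\<lambda>_. 0) (\<lambda>_ _. 0)" using True by (simp add: simple_integrand_def)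
  moreover have "path_energy t X \<omega> = 0" for X :: "real \<Rightarrow> 'w \<Rightarrow> real ^ 'm ^ 'd" and \<omega>
  proof -
    have "AE s in lborel. ennreal ((norm (X s \<omega>))\<^sup>2) * indicator {0..t} s = 0"
      using AE_lborel_singleton[of 0] by eventually_elim (simp add: True)
    from nn_integral_cong_AE[OF this] show ?thesis by (simp add: path_energy_def)
  qed
  ultimately show ?thesis using that[of 0 "\<lambda>_. 0" "\<lambda>_ _. 0"] A \<epsilon> by simp
next
  case False
  then have t0: "0 < t" using t by simp
  have tt: "t \<in> {0..t}" "t \<le> T" using t by auto
  note j = progressive_jointly_measurable_M[OF pr tt]
  define \<Phi>' where "\<Phi>' n s \<omega> = (if norm (\<Phi> s \<omega>) \<le> real n then \<Phi> s \<omega> else 0)" for n s \<omega>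
  have "(\<lambda>n. prob {\<omega>\<in>space M. ennreal (d / 4) < path_energy t (\<lambda>s \<omega>. \<Phi> s \<omega> - \<Phi>' n s \<omega>) \<omega>}) \<longlonglongrightarrow> 0"
    unfolding \<Phi>'_def using d by (intro truncation_approx[OF j fin]) simp
  from eventually_conj[OF order_tendstoD(2)[OF this half_gt_zero[OF \<epsilon>]] eventually_gt_at_top[of 0]]
  obtain k where k: "prob {\<omega>\<in>space M. ennreal (d / 4) < path_energy t (\<lambda>s \<omega>. \<Phi> s \<omega> - \<Phi>' k s \<omega>) \<omega>} < \<epsilon> /
      2" "0 < k"
    by (auto simp: eventually_sequentially)
  define N where "N = real k"
  have N: "0 < N" using k by (simp add: N_def)
  let ?P = "\<Phi>' k"
  have prP: "progressive t F ?P"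
    unfolding progressive_def
  proof
    fix u assume "u \<in> {0..t}"
    then have [measurable]: "(\<lambda>(s, \<omega>). \<Phi> s \<omega>) \<in> borel_measurable (restrict_space borel {0..u} \<Otimes>\<^sub>M F u)"
      using pr by (auto simp: progressive_def)
    have "(\<lambda>(s, \<omega>). ?P s \<omega>) = (\<lambda>x. if norm (case x of (s, \<omega>) \<Rightarrow> \<Phi> s \<omega>)
        \<le> real k then (case x of (s, \<omega>) \<Rightarrow> \<Phi> s \<omega>) else 0)"
      by (auto simp: \<Phi>'_def)
    also have "\<dots> \<in> borel_measurable (restrict_space borel {0..u} \<Otimes>\<^sub>M F u)" by measurable
    finally show "(\<lambda>(s, \<omega>). ?P s \<omega>) \<in> borel_measurable (restrict_space borel {0..u} \<Otimes>\<^sub>M F u)" .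
  qed
  note jP = progressive_jointly_measurable_M[OF prP tt]
  have bdP: "norm (?P s \<omega>) \<le> N" for s \<omega> using N by (auto simp: \<Phi>'_def N_def)
  have mP: "AE s in lborel. s \<in> {0..t} \<longrightarrow> (\<integral>\<^sup>+\<omega>. ennreal (norm (?P s \<omega>) powr p) \<partial>M)
      \<le> ennreal (\<phi> s powr p)"
    using m
  proof eventually_elim
    case (elim s)
    have "(\<integral>\<^sup>+\<omega>. ennreal (norm (?P s \<omega>) powr p) \<partial>M) \<le> (\<integral>\<^sup>+\<omega>. ennreal (norm (\<Phi> s \<omega>) powr p) \<partial>M)"
      by (intro nn_integral_mono ennreal_leI) (auto simp: \<Phi>'_def)
    then show ?case using elim by (meson order_trans)
  qed
  \<comment> \<open>Chosen such that the constant part of the error, \<open>h * t\<close>, equals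
    \<epsilon> / 2.\<close>
  define h where "h = \<epsilon> / (2 * t)"
  have h: "0 < h" using \<epsilon> t0 by (simp add: h_def)
  define C where "C = h powr (1 - p / 2) * (2 * N) powr (p - 1)"
  have C: "0 \<le> C" by (simp add: C_def)
  \<comment> \<open>The first entry keeps the moment error \<open>C * \<eta>\<close> below
    \<epsilon> / 2; the second keeps the probability from Markov's inequality, with factor
    \<open>8 * N / d\<close>, below \<epsilon> / 2.\<close>
  define \<eta> where "\<eta> = min (\<epsilon> / (2 * (C + 1))) (d * \<epsilon> / (16 * N))"
  have \<eta>: "0 < \<eta>" using \<epsilon> d N C by (simp add: \<eta>_def)
  obtain n \<tau> \<xi> where s: "simple_integrand F t n \<tau> \<xi>" and bd\<xi>: "\<And>i \<omega>. i < n \<Longrightarrow> \<omega> \<in> space M \<Longrightarrow> norm (\<xi> i \<omega>)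
      \<le> N"
    and L1: "(\<integral>\<^sup>+\<omega>. (\<integral>\<^sup>+s\<in>{0..t}. ennreal (norm (simple_process n \<tau> \<xi> s \<omega> - ?P s \<omega>)) \<partial>lborel) \<partial>M) <
        ennreal \<eta>"
    by (rule bounded_progressive_approx[OF t t0 prP bdP N \<eta>]) (rule that)
  note sD = simple_integrandD[OF s]
  note js = simple_process_jointly_measurable[OF t s]
  let ?D = "\<lambda>s \<omega>. simple_process n \<tau> \<xi> s \<omega> - ?P s \<omega>"
  let ?L = "\<lambda>\<omega>. (\<integral>\<^sup>+s\<in>{0..t}. ennreal (norm (?D s \<omega>)) \<partial>lborel)"
  note [measurable] = jointly_measurable_L1[OF jointly_measurable_diff[OF js jP]]
    jointly_measurable_energy[OF jointly_measurable_diff[OF js jP]]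
  \<comment> \<open>Since the difference is bounded by 2 N, its square is at most 2 N times its
    norm, and smallness in L^1 gives smallness of the energy.\<close>
  have EL: "path_energy t ?D \<omega> \<le> ennreal (2 * N) * ?L \<omega>" if \<omega>: "\<omega> \<in> space M" for \<omega>
  proof -
    have "norm (simple_process n \<tau> \<xi> s \<omega>) \<le> N" for s
    proof (cases "\<exists>i<n. s \<in> {\<tau> i<..\<tau> (Suc i)}")
      case True
      then obtain i where i: "i < n" "s \<in> {\<tau> i<..\<tau> (Suc i)}" by blast
      have "simple_process n \<tau> \<xi> s \<omega> = \<xi> i \<omega>"
        by (rule simple_process_at(2)[OF _ i]) (rule sD(2))
      then show ?thesis using bd\<xi>[OF i(1) \<omega>] by simp
    next
      case False
      then have "simple_process n \<tau> \<xi> s \<omega> = 0"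
        unfolding simple_process_def by (intro sum.neutral) auto
      then show ?thesis using N by simp
    qed
    then have "norm (?D s \<omega>) \<le> 2 * N" for s
      using norm_triangle_ineq4[of "simple_process n \<tau> \<xi> s \<omega>" "?P s \<omega>"] bdP[of s \<omega>] by (smt (verit))
    then have "(norm (?D s \<omega>))\<^sup>2 \<le> 2 * N * norm (?D s \<omega>)" for s
      unfolding power2_eq_square by (intro mult_right_mono) auto
    then have "path_energy t ?D \<omega> \<le> (\<integral>\<^sup>+s. ennreal (2 * N) * (ennreal (norm (?D s \<omega>)) * indicator {0..t}
        s) \<partial>lborel)"
      unfolding path_energy_def using N
      by (intro nn_integral_mono) (auto simp: indicator_def ennreal_mult[symmetric] intro: ennreal_leI)
    also have "\<dots> = ennreal (2 * N) * ?L \<omega>"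
    proof (rule nn_integral_cmult)
      have "(\<lambda>s. ennreal (norm (?D s \<omega>)) * indicator {0..t} s)
          = (\<lambda>s. ennreal (norm (indicator {0..t} s *\<^sub>R ?D s \<omega>)))"
        by (auto simp: indicator_def)
      also have "\<dots> \<in> borel_measurable lborel"
        using jointly_measurable_section[OF jointly_measurable_diff[OF js jP] \<omega>] by measurable
      finally show "(\<lambda>s. ennreal (norm (?D s \<omega>)) * indicator {0..t} s) \<in> borel_measurable lborel" .
    qed
    finally show ?thesis .
  qed
  have pD: "prob {\<omega>\<in>space M. ennreal (d / 4) < path_energy t ?D \<omega>} \<le> \<epsilon> / 2"
  proof -
    let ?c = "ennreal (8 * N / d)"
    have "1 \<le> ?c * ?L \<omega>" if \<omega>: "\<omega> \<in> space M" "ennreal (d / 4) < path_energy t ?D \<omega>" for \<omega>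
    proof -
      have "ennreal (4 / d) * ennreal (d / 4) \<le> ennreal (4 / d) * (ennreal (2 * N) * ?L \<omega>)"
        using EL[OF \<omega>(1)] \<omega>(2) by (intro mult_left_mono) auto
      also have "\<dots> = ?c * ?L \<omega>" using d N by (simp add: mult.assoc[symmetric] ennreal_mult[symmetric])
      also have "ennreal (4 / d) * ennreal (d / 4) = 1" using d by (simp add: ennreal_mult[symmetric])
      finally show ?thesis .
    qed
    then have "emeasure M {\<omega>\<in>space M. ennreal (d / 4) < path_energy t ?D \<omega>} \<le> emeasure M {\<omega>\<in>space M. 1
        \<le> ?c * ?L \<omega>}"
      by (intro emeasure_mono) auto
    also have "\<dots> \<le> ?c * (\<integral>\<^sup>+\<omega>. ?L \<omega> * indicator (space M) \<omega> \<partial>M)"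
      by (rule nn_integral_Markov_inequality) auto
    also have "(\<integral>\<^sup>+\<omega>. ?L \<omega> * indicator (space M) \<omega> \<partial>M) = (\<integral>\<^sup>+\<omega>. ?L \<omega> \<partial>M)"
      by (intro nn_integral_cong) auto
    also have "?c * \<dots> \<le> ?c * ennreal (d * \<epsilon> / (16 * N))"
      using L1 by (intro mult_left_mono order_trans[OF less_imp_le[OF L1]] ennreal_leI) (auto simp:
        \<eta>_def)
    also have "\<dots> = ennreal (\<epsilon> / 2)" using d N \<epsilon> by (simp add: ennreal_mult[symmetric])
    finally show ?thesis using \<epsilon> by (simp add: emeasure_eq_measure)
  qed
  have eq: "simple_process n \<tau> \<xi> s \<omega> - \<Phi> s \<omega> = ?D s \<omega> - (\<Phi> s \<omega> - ?P s \<omega>)" for s \<omega> by simp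
  have "prob {\<omega>\<in>space M. ennreal d < path_energy t (\<lambda>s \<omega>. simple_process n \<tau> \<xi> s \<omega> - \<Phi> s \<omega>) \<omega>}
      \<le> prob {\<omega>\<in>space M. ennreal (d / 4) < path_energy t ?D \<omega>}
        + prob {\<omega>\<in>space M. ennreal (d / 4) < path_energy t (\<lambda>s \<omega>. \<Phi> s \<omega> - ?P s \<omega>) \<omega>}"
    unfolding eq by (rule prob_energy_diff_le[OF jointly_measurable_diff[OF js jP]
      jointly_measurable_diff[OF j jP] d])
  then have 1: "prob {\<omega>\<in>space M. ennreal d < path_energy t (\<lambda>s \<omega>. simple_process n \<tau> \<xi> s \<omega> - \<Phi> s \<omega>) \<omega>} <
      \<epsilon>"
    using pD k(1) by linarith
  let ?S = "\<Sum>i<n. expectation (\<lambda>\<omega>. norm (\<xi> i \<omega>) powr p) powr (2 / p) * (\<tau> (Suc i) - \<tau> i)"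
  have "ennreal ?S = (\<Sum>i<n. ennreal (expectation (\<lambda>\<omega>. norm (\<xi> i \<omega>) powr p) powr (2 / p)) * ennreal (\<tau>
      (Suc i) - \<tau> i))"
    using sD(2) by (subst sum_ennreal[symmetric]) (auto simp: ennreal_mult)
  also have "\<dots> \<le> 4 * ((\<integral>\<^sup>+s\<in>{0..t}. ennreal ((\<phi> s)\<^sup>2) \<partial>lborel) + (ennreal (h * t) + ennreal C * (\<integral>\<^sup>+\<omega>.
      ?L \<omega> \<partial>M)))"
    unfolding C_def by (rule bounded_progressive_moment[OF t t0 p prP bdP N \<phi> mP s bd\<xi> h])
  also have "\<dots> \<le> 4 * (ennreal A + (ennreal (\<epsilon> / 2) + ennreal C * ennreal (\<epsilon> / (2 * (C + 1)))))"
  proof (intro mult_left_mono add_mono A(1))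
    show "ennreal (h * t) \<le> ennreal (\<epsilon> / 2)" using t0 by (simp add: h_def)
    show "(\<integral>\<^sup>+\<omega>. ?L \<omega> \<partial>M) \<le> ennreal (\<epsilon> / (2 * (C + 1)))"
      by (rule order_trans[OF less_imp_le[OF L1]]) (auto simp: \<eta>_def intro!: ennreal_leI)
  qed auto
  also have "\<dots> = ennreal (4 * (A + (\<epsilon> / 2 + C * (\<epsilon> / (2 * (C + 1))))))"
  proof -
    have "0 \<le> C * (\<epsilon> / (2 * (C + 1)))" using C \<epsilon> by simp
    moreover have "ennreal C * ennreal (\<epsilon> / (2 * (C + 1))) = ennreal (C * (\<epsilon> / (2 * (C + 1))))"
      using C \<epsilon> by (intro ennreal_mult[symmetric]) auto
    ultimately show ?thesis
      using A \<epsilon> by (simp flip: ennreal_plus ennreal_numeral ennreal_mult)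
  qed
  finally have "?S \<le> 4 * (A + (\<epsilon> / 2 + C * (\<epsilon> / (2 * (C + 1)))))"
    using A C \<epsilon> by (subst (asm) ennreal_le_iff) auto
  also have "C * (\<epsilon> / (2 * (C + 1))) \<le> \<epsilon> / 2" using C \<epsilon> by (simp add: field_simps)
  finally have "?S \<le> 4 * (A + \<epsilon>)" by simp
  then show ?thesis using that[OF s 1] by blast
qed

text \<open>A moment bound passes to a limit in probability at the cost of a factor
  \<open>2 powr p\<close>. The power is capped at \<open>n\<close>, so the event where the
  approximation fails contributes at most \<open>n\<close> times its probability; the cap is removed
  by monotone convergence.\<close>

lemma nn_moment_le_of_close:
  fixes Y :: "'w \<Rightarrow> 'b::{second_countable_topology, real_normed_vector}"
  assumes p: "1 \<le> p" and [measurable]: "Y \<in> borel_measurable M" and Q: "0 \<le> Q"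
    and close: "\<And>\<epsilon>. 0 < \<epsilon> \<Longrightarrow> \<epsilon> < \<theta> \<Longrightarrow> \<exists>S\<in>borel_measurable M.
      (\<integral>\<^sup>+\<omega>. ennreal (norm (S \<omega>) powr p) \<partial>M) \<le> ennreal Q \<and> prob {\<omega>\<in>space M. \<epsilon> < norm (S \<omega> - Y \<omega>)} \<le> \<epsilon>"
    and \<theta>: "0 < \<theta>" "\<theta> \<le> 1"
  shows "(\<integral>\<^sup>+\<omega>. ennreal (norm (Y \<omega>) powr p) \<partial>M) \<le> ennreal (2 powr p * Q)"
proof -
  have cap: "(\<integral>\<^sup>+\<omega>. ennreal (min (norm (Y \<omega>) powr p) (real n)) \<partial>M) \<le> ennreal (2 powr p * Q)"
      for n :: nat
  proof (rule ennreal_le_epsilon)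
    fix e :: real assume e: "0 < e"
    \<comment> \<open>Makes the total error, \<open>(2 powr p + real n) * \<epsilon>\<close>, at
      most \<open>e\<close>.\<close>
    define \<epsilon> where "\<epsilon> = min (\<theta> / 2) (e / (2 powr p + real n))"
    have c: "0 < 2 powr p + real n" by (simp add: add_pos_nonneg)
    have "\<epsilon> \<le> \<theta> / 2" unfolding \<epsilon>_def by (rule min.cobounded1)
    then have \<epsilon>: "0 < \<epsilon>" "\<epsilon> < \<theta>" "\<epsilon> \<le> 1" using \<theta> e c by (simp_all add: \<epsilon>_def)
    obtain S where [measurable]: "S \<in> borel_measurable M" and S: "(\<integral>\<^sup>+\<omega>. ennreal (norm (S \<omega>) powr p) \<partial>M)
        \<le> ennreal Q"
      "prob {\<omega>\<in>space M. \<epsilon> < norm (S \<omega> - Y \<omega>)} \<le> \<epsilon>"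
      using close[OF \<epsilon>(1,2)] by blast
    let ?E = "{\<omega>\<in>space M. \<epsilon> < norm (S \<omega> - Y \<omega>)}"
    have "(\<integral>\<^sup>+\<omega>. ennreal (min (norm (Y \<omega>) powr p) (real n)) \<partial>M)
        \<le> (\<integral>\<^sup>+\<omega>. ennreal (2 powr p) * ennreal (norm (S \<omega>) powr p) + (ennreal (2 powr p * \<epsilon>) + ennreal
            (real n) * indicator ?E \<omega>) \<partial>M)"
    proof (intro nn_integral_mono)
      fix \<omega> assume \<omega>: "\<omega> \<in> space M"
      show "ennreal (min (norm (Y \<omega>) powr p) (real n))
          \<le> ennreal (2 powr p) * ennreal (norm (S \<omega>) powr p) + (ennreal (2 powr p * \<epsilon>) + ennreal (real
              n) * indicator ?E \<omega>)"
      proof (cases "\<omega> \<in> ?E")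
        case True
        have "ennreal (min (norm (Y \<omega>) powr p) (real n)) \<le> ennreal (real n)" by (intro ennreal_leI) auto
        then show ?thesis using True by (simp add: add_increasing)
      next
        case False
        then have "norm (S \<omega> - Y \<omega>) \<le> \<epsilon>" using \<omega> by auto
        then have "norm (Y \<omega>) \<le> norm (S \<omega>) + \<epsilon>"
          using norm_triangle_sub[of "Y \<omega>" "S \<omega>"] by (simp add: norm_minus_commute)
        then have "norm (Y \<omega>) powr p \<le> (norm (S \<omega>) + \<epsilon>) powr p" using p by (intro powr_mono2) auto
        also have "\<dots> \<le> 2 powr p * (norm (S \<omega>) powr p + \<epsilon> powr p)" using p \<epsilon> by (intro powr_add_le) auto
        also have "\<dots> \<le> 2 powr p * (norm (S \<omega>) powr p + \<epsilon>)"
          using powr_mono'[of 1 p \<epsilon>] p \<epsilon> by (intro mult_left_mono add_left_mono) auto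
        finally have "min (norm (Y \<omega>) powr p) (real n) \<le> 2 powr p * norm (S \<omega>) powr p + 2 powr p * \<epsilon>"
          by (simp add: distrib_left)
        then have "ennreal (min (norm (Y \<omega>) powr p) (real n))
            \<le> ennreal (2 powr p * norm (S \<omega>) powr p + 2 powr p * \<epsilon>)"
          by (rule ennreal_leI)
        also have "\<dots> = ennreal (2 powr p) * ennreal (norm (S \<omega>) powr p) + ennreal (2 powr p * \<epsilon>)"
          using \<epsilon> by (simp add: ennreal_mult)
        finally show ?thesis using False by simp
      qed
    qed
    also have "\<dots> = ennreal (2 powr p) * (\<integral>\<^sup>+\<omega>. ennreal (norm (S \<omega>) powr p) \<partial>M) + (ennreal (2 powr p * \<epsilon>)
        + ennreal (real n) * ennreal (prob ?E))"
      by (simp add: nn_integral_add nn_integral_cmult emeasure_space_1 emeasure_eq_measure prob_space)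
    also have "\<dots> \<le> ennreal (2 powr p) * ennreal Q + (ennreal (2 powr p * \<epsilon>) + ennreal (real n) * ennreal
        \<epsilon>)"
      by (intro add_mono mult_left_mono S ennreal_leI) auto
    also have "\<dots> = ennreal (2 powr p * Q) + ennreal ((2 powr p + real n) * \<epsilon>)"
      using Q \<epsilon> by (simp add: ennreal_mult[symmetric] ennreal_plus[symmetric] distrib_right del:
        ennreal_plus)
    also have "(2 powr p + real n) * \<epsilon> \<le> (2 powr p + real n) * (e / (2 powr p + real n))"
      using c by (intro mult_left_mono) (auto simp: \<epsilon>_def)
    also have "\<dots> = e" using c by simp
    finally show "(\<integral>\<^sup>+\<omega>. ennreal (min (norm (Y \<omega>) powr p) (real n)) \<partial>M)
        \<le> ennreal (2 powr p * Q) + ennreal e"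
      by (simp add: ennreal_leI add_left_mono)
  qed
  have "(SUP n. ennreal (min y (real n))) = ennreal y" if "0 \<le> y" for y
  proof (rule antisym)
    show "(SUP n. ennreal (min y (real n))) \<le> ennreal y" by (intro SUP_least ennreal_leI) auto
    obtain n where "y \<le> real n" using real_arch_simple by blast
    then have "ennreal y \<le> ennreal (min y (real n))" by simp
    then show "ennreal y \<le> (SUP n. ennreal (min y (real n)))" by (rule SUP_upper2[rotated]) simp
  qed
  then have "(\<integral>\<^sup>+\<omega>. ennreal (norm (Y \<omega>) powr p) \<partial>M)
      = (\<integral>\<^sup>+\<omega>. (SUP n. ennreal (min (norm (Y \<omega>) powr p) (real n))) \<partial>M)"
    by simp
  also have "\<dots> = (SUP n. \<integral>\<^sup>+\<omega>. ennreal (min (norm (Y \<omega>) powr p) (real n)) \<partial>M)"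
    by (rule nn_integral_monotone_convergence_SUP) (auto simp: incseq_def le_fun_def intro!:
      ennreal_leI)
  also have "\<dots> \<le> ennreal (2 powr p * Q)" by (rule SUP_least) (rule cap)
  finally show ?thesis .
qed

end

context brownian_motion
begin

text \<open>The hypothesis involves a measurable majorant \<phi> of the L^p-norms of the integrand
  at fixed times, with \<open>A\<close> bounding its squared L^2-norm in time. Callers can thus
  insert the product of a kernel and the size of a coefficient.\<close>

theorem ito_integral_moment:
  fixes p :: real
  assumes p: "2 \<le> p"
  obtains K where "0 \<le> K"
    and "\<And>t (\<Phi> :: real \<Rightarrow> 'w \<Rightarrow> real ^ 'm ^ 'd) Y \<phi> A. t \<in> {0..T} \<Longrightarrow> has_ito_integral M F B t \<Phi> Y \<Longrightarrow>
      \<phi> \<in> borel_measurable borel \<Longrightarrow> \<forall>s. 0 \<le> \<phi> s \<Longrightarrow>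
      AE s in lborel. s \<in> {0..t} \<longrightarrow> (\<integral>\<^sup>+\<omega>. ennreal (norm (\<Phi> s \<omega>) powr p) \<partial>M) \<le> ennreal (\<phi> s powr p) \<Longrightarrow>
      (\<integral>\<^sup>+s\<in>{0..t}. ennreal ((\<phi> s)\<^sup>2) \<partial>lborel) \<le> ennreal A \<Longrightarrow> 0 \<le> A \<Longrightarrow>
      (\<integral>\<^sup>+\<omega>. ennreal (norm (Y \<omega>) powr p) \<partial>M) \<le> ennreal (K * A powr (p / 2))"
proof -
  obtain K1 where K1: "0 \<le> K1"
    and mom: "\<And>t n \<tau> (\<xi> :: nat \<Rightarrow> 'w \<Rightarrow> real ^ 'm ^ 'd). t \<in> {0..T} \<Longrightarrow> simple_integrand F t n \<tau> \<xi> \<Longrightarrow>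
      integrable M (\<lambda>\<omega>. norm (simple_ito_integral B n \<tau> \<xi> \<omega>) powr p) \<and>
      expectation (\<lambda>\<omega>. norm (simple_ito_integral B n \<tau> \<xi> \<omega>) powr p)
        \<le> (K1 * (\<Sum>i<n. expectation (\<lambda>\<omega>. norm (\<xi> i \<omega>) powr p) powr (2 / p) * (\<tau> (Suc i) - \<tau> i))) powr (p
            / 2)"
    by (rule simple_ito_moment[OF p]) (rule that)
  obtain K2 where K2: "0 \<le> K2"
    and len: "\<And>t n \<tau> (\<xi> :: nat \<Rightarrow> 'w \<Rightarrow> real ^ 'm ^ 'd) d e. t \<in> {0..T} \<Longrightarrow> simple_integrand F t n \<tau> \<xi> \<Longrightarrow>
      0 \<le> d \<Longrightarrow> 0 < e \<Longrightarrow>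
      prob {\<omega>\<in>space M. e < norm (simple_ito_integral B n \<tau> \<xi> \<omega>)}
        \<le> prob {\<omega>\<in>space M. d < (\<Sum>i<n. (norm (\<xi> i \<omega>))\<^sup>2 * (\<tau> (Suc i) - \<tau> i))} + K2 * d / e\<^sup>2"
    by (rule simple_ito_lenglart) (rule that)
  define K where "K = 2 powr p * (4 * K1) powr (p / 2)"
  show thesis
  proof (rule that[of K])
    show K0: "0 \<le> K" by (simp add: K_def)
    fix t Y \<phi> A and \<Phi> :: "real \<Rightarrow> 'w \<Rightarrow> real ^ 'm ^ 'd"
    assume t: "t \<in> {0..T}" and I: "has_ito_integral M F B t \<Phi> Y"
      and \<phi>': "\<phi> \<in> borel_measurable borel" "\<forall>s. 0 \<le> \<phi> s"
      and m: "AE s in lborel. s \<in> {0..t} \<longrightarrow> (\<integral>\<^sup>+\<omega>. ennreal (norm (\<Phi> s \<omega>) powr p) \<partial>M)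
          \<le> ennreal (\<phi> s powr p)"
      and A: "(\<integral>\<^sup>+s\<in>{0..t}. ennreal ((\<phi> s)\<^sup>2) \<partial>lborel) \<le> ennreal A" "0 \<le> A"
    have tt: "t \<in> {0..t}" "t \<le> T" using t by auto
    note \<phi> = \<phi>'(1) \<phi>'(2)[rule_format]
    have pr: "progressive t F \<Phi>" and fin: "AE \<omega> in M. path_energy t \<Phi> \<omega> < \<infinity>"
      and Y [measurable]: "Y \<in> borel_measurable M"
      using I by (auto simp: has_ito_integral_def path_energy_def)
    note j = progressive_jointly_measurable_M[OF pr tt]
    obtain n \<tau> \<xi> where s: "\<And>k. simple_integrand F t (n k) (\<tau> k) (\<xi> k)"
      and c1: "\<And>e. e > 0 \<Longrightarrow> (\<lambda>k. prob {\<omega>\<in>space M. ennreal e <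
        path_energy t (\<lambda>s \<omega>. simple_process (n k) (\<tau> k) (\<xi> k) s \<omega> - \<Phi> s \<omega>) \<omega>}) \<longlonglongrightarrow> 0"
      and c2: "\<And>e. e > 0 \<Longrightarrow> (\<lambda>k. prob {\<omega>\<in>space M.
        e < norm (simple_ito_integral B (n k) (\<tau> k) (\<xi> k) \<omega> - Y \<omega>)}) \<longlonglongrightarrow> 0"
      using I unfolding has_ito_integral_def path_energy_def by blast
    have bound: "(\<integral>\<^sup>+\<omega>. ennreal (norm (Y \<omega>) powr p) \<partial>M) \<le> ennreal (K * (A + \<delta>) powr (p / 2))"
      if \<delta>: "0 < \<delta>" for \<delta>
    proof -
      let ?Q = "(K1 * (4 * (A + \<delta>))) powr (p / 2)"
      have "(\<integral>\<^sup>+\<omega>. ennreal (norm (Y \<omega>) powr p) \<partial>M) \<le> ennreal (2 powr p * ?Q)"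
      proof (rule nn_moment_le_of_close[where \<theta> = "min \<delta> 1"])
        fix \<epsilon> :: real assume \<epsilon>: "0 < \<epsilon>" "\<epsilon> < min \<delta> 1"
        \<comment> \<open>With this energy level the Lenglart term
          \<open>K2 * d / (\<epsilon> / 2)^2\<close> is at most \<epsilon> / 2; the summand 1 avoids
          a division by 0.\<close>
        define d where "d = \<epsilon> ^ 3 / (8 * (K2 + 1))"
        have d: "0 < d" "0 < d / 4" using \<epsilon> K2 by (auto simp: d_def)
        have e6: "0 < \<epsilon> / 6" "0 < \<epsilon> / 2" using \<epsilon> by auto
        obtain n' \<tau>' \<xi>' where s': "simple_integrand F t n' \<tau>' \<xi>'"
          and 1: "prob {\<omega>\<in>space M. ennreal (d / 4) < path_energy t (\<lambda>s \<omega>. simple_process n' \<tau>' \<xi>' s \<omega> -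
              \<Phi> s \<omega>) \<omega>} < \<epsilon> / 6"
          and 2: "(\<Sum>i<n'. expectation (\<lambda>\<omega>. norm (\<xi>' i \<omega>) powr p) powr (2 / p) * (\<tau>' (Suc i) - \<tau>' i))
              \<le> 4 * (A + \<epsilon> / 6)"
          by (rule simple_approx_moment[OF t p pr fin \<phi> m A d(2) e6(1)]) (rule that)
        from eventually_conj[OF order_tendstoD(2)[OF c1[OF d(2)] e6(1)] order_tendstoD(2)[OF c2[OF
            e6(2)] e6(1)]]
        obtain k where 3: "prob {\<omega>\<in>space M. ennreal (d / 4) < path_energy t (\<lambda>s \<omega>. simple_process (n k)
            (\<tau> k) (\<xi> k) s \<omega> - \<Phi> s \<omega>) \<omega>} < \<epsilon> / 6"
          and 4: "prob {\<omega>\<in>space M. \<epsilon> / 2 < norm (simple_ito_integral B (n k) (\<tau> k) (\<xi> k) \<omega> - Y \<omega>)} < \<epsilon> /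
              6"
          by (auto simp: eventually_sequentially)
        obtain N \<rho> \<zeta> where z: "simple_integrand F t N \<rho> \<zeta>"
          and z1: "\<And>s \<omega>. simple_process N \<rho> \<zeta> s \<omega>
              = simple_process n' \<tau>' \<xi>' s \<omega> - simple_process (n k) (\<tau> k) (\<xi> k) s \<omega>"
          and z2: "\<And>\<omega>. simple_ito_integral B N \<rho> \<zeta> \<omega>
              = simple_ito_integral B n' \<tau>' \<xi>' \<omega> - simple_ito_integral B (n k) (\<tau> k) (\<xi> k) \<omega>"
          by (rule simple_integrand_diff[OF t s' s[of k], where B = B]) (rule that)
        let ?S = "simple_ito_integral B n' \<tau>' \<xi>'" and ?Sk = "simple_ito_integral B (n k) (\<tau> k) (\<xi> k)"
        note [measurable] = simple_ito_measurable[OF t s'] simple_ito_measurable[OF t s[of k]]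
        note zD = simple_integrandD[OF z]
        \<comment> \<open>For the difference of the two approximants the path energy is the sum in
          the Lenglart estimate. It is small with high probability because both are close to the
          same integrand.\<close>
        have en: "path_energy t (simple_process N \<rho> \<zeta>) \<omega>
            = ennreal (\<Sum>i<N. (norm (\<zeta> i \<omega>))\<^sup>2 * (\<rho> (Suc i) - \<rho> i))" for \<omega>
        proof -
          have "path_energy t (simple_process N \<rho> \<zeta>) \<omega>
              = (\<Sum>i<N. ennreal ((norm (\<zeta> i \<omega>))\<^sup>2) * ennreal (\<rho> (Suc i) - \<rho> i))"
            unfolding path_energy_def using zD(1,2)
            by (rule nn_integral_simple_process[where h = "\<lambda>x. ennreal ((norm x)\<^sup>2)"]) simp_all
          also have "\<dots> = ennreal (\<Sum>i<N. (norm (\<zeta> i \<omega>))\<^sup>2 * (\<rho> (Suc i) - \<rho> i))"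
            using zD(2) by (subst sum_ennreal[symmetric]) (auto simp: ennreal_mult)
          finally show ?thesis .
        qed
        have "prob {\<omega>\<in>space M. d < (\<Sum>i<N. (norm (\<zeta> i \<omega>))\<^sup>2 * (\<rho> (Suc i) - \<rho> i))}
            = prob {\<omega>\<in>space M. ennreal d < path_energy t (\<lambda>s \<omega>. (simple_process n' \<tau>' \<xi>' s \<omega> - \<Phi> s \<omega>) -
                (simple_process (n k) (\<tau> k) (\<xi> k) s \<omega> - \<Phi> s \<omega>)) \<omega>}"
        proof -
          have "path_energy t (\<lambda>s \<omega>. (simple_process n' \<tau>' \<xi>' s \<omega> - \<Phi> s \<omega>) - (simple_process (n k) (\<tau> k)
              (\<xi> k) s \<omega> - \<Phi> s \<omega>)) \<omega>
              = path_energy t (simple_process N \<rho> \<zeta>) \<omega>" for \<omega>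
            unfolding path_energy_def z1 by simp
          then show ?thesis unfolding en using d by (simp add: ennreal_less_iff)
        qed
        also have "\<dots> \<le> prob {\<omega>\<in>space M. ennreal (d / 4) < path_energy t (\<lambda>s \<omega>. simple_process n' \<tau>' \<xi>' s
            \<omega> - \<Phi> s \<omega>) \<omega>}
            + prob {\<omega>\<in>space M. ennreal (d / 4) < path_energy t (\<lambda>s \<omega>. simple_process (n k) (\<tau> k) (\<xi> k) s
                \<omega> - \<Phi> s \<omega>) \<omega>}"
          by (rule prob_energy_diff_le[OF jointly_measurable_diff[OF
            simple_process_jointly_measurable[OF t s'] j]
            jointly_measurable_diff[OF simple_process_jointly_measurable[OF t s] j] d(1)])
        finally have 5: "prob {\<omega>\<in>space M. d < (\<Sum>i<N. (norm (\<zeta> i \<omega>))\<^sup>2 * (\<rho> (Suc i) - \<rho> i))} \<le> \<epsilon> / 3"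
          using 1 3 by simp
        have "prob {\<omega>\<in>space M. \<epsilon> / 2 < norm (simple_ito_integral B N \<rho> \<zeta> \<omega>)}
            \<le> \<epsilon> / 3 + K2 * d / (\<epsilon> / 2)\<^sup>2"
          using len[OF t z less_imp_le[OF d(1)] e6(2)] 5 by linarith
        also have "K2 * d / (\<epsilon> / 2)\<^sup>2 = (K2 / (K2 + 1)) * (\<epsilon> / 2)"
        proof -
          have "K2 * d / (\<epsilon> / 2)\<^sup>2 = (K2 / (K2 + 1)) * (\<epsilon> ^ 3 / (8 * (\<epsilon> / 2)\<^sup>2))"
            by (simp add: d_def mult.commute)
          also have "\<epsilon> ^ 3 / (8 * (\<epsilon> / 2)\<^sup>2) = \<epsilon> / 2"
            using \<epsilon> by (simp add: power2_eq_square power3_eq_cube)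
          finally show ?thesis .
        qed
        also have "\<dots> \<le> 1 * (\<epsilon> / 2)" using \<epsilon> K2 by (intro mult_right_mono) auto
        finally have 6: "prob {\<omega>\<in>space M. \<epsilon> / 2 < norm (?S \<omega> - ?Sk \<omega>)} \<le> 5 * \<epsilon> / 6"
          unfolding z2 by simp
        \<comment> \<open>The budget is \<epsilon> / 6 for each of the two energies, \<epsilon> / 2
          for the Lenglart term and \<epsilon> / 6 for the convergence of the given approximants to
          \<open>Y\<close>.\<close>
        have "prob {\<omega>\<in>space M. \<epsilon> < norm (?S \<omega> - Y \<omega>)}
            \<le> prob {\<omega>\<in>space M. \<epsilon> / 2 < norm (?S \<omega> - ?Sk \<omega>)} + prob {\<omega>\<in>space M. \<epsilon> / 2 < norm (?Sk \<omega> - Y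
                \<omega>)}"
        proof (rule prob_le_of_cover)
          fix \<omega> assume "\<epsilon> < norm (?S \<omega> - Y \<omega>)"
          then show "\<epsilon> / 2 < norm (?S \<omega> - ?Sk \<omega>) \<or> \<epsilon> / 2 < norm (?Sk \<omega> - Y \<omega>)"
            using norm_triangle_ineq[of "?S \<omega> - ?Sk \<omega>" "?Sk \<omega> - Y \<omega>"] by auto
        qed measurable
        then have P: "prob {\<omega>\<in>space M. \<epsilon> < norm (?S \<omega> - Y \<omega>)} \<le> \<epsilon>" using 4 6 by simp
        let ?s = "\<Sum>i<n'. expectation (\<lambda>\<omega>. norm (\<xi>' i \<omega>) powr p) powr (2 / p) * (\<tau>' (Suc i) - \<tau>' i)"
        have s0: "0 \<le> ?s" using simple_integrandD(2)[OF s']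
            by (intro sum_nonneg mult_nonneg_nonneg) auto
        have "(\<integral>\<^sup>+\<omega>. ennreal (norm (?S \<omega>) powr p) \<partial>M) = ennreal (expectation (\<lambda>\<omega>. norm (?S \<omega>) powr p))"
          using mom[OF t s'] by (intro nn_integral_eq_integral) auto
        also have "\<dots> \<le> ennreal ((K1 * ?s) powr (p / 2))"
          using mom[OF t s'] by (intro ennreal_leI) blast
        also have "\<dots> \<le> ennreal ?Q"
          using 2 s0 K1 \<epsilon> A p by (intro ennreal_leI powr_mono2 mult_left_mono) auto
        finally have "(\<integral>\<^sup>+\<omega>. ennreal (norm (?S \<omega>) powr p) \<partial>M) \<le> ennreal ?Q" .
        with P show "\<exists>S\<in>borel_measurable M. (\<integral>\<^sup>+\<omega>. ennreal (norm (S \<omega>) powr p) \<partial>M) \<le> ennreal ?Q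
            \<and> prob {\<omega>\<in>space M. \<epsilon> < norm (S \<omega> - Y \<omega>)} \<le> \<epsilon>"
          using simple_ito_measurable[OF t s'] by blast
      qed (use p \<delta> in auto)
      also have "2 powr p * ?Q = K * (A + \<delta>) powr (p / 2)"
      proof -
        have "K1 * (4 * (A + \<delta>)) = (4 * K1) * (A + \<delta>)" by simp
        then have "?Q = (4 * K1) powr (p / 2) * (A + \<delta>) powr (p / 2)"
          using K1 A \<delta> by (simp only:) (intro powr_mult; simp)
        then show ?thesis by (simp only: K_def mult.assoc)
      qed
      finally show ?thesis .
    qed
    \<comment> \<open>The slack \<delta> in the moment of the approximants is removed by continuity
      of the power at \<open>A\<close>, including A = 0.\<close>
    have "(\<lambda>k. K * (A + 1 / real (Suc k)) powr (p / 2)) \<longlonglongrightarrow> K * (A + 0) powr (p / 2)"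
      using A p by (intro tendsto_mult tendsto_const tendsto_powr2 tendsto_add lim_1_over_n[THEN
        LIMSEQ_Suc]) auto
    then have "(\<lambda>k. ennreal (K * (A + 1 / real (Suc k)) powr (p / 2))) \<longlonglongrightarrow> ennreal (K * A powr (p / 2))"
      by (intro tendsto_ennrealI) simp
    then show "(\<integral>\<^sup>+\<omega>. ennreal (norm (Y \<omega>) powr p) \<partial>M) \<le> ennreal (K * A powr (p / 2))"
      by (rule LIMSEQ_le_const) (use bound in auto)
  qed
qed

end

subsection \<open>One step of a Volterra equation\<close>

lemma powr_add3_le:
  fixes x y z r :: real
  assumes "0 \<le> x" "0 \<le> y" "0 \<le> z" "0 \<le> r"
  shows "(x + y + z) powr r \<le> 4 powr r * (x powr r + y powr r + z powr r)"
proof -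
  have 1: "1 \<le> (2::real) powr r" using assms by (simp add: ge_one_powr_ge_zero)
  have "(x + y + z) powr r \<le> 2 powr r * ((x + y) powr r + z powr r)"
    using assms by (intro powr_add_le) auto
  also have "\<dots> \<le> 2 powr r * (2 powr r * (x powr r + y powr r) + 2 powr r * z powr r)"
    using assms 1 mult_right_mono[OF 1, of "z powr r"]
    by (intro mult_left_mono add_mono powr_add_le) auto
  also have "\<dots> = (2 * 2) powr r * (x powr r + y powr r + z powr r)"
    by (subst powr_mult) (auto simp: algebra_simps)
  finally show ?thesis by simp
qed

lemma powr_le_one_plus:
  fixes x a b :: real
  assumes "0 \<le> x" "0 \<le> a" "a \<le> b"
  shows "x powr a \<le> 1 + x powr b"
proof (cases "x \<le> 1")
  case True
  then have "x powr a \<le> 1" using assms by (intro powr_le1) auto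
  then show ?thesis by (simp add: add_increasing2)
next
  case False
  then have "x powr a \<le> x powr b" using assms by (intro powr_mono) auto
  then show ?thesis by simp
qed

lemma jointly_measurable_powr_nn_integral:
  fixes g :: "real \<Rightarrow> 'w \<Rightarrow> real"
  assumes j: "jointly_measurable N t g"
  shows "(\<lambda>\<omega>. \<integral>\<^sup>+s\<in>{0..t}. ennreal (g s \<omega> powr p) \<partial>lborel) \<in> borel_measurable N"
    and "sigma_finite_measure N \<Longrightarrow> (\<lambda>s. (\<integral>\<^sup>+\<omega>. ennreal (g s \<omega> powr p) \<partial>N) * indicator {0..t} s) \<in>
        borel_measurable lborel"
    and "sigma_finite_measure N \<Longrightarrow> (\<integral>\<^sup>+\<omega>. (\<integral>\<^sup>+s\<in>{0..t}. ennreal (g s \<omega> powr p) \<partial>lborel) \<partial>N)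
      = (\<integral>\<^sup>+s\<in>{0..t}. (\<integral>\<^sup>+\<omega>. ennreal (g s \<omega> powr p) \<partial>N) \<partial>lborel)"
proof -
  note [measurable] = j[unfolded jointly_measurable_def]
  let ?f = "\<lambda>\<omega> s. ennreal (g s \<omega> powr p) * indicator {0..t} s"
  have eq: "(\<lambda>(\<omega>, s). ?f \<omega> s) = (\<lambda>x. ennreal ((case x of (\<omega>, s) \<Rightarrow> indicator {0..t} s *\<^sub>R g s \<omega>) powr p)
      * indicator {0..t} (snd x))"
    by (auto simp: fun_eq_iff indicator_def)
  have m: "(\<lambda>(\<omega>, s). ?f \<omega> s) \<in> borel_measurable (N \<Otimes>\<^sub>M lborel)"
    unfolding eq by measurable
  show "(\<lambda>\<omega>. \<integral>\<^sup>+s\<in>{0..t}. ennreal (g s \<omega> powr p) \<partial>lborel) \<in> borel_measurable N"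
    by (rule lborel.borel_measurable_nn_integral[OF m])
  assume "sigma_finite_measure N"
  then interpret N: sigma_finite_measure N .
  interpret P: pair_sigma_finite N "lborel :: real measure" ..
  have ind: "(\<integral>\<^sup>+\<omega>. ennreal (g s \<omega> powr p) \<partial>N) * indicator {0..t} s = (\<integral>\<^sup>+\<omega>. ?f \<omega> s \<partial>N)" for s
    by (auto simp: indicator_def)
  show "(\<lambda>s. (\<integral>\<^sup>+\<omega>. ennreal (g s \<omega> powr p) \<partial>N) * indicator {0..t} s) \<in> borel_measurable lborel"
    unfolding ind using measurable_pair_swap[OF m] by (intro N.borel_measurable_nn_integral) simp
  show "(\<integral>\<^sup>+\<omega>. (\<integral>\<^sup>+s\<in>{0..t}. ennreal (g s \<omega> powr p) \<partial>lborel) \<partial>N)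
      = (\<integral>\<^sup>+s\<in>{0..t}. (\<integral>\<^sup>+\<omega>. ennreal (g s \<omega> powr p) \<partial>N) \<partial>lborel)"
    unfolding ind by (rule P.Fubini'[OF m, symmetric])
qed

context prob_space
begin

text \<open>Pathwise Hoelder in time with exponents \<open>p / (p - 1)\<close> and \<open>p\<close>.
  Taking the p-th power and the expectation leaves a bound linear in \<open>A\<close>. An explicit
  random majorant is produced so that the drift can be added to the other terms of the
  equation.\<close>

lemma drift_dominating:
  fixes k :: "real \<Rightarrow> real" and g :: "real \<Rightarrow> 'a \<Rightarrow> real"
  assumes p: "1 < p" and k: "k \<in> borel_measurable borel" "\<And>s. 0 \<le> k s"
    and g: "jointly_measurable M t g" "\<And>s \<omega>. 0 \<le> g s \<omega>"
    and \<kappa>: "(\<integral>\<^sup>+s\<in>{0..t}. ennreal (k s powr (p / (p - 1))) \<partial>lborel) \<le> ennreal \<kappa>" "0 \<le> \<kappa>"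
    and A: "(\<integral>\<^sup>+s\<in>{0..t}. (\<integral>\<^sup>+\<omega>. ennreal (g s \<omega> powr p) \<partial>M) \<partial>lborel) \<le> ennreal A" "0 \<le> A"
  obtains w where "w \<in> borel_measurable M" "\<And>\<omega>. 0 \<le> w \<omega>"
    "AE \<omega> in M. (\<integral>\<^sup>+s\<in>{0..t}. ennreal (k s * g s \<omega>) \<partial>lborel) \<le> ennreal (w \<omega>)"
    "(\<integral>\<^sup>+\<omega>. ennreal (w \<omega> powr p) \<partial>M) \<le> ennreal (\<kappa> powr (p - 1) * A)"
proof -
  define a where "a \<omega> = (\<integral>\<^sup>+s\<in>{0..t}. ennreal (g s \<omega> powr p) \<partial>lborel)" for \<omega>
  note jm = jointly_measurable_powr_nn_integral[OF g(1), of p]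
  have ma [measurable]: "a \<in> borel_measurable M" unfolding a_def[abs_def] by (rule jm(1))
  have ia: "(\<integral>\<^sup>+\<omega>. a \<omega> \<partial>M) \<le> ennreal A"
    unfolding a_def jm(3)[OF sigma_finite_measure_axioms] by (rule A(1))
  then have "(\<integral>\<^sup>+\<omega>. a \<omega> \<partial>M) \<noteq> \<infinity>" by (auto simp: top_unique)
  then have fin: "AE \<omega> in M. a \<omega> \<noteq> \<infinity>" by (intro nn_integral_PInf_AE) auto
  \<comment> \<open>The conversion \<open>enn2real\<close> sends an infinite path integral to 0,
    which would spoil the domination, but such paths form a null set because the expectation of
    \<open>a\<close> is finite.\<close>
  define w where "w \<omega> = \<kappa> powr ((p - 1) / p) * enn2real (a \<omega>) powr (1 / p)" for \<omega>
  show thesis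
  proof (rule that[of w])
    show "w \<in> borel_measurable M" unfolding w_def[abs_def] by measurable
    show "0 \<le> w \<omega>" for \<omega> by (simp add: w_def)
    show "AE \<omega> in M. (\<integral>\<^sup>+s\<in>{0..t}. ennreal (k s * g s \<omega>) \<partial>lborel) \<le> ennreal (w \<omega>)"
      using fin AE_space
    proof eventually_elim
      case (elim \<omega>)
      note [measurable] = jointly_measurable_section[OF g(1) elim(2)] k(1)
      have "(\<integral>\<^sup>+s\<in>{0..t}. ennreal (k s * g s \<omega>) \<partial>lborel)
          = (\<integral>\<^sup>+s. ennreal ((indicator {0..t} s * k s) * (indicator {0..t} s *\<^sub>R g s \<omega>)) \<partial>lborel)"
        by (intro nn_integral_cong) (auto simp: indicator_def)
      also have "\<dots> \<le> ennreal (\<kappa> powr (1 / (p / (p - 1))) * enn2real (a \<omega>) powr (1 / p))"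
      proof (rule nn_integral_holder)
        show "(\<integral>\<^sup>+s. ennreal ((indicator {0..t} s * k s) powr (p / (p - 1))) \<partial>lborel) \<le> ennreal \<kappa>"
        proof -
          have "(\<integral>\<^sup>+s. ennreal ((indicator {0..t} s * k s) powr (p / (p - 1))) \<partial>lborel)
              = (\<integral>\<^sup>+s\<in>{0..t}. ennreal (k s powr (p / (p - 1))) \<partial>lborel)"
            by (intro nn_integral_cong) (auto simp: indicator_def)
          then show ?thesis using \<kappa>(1) by simp
        qed
        show "(\<integral>\<^sup>+s. ennreal ((indicator {0..t} s *\<^sub>R g s \<omega>) powr p) \<partial>lborel)
            \<le> ennreal (enn2real (a \<omega>))"
        proof -
          have "(\<integral>\<^sup>+s. ennreal ((indicator {0..t} s *\<^sub>R g s \<omega>) powr p) \<partial>lborel) = a \<omega>"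
            unfolding a_def by (intro nn_integral_cong) (auto simp: indicator_def)
          then show ?thesis using elim(1) by (simp add: less_top[symmetric])
        qed
        show "1 / (p / (p - 1)) + 1 / p = 1" using p by (simp add: field_simps)
      qed (use p k g \<kappa> jointly_measurable_section[OF g(1) elim(2)] in auto)
      finally show ?case by (simp add: w_def)
    qed
    have wp: "ennreal (w \<omega> powr p) \<le> ennreal (\<kappa> powr (p - 1)) * a \<omega>" for \<omega>
    proof -
      have "w \<omega> powr p = \<kappa> powr (p - 1) * enn2real (a \<omega>)"
        unfolding w_def using p by (subst powr_mult) (auto simp: powr_powr)
      then have "ennreal (w \<omega> powr p) = ennreal (\<kappa> powr (p - 1)) * ennreal (enn2real (a \<omega>))"
        by (simp add: ennreal_mult)
      also have "\<dots> \<le> ennreal (\<kappa> powr (p - 1)) * a \<omega>"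
        by (intro mult_left_mono) (cases "a \<omega>"; auto)+
      finally show ?thesis .
    qed
    have "(\<integral>\<^sup>+\<omega>. ennreal (w \<omega> powr p) \<partial>M) \<le> (\<integral>\<^sup>+\<omega>. ennreal (\<kappa> powr (p - 1)) * a \<omega> \<partial>M)"
      by (intro nn_integral_mono wp)
    also have "\<dots> = ennreal (\<kappa> powr (p - 1)) * (\<integral>\<^sup>+\<omega>. a \<omega> \<partial>M)"
      by (rule nn_integral_cmult) measurable
    also have "\<dots> \<le> ennreal (\<kappa> powr (p - 1)) * ennreal A"
      by (intro mult_left_mono ia) simp
    also have "\<dots> = ennreal (\<kappa> powr (p - 1) * A)" using A by (simp add: ennreal_mult)
    finally show "(\<integral>\<^sup>+\<omega>. ennreal (w \<omega> powr p) \<partial>M) \<le> ennreal (\<kappa> powr (p - 1) * A)" .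
  qed
qed

text \<open>The kernel times the L^p-norm of the process is the natural majorant for a stochastic
  integrand. Its squared L^2-norm is estimated by Hoelder with exponents \<open>p / (p - 2)\<close>
  and \<open>p / 2\<close>, which turns k^2 into the power \<open>2 * (p / (p - 2))\<close>.\<close>

lemma weighted_moment_holder:
  fixes k :: "real \<Rightarrow> real" and g :: "real \<Rightarrow> 'a \<Rightarrow> real"
  assumes p: "2 < p" and k: "k \<in> borel_measurable borel" "\<And>s. 0 \<le> k s"
    and g: "jointly_measurable M t g"
    and \<kappa>: "(\<integral>\<^sup>+s\<in>{0..t}. ennreal (k s powr (2 * (p / (p - 2)))) \<partial>lborel) \<le> ennreal \<kappa>" "0 \<le> \<kappa>"
    and A: "(\<integral>\<^sup>+s\<in>{0..t}. (\<integral>\<^sup>+\<omega>. ennreal (g s \<omega> powr p) \<partial>M) \<partial>lborel) \<le> ennreal A" "0 \<le> A"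
  shows "(\<lambda>s. indicator {0..t} s * (k s * enn2real (\<integral>\<^sup>+\<omega>. ennreal (g s \<omega> powr p) \<partial>M) powr (1 / p))) \<in>
      borel_measurable borel"
    and "(\<integral>\<^sup>+s\<in>{0..t}. ennreal ((k s * enn2real (\<integral>\<^sup>+\<omega>. ennreal (g s \<omega> powr p) \<partial>M) powr (1 / p))\<^sup>2)
        \<partial>lborel)
      \<le> ennreal (\<kappa> powr ((p - 2) / p) * A powr (2 / p))"
    and "AE s in lborel. s \<in> {0..t} \<longrightarrow> (\<integral>\<^sup>+\<omega>. ennreal (g s \<omega> powr p) \<partial>M) < \<infinity>"
proof -
  let ?G = "\<lambda>s. \<integral>\<^sup>+\<omega>. ennreal (g s \<omega> powr p) \<partial>M"
  have mG: "(\<lambda>s. ?G s * indicator {0..t} s) \<in> borel_measurable lborel"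
    by (rule jointly_measurable_powr_nn_integral(2)[OF g sigma_finite_measure_axioms])
  have mG' [measurable]: "(\<lambda>s. enn2real (?G s * indicator {0..t} s)) \<in> borel_measurable borel"
    using mG by simp
  note [measurable] = k(1)
  have eq: "indicator {0..t} s * (k s * enn2real (?G s) powr (1 / p))
      = k s * enn2real (?G s * indicator {0..t} s) powr (1 / p)" for s
    by (auto simp: indicator_def)
  show "(\<lambda>s. indicator {0..t} s * (k s * enn2real (?G s) powr (1 / p))) \<in> borel_measurable borel"
    unfolding eq by measurable
  have "(\<integral>\<^sup>+s. ?G s * indicator {0..t} s \<partial>lborel) \<noteq> \<infinity>" using A(1) by (auto simp: top_unique)
  then have "AE s in lborel. ?G s * indicator {0..t} s \<noteq> \<infinity>" by (rule nn_integral_PInf_AE[OF mG])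
  then show "AE s in lborel. s \<in> {0..t} \<longrightarrow> ?G s < \<infinity>"
    by eventually_elim (auto simp: less_top)
  have "(\<integral>\<^sup>+s\<in>{0..t}. ennreal ((k s * enn2real (?G s) powr (1 / p))\<^sup>2) \<partial>lborel)
      = (\<integral>\<^sup>+s. ennreal ((indicator {0..t} s * (k s)\<^sup>2) * enn2real (?G s * indicator {0..t} s) powr (2 /
          p)) \<partial>lborel)"
  proof (intro nn_integral_cong)
    fix s
    have "(enn2real (?G s) powr (1 / p))\<^sup>2 = enn2real (?G s) powr (2 / p)"
      by (simp add: power2_eq_square flip: powr_add)
    then show "ennreal ((k s * enn2real (?G s) powr (1 / p))\<^sup>2) * indicator {0..t} s
        = ennreal ((indicator {0..t} s * (k s)\<^sup>2) * enn2real (?G s * indicator {0..t} s) powr (2 / p))"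
      by (auto simp: indicator_def power_mult_distrib)
  qed
  also have "\<dots> \<le> ennreal (\<kappa> powr (1 / (p / (p - 2))) * A powr (1 / (p / 2)))"
  proof (rule nn_integral_holder)
    show "(\<integral>\<^sup>+s. ennreal ((indicator {0..t} s * (k s)\<^sup>2) powr (p / (p - 2))) \<partial>lborel) \<le> ennreal \<kappa>"
    proof -
      have "((k s)\<^sup>2) powr (p / (p - 2)) = k s powr (2 * (p / (p - 2)))" for s
        using k(2)[of s] by (subst powr_powr[symmetric]) simp
      then have "(\<integral>\<^sup>+s. ennreal ((indicator {0..t} s * (k s)\<^sup>2) powr (p / (p - 2))) \<partial>lborel)
          = (\<integral>\<^sup>+s\<in>{0..t}. ennreal (k s powr (2 * (p / (p - 2)))) \<partial>lborel)"
        by (intro nn_integral_cong) (auto simp: indicator_def)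
      then show ?thesis using \<kappa>(1) by simp
    qed
    show "(\<integral>\<^sup>+s. ennreal ((enn2real (?G s * indicator {0..t} s) powr (2 / p)) powr (p / 2)) \<partial>lborel)
        \<le> ennreal A"
    proof -
      have "(\<integral>\<^sup>+s. ennreal ((enn2real (?G s * indicator {0..t} s) powr (2 / p)) powr (p / 2)) \<partial>lborel)
          \<le> (\<integral>\<^sup>+s. ?G s * indicator {0..t} s \<partial>lborel)"
      proof (intro nn_integral_mono)
        fix s
        have "(enn2real (?G s * indicator {0..t} s) powr (2 / p)) powr (p / 2)
            = enn2real (?G s * indicator {0..t} s)"
          using p by (simp add: powr_powr)
        moreover have "ennreal (enn2real y) \<le> y" for y by (cases y) auto
        ultimately show "ennreal ((enn2real (?G s * indicator {0..t} s) powr (2 / p)) powr (p / 2))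
            \<le> ?G s * indicator {0..t} s"
          by simp
      qed
      then show ?thesis using A(1) by (rule order_trans)
    qed
    show "1 / (p / (p - 2)) + 1 / (p / 2) = 1" using p by (simp add: field_simps)
  qed (use p \<kappa> A in auto)
  finally show "(\<integral>\<^sup>+s\<in>{0..t}. ennreal ((k s * enn2real (?G s) powr (1 / p))\<^sup>2) \<partial>lborel)
      \<le> ennreal (\<kappa> powr ((p - 2) / p) * A powr (2 / p))" by simp
qed


text \<open>Two kernel terms are merged into one majorant: superadditivity combines
  \<open>u powr p + u' powr p\<close> into a single power, and (2 (x + y))^2 \<le> 8 (x^2 + y^2)
  gives the factor 8.\<close>

lemma diffusion_weight:
  fixes k k' :: "real \<Rightarrow> real" and g g' :: "real \<Rightarrow> 'a \<Rightarrow> real"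
      and \<Phi> :: "real \<Rightarrow> 'a \<Rightarrow> 'b::real_normed_vector"
  assumes p: "2 < p" and k: "k \<in> borel_measurable borel" "\<And>s. 0 \<le> k s"
      and k': "k' \<in> borel_measurable borel" "\<And>s. 0 \<le> k' s"
    and g: "jointly_measurable M t g" "\<And>s \<omega>. 0 \<le> g s \<omega>" and g': "jointly_measurable M t g'" "\<And>s \<omega>. 0
        \<le> g' s \<omega>"
    and \<kappa>: "(\<integral>\<^sup>+s\<in>{0..t}. ennreal (k s powr (2 * (p / (p - 2)))) \<partial>lborel) \<le> ennreal \<kappa>" "0 \<le> \<kappa>"
    and \<kappa>': "(\<integral>\<^sup>+s\<in>{0..t}. ennreal (k' s powr (2 * (p / (p - 2)))) \<partial>lborel) \<le> ennreal \<kappa>'" "0 \<le> \<kappa>'"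
    and A: "(\<integral>\<^sup>+s\<in>{0..t}. (\<integral>\<^sup>+\<omega>. ennreal (g s \<omega> powr p) \<partial>M) \<partial>lborel) \<le> ennreal A" "0 \<le> A"
    and A': "(\<integral>\<^sup>+s\<in>{0..t}. (\<integral>\<^sup>+\<omega>. ennreal (g' s \<omega> powr p) \<partial>M) \<partial>lborel) \<le> ennreal A'" "0 \<le> A'"
    and \<Phi>: "AE s in lborel. s \<in> {0..t} \<longrightarrow> (\<forall>\<omega>\<in>space M. norm (\<Phi> s \<omega>) \<le> k s * g s \<omega> + k' s * g' s \<omega>)"
  obtains \<phi> where "\<phi> \<in> borel_measurable borel" "\<And>s. 0 \<le> \<phi> s"
    "AE s in lborel. s \<in> {0..t} \<longrightarrow> (\<integral>\<^sup>+\<omega>. ennreal (norm (\<Phi> s \<omega>) powr p) \<partial>M) \<le> ennreal (\<phi> s powr p)"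
    "(\<integral>\<^sup>+s\<in>{0..t}. ennreal ((\<phi> s)\<^sup>2) \<partial>lborel)
      \<le> ennreal (8 * (\<kappa> powr ((p - 2) / p) * A powr (2 / p) + \<kappa>' powr ((p - 2) / p) * A' powr (2 / p)))"
proof -
  let ?G = "\<lambda>s. \<integral>\<^sup>+\<omega>. ennreal (g s \<omega> powr p) \<partial>M" and ?G' = "\<lambda>s. \<integral>\<^sup>+\<omega>. ennreal (g' s \<omega> powr p) \<partial>M"
  define u u' where "u s = k s * enn2real (?G s) powr (1 / p)" and "u' s
      = k' s * enn2real (?G' s) powr (1 / p)" for s
  note h = weighted_moment_holder[OF p k g(1) \<kappa> A, folded u_def] and h'
      = weighted_moment_holder[OF p k' g'(1) \<kappa>' A', folded u'_def]
  have u0: "0 \<le> u s" "0 \<le> u' s" for s using k k' by (auto simp: u_def u'_def)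
  define \<phi> where "\<phi> s = 2 * (indicator {0..t} s * u s + indicator {0..t} s * u' s)" for s
  show thesis
  proof (rule that[of \<phi>])
    show "\<phi> \<in> borel_measurable borel" unfolding \<phi>_def[abs_def] using h(1) h'(1) by measurable
    show "0 \<le> \<phi> s" for s unfolding \<phi>_def using u0 by simp
    show "AE s in lborel. s \<in> {0..t} \<longrightarrow> (\<integral>\<^sup>+\<omega>. ennreal (norm (\<Phi> s \<omega>) powr p) \<partial>M) \<le> ennreal (\<phi> s powr p)"
      using \<Phi> h(3) h'(3)
    proof eventually_elim
      case (elim s)
      show ?case
      proof
        assume s: "s \<in> {0..t}"
        have G: "?G s = ennreal (enn2real (?G s))" "?G' s = ennreal (enn2real (?G' s))"
          using elim s by (auto simp: less_top)
        have sec: "g s \<in> borel_measurable M" "g' s \<in> borel_measurable M"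
          using measurable_compose[OF measurable_Pair2'[of s lborel M] g(1)[unfolded
            jointly_measurable_def]]
            measurable_compose[OF measurable_Pair2'[of s lborel M] g'(1)[unfolded
                jointly_measurable_def]] s by simp_all
        note [measurable] = sec
        have pt: "norm (\<Phi> s \<omega>) powr p \<le> 2 powr p * (k s powr p * g s \<omega> powr p + k' s powr p * g' s \<omega>
            powr p)"
          if \<omega>: "\<omega> \<in> space M" for \<omega>
        proof -
          have "norm (\<Phi> s \<omega>) powr p \<le> (k s * g s \<omega> + k' s * g' s \<omega>) powr p"
            using elim s \<omega> p by (intro powr_mono2) auto
          also have "\<dots> \<le> 2 powr p * ((k s * g s \<omega>) powr p + (k' s * g' s \<omega>) powr p)"
            using k k' g g' p by (intro powr_add_le) auto
          finally show ?thesis using k k' g g' by (simp add: powr_mult)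
        qed
        have "(\<integral>\<^sup>+\<omega>. ennreal (norm (\<Phi> s \<omega>) powr p) \<partial>M)
            \<le> (\<integral>\<^sup>+\<omega>. ennreal (2 powr p) * (ennreal (k s powr p) * ennreal (g s \<omega> powr p) + ennreal (k' s
                powr p) * ennreal (g' s \<omega> powr p)) \<partial>M)"
          using pt by (intro nn_integral_mono) (simp flip: ennreal_mult ennreal_plus add: ennreal_leI)
        also have "\<dots> = ennreal (2 powr p) * (ennreal (k s powr p) * ?G s + ennreal (k' s powr p) * ?G'
            s)"
          by (simp add: nn_integral_cmult nn_integral_add)
        also have "\<dots> = ennreal (2 powr p * (k s powr p * enn2real (?G s) + k' s powr p * enn2real (?G'
            s)))"
        proof -
          obtain x x' where "?G s = ennreal x" "0 \<le> x" "?G' s = ennreal x'" "0 \<le> x'"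
            using G enn2real_nonneg by blast
          then show ?thesis
            by (simp add: ennreal_mult[symmetric] ennreal_plus[symmetric] del: ennreal_plus)
        qed
        also have "k s powr p * enn2real (?G s) + k' s powr p * enn2real (?G' s)
            = u s powr p + u' s powr p"
          using p k k' by (simp add: u_def u'_def powr_mult powr_powr)
        also have "ennreal (2 powr p * (u s powr p + u' s powr p))
            \<le> ennreal (2 powr p * (u s + u' s) powr p)"
          using u0 p by (intro ennreal_leI mult_left_mono powr_superadd) auto
        also have "2 powr p * (u s + u' s) powr p = (2 * (u s + u' s)) powr p"
          by (rule powr_mult[symmetric])
        also have "2 * (u s + u' s) = \<phi> s"
          using s by (simp add: \<phi>_def)
        finally show "(\<integral>\<^sup>+\<omega>. ennreal (norm (\<Phi> s \<omega>) powr p) \<partial>M) \<le> ennreal (\<phi> s powr p)" .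
      qed
    qed
    have sq: "(2 * (x + y))\<^sup>2 \<le> 8 * (x\<^sup>2 + y\<^sup>2)" for x y :: real
      using zero_le_power2[of "x - y"] by (simp add: power2_eq_square algebra_simps)
    note [measurable] = h(1) h'(1)
    have "(\<integral>\<^sup>+s\<in>{0..t}. ennreal ((\<phi> s)\<^sup>2) \<partial>lborel)
        \<le> (\<integral>\<^sup>+s. 8 * (ennreal ((indicator {0..t} s * u s)\<^sup>2) + ennreal ((indicator {0..t} s * u' s)\<^sup>2))
            \<partial>lborel)"
    proof (intro nn_integral_mono)
      fix s
      let ?a = "indicator {0..t} s * u s" and ?b = "indicator {0..t} s * u' s"
      have "ennreal ((\<phi> s)\<^sup>2) * indicator {0..t} s \<le> ennreal ((\<phi> s)\<^sup>2)"
        by (simp add: indicator_def)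
      also have "\<dots> \<le> ennreal (8 * (?a\<^sup>2 + ?b\<^sup>2))"
        unfolding \<phi>_def by (intro ennreal_leI sq)
      also have "\<dots> = 8 * (ennreal (?a\<^sup>2) + ennreal (?b\<^sup>2))"
        by (simp only: ennreal_mult ennreal_plus ennreal_numeral zero_le_power2 add_nonneg_nonneg
          zero_le_numeral)
      finally show "ennreal ((\<phi> s)\<^sup>2) * indicator {0..t} s \<le> 8 * (ennreal (?a\<^sup>2) + ennreal (?b\<^sup>2))" .
    qed
    also have "\<dots> = 8 * ((\<integral>\<^sup>+s. ennreal ((indicator {0..t} s * u s)\<^sup>2) \<partial>lborel) + (\<integral>\<^sup>+s. ennreal
        ((indicator {0..t} s * u' s)\<^sup>2) \<partial>lborel))"
      by (simp add: nn_integral_cmult nn_integral_add)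
    also have "(\<integral>\<^sup>+s. ennreal ((indicator {0..t} s * u s)\<^sup>2) \<partial>lborel)
        = (\<integral>\<^sup>+s\<in>{0..t}. ennreal ((u s)\<^sup>2) \<partial>lborel)"
      by (intro nn_integral_cong) (auto simp: indicator_def)
    also have "(\<integral>\<^sup>+s. ennreal ((indicator {0..t} s * u' s)\<^sup>2) \<partial>lborel)
        = (\<integral>\<^sup>+s\<in>{0..t}. ennreal ((u' s)\<^sup>2) \<partial>lborel)"
      by (intro nn_integral_cong) (auto simp: indicator_def)
    also have "8 * ((\<integral>\<^sup>+s\<in>{0..t}. ennreal ((u s)\<^sup>2) \<partial>lborel) + (\<integral>\<^sup>+s\<in>{0..t}. ennreal ((u' s)\<^sup>2)
        \<partial>lborel))
        \<le> 8 * (ennreal (\<kappa> powr ((p - 2) / p) * A powr (2 / p)) + ennreal (\<kappa>' powr ((p - 2) / p) * A'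
            powr (2 / p)))"
      by (intro mult_left_mono add_mono h(2) h'(2)) auto
    also have "\<dots> = ennreal (8 * (\<kappa> powr ((p - 2) / p) * A powr (2 / p) + \<kappa>' powr ((p - 2) / p) * A' powr
        (2 / p)))"
      by (simp flip: ennreal_numeral ennreal_mult ennreal_plus)
    finally show "(\<integral>\<^sup>+s\<in>{0..t}. ennreal ((\<phi> s)\<^sup>2) \<partial>lborel)
      \<le> ennreal (8 * (\<kappa> powr ((p - 2) / p) * A powr (2 / p) + \<kappa>' powr ((p - 2) / p) * A' powr (2 / p)))"
          .
  qed
qed

end

context brownian_motion
begin

text \<open>One estimate for two uses: the moment bound of a solution, where the second pair of
  kernel and process is 0, and the difference of two solutions, where it carries the kernel
  difference. The powers of \<kappa> and \<nu> are the p-th powers of the kernel norms in L^q and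
  L^(2q').\<close>

lemma volterra_step_moment:
  fixes p :: real
  assumes p: "2 < p"
  obtains C where "0 \<le> C"
    and "\<And>t (\<Phi> :: real \<Rightarrow> 'w \<Rightarrow> real ^ 'm ^ 'd) Y Z Z0 D k k' l l' g g' \<kappa> \<kappa>' \<nu> \<nu>' A A'.
      t \<in> {0..T} \<Longrightarrow> has_ito_integral M F B t \<Phi> Y \<Longrightarrow> Z0 \<in> borel_measurable M \<Longrightarrow>
      AE \<omega> in M. Z \<omega> = Z0 \<omega> + D \<omega> + Y \<omega> \<Longrightarrow>
      AE \<omega> in M. ennreal (norm (D \<omega> :: real ^ 'd))
          \<le> (\<integral>\<^sup>+s\<in>{0..t}. ennreal (k s * g s \<omega> + k' s * g' s \<omega>) \<partial>lborel) \<Longrightarrow>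
      AE s in lborel. s \<in> {0..t} \<longrightarrow> (\<forall>\<omega>\<in>space M. norm (\<Phi> s \<omega>) \<le> l s * g s \<omega> + l' s * g' s \<omega>) \<Longrightarrow>
      \<forall>f\<in>{k, k', l, l'}. f \<in> borel_measurable borel \<and> (\<forall>s. 0 \<le> f s) \<Longrightarrow>
      \<forall>f\<in>{g, g'}. jointly_measurable M t f \<and> (\<forall>s \<omega>. 0 \<le> f s \<omega>) \<Longrightarrow>
      (\<integral>\<^sup>+s\<in>{0..t}. ennreal (k s powr (p / (p - 1))) \<partial>lborel) \<le> ennreal \<kappa> \<Longrightarrow>
      (\<integral>\<^sup>+s\<in>{0..t}. ennreal (k' s powr (p / (p - 1))) \<partial>lborel) \<le> ennreal \<kappa>' \<Longrightarrow>
      (\<integral>\<^sup>+s\<in>{0..t}. ennreal (l s powr (2 * (p / (p - 2)))) \<partial>lborel) \<le> ennreal \<nu> \<Longrightarrow>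
      (\<integral>\<^sup>+s\<in>{0..t}. ennreal (l' s powr (2 * (p / (p - 2)))) \<partial>lborel) \<le> ennreal \<nu>' \<Longrightarrow>
      (\<integral>\<^sup>+s\<in>{0..t}. (\<integral>\<^sup>+\<omega>. ennreal (g s \<omega> powr p) \<partial>M) \<partial>lborel) \<le> ennreal A \<Longrightarrow>
      (\<integral>\<^sup>+s\<in>{0..t}. (\<integral>\<^sup>+\<omega>. ennreal (g' s \<omega> powr p) \<partial>M) \<partial>lborel) \<le> ennreal A' \<Longrightarrow>
      \<forall>x\<in>{\<kappa>, \<kappa>', \<nu>, \<nu>', A, A'}. 0 \<le> x \<Longrightarrow>
      (\<integral>\<^sup>+\<omega>. ennreal (norm (Z \<omega>) powr p) \<partial>M)
        \<le> ennreal C * ((\<integral>\<^sup>+\<omega>. ennreal (norm (Z0 \<omega>) powr p) \<partial>M)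
            + ennreal ((\<kappa> powr (p - 1) + \<nu> powr ((p - 2) / 2)) * A + (\<kappa>' powr (p - 1) + \<nu>' powr ((p - 2)
                / 2)) * A'))"
proof -
  have p1: "1 < p" "2 \<le> p" using p by auto
  obtain K where K: "0 \<le> K" and ito: "\<And>t (\<Phi> :: real \<Rightarrow> 'w \<Rightarrow> real ^ 'm ^ 'd) Y \<phi> A. t \<in> {0..T} \<Longrightarrow>
      has_ito_integral M F B t \<Phi> Y \<Longrightarrow>
      \<phi> \<in> borel_measurable borel \<Longrightarrow> \<forall>s. 0 \<le> \<phi> s \<Longrightarrow>
      AE s in lborel. s \<in> {0..t} \<longrightarrow> (\<integral>\<^sup>+\<omega>. ennreal (norm (\<Phi> s \<omega>) powr p) \<partial>M) \<le> ennreal (\<phi> s powr p) \<Longrightarrow>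
      (\<integral>\<^sup>+s\<in>{0..t}. ennreal ((\<phi> s)\<^sup>2) \<partial>lborel) \<le> ennreal A \<Longrightarrow> 0 \<le> A \<Longrightarrow>
      (\<integral>\<^sup>+\<omega>. ennreal (norm (Y \<omega>) powr p) \<partial>M) \<le> ennreal (K * A powr (p / 2))"
    by (rule ito_integral_moment[OF p1(2)]) (rule that)
  \<comment> \<open>The factor 8 comes from merging two diffusion terms, the factor 2 from
    separating their contributions again, both under the power \<open>p / 2\<close>.\<close>
  define K' where "K' = K * (8 powr (p / 2) * 2 powr (p / 2))"
  have K': "0 \<le> K'" using K by (simp add: K'_def)
  define C where "C = 4 powr p * (1 + 2 powr p + K')"
  have C: "0 \<le> C" using K' by (simp add: C_def)
  show thesis
  proof (rule that[OF C])
    fix t Y Z Z0 D k k' l l' g g' \<kappa> \<kappa>' \<nu> \<nu>' A A' and \<Phi> :: "real \<Rightarrow> 'w \<Rightarrow> real ^ 'm ^ 'd"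
    assume t: "t \<in> {0..T}" and I: "has_ito_integral M F B t \<Phi> Y"
        and Z0 [measurable]: "Z0 \<in> borel_measurable M"
      and Z: "AE \<omega> in M. Z \<omega> = Z0 \<omega> + D \<omega> + Y \<omega>"
      and D: "AE \<omega> in M. ennreal (norm (D \<omega> :: real ^ 'd))
          \<le> (\<integral>\<^sup>+s\<in>{0..t}. ennreal (k s * g s \<omega> + k' s * g' s \<omega>) \<partial>lborel)"
      and \<Phi>: "AE s in lborel. s \<in> {0..t} \<longrightarrow> (\<forall>\<omega>\<in>space M. norm (\<Phi> s \<omega>) \<le> l s * g s \<omega> + l' s * g' s \<omega>)"
      and ker: "\<forall>f\<in>{k, k', l, l'}. f \<in> borel_measurable borel \<and> (\<forall>s. 0 \<le> f s)"
      and gs: "\<forall>f\<in>{g, g'}. jointly_measurable M t f \<and> (\<forall>s \<omega>. 0 \<le> f s \<omega>)"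
      and b1: "(\<integral>\<^sup>+s\<in>{0..t}. ennreal (k s powr (p / (p - 1))) \<partial>lborel) \<le> ennreal \<kappa>"
      and b2: "(\<integral>\<^sup>+s\<in>{0..t}. ennreal (k' s powr (p / (p - 1))) \<partial>lborel) \<le> ennreal \<kappa>'"
      and b3: "(\<integral>\<^sup>+s\<in>{0..t}. ennreal (l s powr (2 * (p / (p - 2)))) \<partial>lborel) \<le> ennreal \<nu>"
      and b4: "(\<integral>\<^sup>+s\<in>{0..t}. ennreal (l' s powr (2 * (p / (p - 2)))) \<partial>lborel) \<le> ennreal \<nu>'"
      and a1: "(\<integral>\<^sup>+s\<in>{0..t}. (\<integral>\<^sup>+\<omega>. ennreal (g s \<omega> powr p) \<partial>M) \<partial>lborel) \<le> ennreal A"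
      and a2: "(\<integral>\<^sup>+s\<in>{0..t}. (\<integral>\<^sup>+\<omega>. ennreal (g' s \<omega> powr p) \<partial>M) \<partial>lborel) \<le> ennreal A'"
      and nn: "\<forall>x\<in>{\<kappa>, \<kappa>', \<nu>, \<nu>', A, A'}. 0 \<le> x"
    have n: "0 \<le> \<kappa>" "0 \<le> \<kappa>'" "0 \<le> \<nu>" "0 \<le> \<nu>'" "0 \<le> A" "0 \<le> A'" using nn by auto
    have mk: "k \<in> borel_measurable borel" "k' \<in> borel_measurable borel" "l \<in> borel_measurable borel" "l'
        \<in> borel_measurable borel"
      and k0: "\<And>s. 0 \<le> k s" "\<And>s. 0 \<le> k' s" "\<And>s. 0 \<le> l s" "\<And>s. 0 \<le> l' s" using ker by blast+
    have jg: "jointly_measurable M t g" "jointly_measurable M t g'" and g0: "\<And>s \<omega>. 0 \<le> g s \<omega>" "\<And>s \<omega>. 0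
        \<le> g' s \<omega>"
      using gs by blast+
    have Y [measurable]: "Y \<in> borel_measurable M" using I by (simp add: has_ito_integral_def)
    obtain w where w [measurable]: "w \<in> borel_measurable M" and w0: "\<And>\<omega>. 0 \<le> w \<omega>"
      and w1: "AE \<omega> in M. (\<integral>\<^sup>+s\<in>{0..t}. ennreal (k s * g s \<omega>) \<partial>lborel) \<le> ennreal (w \<omega>)"
      and w2: "(\<integral>\<^sup>+\<omega>. ennreal (w \<omega> powr p) \<partial>M) \<le> ennreal (\<kappa> powr (p - 1) * A)"
      by (rule drift_dominating[OF p1(1) mk(1) k0(1) jg(1) g0(1) b1 n(1) a1 n(5)]) (rule that)
    obtain w' where w' [measurable]: "w' \<in> borel_measurable M" and w0': "\<And>\<omega>. 0 \<le> w' \<omega>"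
      and w1': "AE \<omega> in M. (\<integral>\<^sup>+s\<in>{0..t}. ennreal (k' s * g' s \<omega>) \<partial>lborel) \<le> ennreal (w' \<omega>)"
      and w2': "(\<integral>\<^sup>+\<omega>. ennreal (w' \<omega> powr p) \<partial>M) \<le> ennreal (\<kappa>' powr (p - 1) * A')"
      by (rule drift_dominating[OF p1(1) mk(2) k0(2) jg(2) g0(2) b2 n(2) a2 n(6)]) (rule that)
    define X where "X = \<nu> powr ((p - 2) / p) * A powr (2 / p)"
    define X' where "X' = \<nu>' powr ((p - 2) / p) * A' powr (2 / p)"
    have X0: "0 \<le> X" "0 \<le> X'" by (simp_all add: X_def X'_def)
    obtain \<phi> where \<phi>: "\<phi> \<in> borel_measurable borel" "\<And>s. 0 \<le> \<phi> s"
      "AE s in lborel. s \<in> {0..t} \<longrightarrow> (\<integral>\<^sup>+\<omega>. ennreal (norm (\<Phi> s \<omega>) powr p) \<partial>M) \<le> ennreal (\<phi> s powr p)"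
      "(\<integral>\<^sup>+s\<in>{0..t}. ennreal ((\<phi> s)\<^sup>2) \<partial>lborel)
        \<le> ennreal (8 * (\<nu> powr ((p - 2) / p) * A powr (2 / p) + \<nu>' powr ((p - 2) / p) * A' powr (2 /
            p)))"
      by (rule diffusion_weight[OF p mk(3) k0(3) mk(4) k0(4) jg(1) g0(1) jg(2) g0(2) b3 n(3) b4 n(4) a1
        n(5) a2 n(6) \<Phi>]) (rule that)
    have "(\<integral>\<^sup>+\<omega>. ennreal (norm (Y \<omega>) powr p) \<partial>M) \<le> ennreal (K * (8 * (X + X')) powr (p / 2))"
      unfolding X_def X'_def by (rule ito[OF t I \<phi>(1) _ \<phi>(3,4)]) (use \<phi>(2) in simp_all)
    also have "K * (8 * (X + X')) powr (p / 2) \<le> K * (8 powr (p / 2) * (2 powr (p / 2) * (X powr (p / 2)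
        + X' powr (p / 2))))"
    proof -
      have "(8 * (X + X')) powr (p / 2) = 8 powr (p / 2) * (X + X') powr (p / 2)"
        by (rule powr_mult)
      also have "\<dots> \<le> 8 powr (p / 2) * (2 powr (p / 2) * (X powr (p / 2) + X' powr (p / 2)))"
        using X0 p by (intro mult_left_mono powr_add_le) auto
      finally show ?thesis using K by (rule mult_left_mono)
    qed
    also have "\<dots> = K' * (X powr (p / 2) + X' powr (p / 2))" by (simp add: K'_def)
    \<comment> \<open>The power \<open>p / 2\<close> cancels the exponent \<open>2 / p\<close> of
      \<open>A\<close>, so the stochastic term is linear in the time integral of moments just like
      the drift.\<close>
    also have "X powr (p / 2) = \<nu> powr ((p - 2) / 2) * A"
      unfolding X_def using p n by (subst powr_mult) (auto simp: powr_powr)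
    also have "X' powr (p / 2) = \<nu>' powr ((p - 2) / 2) * A'"
      unfolding X'_def using p n by (subst powr_mult) (auto simp: powr_powr)
    finally have EY: "(\<integral>\<^sup>+\<omega>. ennreal (norm (Y \<omega>) powr p) \<partial>M)
        \<le> ennreal (K' * (\<nu> powr ((p - 2) / 2) * A + \<nu>' powr ((p - 2) / 2) * A'))"
      by (simp add: ennreal_leI)
    have "AE \<omega> in M. ennreal (norm (Z \<omega>) powr p) \<le> ennreal (4 powr p) * (ennreal (norm (Z0 \<omega>) powr p)
      + (ennreal (2 powr p) * (ennreal (w \<omega> powr p) + ennreal (w' \<omega> powr p)) + ennreal (norm (Y \<omega>) powr
          p)))"
      using Z D w1 w1' AE_space
    proof eventually_elim
      case (elim \<omega>)
      have sec: "(\<lambda>s. ennreal (f s * h s \<omega>) * indicator {0..t} s) \<in> borel_measurable lborel"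
        if "f \<in> borel_measurable borel" "jointly_measurable M t h" for f h
      proof -
        note [measurable] = that(1) jointly_measurable_section[OF that(2) elim(5)]
        have "(\<lambda>s. ennreal (f s * h s \<omega>) * indicator {0..t} s)
            = (\<lambda>s. ennreal (f s * (indicator {0..t} s *\<^sub>R h s \<omega>)))"
          by (auto simp: indicator_def)
        also have "\<dots> \<in> borel_measurable lborel" by measurable
        finally show ?thesis .
      qed
      have "ennreal (norm (D \<omega>)) \<le> (\<integral>\<^sup>+s. ennreal (k s * g s \<omega>) * indicator {0..t} s + ennreal (k' s *
          g' s \<omega>) * indicator {0..t} s \<partial>lborel)"
        using elim(2) k0 g0 by (simp add: distrib_right)
      also have "\<dots> = (\<integral>\<^sup>+s\<in>{0..t}. ennreal (k s * g s \<omega>) \<partial>lborel) + (\<integral>\<^sup>+s\<in>{0..t}. ennreal (k' s * g' s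
          \<omega>) \<partial>lborel)"
        by (rule nn_integral_add[OF sec[OF mk(1) jg(1)] sec[OF mk(2) jg(2)]])
      also have "\<dots> \<le> ennreal (w \<omega>) + ennreal (w' \<omega>)" using elim(3,4) by (rule add_mono)
      also have "\<dots> = ennreal (w \<omega> + w' \<omega>)" using w0 w0' by simp
      finally have nD: "norm (D \<omega>) \<le> w \<omega> + w' \<omega>" using w0 w0'
          by (subst (asm) ennreal_le_iff) (auto intro: add_nonneg_nonneg)
      have "norm (Z \<omega>) \<le> norm (Z0 \<omega>) + (w \<omega> + w' \<omega>) + norm (Y \<omega>)"
        unfolding elim(1) using nD by (intro order_trans[OF norm_triangle_ineq] add_mono) auto
      then have "norm (Z \<omega>) powr p \<le> (norm (Z0 \<omega>) + (w \<omega> + w' \<omega>) + norm (Y \<omega>)) powr p"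
        using p by (intro powr_mono2) auto
      also have "\<dots> \<le> 4 powr p * (norm (Z0 \<omega>) powr p + (w \<omega> + w' \<omega>) powr p + norm (Y \<omega>) powr p)"
        using p w0 w0' by (intro powr_add3_le) auto
      also have "\<dots> \<le> 4 powr p * (norm (Z0 \<omega>) powr p + 2 powr p * (w \<omega> powr p + w' \<omega> powr p) + norm (Y \<omega>)
          powr p)"
        using p w0 w0' by (intro mult_left_mono add_mono powr_add_le) auto
      finally have "ennreal (norm (Z \<omega>) powr p)
          \<le> ennreal (4 powr p * (norm (Z0 \<omega>) powr p + 2 powr p * (w \<omega> powr p + w' \<omega> powr p) + norm (Y \<omega>)
              powr p))"
        by (rule ennreal_leI)
      also have "\<dots> = ennreal (4 powr p) * (ennreal (norm (Z0 \<omega>) powr p)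
          + (ennreal (2 powr p) * (ennreal (w \<omega> powr p) + ennreal (w' \<omega> powr p)) + ennreal (norm (Y \<omega>)
              powr p)))"
        by (simp add: ennreal_mult[symmetric] ennreal_plus[symmetric] add.assoc del: ennreal_plus)
      finally show ?case .
    qed
    then have "(\<integral>\<^sup>+\<omega>. ennreal (norm (Z \<omega>) powr p) \<partial>M)
        \<le> (\<integral>\<^sup>+\<omega>. ennreal (4 powr p) * (ennreal (norm (Z0 \<omega>) powr p)
      + (ennreal (2 powr p) * (ennreal (w \<omega> powr p) + ennreal (w' \<omega> powr p)) + ennreal (norm (Y \<omega>) powr
          p))) \<partial>M)"
      by (rule nn_integral_mono_AE)
    also have "\<dots> = ennreal (4 powr p) * ((\<integral>\<^sup>+\<omega>. ennreal (norm (Z0 \<omega>) powr p) \<partial>M)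
      + (ennreal (2 powr p) * ((\<integral>\<^sup>+\<omega>. ennreal (w \<omega> powr p) \<partial>M) + (\<integral>\<^sup>+\<omega>. ennreal (w' \<omega> powr p) \<partial>M)) +
          (\<integral>\<^sup>+\<omega>. ennreal (norm (Y \<omega>) powr p) \<partial>M)))"
      by (simp add: nn_integral_cmult nn_integral_add)
    also have "\<dots> \<le> ennreal (4 powr p) * ((\<integral>\<^sup>+\<omega>. ennreal (norm (Z0 \<omega>) powr p) \<partial>M)
      + (ennreal (2 powr p) * (ennreal (\<kappa> powr (p - 1) * A) + ennreal (\<kappa>' powr (p - 1) * A')) + ennreal
          (K' * (\<nu> powr ((p - 2) / 2) * A + \<nu>' powr ((p - 2) / 2) * A'))))"
      by (intro mult_left_mono add_mono w2 w2' EY order_refl) auto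
    also have "\<dots> \<le> ennreal (4 powr p) * ((\<integral>\<^sup>+\<omega>. ennreal (norm (Z0 \<omega>) powr p) \<partial>M)
      + ennreal ((1 + 2 powr p + K') * ((\<kappa> powr (p - 1) + \<nu> powr ((p - 2) / 2)) * A + (\<kappa>' powr (p - 1) +
          \<nu>' powr ((p - 2) / 2)) * A')))"
    proof (intro mult_left_mono add_mono order_refl)
      let ?a = "\<kappa> powr (p - 1) * A" and ?b = "\<kappa>' powr (p - 1) * A'" and ?c = "\<nu> powr ((p - 2) / 2) * A"
          and ?d = "\<nu>' powr ((p - 2) / 2) * A'"
      have nn4: "0 \<le> ?a" "0 \<le> ?b" "0 \<le> ?c" "0 \<le> ?d" using n by auto
      have "2 powr p * (?a + ?b) + K' * (?c + ?d) \<le> (1 + 2 powr p + K') * ((?a + ?b) + (?c + ?d))"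
        using nn4 K' by (simp add: distrib_left distrib_right add_nonneg_nonneg mult_nonneg_nonneg
          add_increasing2)
      also have "(?a + ?b) + (?c + ?d) = (\<kappa> powr (p - 1) + \<nu> powr ((p - 2) / 2)) * A + (\<kappa>' powr (p - 1)
          + \<nu>' powr ((p - 2) / 2)) * A'"
        by (simp add: algebra_simps)
      finally have le: "2 powr p * (?a + ?b) + K' * (?c + ?d)
          \<le> (1 + 2 powr p + K') * ((\<kappa> powr (p - 1) + \<nu> powr ((p - 2) / 2)) * A + (\<kappa>' powr (p - 1) + \<nu>'
              powr ((p - 2) / 2)) * A')" .
      have "ennreal (2 powr p) * (ennreal ?a + ennreal ?b) + ennreal (K' * (?c + ?d))
          = ennreal (2 powr p * (?a + ?b) + K' * (?c + ?d))"
        using nn4 K' by (simp add: ennreal_mult[symmetric] ennreal_plus[symmetric] del: ennreal_plus)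
      also have "\<dots> \<le> ennreal ((1 + 2 powr p + K') * ((\<kappa> powr (p - 1) + \<nu> powr ((p - 2) / 2)) * A + (\<kappa>'
          powr (p - 1) + \<nu>' powr ((p - 2) / 2)) * A'))"
        by (rule ennreal_leI[OF le])
      finally show "ennreal (2 powr p) * (ennreal ?a + ennreal ?b) + ennreal (K' * (?c + ?d))
        \<le> ennreal ((1 + 2 powr p + K') * ((\<kappa> powr (p - 1) + \<nu> powr ((p - 2) / 2)) * A + (\<kappa>' powr (p - 1)
            + \<nu>' powr ((p - 2) / 2)) * A'))" .
    qed auto
    also have "\<dots> \<le> ennreal C * ((\<integral>\<^sup>+\<omega>. ennreal (norm (Z0 \<omega>) powr p) \<partial>M)
            + ennreal ((\<kappa> powr (p - 1) + \<nu> powr ((p - 2) / 2)) * A + (\<kappa>' powr (p - 1) + \<nu>' powr ((p - 2)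
                / 2)) * A'))"
    proof -
      let ?r = "(\<kappa> powr (p - 1) + \<nu> powr ((p - 2) / 2)) * A + (\<kappa>' powr (p - 1) + \<nu>' powr ((p - 2) / 2))
          * A'"
      let ?z = "\<integral>\<^sup>+\<omega>. ennreal (norm (Z0 \<omega>) powr p) \<partial>M"
      have m: "1 \<le> 1 + 2 powr p + K'" using K' by simp
      have "?z = ennreal 1 * ?z" by simp
      also have "\<dots> \<le> ennreal (1 + 2 powr p + K') * ?z" using m
          by (intro mult_right_mono ennreal_leI) auto
      finally have "?z + ennreal ((1 + 2 powr p + K') * ?r)
          \<le> ennreal (1 + 2 powr p + K') * ?z + ennreal (1 + 2 powr p + K') * ennreal ?r"
        using m n by (intro add_mono) (auto simp: ennreal_mult)
      then have "ennreal (4 powr p) * (?z + ennreal ((1 + 2 powr p + K') * ?r))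
          \<le> ennreal (4 powr p) * (ennreal (1 + 2 powr p + K') * (?z + ennreal ?r))"
        by (intro mult_left_mono) (auto simp: distrib_left)
      also have "\<dots> = ennreal C * (?z + ennreal ?r)"
        unfolding C_def using m by (simp only: mult.assoc[symmetric] ennreal_mult powr_ge_zero)
      finally show ?thesis .
    qed
    finally show "(\<integral>\<^sup>+\<omega>. ennreal (norm (Z \<omega>) powr p) \<partial>M)
        \<le> ennreal C * ((\<integral>\<^sup>+\<omega>. ennreal (norm (Z0 \<omega>) powr p) \<partial>M)
            + ennreal ((\<kappa> powr (p - 1) + \<nu> powr ((p - 2) / 2)) * A + (\<kappa>' powr (p - 1) + \<nu>' powr ((p - 2)
                / 2)) * A'))" .
  qed
qed

end

subsection \<open>Wasserstein distance of laws\<close>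

lemma jointly_measurable_at:
  assumes "jointly_measurable N t X" "s \<in> {0..t}"
  shows "X s \<in> borel_measurable N"
  using measurable_compose[OF measurable_Pair2'[of s lborel N] assms(1)[unfolded
    jointly_measurable_def]] assms(2)
  by simp

lemma jointly_measurable_norm:
  fixes X :: "real \<Rightarrow> 'w \<Rightarrow> 'b::{second_countable_topology, real_normed_vector}"
  assumes "jointly_measurable N t X"
  shows "jointly_measurable N t (\<lambda>s \<omega>. norm (X s \<omega>))"
proof -
  note [measurable] = assms[unfolded jointly_measurable_def]
  have "(\<lambda>(\<omega>, s). indicator {0..t} s *\<^sub>R norm (X s \<omega>))
      = (\<lambda>x. norm (case x of (\<omega>, s) \<Rightarrow> indicator {0..t} s *\<^sub>R X s \<omega>))"
    by auto
  also have "\<dots> \<in> borel_measurable (N \<Otimes>\<^sub>M lborel)" by measurable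
  finally show ?thesis by (simp add: jointly_measurable_def)
qed

context prob_space
begin

text \<open>Lyapunov's inequality, obtained from Hoelder with the constant function 1 on a
  probability space.\<close>

lemma expectation_powr_mono:
  fixes u :: "'a \<Rightarrow> real"
  assumes [measurable]: "u \<in> borel_measurable M" and u: "\<And>\<omega>. 0 \<le> u \<omega>" "integrable M (\<lambda>\<omega>. u \<omega> powr p)"
    and r: "0 < r" "r \<le> p"
  shows "integrable M (\<lambda>\<omega>. u \<omega> powr r)"
    and "expectation (\<lambda>\<omega>. u \<omega> powr r) \<le> expectation (\<lambda>\<omega>. u \<omega> powr p) powr (r / p)"
proof -
  show int: "integrable M (\<lambda>\<omega>. u \<omega> powr r)"
  proof (rule Bochner_Integration.integrable_bound)
    show "integrable M (\<lambda>\<omega>. 1 + u \<omega> powr p)" using u by simp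
    show "AE \<omega> in M. norm (u \<omega> powr r) \<le> norm (1 + u \<omega> powr p)"
      using powr_le_one_plus[OF u(1), of r p] r
        by (intro AE_I2) (simp add: order_trans[OF _ abs_ge_self])
  qed measurable
  show "expectation (\<lambda>\<omega>. u \<omega> powr r) \<le> expectation (\<lambda>\<omega>. u \<omega> powr p) powr (r / p)"
  proof (cases "r = p")
    case True
    then show ?thesis using r by simp
  next
    case False
    then have rp: "r < p" using r by simp
    define E where "E = expectation (\<lambda>\<omega>. u \<omega> powr p)"
    have E: "0 \<le> E" "(\<integral>\<^sup>+\<omega>. ennreal (u \<omega> powr p) \<partial>M) = ennreal E"
      unfolding E_def using u by (auto intro!: nn_integral_eq_integral)
    have "(\<integral>\<^sup>+\<omega>. ennreal (u \<omega> powr r * 1) \<partial>M) \<le> ennreal (E powr (1 / (p / r)) * 1 powr (1 / (p / (p -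
        r))))"
    proof (rule nn_integral_holder)
      show "(\<integral>\<^sup>+\<omega>. ennreal ((u \<omega> powr r) powr (p / r)) \<partial>M) \<le> ennreal E"
        using E r by (simp add: powr_powr)
      show "1 / (p / r) + 1 / (p / (p - r)) = 1" using rp r by (simp add: field_simps)
    qed (use rp r E in \<open>auto simp: emeasure_space_1\<close>)
    then have "ennreal (expectation (\<lambda>\<omega>. u \<omega> powr r)) \<le> ennreal (E powr (r / p))"
      using nn_integral_eq_integral[OF int] by simp
    then show ?thesis by (subst (asm) ennreal_le_iff) (auto simp: E_def)
  qed
qed

lemma law_in_wasserstein_space:
  fixes X :: "'a \<Rightarrow> 'b::euclidean_space"
  assumes [measurable]: "X \<in> borel_measurable M" and "integrable M (\<lambda>\<omega>. norm (X \<omega>) powr p)" "0 < r" "r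
      \<le> p"
  shows "law M X \<in> wasserstein_space r"
  using expectation_powr_mono(1)[of "\<lambda>\<omega>. norm (X \<omega>)" p r] assms
  by (simp add: wasserstein_space_def law_def prob_space_distr integrable_distr_eq)

text \<open>The joint law of the two variables is a coupling, hence an upper bound for the infimum;
  Lyapunov's inequality raises the exponent from \<open>r\<close> to \<open>p\<close>.\<close>

lemma wasserstein_law_le:
  fixes X X' :: "'a \<Rightarrow> 'b::euclidean_space"
  assumes [measurable]: "X \<in> borel_measurable M" "X' \<in> borel_measurable M"
    and r: "0 < r" "r \<le> p" and int: "integrable M (\<lambda>\<omega>. norm (X \<omega> - X' \<omega>) powr p)"
  shows "wasserstein r (law M X) (law M X') \<le> expectation (\<lambda>\<omega>. norm (X \<omega> - X' \<omega>) powr p) powr (1 / p)"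
proof -
  define \<pi> where "\<pi> = distr M (borel \<Otimes>\<^sub>M borel) (\<lambda>\<omega>. (X \<omega>, X' \<omega>))"
  have \<pi>: "\<pi> \<in> couplings (law M X) (law M X')"
    unfolding couplings_def \<pi>_def law_def
    by (auto simp: prob_space_distr distr_distr comp_def)
  have "(\<integral>z. norm (fst z - snd z) powr r \<partial>\<pi>) = expectation (\<lambda>\<omega>. norm (X \<omega> - X' \<omega>) powr r)"
    unfolding \<pi>_def by (subst integral_distr) auto
  moreover have "wasserstein r (law M X) (law M X') \<le> (\<integral>z. norm (fst z - snd z) powr r \<partial>\<pi>) powr (1 / r)"
    unfolding wasserstein_def by (intro cINF_lower \<pi> bdd_belowI2[where m = 0]) auto
  ultimately have "wasserstein r (law M X) (law M X')
      \<le> expectation (\<lambda>\<omega>. norm (X \<omega> - X' \<omega>) powr r) powr (1 / r)"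
    by simp
  also have "\<dots> \<le> (expectation (\<lambda>\<omega>. norm (X \<omega> - X' \<omega>) powr p) powr (r / p)) powr (1 / r)"
    using r int by (intro powr_mono2 expectation_powr_mono(2)) (auto intro: integral_nonneg_AE)
  also have "\<dots> = expectation (\<lambda>\<omega>. norm (X \<omega> - X' \<omega>) powr p) powr (1 / p)"
    using r by (simp add: powr_powr)
  finally show ?thesis .
qed

text \<open>Built on the nonnegative integral so that it is defined for every variable and depends
  measurably on a time parameter by Tonelli. An infinite moment gives the value 0, so it acts as a
  norm only where the moment is finite.\<close>

definition Lp_norm :: "real \<Rightarrow> ('a \<Rightarrow> 'b::real_normed_vector) \<Rightarrow> real" where
  "Lp_norm p X = enn2real (\<integral>\<^sup>+\<omega>. ennreal (norm (X \<omega>) powr p) \<partial>M) powr (1 / p)"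

lemma finite_moment_integrable:
  fixes X :: "'a \<Rightarrow> 'b::{second_countable_topology, real_normed_vector}"
  assumes [measurable]: "X \<in> borel_measurable M" and "(\<integral>\<^sup>+\<omega>. ennreal (norm (X \<omega>) powr p) \<partial>M) < \<infinity>"
  shows "integrable M (\<lambda>\<omega>. norm (X \<omega>) powr p)"
    and "expectation (\<lambda>\<omega>. norm (X \<omega>) powr p) powr (1 / p) = Lp_norm p X"
proof -
  show i: "integrable M (\<lambda>\<omega>. norm (X \<omega>) powr p)"
    using assms by (intro integrableI_nonneg) auto
  show "expectation (\<lambda>\<omega>. norm (X \<omega>) powr p) powr (1 / p) = Lp_norm p X"
    unfolding Lp_norm_def by (subst nn_integral_eq_integral[OF i]) auto
qed

text \<open>The process \<open>g\<close> majorises coefficients and their differences, with the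
  L^p-norm in place of the Wasserstein distance. This deterministic part has the same p-th moment
  bound as the random part, whence the factor 2.\<close>

lemma affine_moment_process:
  fixes X :: "real \<Rightarrow> 'a \<Rightarrow> 'b::{second_countable_topology, real_normed_vector}"
  assumes j: "jointly_measurable M t X" and c: "0 \<le> c" "0 \<le> \<beta>" and p: "1 \<le> p" and t: "0 \<le> t"
  defines "g \<equiv> \<lambda>s \<omega>. c * (norm (X s \<omega>) + Lp_norm p (X s)) + \<beta>"
  shows "jointly_measurable M t g"
    and "(\<integral>\<^sup>+s\<in>{0..t}. (\<integral>\<^sup>+\<omega>. ennreal (g s \<omega> powr p) \<partial>M) \<partial>lborel)
      \<le> ennreal (4 powr p * (2 * c powr p)) * (\<integral>\<^sup>+s\<in>{0..t}. (\<integral>\<^sup>+\<omega>. ennreal (norm (X s \<omega>) powr p) \<partial>M)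
          \<partial>lborel)
        + ennreal (4 powr p * \<beta> powr p * t)"
proof -
  let ?G = "\<lambda>s. \<integral>\<^sup>+\<omega>. ennreal (norm (X s \<omega>) powr p) \<partial>M"
  note jn = jointly_measurable_norm[OF j]
  have mG: "(\<lambda>s. ?G s * indicator {0..t} s) \<in> borel_measurable lborel"
    by (rule jointly_measurable_powr_nn_integral(2)[OF jn sigma_finite_measure_axioms])
  have mN [measurable]: "(\<lambda>s. enn2real (?G s * indicator {0..t} s) powr (1 / p)) \<in> borel_measurable
      borel"
    using mG by measurable
  show "jointly_measurable M t g"
  proof -
    note [measurable] = jn[unfolded jointly_measurable_def]
    have "(\<lambda>(\<omega>, s). indicator {0..t} s *\<^sub>R g s \<omega>)
        = (\<lambda>x. c * ((case x of (\<omega>, s) \<Rightarrow> indicator {0..t} s *\<^sub>R norm (X s \<omega>)) + enn2real (?G (snd x) *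
            indicator {0..t} (snd x)) powr (1 / p)) + indicator {0..t} (snd x) * \<beta>)"
      by (auto simp: fun_eq_iff g_def Lp_norm_def indicator_def)
    also have "\<dots> \<in> borel_measurable (M \<Otimes>\<^sub>M lborel)" by measurable
    finally show ?thesis by (simp add: jointly_measurable_def)
  qed
  have "(\<integral>\<^sup>+s\<in>{0..t}. (\<integral>\<^sup>+\<omega>. ennreal (g s \<omega> powr p) \<partial>M) \<partial>lborel)
      \<le> (\<integral>\<^sup>+s. ennreal (4 powr p * (2 * c powr p)) * (?G s * indicator {0..t} s) + ennreal (4 powr p * \<beta>
          powr p) * indicator {0..t} s \<partial>lborel)"
  proof (intro nn_integral_mono)
    fix s
    show "(\<integral>\<^sup>+\<omega>. ennreal (g s \<omega> powr p) \<partial>M) * indicator {0..t} s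
        \<le> ennreal (4 powr p * (2 * c powr p)) * (?G s * indicator {0..t} s) + ennreal (4 powr p * \<beta> powr
            p) * indicator {0..t} s"
    proof (cases "s \<in> {0..t}")
      case True
      note [measurable] = jointly_measurable_at[OF j True]
      let ?N = "Lp_norm p (X s)"
      have N0: "0 \<le> ?N" by (simp add: Lp_norm_def)
      \<comment> \<open>Only an inequality, because the norm is 0 where the moment is
        infinite.\<close>
      have N: "ennreal (?N powr p) \<le> ?G s"
      proof -
        have "?N powr p = enn2real (?G s)" using p by (simp add: Lp_norm_def powr_powr)
        moreover have "ennreal (enn2real y) \<le> y" for y by (cases y) auto
        ultimately show ?thesis by simp
      qed
      have "g s \<omega> powr p \<le> 4 powr p * (c powr p * norm (X s \<omega>) powr p + (c powr p * ?N powr p + \<beta> powr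
          p))" for \<omega>
      proof -
        have "g s \<omega> = c * norm (X s \<omega>) + c * ?N + \<beta>" by (simp add: g_def distrib_left)
        also have "\<dots> powr p \<le> 4 powr p * ((c * norm (X s \<omega>)) powr p + (c * ?N) powr p + \<beta> powr p)"
          using c N0 p by (intro powr_add3_le) auto
        finally show ?thesis by (simp only: powr_mult add.assoc)
      qed
      then have "(\<integral>\<^sup>+\<omega>. ennreal (g s \<omega> powr p) \<partial>M)
          \<le> (\<integral>\<^sup>+\<omega>. ennreal (4 powr p) * (ennreal (c powr p) * ennreal (norm (X s \<omega>) powr p) + ennreal (c
              powr p * ?N powr p + \<beta> powr p)) \<partial>M)"
        by (intro nn_integral_mono)
          (simp add: ennreal_mult[symmetric] ennreal_plus[symmetric] ennreal_leI del: ennreal_plus)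
      also have "\<dots> = ennreal (4 powr p) * (ennreal (c powr p) * ?G s + ennreal (c powr p * ?N powr p + \<beta>
          powr p))"
        by (simp add: nn_integral_cmult nn_integral_add emeasure_space_1 del: ennreal_plus)
      also have "ennreal (c powr p * ?N powr p + \<beta> powr p)
          = ennreal (c powr p) * ennreal (?N powr p) + ennreal (\<beta> powr p)"
        by (simp add: ennreal_mult)
      also have "ennreal (4 powr p) * (ennreal (c powr p) * ?G s + (ennreal (c powr p) * ennreal (?N
          powr p) + ennreal (\<beta> powr p)))
          \<le> ennreal (4 powr p) * (ennreal (c powr p) * ?G s + (ennreal (c powr p) * ?G s + ennreal (\<beta>
              powr p)))"
        by (intro mult_left_mono add_mono N order_refl) auto
      also have "\<dots> = ennreal (4 powr p * (2 * c powr p)) * ?G s + ennreal (4 powr p * \<beta> powr p)"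
      proof -
        have "ennreal (4 powr p * (2 * c powr p))
            = ennreal (4 powr p) * (ennreal (c powr p) + ennreal (c powr p))"
          by (simp add: ennreal_mult[symmetric] ennreal_plus[symmetric] del: ennreal_plus)
        then show ?thesis by (simp add: distrib_left distrib_right ennreal_mult mult.assoc add.assoc)
      qed
      finally show ?thesis using True by simp
    qed simp
  qed
  also have "\<dots> = ennreal (4 powr p * (2 * c powr p)) * (\<integral>\<^sup>+s\<in>{0..t}. ?G s \<partial>lborel) + ennreal (4 powr p *
      \<beta> powr p * t)"
    using mG t by (simp add: nn_integral_add nn_integral_cmult nn_integral_cmult_indicator ennreal_mult)
  finally show "(\<integral>\<^sup>+s\<in>{0..t}. (\<integral>\<^sup>+\<omega>. ennreal (g s \<omega> powr p) \<partial>M) \<partial>lborel)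
      \<le> ennreal (4 powr p * (2 * c powr p)) * (\<integral>\<^sup>+s\<in>{0..t}. ?G s \<partial>lborel) + ennreal (4 powr p * \<beta> powr p
          * t)" .
qed

end

subsection \<open>Moments and stability of the solutions\<close>

lemma kernel_section_measurable:
  assumes "measurable_kernel T K" "t \<in> {0..T}"
  shows "(\<lambda>s. indicator {0..t} s * K s t) \<in> borel_measurable borel"
proof -
  have "(\<lambda>s. (s, t)) \<in> measurable (restrict_space borel {0..t}) (restrict_space borel (Delta T))"
  proof (rule measurable_restrict_space2)
    show "(\<lambda>s. (s, t)) \<in> space (restrict_space borel {0..t}) \<rightarrow> Delta T"
      using assms(2) by (auto simp: Delta_def space_restrict_space)
    show "(\<lambda>s. (s, t)) \<in> borel_measurable (restrict_space borel {0..t})"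
      by (rule measurable_restrict_space1) measurable
  qed
  from measurable_compose[OF this assms(1)[unfolded measurable_kernel_def]]
  have "(\<lambda>s. K s t) \<in> borel_measurable (restrict_space borel {0..t})" by simp
  then show ?thesis by (subst (asm) borel_measurable_restrict_space_iff) auto
qed

text \<open>The regularity condition for the pair of times 0 and \<open>t\<close> bounds the
  integral over the whole of \<open>{0..t}\<close>. Smaller exponents are reduced to
  \<open>r\<close> by x^a \<le> 1 + x^r, which adds the length of the interval.\<close>

lemma kernel_power_bound:
  assumes K: "kernel_regularity T \<gamma> L r K" "measurable_kernel T K" and t: "t \<in> {0..T}" and L: "0 \<le> L"
    and \<gamma>: "0 \<le> \<gamma> * r" and a: "0 \<le> a" "a \<le> r"
  shows "(\<integral>\<^sup>+s\<in>{0..t}. ennreal (\<bar>K s t\<bar> powr a) \<partial>lborel) \<le> ennreal (T + L * T powr (\<gamma> * r))"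
proof -
  note [measurable] = kernel_section_measurable[OF K(2) t]
  have "(0, t) \<in> Delta T" using t by (auto simp: Delta_def)
  then have "(\<integral>\<^sup>+s\<in>{0..0}. ennreal (\<bar>K s t - K s 0\<bar> powr r) \<partial>lborel) + (\<integral>\<^sup>+s\<in>{0..t}. ennreal (\<bar>K s t\<bar>
      powr r) \<partial>lborel)
      \<le> ennreal (L * \<bar>t - 0\<bar> powr (\<gamma> * r))"
    using K(1) unfolding kernel_regularity_def by fast
  then have "(\<integral>\<^sup>+s\<in>{0..t}. ennreal (\<bar>K s t\<bar> powr r) \<partial>lborel) \<le> ennreal (L * \<bar>t - 0\<bar> powr (\<gamma> * r))"
    by (rule order_trans[rotated]) simp
  also have "\<dots> \<le> ennreal (L * T powr (\<gamma> * r))"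
    using t L \<gamma> by (intro ennreal_leI mult_left_mono powr_mono2) auto
  finally have r: "(\<integral>\<^sup>+s\<in>{0..t}. ennreal (\<bar>K s t\<bar> powr r) \<partial>lborel) \<le> ennreal (L * T powr (\<gamma> * r))" .
  have eq: "ennreal (\<bar>K s t\<bar> powr r) * indicator {0..t} s
      = ennreal (\<bar>indicator {0..t} s * K s t\<bar> powr r) * indicator {0..t} s" for s
    by (auto simp: indicator_def)
  have m: "(\<lambda>s. ennreal (\<bar>K s t\<bar> powr r) * indicator {0..t} s) \<in> borel_measurable lborel"
    unfolding eq by measurable
  have "(\<integral>\<^sup>+s\<in>{0..t}. ennreal (\<bar>K s t\<bar> powr a) \<partial>lborel)
      \<le> (\<integral>\<^sup>+s. indicator {0..t} s + ennreal (\<bar>K s t\<bar> powr r) * indicator {0..t} s \<partial>lborel)"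
  proof (intro nn_integral_mono)
    fix s
    have "ennreal (\<bar>K s t\<bar> powr a) \<le> ennreal (1 + \<bar>K s t\<bar> powr r)"
      using a by (intro ennreal_leI powr_le_one_plus) auto
    then show "ennreal (\<bar>K s t\<bar> powr a) * indicator {0..t} s
        \<le> indicator {0..t} s + ennreal (\<bar>K s t\<bar> powr r) * indicator {0..t} s"
      by (auto simp: indicator_def)
  qed
  also have "\<dots> = ennreal t + (\<integral>\<^sup>+s\<in>{0..t}. ennreal (\<bar>K s t\<bar> powr r) \<partial>lborel)"
    using m t by (subst nn_integral_add) auto
  also have "\<dots> \<le> ennreal T + ennreal (L * T powr (\<gamma> * r))"
    using r t by (intro add_mono ennreal_leI) auto
  also have "\<dots> = ennreal (T + L * T powr (\<gamma> * r))" using t L by simp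
  finally show ?thesis .
qed

context usual_filtered_prob_space
begin

text \<open>Tonelli turns membership in L^p of the product space into the finite time integral that
  Gronwall's lemma requires beforehand.\<close>

lemma Lp_process_moment_finite:
  fixes X :: "real \<Rightarrow> 'w \<Rightarrow> 'b::{second_countable_topology, real_normed_vector}"
  assumes j: "jointly_measurable M T X"
    and int: "integrable (M \<Otimes>\<^sub>M restrict_space lborel {0..T}) (\<lambda>(\<omega>, s). norm (X s \<omega>) powr p)"
  shows "(\<integral>\<^sup>+s\<in>{0..T}. (\<integral>\<^sup>+\<omega>. ennreal (norm (X s \<omega>) powr p) \<partial>M) \<partial>lborel) < \<infinity>"
proof -
  interpret R: finite_measure "restrict_space lborel {0..T :: real}"
    by (rule finite_measureI) (simp add: emeasure_restrict_space space_restrict_space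
      emeasure_lborel_Icc_eq)
  let ?f = "\<lambda>x. ennreal (case x of (\<omega>, s) \<Rightarrow> norm (X s \<omega>) powr p)"
  have "(\<integral>\<^sup>+x. ?f x \<partial>(M \<Otimes>\<^sub>M restrict_space lborel {0..T})) < \<infinity>"
    using int by (subst nn_integral_eq_integral) auto
  also have "(\<integral>\<^sup>+x. ?f x \<partial>(M \<Otimes>\<^sub>M restrict_space lborel {0..T}))
      = (\<integral>\<^sup>+\<omega>. (\<integral>\<^sup>+s. ?f (\<omega>, s) \<partial>restrict_space lborel {0..T}) \<partial>M)"
    using int by (intro R.nn_integral_fst[symmetric]) auto
  also have "\<dots> = (\<integral>\<^sup>+\<omega>. (\<integral>\<^sup>+s\<in>{0..T}. ennreal (norm (X s \<omega>) powr p) \<partial>lborel) \<partial>M)"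
    by (simp add: nn_integral_restrict_space)
  also have "\<dots> = (\<integral>\<^sup>+s\<in>{0..T}. (\<integral>\<^sup>+\<omega>. ennreal (norm (X s \<omega>) powr p) \<partial>M) \<partial>lborel)"
    by (rule jointly_measurable_powr_nn_integral(3)[OF jointly_measurable_norm[OF j]
      sigma_finite_measure_axioms])
  finally show ?thesis .
qed

end

lemma set_integral_norm_le:
  fixes f :: "real \<Rightarrow> 'b::{banach, second_countable_topology}"
  assumes "set_integrable lborel S f" "AE s in lborel. s \<in> S \<longrightarrow> norm (f s) \<le> h s"
  shows "ennreal (norm (LINT s:S|lborel. f s)) \<le> (\<integral>\<^sup>+s\<in>S. ennreal (h s) \<partial>lborel)"
proof -
  have "ennreal (norm (LINT s:S|lborel. f s)) \<le> (\<integral>\<^sup>+s. ennreal (norm (indicator S s *\<^sub>R f s)) \<partial>lborel)"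
    unfolding set_lebesgue_integral_def
    by (rule integral_norm_bound_ennreal) (use assms(1) in \<open>simp add: set_integrable_def\<close>)
  also have "\<dots> \<le> (\<integral>\<^sup>+s\<in>S. ennreal (h s) \<partial>lborel)"
    by (rule nn_integral_mono_AE, use assms(2) in eventually_elim) (auto simp: indicator_def intro:
      ennreal_leI)
  finally show ?thesis .
qed

lemma strong_Lp_solution_at:
  assumes "strong_Lp_solution M T F B p Kb K\<sigma> b \<sigma> X0 X" "t \<in> {0..T}"
  obtains Y where "has_ito_integral M F B t (\<lambda>s \<omega>. K\<sigma> s t *\<^sub>R \<sigma> s (X s \<omega>) (law M (X s))) Y"
    "AE \<omega> in M. X t \<omega> = X0 \<omega> + (LINT s:{0..t}|lborel. Kb s t *\<^sub>R b s (X s \<omega>) (law M (X s))) + Y \<omega>"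
    "AE \<omega> in M. set_integrable lborel {0..t} (\<lambda>s. Kb s t *\<^sub>R b s (X s \<omega>) (law M (X s)))"
proof -
  have at: "(AE \<omega> in M. set_integrable lborel {0..t} (\<lambda>s. Kb s t *\<^sub>R b s (X s \<omega>) (law M (X s))) \<and>
        set_integrable lborel {0..t} (\<lambda>s. (norm (K\<sigma> s t *\<^sub>R \<sigma> s (X s \<omega>) (law M (X s))))\<^sup>2)) \<and>
      (\<exists>Y. has_ito_integral M F B t (\<lambda>s \<omega>. K\<sigma> s t *\<^sub>R \<sigma> s (X s \<omega>) (law M (X s))) Y \<and>
        (AE \<omega> in M. X t \<omega> = X0 \<omega> + (LINT s:{0..t}|lborel. Kb s t *\<^sub>R b s (X s \<omega>) (law M (X s))) + Y \<omega>))"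
    by (rule bspec[OF conjunct2[OF conjunct2[OF assms(1)[unfolded strong_Lp_solution_def]]] assms(2)])
  have D: "AE \<omega> in M. set_integrable lborel {0..t} (\<lambda>s. Kb s t *\<^sub>R b s (X s \<omega>) (law M (X s)))"
    using conjunct1[OF at] by (rule AE_mp) (intro AE_I2 impI, erule conjunct1)
  obtain Y where Y: "has_ito_integral M F B t (\<lambda>s \<omega>. K\<sigma> s t *\<^sub>R \<sigma> s (X s \<omega>) (law M (X s))) Y"
    "AE \<omega> in M. X t \<omega> = X0 \<omega> + (LINT s:{0..t}|lborel. Kb s t *\<^sub>R b s (X s \<omega>) (law M (X s))) + Y \<omega>"
    using conjunct2[OF at] by (elim exE conjE)
  show thesis by (rule that[OF Y D])
qed

lemma kernel_section_moment:
  "(\<integral>\<^sup>+s\<in>{0..t}. ennreal (\<bar>indicator {0..t} s * K s t\<bar> powr a) \<partial>lborel)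
      = (\<integral>\<^sup>+s\<in>{0..t}. ennreal (\<bar>K s t\<bar> powr a) \<partial>lborel)"
  by (intro nn_integral_cong) (auto simp: indicator_def)

context prob_space
begin

text \<open>The moment bound for the difference supplies the integrability that the Wasserstein
  estimate needs, and it also bounds the difference of the initial values.\<close>

lemma law_distance_le:
  fixes X X' :: "'a \<Rightarrow> 'b::euclidean_space"
  assumes X: "X \<in> borel_measurable M" "(\<integral>\<^sup>+\<omega>. ennreal (norm (X \<omega>) powr p) \<partial>M) < \<infinity>"
    and X': "X' \<in> borel_measurable M" "(\<integral>\<^sup>+\<omega>. ennreal (norm (X' \<omega>) powr p) \<partial>M) < \<infinity>"
    and r: "0 < r" "r \<le> p"
  shows "wasserstein r (law M X) (law M X') \<le> Lp_norm p (\<lambda>\<omega>. X \<omega> - X' \<omega>)"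
    and "(\<integral>\<^sup>+\<omega>. ennreal (norm (X \<omega> - X' \<omega>) powr p) \<partial>M)
      \<le> ennreal (2 powr p) * ((\<integral>\<^sup>+\<omega>. ennreal (norm (X \<omega>) powr p) \<partial>M) + (\<integral>\<^sup>+\<omega>. ennreal (norm (X' \<omega>) powr
          p) \<partial>M))"
proof -
  note [measurable] = X(1) X'(1)
  have "norm (X \<omega> - X' \<omega>) powr p \<le> 2 powr p * (norm (X \<omega>) powr p + norm (X' \<omega>) powr p)" for \<omega>
  proof -
    have "norm (X \<omega> - X' \<omega>) powr p \<le> (norm (X \<omega>) + norm (X' \<omega>)) powr p"
      using r by (intro powr_mono2 norm_triangle_ineq4) auto
    also have "\<dots> \<le> 2 powr p * (norm (X \<omega>) powr p + norm (X' \<omega>) powr p)"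
      using r by (intro powr_add_le) auto
    finally show ?thesis .
  qed
  then have "(\<integral>\<^sup>+\<omega>. ennreal (norm (X \<omega> - X' \<omega>) powr p) \<partial>M)
      \<le> (\<integral>\<^sup>+\<omega>. ennreal (2 powr p) * (ennreal (norm (X \<omega>) powr p) + ennreal (norm (X' \<omega>) powr p)) \<partial>M)"
    by (intro nn_integral_mono) (simp flip: ennreal_mult ennreal_plus add: ennreal_leI)
  also have "\<dots> = ennreal (2 powr p) * ((\<integral>\<^sup>+\<omega>. ennreal (norm (X \<omega>) powr p) \<partial>M) + (\<integral>\<^sup>+\<omega>. ennreal (norm (X'
      \<omega>) powr p) \<partial>M))"
    by (simp add: nn_integral_cmult nn_integral_add)
  finally show le: "(\<integral>\<^sup>+\<omega>. ennreal (norm (X \<omega> - X' \<omega>) powr p) \<partial>M)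
      \<le> ennreal (2 powr p) * ((\<integral>\<^sup>+\<omega>. ennreal (norm (X \<omega>) powr p) \<partial>M) + (\<integral>\<^sup>+\<omega>. ennreal (norm (X' \<omega>) powr
          p) \<partial>M))" .
  also have "\<dots> < \<infinity>" using X(2) X'(2) by (simp add: ennreal_mult_less_top)
  finally have fin: "(\<integral>\<^sup>+\<omega>. ennreal (norm (X \<omega> - X' \<omega>) powr p) \<partial>M) < \<infinity>" .
  have m: "(\<lambda>\<omega>. X \<omega> - X' \<omega>) \<in> borel_measurable M" by measurable
  show "wasserstein r (law M X) (law M X') \<le> Lp_norm p (\<lambda>\<omega>. X \<omega> - X' \<omega>)"
    using wasserstein_law_le[OF X(1) X'(1) r finite_moment_integrable(1)[OF m fin]]
    unfolding finite_moment_integrable(2)[OF m fin] .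
qed

text \<open>The Dirac measure at 0 is written as the law of the zero variable, so the distance to it
  is a case of the estimate for two laws.\<close>

lemma law_distance_zero_le:
  fixes X :: "'a \<Rightarrow> 'b::euclidean_space"
  assumes X: "X \<in> borel_measurable M" "(\<integral>\<^sup>+\<omega>. ennreal (norm (X \<omega>) powr p) \<partial>M) < \<infinity>"
    and r: "0 < r" "r \<le> p"
  shows "law M X \<in> wasserstein_space r" "wasserstein r (law M X) (law M (\<lambda>_. 0)) \<le> Lp_norm p X"
proof -
  show "law M X \<in> wasserstein_space r"
    by (rule law_in_wasserstein_space[OF X(1) finite_moment_integrable(1)[OF X] r])
  have z: "(\<lambda>_. 0) \<in> borel_measurable M" "(\<integral>\<^sup>+\<omega>. ennreal (norm (0 :: 'b) powr p) \<partial>M) < \<infinity>" by simp_all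
  show "wasserstein r (law M X) (law M (\<lambda>_. 0)) \<le> Lp_norm p X"
    using law_distance_le(1)[OF X z r] by simp
qed

end

context brownian_motion
begin

text \<open>Upgrades membership in L^p of the product space to a moment bound at every time. The
  constant is fixed before the solution and depends on the initial value only through
  \<open>R\<close>, so it can enter the constant of the stability estimate.\<close>

lemma solution_moment_bound:
  fixes p r R :: real
    and b :: "real \<Rightarrow> real ^ 'd \<Rightarrow> (real ^ 'd) measure \<Rightarrow> real ^ 'd"
    and \<sigma> :: "real \<Rightarrow> real ^ 'd \<Rightarrow> (real ^ 'd) measure \<Rightarrow> real ^ 'm ^ 'd"
  assumes p: "2 < p" and r: "0 < r" "r \<le> p" and R: "0 \<le> R"
    and K: "measurable_kernel T Kb" "measurable_kernel T K\<sigma>"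
    and \<kappa>: "\<And>t. t \<in> {0..T} \<Longrightarrow> (\<integral>\<^sup>+s\<in>{0..t}. ennreal (\<bar>Kb s t\<bar> powr (p / (p - 1))) \<partial>lborel)
        \<le> ennreal \<kappa>" "0 \<le> \<kappa>"
    and \<nu>: "\<And>t. t \<in> {0..T} \<Longrightarrow> (\<integral>\<^sup>+s\<in>{0..t}. ennreal (\<bar>K\<sigma> s t\<bar> powr (2 * (p / (p - 2)))) \<partial>lborel)
        \<le> ennreal \<nu>" "0 \<le> \<nu>"
    and c: "0 \<le> c"
    and growth: "\<And>s x \<rho>. s \<in> {0..T} \<Longrightarrow> \<rho> \<in> wasserstein_space r \<Longrightarrow>
        norm (b s x \<rho>) \<le> c * (norm x + wasserstein r \<rho> (law M (\<lambda>_. 0))) + c"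
      "\<And>s x \<rho>. s \<in> {0..T} \<Longrightarrow> \<rho> \<in> wasserstein_space r \<Longrightarrow>
        norm (\<sigma> s x \<rho>) \<le> c * (norm x + wasserstein r \<rho> (law M (\<lambda>_. 0))) + c"
  obtains H where "0 \<le> H"
    and "\<And>X0 X t. X0 \<in> borel_measurable M \<Longrightarrow> (\<integral>\<^sup>+\<omega>. ennreal (norm (X0 \<omega>) powr p) \<partial>M) \<le> ennreal R \<Longrightarrow>
      strong_Lp_solution M T F B p Kb K\<sigma> b \<sigma> X0 X \<Longrightarrow> t \<in> {0..T} \<Longrightarrow>
      (\<integral>\<^sup>+\<omega>. ennreal (norm (X t \<omega>) powr p) \<partial>M) \<le> ennreal H"
proof (rule volterra_step_moment[OF p, where 'd = 'd], goal_cases)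
  case (1 C)
  note C = 1(2) and step = 1(3)
  have T0: "0 \<le> T" using T_pos by simp
  define Q where "Q = \<kappa> powr (p - 1) + \<nu> powr ((p - 2) / 2)"
  define \<alpha> where "\<alpha> = 4 powr p * (2 * c powr p)"
  define \<theta> where "\<theta> = 4 powr p * c powr p"
  have nn: "0 \<le> Q" "0 \<le> \<alpha>" "0 \<le> \<theta>" by (simp_all add: Q_def \<alpha>_def \<theta>_def)
  define a where "a = C * (R + Q * (\<theta> * T))"
  \<comment> \<open>The rate for Gronwall; the added 1 keeps it positive when \<open>C\<close>, the
    kernels or the growth constant vanish.\<close>
  define c' where "c' = C * (Q * \<alpha>) + 1"
  have a0: "0 \<le> a" and c'0: "0 < c'" using C nn R T0 by (auto simp: a_def c'_def add_nonneg_pos)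
  show thesis
  proof (rule that[of "2 * a * exp (2 * c' * T)"])
    show "0 \<le> 2 * a * exp (2 * c' * T)" using a0 by simp
    fix X0 t and X :: "real \<Rightarrow> 'w \<Rightarrow> real ^ 'd"
    assume X0: "X0 \<in> borel_measurable M" "(\<integral>\<^sup>+\<omega>. ennreal (norm (X0 \<omega>) powr p) \<partial>M) \<le> ennreal R"
      and sol: "strong_Lp_solution M T F B p Kb K\<sigma> b \<sigma> X0 X" and t: "t \<in> {0..T}"
    have pr: "progressive T F X" using sol by (simp add: strong_Lp_solution_def)
    note j = progressive_jointly_measurable_M[OF pr]
    let ?G = "\<lambda>s. \<integral>\<^sup>+\<omega>. ennreal (norm (X s \<omega>) powr p) \<partial>M"
    have jT: "jointly_measurable M T X" using j[of T] T0 by simp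
    have fin: "(\<integral>\<^sup>+s\<in>{0..T}. ?G s \<partial>lborel) < \<infinity>"
      by (rule Lp_process_moment_finite[OF jT]) (use sol in \<open>simp add: strong_Lp_solution_def\<close>)
    have mG: "(\<lambda>s. ?G s * indicator {0..T} s) \<in> borel_measurable lborel"
      by (rule jointly_measurable_powr_nn_integral(2)[OF jointly_measurable_norm[OF jT]
        sigma_finite_measure_axioms])
    have "AE s in lborel. ?G s * indicator {0..T} s \<noteq> \<infinity>"
      using fin by (intro nn_integral_PInf_AE mG) auto
    then have finAE: "AE s in lborel. s \<in> {0..T} \<longrightarrow> ?G s < \<infinity>"
      by eventually_elim (auto simp: less_top)
    show "?G t \<le> ennreal (2 * a * exp (2 * c' * T))"
    proof (rule gronwall_ennreal[OF T0 c'0 a0 _ fin t])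
      fix t assume t: "t \<in> {0..T}"
      have tt: "0 \<le> t" "t \<le> T" using t by auto
      define g where "g s \<omega> = c * (norm (X s \<omega>) + Lp_norm p (X s)) + c" for s \<omega>
      define I where "I = (\<integral>\<^sup>+s\<in>{0..t}. ?G s \<partial>lborel)"
      have "I \<le> (\<integral>\<^sup>+s\<in>{0..T}. ?G s \<partial>lborel)"
        unfolding I_def using tt by (intro nn_integral_mono) (auto simp: indicator_def)
      then have "I < \<infinity>" using fin by (rule order.strict_trans1)
      then obtain x where x: "I = ennreal x" "0 \<le> x" by (cases I) auto
      have p1: "1 \<le> p" using p by simp
      note jt = j[OF t tt(2)]
      note am = affine_moment_process[OF jt c c p1 tt(1), folded g_def]
      have g0: "0 \<le> g s \<omega>" for s \<omega> using c by (simp add: g_def Lp_norm_def)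
      have gA: "(\<integral>\<^sup>+s\<in>{0..t}. (\<integral>\<^sup>+\<omega>. ennreal (g s \<omega> powr p) \<partial>M) \<partial>lborel) \<le> ennreal (\<alpha> * x + \<theta> * t)"
        using am(2) nn x tt unfolding I_def[symmetric]
        by (simp add: \<alpha>_def[symmetric] \<theta>_def[symmetric] ennreal_mult)
      \<comment> \<open>At this stage the moment is finite only for almost every time, and only
        there does the law lie in the Wasserstein space on which the growth bound is
        available.\<close>
      have good: "AE s in lborel. s \<in> {0..t} \<longrightarrow> (\<forall>\<omega>\<in>space M.
          norm (b s (X s \<omega>) (law M (X s))) \<le> g s \<omega> \<and> norm (\<sigma> s (X s \<omega>) (law M (X s))) \<le> g s \<omega>)"
        using finAE
      proof eventually_elim
        case (elim s)
        show ?case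
        proof (intro impI ballI)
          fix \<omega> assume s: "s \<in> {0..t}" and "\<omega> \<in> space M"
          have sT: "s \<in> {0..T}" using s tt by auto
          have lz: "law M (X s) \<in> wasserstein_space r" "wasserstein r (law M (X s)) (law M (\<lambda>_. 0))
              \<le> Lp_norm p (X s)"
            using law_distance_zero_le[OF jointly_measurable_at[OF jt s] _ r] elim sT by auto
          have "c * (norm (X s \<omega>) + wasserstein r (law M (X s)) (law M (\<lambda>_. 0))) + c \<le> g s \<omega>"
            unfolding g_def using lz(2) c by (intro add_mono mult_left_mono) auto
          then show "norm (b s (X s \<omega>) (law M (X s))) \<le> g s \<omega> \<and> norm (\<sigma> s (X s \<omega>) (law M (X s)))
              \<le> g s \<omega>"
            using growth[OF sT lz(1), of "X s \<omega>"] by linarith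
        qed
      qed
      define D where "D \<omega> = (LINT s:{0..t}|lborel. Kb s t *\<^sub>R b s (X s \<omega>) (law M (X s)))" for \<omega>
      define k where "k s = \<bar>indicator {0..t} s * Kb s t\<bar>" for s
      define l where "l s = \<bar>indicator {0..t} s * K\<sigma> s t\<bar>" for s
      obtain Y where Y: "has_ito_integral M F B t (\<lambda>s \<omega>. K\<sigma> s t *\<^sub>R \<sigma> s (X s \<omega>) (law M (X s))) Y"
          "AE \<omega> in M. X t \<omega> = X0 \<omega> + D \<omega> + Y \<omega>"
        and D: "AE \<omega> in M. set_integrable lborel {0..t} (\<lambda>s. Kb s t *\<^sub>R b s (X s \<omega>) (law M (X s)))"
        unfolding D_def by (rule strong_Lp_solution_at[OF sol t])
      \<comment> \<open>The second kernels, the second process and their bounds are all 0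
        here.\<close>
      have "?G t \<le> ennreal C * ((\<integral>\<^sup>+\<omega>. ennreal (norm (X0 \<omega>) powr p) \<partial>M)
          + ennreal ((\<kappa> powr (p - 1) + \<nu> powr ((p - 2) / 2)) * (\<alpha> * x + \<theta> * t) + (0 powr (p - 1) + 0
              powr ((p - 2) / 2)) * 0))"
      proof (rule step[of t _ _ _ _ _ k g "\<lambda>_. 0" "\<lambda>_ _. 0" l "\<lambda>_. 0", OF t Y(1) X0(1) Y(2)])
        show "AE \<omega> in M. ennreal (norm (D \<omega>)) \<le> (\<integral>\<^sup>+s\<in>{0..t}. ennreal (k s * g s \<omega> + 0 * 0) \<partial>lborel)"
          using D AE_space
        proof eventually_elim
          case (elim \<omega>)
          have "AE s in lborel. s \<in> {0..t} \<longrightarrow> norm (Kb s t *\<^sub>R b s (X s \<omega>) (law M (X s)))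
              \<le> k s * g s \<omega> + 0 * 0"
            using good by eventually_elim (use elim(2) in \<open>auto simp: k_def intro!: mult_left_mono\<close>)
          then show ?case unfolding D_def by (rule set_integral_norm_le[OF elim(1)])
        qed
        show "AE s in lborel. s \<in> {0..t} \<longrightarrow> (\<forall>\<omega>\<in>space M. norm (K\<sigma> s t *\<^sub>R \<sigma> s (X s \<omega>) (law M (X s)))
            \<le> l s * g s \<omega> + 0 * 0)"
          using good by eventually_elim (auto simp: l_def intro!: mult_left_mono)
        show "\<forall>f\<in>{k, \<lambda>_. 0, l, \<lambda>_. 0}. f \<in> borel_measurable borel \<and> (\<forall>s. 0 \<le> f s)"
          using borel_measurable_abs[OF kernel_section_measurable[OF K(1) t]] borel_measurable_abs[OF
            kernel_section_measurable[OF K(2) t]]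
          by (auto simp: k_def[abs_def] l_def[abs_def])
        show "\<forall>f\<in>{g, \<lambda>_ _. 0}. jointly_measurable M t f \<and> (\<forall>s \<omega>. 0 \<le> f s \<omega>)"
          using am(1) g0 by (auto simp: jointly_measurable_def)
        show "(\<integral>\<^sup>+s\<in>{0..t}. ennreal (k s powr (p / (p - 1))) \<partial>lborel) \<le> ennreal \<kappa>"
          unfolding k_def kernel_section_moment by (rule \<kappa>(1)[OF t])
        show "(\<integral>\<^sup>+s\<in>{0..t}. ennreal (l s powr (2 * (p / (p - 2)))) \<partial>lborel) \<le> ennreal \<nu>"
          unfolding l_def kernel_section_moment by (rule \<nu>(1)[OF t])
        show "\<forall>x\<in>{\<kappa>, 0, \<nu>, 0, \<alpha> * x + \<theta> * t, 0}. 0 \<le> x" using \<kappa> \<nu> nn x tt by auto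
      qed (use gA in simp_all)
      also have "\<dots> \<le> ennreal C * (ennreal R + ennreal (Q * (\<alpha> * x + \<theta> * t)))"
        using X0(2) by (intro mult_left_mono add_mono) (simp_all add: Q_def)
      also have "\<dots> = ennreal (C * (R + Q * (\<alpha> * x + \<theta> * t)))"
        using C R nn x tt by (simp add: ennreal_mult[symmetric] ennreal_plus[symmetric] del:
          ennreal_plus)
      also have "\<dots> \<le> ennreal (a + c' * x)"
      proof (rule ennreal_leI)
        have "C * (Q * (\<theta> * t)) \<le> C * (Q * (\<theta> * T))" using C nn tt by (intro mult_left_mono) auto
        then show "C * (R + Q * (\<alpha> * x + \<theta> * t)) \<le> a + c' * x" using x
            by (simp add: a_def c'_def algebra_simps)
      qed
      also have "\<dots> = ennreal a + ennreal c' * I" using a0 c'0 x by (simp add: ennreal_mult)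
      finally show "?G t \<le> ennreal a + ennreal c' * (\<integral>\<^sup>+s\<in>{0..t}. ?G s \<partial>lborel)" unfolding I_def .
    qed
  qed
qed

end

context brownian_motion
begin

text \<open>The Lipschitz property is used for the first pair of coefficients, the growth bound for
  the second. The first kernels multiply the difference of the solutions, which Gronwall absorbs;
  the kernel differences multiply the size of the second solution, which the moment bound
  \<open>H\<close> controls.\<close>

lemma solution_difference_bound:
  fixes p r H :: real
    and b b' :: "real \<Rightarrow> real ^ 'd \<Rightarrow> (real ^ 'd) measure \<Rightarrow> real ^ 'd"
    and \<sigma> \<sigma>' :: "real \<Rightarrow> real ^ 'd \<Rightarrow> (real ^ 'd) measure \<Rightarrow> real ^ 'm ^ 'd"
  assumes p: "2 < p" and r: "0 < r" "r \<le> p" and H: "0 \<le> H"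
    and K: "measurable_kernel T Kb" "measurable_kernel T K\<sigma>" "measurable_kernel T Kb'"
        "measurable_kernel T K\<sigma>'"
    and \<kappa>: "\<And>t. t \<in> {0..T} \<Longrightarrow> (\<integral>\<^sup>+s\<in>{0..t}. ennreal (\<bar>Kb s t\<bar> powr (p / (p - 1))) \<partial>lborel)
        \<le> ennreal \<kappa>" "0 \<le> \<kappa>"
    and \<nu>: "\<And>t. t \<in> {0..T} \<Longrightarrow> (\<integral>\<^sup>+s\<in>{0..t}. ennreal (\<bar>K\<sigma> s t\<bar> powr (2 * (p / (p - 2)))) \<partial>lborel)
        \<le> ennreal \<nu>" "0 \<le> \<nu>"
    and c: "0 \<le> c" "0 \<le> \<Lambda>"
    and growth: "\<And>s x \<rho>. s \<in> {0..T} \<Longrightarrow> \<rho> \<in> wasserstein_space r \<Longrightarrow>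
        norm (b' s x \<rho>) \<le> c * (norm x + wasserstein r \<rho> (law M (\<lambda>_. 0))) + c"
      "\<And>s x \<rho>. s \<in> {0..T} \<Longrightarrow> \<rho> \<in> wasserstein_space r \<Longrightarrow>
        norm (\<sigma>' s x \<rho>) \<le> c * (norm x + wasserstein r \<rho> (law M (\<lambda>_. 0))) + c"
    and lip: "\<And>s x y \<rho> \<mu>. s \<in> {0..T} \<Longrightarrow> \<rho> \<in> wasserstein_space r \<Longrightarrow> \<mu> \<in> wasserstein_space r \<Longrightarrow>
        norm (b s x \<rho> - b s y \<mu>) \<le> \<Lambda> * (norm (x - y) + wasserstein r \<rho> \<mu>)"
      "\<And>s x y \<rho> \<mu>. s \<in> {0..T} \<Longrightarrow> \<rho> \<in> wasserstein_space r \<Longrightarrow> \<mu> \<in> wasserstein_space r \<Longrightarrow>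
        norm (\<sigma> s x \<rho> - \<sigma> s y \<mu>) \<le> \<Lambda> * (norm (x - y) + wasserstein r \<rho> \<mu>)"
  obtains C where "0 \<le> C"
    and "\<And>X0 X0' X X' \<beta> \<kappa>' \<nu>' t. X0 \<in> borel_measurable M \<Longrightarrow> X0' \<in> borel_measurable M \<Longrightarrow>
      (\<integral>\<^sup>+\<omega>. ennreal (norm (X0 \<omega> - X0' \<omega>) powr p) \<partial>M) < \<infinity> \<Longrightarrow>
      strong_Lp_solution M T F B p Kb K\<sigma> b \<sigma> X0 X \<Longrightarrow> strong_Lp_solution M T F B p Kb' K\<sigma>' b' \<sigma>' X0' X' \<Longrightarrow>
      \<forall>s\<in>{0..T}. (\<integral>\<^sup>+\<omega>. ennreal (norm (X s \<omega>) powr p) \<partial>M) \<le> ennreal H \<Longrightarrow>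
      \<forall>s\<in>{0..T}. (\<integral>\<^sup>+\<omega>. ennreal (norm (X' s \<omega>) powr p) \<partial>M) \<le> ennreal H \<Longrightarrow>
      0 \<le> \<beta> \<Longrightarrow> \<forall>s\<in>{0..T}. \<forall>x. \<forall>\<rho>\<in>wasserstein_space r. norm (b s x \<rho> - b' s x \<rho>) \<le> \<beta> \<and>
          norm (\<sigma> s x \<rho> - \<sigma>' s x \<rho>) \<le> \<beta> \<Longrightarrow>
      0 \<le> \<kappa>' \<Longrightarrow> \<forall>t\<in>{0..T}. (\<integral>\<^sup>+s\<in>{0..t}. ennreal (\<bar>Kb s t - Kb' s t\<bar> powr (p / (p - 1))) \<partial>lborel)
          \<le> ennreal \<kappa>' \<Longrightarrow>
      0 \<le> \<nu>' \<Longrightarrow> \<forall>t\<in>{0..T}. (\<integral>\<^sup>+s\<in>{0..t}. ennreal (\<bar>K\<sigma> s t - K\<sigma>' s t\<bar> powr (2 * (p / (p - 2)))) \<partial>lborel)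
          \<le> ennreal \<nu>' \<Longrightarrow>
      t \<in> {0..T} \<Longrightarrow>
      (\<integral>\<^sup>+\<omega>. ennreal (norm (X t \<omega> - X' t \<omega>) powr p) \<partial>M)
        \<le> ennreal C * ((\<integral>\<^sup>+\<omega>. ennreal (norm (X0 \<omega> - X0' \<omega>) powr p) \<partial>M)
            + ennreal (\<beta> powr p + \<kappa>' powr (p - 1) + \<nu>' powr ((p - 2) / 2)))"
proof (rule volterra_step_moment[OF p, where 'd = 'd], goal_cases)
  case (1 C)
  note C = 1(2) and step = 1(3)
  have T0: "0 \<le> T" using T_pos by simp
  have p1: "1 \<le> p" using p by simp
  define Q where "Q = \<kappa> powr (p - 1) + \<nu> powr ((p - 2) / 2)"
  define \<alpha> where "\<alpha> = 4 powr p * (2 * \<Lambda> powr p)"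
  \<comment> \<open>Bounds the time integral of the p-th moments of the majorant \<open>g'\<close>,
    which depends on the second solution alone.\<close>
  define S where "S = 4 powr p * (2 * c powr p) * (H * T) + 4 powr p * c powr p * T"
  have nn: "0 \<le> Q" "0 \<le> \<alpha>" "0 \<le> S" using H T0 by (simp_all add: Q_def \<alpha>_def S_def)
  define c' where "c' = C * (Q * \<alpha>) + 1"
  have c'0: "0 < c'" using C nn by (auto simp: c'_def add_nonneg_pos)
  \<comment> \<open>The exponential is Gronwall's; the last factor dominates the weights that the
    initial error, the coefficient error and the kernel errors receive.\<close>
  define C' where "C' = 2 * exp (2 * c' * T) * (C * (1 + Q * (4 powr p * T) + S))"
  show thesis
  proof (rule 1(1)[of C'])
    show "0 \<le> C'" using C nn T0 by (simp add: C'_def)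
    fix X0 X0' \<beta> \<kappa>' \<nu>' t and X X' :: "real \<Rightarrow> 'w \<Rightarrow> real ^ 'd"
    assume X0: "X0 \<in> borel_measurable M" and X0': "X0' \<in> borel_measurable M"
      and e_fin: "(\<integral>\<^sup>+\<omega>. ennreal (norm (X0 \<omega> - X0' \<omega>) powr p) \<partial>M) < \<infinity>"
      and sol: "strong_Lp_solution M T F B p Kb K\<sigma> b \<sigma> X0 X"
          and sol': "strong_Lp_solution M T F B p Kb' K\<sigma>' b' \<sigma>' X0' X'"
      and XH: "\<forall>s\<in>{0..T}. (\<integral>\<^sup>+\<omega>. ennreal (norm (X s \<omega>) powr p) \<partial>M) \<le> ennreal H"
      and XH': "\<forall>s\<in>{0..T}. (\<integral>\<^sup>+\<omega>. ennreal (norm (X' s \<omega>) powr p) \<partial>M) \<le> ennreal H"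
      and \<beta>: "0 \<le> \<beta>" "\<forall>s\<in>{0..T}. \<forall>x. \<forall>\<rho>\<in>wasserstein_space r. norm (b s x \<rho> - b' s x \<rho>) \<le> \<beta> \<and>
          norm (\<sigma> s x \<rho> - \<sigma>' s x \<rho>) \<le> \<beta>"
      and \<kappa>': "0 \<le> \<kappa>'" "\<forall>t\<in>{0..T}. (\<integral>\<^sup>+s\<in>{0..t}. ennreal (\<bar>Kb s t - Kb' s t\<bar> powr (p / (p - 1)))
          \<partial>lborel) \<le> ennreal \<kappa>'"
      and \<nu>': "0 \<le> \<nu>'" "\<forall>t\<in>{0..T}. (\<integral>\<^sup>+s\<in>{0..t}. ennreal (\<bar>K\<sigma> s t - K\<sigma>' s t\<bar> powr (2 * (p / (p - 2))))
          \<partial>lborel) \<le> ennreal \<nu>'"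
      and t: "t \<in> {0..T}"
    have pr: "progressive T F X" "progressive T F X'" using sol sol'
        by (simp_all add: strong_Lp_solution_def)
    note j = progressive_jointly_measurable_M[OF pr(1)] and j'
        = progressive_jointly_measurable_M[OF pr(2)]
    let ?G = "\<lambda>s. \<integral>\<^sup>+\<omega>. ennreal (norm (X s \<omega> - X' s \<omega>) powr p) \<partial>M"
    obtain e where e: "(\<integral>\<^sup>+\<omega>. ennreal (norm (X0 \<omega> - X0' \<omega>) powr p) \<partial>M) = ennreal e" "0 \<le> e"
      using e_fin by (cases "\<integral>\<^sup>+\<omega>. ennreal (norm (X0 \<omega> - X0' \<omega>) powr p) \<partial>M") auto
    define q where "q = \<kappa>' powr (p - 1) + \<nu>' powr ((p - 2) / 2)"
    have q0: "0 \<le> q" by (simp add: q_def)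
    have meas: "X s \<in> borel_measurable M" "X' s \<in> borel_measurable M" if s: "s \<in> {0..T}" for s
      using jointly_measurable_at[OF j[of T]] jointly_measurable_at[OF j'[of T]] s T0 by auto
    have mom: "(\<integral>\<^sup>+\<omega>. ennreal (norm (X s \<omega>) powr p) \<partial>M) < \<infinity>" "(\<integral>\<^sup>+\<omega>. ennreal (norm (X' s \<omega>) powr p) \<partial>M)
        < \<infinity>"
      if s: "s \<in> {0..T}" for s
      using order.strict_trans1[OF bspec[OF XH s], of \<infinity>] order.strict_trans1[OF bspec[OF XH' s], of \<infinity>]
        by simp_all
    have dist: "law M (X s) \<in> wasserstein_space r" "law M (X' s) \<in> wasserstein_space r"
        "wasserstein r (law M (X s)) (law M (X' s)) \<le> Lp_norm p (\<lambda>\<omega>. X s \<omega> - X' s \<omega>)"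
        "wasserstein r (law M (X' s)) (law M (\<lambda>_. 0)) \<le> Lp_norm p (X' s)"
        "?G s \<le> ennreal (2 powr p * (H + H))" if s: "s \<in> {0..T}" for s
    proof -
      show "law M (X s) \<in> wasserstein_space r" by (rule law_distance_zero_le(1)[OF meas(1)[OF s]
          mom(1)[OF s] r])
      show "law M (X' s) \<in> wasserstein_space r" "wasserstein r (law M (X' s)) (law M (\<lambda>_. 0))
          \<le> Lp_norm p (X' s)"
        by (rule law_distance_zero_le[OF meas(2)[OF s] mom(2)[OF s] r])+
      note d = law_distance_le[OF meas(1)[OF s] mom(1)[OF s] meas(2)[OF s] mom(2)[OF s] r]
      show "wasserstein r (law M (X s)) (law M (X' s)) \<le> Lp_norm p (\<lambda>\<omega>. X s \<omega> - X' s \<omega>)" by (rule d(1))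
      have "?G s \<le> ennreal (2 powr p) * (ennreal H + ennreal H)"
        using XH XH' s by (intro order_trans[OF d(2)] mult_left_mono add_mono) auto
      also have "\<dots> = ennreal (2 powr p * (H + H))"
          by (simp only: ennreal_mult ennreal_plus H powr_ge_zero add_nonneg_nonneg)
      finally show "?G s \<le> ennreal (2 powr p * (H + H))" .
    qed
    have fin: "(\<integral>\<^sup>+s\<in>{0..T}. ?G s \<partial>lborel) < \<infinity>"
    proof -
      have "(\<integral>\<^sup>+s\<in>{0..T}. ?G s \<partial>lborel) \<le> (\<integral>\<^sup>+s. ennreal (2 powr p * (H + H)) * indicator {0..T} s
          \<partial>lborel)"
        using dist(5) by (intro nn_integral_mono) (simp add: indicator_def)
      also have "\<dots> < \<infinity>"
        using T0 by (subst nn_integral_cmult_indicator) (auto simp: ennreal_mult_less_top)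
      finally show ?thesis .
    qed
    define a where "a = C * (e + Q * (4 powr p * \<beta> powr p * T) + q * S)"
    have a0: "0 \<le> a" using C nn T0 e q0 by (simp add: a_def)
    have "?G t \<le> ennreal (2 * a * exp (2 * c' * T))"
    proof (rule gronwall_ennreal[OF T0 c'0 a0 _ fin t])
      fix t assume t: "t \<in> {0..T}"
      have tt: "0 \<le> t" "t \<le> T" using t by auto
      define I where "I = (\<integral>\<^sup>+s\<in>{0..t}. ?G s \<partial>lborel)"
      have "I \<le> (\<integral>\<^sup>+s\<in>{0..T}. ?G s \<partial>lborel)"
        unfolding I_def using tt by (intro nn_integral_mono) (auto simp: indicator_def)
      then have "I < \<infinity>" using fin by (rule order.strict_trans1)
      then obtain x where x: "I = ennreal x" "0 \<le> x" by (cases I) auto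
      note jt = j[OF t tt(2)] and jt' = j'[OF t tt(2)]
      define g where "g s \<omega> = \<Lambda> * (norm (X s \<omega> - X' s \<omega>) + Lp_norm p (\<lambda>\<omega>. X s \<omega> - X' s \<omega>)) + \<beta>" for s \<omega>
      define g' where "g' s \<omega> = c * (norm (X' s \<omega>) + Lp_norm p (X' s)) + c" for s \<omega>
      note am = affine_moment_process[OF jointly_measurable_diff[OF jt jt'] c(2) \<beta>(1) p1 tt(1), folded
          g_def]
      note am' = affine_moment_process[OF jt' c(1) c(1) p1 tt(1), folded g'_def]
      have g0: "0 \<le> g s \<omega>" "0 \<le> g' s \<omega>" for s \<omega> using c \<beta> by (simp_all add: g_def g'_def Lp_norm_def)
      define A where "A = \<alpha> * x + 4 powr p * \<beta> powr p * t"
      have A0: "0 \<le> A" using nn x tt by (simp add: A_def)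
      have gA: "(\<integral>\<^sup>+s\<in>{0..t}. (\<integral>\<^sup>+\<omega>. ennreal (g s \<omega> powr p) \<partial>M) \<partial>lborel) \<le> ennreal A"
        using am(2) nn x tt unfolding I_def[symmetric] A_def
        by (simp add: \<alpha>_def[symmetric] ennreal_mult)
      have gA': "(\<integral>\<^sup>+s\<in>{0..t}. (\<integral>\<^sup>+\<omega>. ennreal (g' s \<omega> powr p) \<partial>M) \<partial>lborel) \<le> ennreal S"
      proof -
        have "(\<integral>\<^sup>+s\<in>{0..t}. (\<integral>\<^sup>+\<omega>. ennreal (norm (X' s \<omega>) powr p) \<partial>M) \<partial>lborel)
            \<le> (\<integral>\<^sup>+s. ennreal H * indicator {0..t} s \<partial>lborel)"
          using XH' tt by (intro nn_integral_mono) (auto simp: indicator_def)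
        also have "\<dots> = ennreal (H * t)" using H tt
            by (subst nn_integral_cmult_indicator) (auto simp: ennreal_mult)
        also have "\<dots> \<le> ennreal (H * T)" using H tt by (intro ennreal_leI mult_left_mono) auto
        finally have 1: "(\<integral>\<^sup>+s\<in>{0..t}. (\<integral>\<^sup>+\<omega>. ennreal (norm (X' s \<omega>) powr p) \<partial>M) \<partial>lborel)
            \<le> ennreal (H * T)" .
        have "(\<integral>\<^sup>+s\<in>{0..t}. (\<integral>\<^sup>+\<omega>. ennreal (g' s \<omega> powr p) \<partial>M) \<partial>lborel)
            \<le> ennreal (4 powr p * (2 * c powr p)) * ennreal (H * T) + ennreal (4 powr p * c powr p * T)"
          using tt by (intro order_trans[OF am'(2)] add_mono mult_left_mono 1 ennreal_leI) auto
        also have "\<dots> = ennreal S" using H T0 by (simp add: S_def ennreal_mult)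
        finally show ?thesis .
      qed
      \<comment> \<open>With \<open>u\<close>, \<open>v\<close>, \<open>w\<close> the first
        coefficient at the first solution, the first at the second solution and the second at the
        second solution, \<open>f\<close> and \<open>f'\<close> being the kernels: the difference is
        \<open>f\<close> times \<open>u - w\<close> plus \<open>f - f'\<close> times
        \<open>w\<close>, and \<open>u - w\<close> passes through \<open>v\<close>.\<close>
      have good: "norm (f *\<^sub>R u - f' *\<^sub>R w) \<le> \<bar>f\<bar> * g s \<omega> + \<bar>f - f'\<bar> * g' s \<omega>"
        if s: "s \<in> {0..T}"
          and lu: "norm (u - v) \<le> \<Lambda> * (norm (X s \<omega> - X' s \<omega>) + wasserstein r (law M (X s)) (law M (X'
              s)))"
          and du: "norm (v - w) \<le> \<beta>"
          and gu: "norm w \<le> c * (norm (X' s \<omega>) + wasserstein r (law M (X' s)) (law M (\<lambda>_. 0))) + c"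
        for s \<omega> f f' and u v w :: "'z::real_normed_vector"
      proof -
        have "\<Lambda> * (norm (X s \<omega> - X' s \<omega>) + wasserstein r (law M (X s)) (law M (X' s)))
            \<le> \<Lambda> * (norm (X s \<omega> - X' s \<omega>) + Lp_norm p (\<lambda>\<omega>. X s \<omega> - X' s \<omega>))"
          using dist(3)[OF s] c by (intro mult_left_mono add_left_mono) auto
        then have 1: "norm (u - w) \<le> g s \<omega>"
          using norm_triangle_ineq[of "u - v" "v - w"] lu du unfolding g_def by simp
        have "c * (norm (X' s \<omega>) + wasserstein r (law M (X' s)) (law M (\<lambda>_. 0)))
            \<le> c * (norm (X' s \<omega>) + Lp_norm p (X' s))"
          using dist(4)[OF s] c by (intro mult_left_mono add_left_mono) auto
        then have 2: "norm w \<le> g' s \<omega>" using gu unfolding g'_def by linarith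
        have "f *\<^sub>R u - f' *\<^sub>R w = f *\<^sub>R (u - w) + (f - f') *\<^sub>R w"
          by (simp add: scaleR_diff_right scaleR_diff_left)
        then have "norm (f *\<^sub>R u - f' *\<^sub>R w) \<le> norm (f *\<^sub>R (u - w)) + norm ((f - f') *\<^sub>R w)"
          using norm_triangle_ineq[of "f *\<^sub>R (u - w)" "(f - f') *\<^sub>R w"] by (simp only:)
        also have "\<dots> \<le> \<bar>f\<bar> * g s \<omega> + \<bar>f - f'\<bar> * g' s \<omega>"
          unfolding norm_scaleR using 1 2 by (intro add_mono mult_left_mono) auto
        finally show ?thesis .
      qed
      let ?u = "\<lambda>s \<omega>. Kb s t *\<^sub>R b s (X s \<omega>) (law M (X s))" and ?u'
          = "\<lambda>s \<omega>. Kb' s t *\<^sub>R b' s (X' s \<omega>) (law M (X' s))"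
      define D where "D \<omega> = (LINT s:{0..t}|lborel. ?u s \<omega> - ?u' s \<omega>)" for \<omega>
      define k where "k s = \<bar>indicator {0..t} s * Kb s t\<bar>" for s
      define k' where "k' s = \<bar>indicator {0..t} s * (Kb s t - Kb' s t)\<bar>" for s
      define l where "l s = \<bar>indicator {0..t} s * K\<sigma> s t\<bar>" for s
      define l' where "l' s = \<bar>indicator {0..t} s * (K\<sigma> s t - K\<sigma>' s t)\<bar>" for s
      obtain Y where Y: "has_ito_integral M F B t (\<lambda>s \<omega>. K\<sigma> s t *\<^sub>R \<sigma> s (X s \<omega>) (law M (X s))) Y"
          "AE \<omega> in M. X t \<omega> = X0 \<omega> + (LINT s:{0..t}|lborel. ?u s \<omega>) + Y \<omega>"
        and D1: "AE \<omega> in M. set_integrable lborel {0..t} (\<lambda>s. ?u s \<omega>)"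
        by (rule strong_Lp_solution_at[OF sol t])
      obtain Y' where Y': "has_ito_integral M F B t (\<lambda>s \<omega>. K\<sigma>' s t *\<^sub>R \<sigma>' s (X' s \<omega>) (law M (X' s))) Y'"
          "AE \<omega> in M. X' t \<omega> = X0' \<omega> + (LINT s:{0..t}|lborel. ?u' s \<omega>) + Y' \<omega>"
        and D2: "AE \<omega> in M. set_integrable lborel {0..t} (\<lambda>s. ?u' s \<omega>)"
        by (rule strong_Lp_solution_at[OF sol' t])
      have mB: "B s \<in> borel_measurable M" if "s \<in> {0..T}" for s
          by (rule measurable_F_M[OF that B_adapted[OF that]])
      note ito = has_ito_integral_diff[OF t mB Y(1) Y'(1)]
      have eqn: "AE \<omega> in M. X t \<omega> - X' t \<omega> = (X0 \<omega> - X0' \<omega>) + D \<omega> + (Y \<omega> - Y' \<omega>)"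
        using Y(2) Y'(2) D1 D2
      proof eventually_elim
        case (elim \<omega>)
        have "D \<omega> = (LINT s:{0..t}|lborel. ?u s \<omega>) - (LINT s:{0..t}|lborel. ?u' s \<omega>)"
          unfolding D_def by (rule set_integral_diff(2)[OF elim(3,4)])
        then show ?case unfolding elim(1,2) by (simp add: algebra_simps)
      qed
      have mX0: "(\<lambda>\<omega>. X0 \<omega> - X0' \<omega>) \<in> borel_measurable M" using X0 X0' by measurable
      have "?G t \<le> ennreal C * ((\<integral>\<^sup>+\<omega>. ennreal (norm (X0 \<omega> - X0' \<omega>) powr p) \<partial>M)
          + ennreal ((\<kappa> powr (p - 1) + \<nu> powr ((p - 2) / 2)) * A + (\<kappa>' powr (p - 1) + \<nu>' powr ((p - 2) /
              2)) * S))"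
      proof (rule step[of t _ _ _ _ _ k g k' g' l l', OF t ito mX0 eqn])
        show "AE \<omega> in M. ennreal (norm (D \<omega>)) \<le> (\<integral>\<^sup>+s\<in>{0..t}. ennreal (k s * g s \<omega> + k' s * g' s \<omega>)
            \<partial>lborel)"
          using D1 D2
        proof eventually_elim
          case (elim \<omega>)
          have "norm (?u s \<omega> - ?u' s \<omega>) \<le> k s * g s \<omega> + k' s * g' s \<omega>" if s: "s \<in> {0..t}" for s
          proof -
            have sT: "s \<in> {0..T}" using s tt by auto
            have L: "norm (b s (X s \<omega>) (law M (X s)) - b s (X' s \<omega>) (law M (X' s)))
                \<le> \<Lambda> * (norm (X s \<omega> - X' s \<omega>) + wasserstein r (law M (X s)) (law M (X' s)))"
              by (rule lip(1)[OF sT dist(1)[OF sT] dist(2)[OF sT]])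
            have N: "norm (b s (X' s \<omega>) (law M (X' s)) - b' s (X' s \<omega>) (law M (X' s))) \<le> \<beta>"
              using \<beta>(2) sT dist(2)[OF sT] by blast
            have W: "norm (b' s (X' s \<omega>) (law M (X' s)))
                \<le> c * (norm (X' s \<omega>) + wasserstein r (law M (X' s)) (law M (\<lambda>_. 0))) + c"
              by (rule growth(1)[OF sT dist(2)[OF sT]])
            have eq: "k s = \<bar>Kb s t\<bar>" "k' s = \<bar>Kb s t - Kb' s t\<bar>" using s
                by (simp_all add: k_def k'_def)
            show ?thesis unfolding eq by (rule good[OF sT L N W])
          qed
          then show ?case unfolding D_def by (intro set_integral_norm_le set_integral_diff(1)[OF elim]
              AE_I2) blast
        qed
        show "AE s in lborel. s \<in> {0..t} \<longrightarrow> (\<forall>\<omega>\<in>space M. norm (K\<sigma> s t *\<^sub>R \<sigma> s (X s \<omega>) (law M (X s)) - K\<sigma>'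
            s t *\<^sub>R \<sigma>' s (X' s \<omega>) (law M (X' s)))
            \<le> l s * g s \<omega> + l' s * g' s \<omega>)"
        proof (intro AE_I2 impI ballI)
          fix s \<omega> assume s: "s \<in> {0..t}"
          have sT: "s \<in> {0..T}" using s tt by auto
          have L: "norm (\<sigma> s (X s \<omega>) (law M (X s)) - \<sigma> s (X' s \<omega>) (law M (X' s)))
              \<le> \<Lambda> * (norm (X s \<omega> - X' s \<omega>) + wasserstein r (law M (X s)) (law M (X' s)))"
            by (rule lip(2)[OF sT dist(1)[OF sT] dist(2)[OF sT]])
          have N: "norm (\<sigma> s (X' s \<omega>) (law M (X' s)) - \<sigma>' s (X' s \<omega>) (law M (X' s))) \<le> \<beta>"
            using \<beta>(2) sT dist(2)[OF sT] by blast
          have W: "norm (\<sigma>' s (X' s \<omega>) (law M (X' s)))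
              \<le> c * (norm (X' s \<omega>) + wasserstein r (law M (X' s)) (law M (\<lambda>_. 0))) + c"
            by (rule growth(2)[OF sT dist(2)[OF sT]])
          have eq: "l s = \<bar>K\<sigma> s t\<bar>" "l' s = \<bar>K\<sigma> s t - K\<sigma>' s t\<bar>" using s by (simp_all add: l_def l'_def)
          show "norm (K\<sigma> s t *\<^sub>R \<sigma> s (X s \<omega>) (law M (X s)) - K\<sigma>' s t *\<^sub>R \<sigma>' s (X' s \<omega>) (law M (X' s)))
              \<le> l s * g s \<omega> + l' s * g' s \<omega>"
            unfolding eq by (rule good[OF sT L N W])
        qed
        note mk = kernel_section_measurable[OF K(1) t] kernel_section_measurable[OF K(2) t]
          kernel_section_measurable[OF K(3) t] kernel_section_measurable[OF K(4) t]
        show "\<forall>f\<in>{k, k', l, l'}. f \<in> borel_measurable borel \<and> (\<forall>s. 0 \<le> f s)"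
          using borel_measurable_abs[OF mk(1)] borel_measurable_abs[OF mk(2)]
            borel_measurable_abs[OF borel_measurable_diff[OF mk(1,3)]] borel_measurable_abs[OF
                borel_measurable_diff[OF mk(2,4)]]
          by (auto simp: k_def[abs_def] k'_def[abs_def] l_def[abs_def] l'_def[abs_def]
            right_diff_distrib)
        show "\<forall>f\<in>{g, g'}. jointly_measurable M t f \<and> (\<forall>s \<omega>. 0 \<le> f s \<omega>)"
          using am(1) am'(1) g0 by auto
        show "(\<integral>\<^sup>+s\<in>{0..t}. ennreal (k s powr (p / (p - 1))) \<partial>lborel) \<le> ennreal \<kappa>"
          unfolding k_def kernel_section_moment by (rule \<kappa>(1)[OF t])
        show "(\<integral>\<^sup>+s\<in>{0..t}. ennreal (l s powr (2 * (p / (p - 2)))) \<partial>lborel) \<le> ennreal \<nu>"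
          unfolding l_def kernel_section_moment by (rule \<nu>(1)[OF t])
        show "(\<integral>\<^sup>+s\<in>{0..t}. ennreal (k' s powr (p / (p - 1))) \<partial>lborel) \<le> ennreal \<kappa>'"
          unfolding k'_def kernel_section_moment[of t "\<lambda>s t. Kb s t - Kb' s t"] using \<kappa>'(2) t by blast
        show "(\<integral>\<^sup>+s\<in>{0..t}. ennreal (l' s powr (2 * (p / (p - 2)))) \<partial>lborel) \<le> ennreal \<nu>'"
          unfolding l'_def kernel_section_moment[of t "\<lambda>s t. K\<sigma> s t - K\<sigma>' s t"] using \<nu>'(2) t by blast
        show "\<forall>x\<in>{\<kappa>, \<kappa>', \<nu>, \<nu>', A, S}. 0 \<le> x" using \<kappa> \<nu> \<kappa>' \<nu>' A0 nn by auto
      qed (assumption | rule gA gA')+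
      also have "\<dots> = ennreal C * (ennreal e + ennreal (Q * A + q * S))"
        by (simp add: e Q_def q_def)
      also have "\<dots> = ennreal (C * (e + (Q * A + q * S)))"
        using C e nn A0 q0 by (simp add: ennreal_mult[symmetric] ennreal_plus[symmetric] del:
          ennreal_plus)
      also have "\<dots> \<le> ennreal (a + c' * x)"
      proof (rule ennreal_leI)
        have "C * (Q * (4 powr p * \<beta> powr p * t)) \<le> C * (Q * (4 powr p * \<beta> powr p * T))"
          using C nn tt by (intro mult_left_mono) auto
        then show "C * (e + (Q * A + q * S)) \<le> a + c' * x" using x
            by (simp add: a_def c'_def A_def algebra_simps)
      qed
      also have "\<dots> = ennreal a + ennreal c' * I" using a0 c'0 x by (simp add: ennreal_mult)
      finally show "?G t \<le> ennreal a + ennreal c' * (\<integral>\<^sup>+s\<in>{0..t}. ?G s \<partial>lborel)" unfolding I_def .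
    qed
    \<comment> \<open>Collects the three error terms with the common weight \<open>?m\<close>, which
      is at least each of their individual weights.\<close>
    also have "2 * a * exp (2 * c' * T) \<le> C' * (e + (\<beta> powr p + q))"
    proof -
      let ?m = "1 + Q * (4 powr p * T) + S"
      have m: "1 \<le> ?m" "Q * (4 powr p * T) \<le> ?m" "S \<le> ?m" using nn T0 by simp_all
      have "e + Q * (4 powr p * \<beta> powr p * T) + q * S \<le> ?m * e + ?m * \<beta> powr p + ?m * q"
      proof (intro add_mono)
        show "e \<le> ?m * e" using mult_right_mono[OF m(1) e(2)] by simp
        show "Q * (4 powr p * \<beta> powr p * T) \<le> ?m * \<beta> powr p"
          using mult_right_mono[OF m(2), of "\<beta> powr p"]
            by (simp add: mult.assoc mult.commute mult.left_commute)
        show "q * S \<le> ?m * q" using mult_right_mono[OF m(3) q0] by (simp add: mult.commute)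
      qed
      then have "a \<le> C * (?m * (e + (\<beta> powr p + q)))"
        unfolding a_def using C by (intro mult_left_mono) (simp_all add: distrib_left add.assoc)
      then have "2 * exp (2 * c' * T) * a \<le> 2 * exp (2 * c' * T) * (C * (?m * (e + (\<beta> powr p + q))))"
        by (intro mult_left_mono) auto
      then show ?thesis by (simp only: C'_def mult.assoc mult.commute mult.left_commute)
    qed
    finally have "?G t \<le> ennreal (C' * (e + (\<beta> powr p + q)))" by (simp add: ennreal_leI)
    also have "\<dots> = ennreal C' * (ennreal e + ennreal (\<beta> powr p + q))"
      using \<open>0 \<le> C'\<close> e q0 by (simp add: ennreal_mult[symmetric] ennreal_plus[symmetric] del:
        ennreal_plus)
    finally show "?G t \<le> ennreal C' * ((\<integral>\<^sup>+\<omega>. ennreal (norm (X0 \<omega> - X0' \<omega>) powr p) \<partial>M)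
            + ennreal (\<beta> powr p + \<kappa>' powr (p - 1) + \<nu>' powr ((p - 2) / 2)))"
      by (simp add: e q_def add.assoc)
  qed
qed

end

section \<open>Extended norms and the stability estimate\<close>

lemma ennreal_powr_kernel_norm:
  assumes "0 < a" "(SUP t\<in>{0..T}. \<integral>\<^sup>+s\<in>{0..t}. ennreal (\<bar>h s t\<bar> powr a) \<partial>lborel) = ennreal S" "0 \<le> S"
  shows "ennreal_powr (kernel_norm T a h) p = ennreal (S powr (p / a))"
  using assms by (simp add: kernel_norm_def ennreal_powr_def powr_powr)

lemma kernel_norm_infinite:
  assumes "(SUP t\<in>{0..T}. \<integral>\<^sup>+s\<in>{0..t}. ennreal (\<bar>h s t\<bar> powr a) \<partial>lborel) = \<infinity>"
  shows "ennreal_powr (kernel_norm T a h) p = \<infinity>"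
  using assms by (simp add: kernel_norm_def ennreal_powr_def)

lemma coeff_sup_norm_upper:
  assumes "s \<in> {0..T}" "\<rho> \<in> wasserstein_space (real \<eta>)"
  shows "ennreal (norm (f s x \<rho>)) \<le> coeff_sup_norm T \<eta> f"
  unfolding coeff_sup_norm_def
  by (rule SUP_upper2[of "(s, x, \<rho>)"]) (use assms in auto)

lemma (in prob_space) law_zero_in_wasserstein_space:
  "0 < r \<Longrightarrow> law M (\<lambda>_. 0 :: 'b::euclidean_space) \<in> wasserstein_space r"
  by (rule law_in_wasserstein_space[where p = r]) auto

theorem theorem3p2:
  fixes M :: "'w measure" and T :: real and F :: "real \<Rightarrow> 'w measure"
    and B :: "real \<Rightarrow> 'w \<Rightarrow> real ^ 'm"
    and \<eta> :: nat and \<gamma> \<epsilon> \<delta> p q q' L :: real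
    and Kb K\<sigma> Kb' K\<sigma>' :: "real \<Rightarrow> real \<Rightarrow> real"
    and b b' :: "real \<Rightarrow> real ^ 'd \<Rightarrow> (real ^ 'd) measure \<Rightarrow> real ^ 'd"
    and \<sigma> \<sigma>' :: "real \<Rightarrow> real ^ 'd \<Rightarrow> (real ^ 'd) measure \<Rightarrow> real ^ 'm ^ 'd"
  assumes "brownian_motion M T F B"
    and "\<eta> \<ge> 1" and "0 < \<gamma>" and "\<gamma> \<le> 1 / 2" and "\<epsilon> > 0"
    and "\<delta> = 2 + 4 / \<epsilon>" and "p > max (1 / \<gamma>) \<delta>" and "p \<ge> real \<eta>"
    and "q = p / (p - 1)" and "q' = p / (p - 2)"
    and "L > 0"
    and "admissible_kernels T \<gamma> \<epsilon> L Kb K\<sigma>"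
    and "admissible_kernels T \<gamma> \<epsilon> L Kb' K\<sigma>'"
    and "measurable_coeff T \<eta> b" and "measurable_coeff T \<eta> b'"
    and "measurable_coeff T \<eta> \<sigma>" and "measurable_coeff T \<eta> \<sigma>'"
    and "\<forall>K. wasserstein_bounded \<delta> K \<longrightarrow>
           (\<exists>C>0. \<forall>\<rho> \<in> K \<inter> wasserstein_space (real \<eta>). \<forall>t\<in>{0..T}. \<forall>x.
              norm (b t x \<rho>) + norm (b' t x \<rho>) + norm (\<sigma> t x \<rho>) + norm (\<sigma>' t x \<rho>)
                \<le> C * (1 + norm x))"
    and "\<exists>C>0. \<forall>t\<in>{0..T}. \<forall>x y. \<forall>\<rho> \<in> wasserstein_space (real \<eta>). \<forall>\<nu> \<in> wasserstein_space (real \<eta>).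
           norm (b t x \<rho> - b t y \<nu>) + norm (\<sigma> t x \<rho> - \<sigma> t y \<nu>)
             \<le> C * (norm (x - y) + wasserstein (real \<eta>) \<rho> \<nu>) \<and>
           norm (b' t x \<rho> - b' t y \<nu>) + norm (\<sigma>' t x \<rho> - \<sigma>' t y \<nu>)
             \<le> C * (norm (x - y) + wasserstein (real \<eta>) \<rho> \<nu>)"
  shows "\<forall>R. \<exists>C>0. \<forall>X0 X0' X X'.
           X0 \<in> borel_measurable (F 0) \<longrightarrow> X0' \<in> borel_measurable (F 0) \<longrightarrow>
           integrable M (\<lambda>\<omega>. norm (X0 \<omega>) powr p) \<longrightarrow>
           integrable M (\<lambda>\<omega>. norm (X0' \<omega>) powr p) \<longrightarrow>
           (\<integral>\<omega>. norm (X0 \<omega>) powr p \<partial>M) \<le> R \<longrightarrow>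
           (\<integral>\<omega>. norm (X0' \<omega>) powr p \<partial>M) \<le> R \<longrightarrow>
           strong_Lp_solution M T F B p Kb K\<sigma> b \<sigma> X0 X \<longrightarrow>
           strong_Lp_solution M T F B p Kb' K\<sigma>' b' \<sigma>' X0' X' \<longrightarrow>
           (SUP t\<in>{0..T}. \<integral>\<^sup>+\<omega>. ennreal (norm (X t \<omega> - X' t \<omega>) powr p) \<partial>M)
             \<le> ennreal C *
                ((\<integral>\<^sup>+\<omega>. ennreal (norm (X0 \<omega> - X0' \<omega>) powr p) \<partial>M)
                 + ennreal_powr (coeff_sup_norm T \<eta> (\<lambda>t x \<rho>. b t x \<rho> - b' t x \<rho>)) p
                 + ennreal_powr (coeff_sup_norm T \<eta> (\<lambda>t x \<rho>. \<sigma> t x \<rho> - \<sigma>' t x \<rho>)) p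
                 + ennreal_powr (kernel_norm T q (\<lambda>s t. Kb s t - Kb' s t)) p
                 + ennreal_powr (kernel_norm T (2 * q') (\<lambda>s t. K\<sigma> s t - K\<sigma>' s t)) p)"
proof -
  interpret brownian_motion M T F B by fact
  have eps: "0 < 4 / \<epsilon>" using assms by simp
  have p: "2 < p" "2 + 4 / \<epsilon> < p" using assms(6,7) eps unfolding max_less_iff_conj by linarith+
  have \<eta>: "0 < real \<eta>" "real \<eta> \<le> p" using assms(2,8) by simp_all
  have T0: "0 < T" by (rule T_pos)
  \<comment> \<open>The lower bound \<delta> for p in product form; both exponent comparisons, q
    \<le> 1 + \<epsilon> and 2 q' \<le> 2 + \<epsilon>, follow from it.\<close>
  have \<epsilon>p: "4 < \<epsilon> * (p - 2)" using p(2) \<open>\<epsilon> > 0\<close> by (simp add: field_simps)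
  have q: "0 < q" "q \<le> 1 + \<epsilon>" "p / q = p - 1"
  proof -
    show "0 < q" "p / q = p - 1" unfolding assms(9) using p(1) by simp_all
    have "p \<le> (1 + \<epsilon>) * (p - 1)" using \<epsilon>p \<open>\<epsilon> > 0\<close> by (simp add: algebra_simps)
    then show "q \<le> 1 + \<epsilon>" unfolding assms(9) using p(1) by (simp add: divide_le_eq)
  qed
  have q': "0 < 2 * q'" "2 * q' \<le> 2 + \<epsilon>" "p / (2 * q') = (p - 2) / 2"
  proof -
    show "0 < 2 * q'" "p / (2 * q') = (p - 2) / 2" unfolding assms(10) using p(1) by simp_all
    have "2 * p \<le> (2 + \<epsilon>) * (p - 2)" using \<epsilon>p by (simp add: algebra_simps)
    then show "2 * q' \<le> 2 + \<epsilon>" unfolding assms(10) using p(1) by (simp add: divide_le_eq)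
  qed
  have adm: "measurable_kernel T Kb" "measurable_kernel T K\<sigma>" "kernel_regularity T \<gamma> L (1 + \<epsilon>) Kb"
      "kernel_regularity T \<gamma> L (2 + \<epsilon>) K\<sigma>"
    using assms(12) by (simp_all add: admissible_kernels_def)
  have adm': "measurable_kernel T Kb'" "measurable_kernel T K\<sigma>'" "kernel_regularity T \<gamma> L (1 + \<epsilon>) Kb'"
      "kernel_regularity T \<gamma> L (2 + \<epsilon>) K\<sigma>'"
    using assms(13) by (simp_all add: admissible_kernels_def)
  \<comment> \<open>The value of the kernel bound for the exponent 1 + \<epsilon>. Both pairs of
    kernels share it, since they are admissible for the same constants.\<close>
  define \<kappa> where "\<kappa> = T + L * T powr (\<gamma> * (1 + \<epsilon>))"
  define \<nu> where "\<nu> = T + L * T powr (\<gamma> * (2 + \<epsilon>))"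
  have \<kappa>\<nu>: "0 \<le> \<kappa>" "0 \<le> \<nu>" using T0 \<open>L > 0\<close> by (auto simp: \<kappa>_def \<nu>_def)
  have L: "0 \<le> L" "0 \<le> \<gamma> * (1 + \<epsilon>)" "0 \<le> \<gamma> * (2 + \<epsilon>)" using assms(3,5,11) by simp_all
  have kb: "(\<integral>\<^sup>+s\<in>{0..t}. ennreal (\<bar>Kb s t\<bar> powr (p / (p - 1))) \<partial>lborel) \<le> ennreal \<kappa>"
    "(\<integral>\<^sup>+s\<in>{0..t}. ennreal (\<bar>Kb' s t\<bar> powr (p / (p - 1))) \<partial>lborel) \<le> ennreal \<kappa>" if t: "t \<in> {0..T}" for t
    unfolding assms(9)[symmetric] \<kappa>_def
    using kernel_power_bound[OF adm(3,1) t L(1,2) less_imp_le[OF q(1)] q(2)]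
      kernel_power_bound[OF adm'(3,1) t L(1,2) less_imp_le[OF q(1)] q(2)] by blast+
  have k\<sigma>: "(\<integral>\<^sup>+s\<in>{0..t}. ennreal (\<bar>K\<sigma> s t\<bar> powr (2 * (p / (p - 2)))) \<partial>lborel) \<le> ennreal \<nu>"
    "(\<integral>\<^sup>+s\<in>{0..t}. ennreal (\<bar>K\<sigma>' s t\<bar> powr (2 * (p / (p - 2)))) \<partial>lborel) \<le> ennreal \<nu>" if t: "t \<in> {0..T}"
        for t
    unfolding assms(10)[symmetric] \<nu>_def
    using kernel_power_bound[OF adm(4,2) t L(1,3) less_imp_le[OF q'(1)] q'(2)]
      kernel_power_bound[OF adm'(4,2) t L(1,3) less_imp_le[OF q'(1)] q'(2)] by blast+
  \<comment> \<open>The growth hypothesis is evaluated on the bounded set consisting of this law, at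
    the point 0; Lipschitz continuity then gives linear growth jointly in the point and the
    measure.\<close>
  let ?\<delta>0 = "law M (\<lambda>_. 0) :: (real ^ 'd) measure"
  have \<delta>0: "?\<delta>0 \<in> wasserstein_space \<delta>" "?\<delta>0 \<in> wasserstein_space (real \<eta>)"
    using assms(6) eps \<eta> by (auto intro!: law_zero_in_wasserstein_space add_pos_pos)
  then have "wasserstein_bounded \<delta> {?\<delta>0}" by (auto simp: wasserstein_bounded_def)
  then obtain c0 where c0: "0 < c0" "\<And>t x. t \<in> {0..T} \<Longrightarrow>
      norm (b t x ?\<delta>0) + norm (b' t x ?\<delta>0) + norm (\<sigma> t x ?\<delta>0) + norm (\<sigma>' t x ?\<delta>0) \<le> c0 * (1 + norm x)"
    using assms(18) \<delta>0(2) by (elim allE[of _ "{?\<delta>0}"]) auto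
  obtain \<Lambda> where \<Lambda>: "0 < \<Lambda>" and lip4: "\<And>t x y \<rho> \<nu>. t \<in> {0..T} \<Longrightarrow> \<rho> \<in> wasserstein_space (real \<eta>) \<Longrightarrow>
      \<nu> \<in> wasserstein_space (real \<eta>) \<Longrightarrow>
      norm (b t x \<rho> - b t y \<nu>) + norm (\<sigma> t x \<rho> - \<sigma> t y \<nu>)
          \<le> \<Lambda> * (norm (x - y) + wasserstein (real \<eta>) \<rho> \<nu>) \<and>
      norm (b' t x \<rho> - b' t y \<nu>) + norm (\<sigma>' t x \<rho> - \<sigma>' t y \<nu>)
          \<le> \<Lambda> * (norm (x - y) + wasserstein (real \<eta>) \<rho> \<nu>)"
    using assms(19) by blast
  have lip: "norm (b t x \<rho> - b t y \<nu>) \<le> \<Lambda> * (norm (x - y) + wasserstein (real \<eta>) \<rho> \<nu>)"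
      "norm (\<sigma> t x \<rho> - \<sigma> t y \<nu>) \<le> \<Lambda> * (norm (x - y) + wasserstein (real \<eta>) \<rho> \<nu>)"
      "norm (b' t x \<rho> - b' t y \<nu>) \<le> \<Lambda> * (norm (x - y) + wasserstein (real \<eta>) \<rho> \<nu>)"
      "norm (\<sigma>' t x \<rho> - \<sigma>' t y \<nu>) \<le> \<Lambda> * (norm (x - y) + wasserstein (real \<eta>) \<rho> \<nu>)"
    if "t \<in> {0..T}" "\<rho> \<in> wasserstein_space (real \<eta>)" "\<nu> \<in> wasserstein_space (real \<eta>)" for t x y \<rho> \<nu>
    using lip4[OF that, of x y] norm_ge_zero[of "b t x \<rho> - b t y \<nu>"] norm_ge_zero[of "\<sigma> t x \<rho> - \<sigma> t y
      \<nu>"]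
      norm_ge_zero[of "b' t x \<rho> - b' t y \<nu>"] norm_ge_zero[of "\<sigma>' t x \<rho> - \<sigma>' t y \<nu>"] by linarith+
  define c where "c = \<Lambda> + c0"
  have c: "0 \<le> c" using \<Lambda> c0 by (simp add: c_def)
  have grow: "norm v \<le> c * (norm x + wasserstein (real \<eta>) \<rho> ?\<delta>0) + c"
    if "norm (v - w) \<le> \<Lambda> * (norm (x - 0) + wasserstein (real \<eta>) \<rho> ?\<delta>0)" "norm w \<le> c0" "0
        \<le> norm x + wasserstein (real \<eta>) \<rho> ?\<delta>0"
    for v w :: "'z::real_normed_vector" and x :: "real ^ 'd" and \<rho>
  proof -
    have "norm v \<le> \<Lambda> * (norm x + wasserstein (real \<eta>) \<rho> ?\<delta>0) + c0"
      using norm_triangle_sub[of v w] that(1,2) by simp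
    moreover have "\<Lambda> * (norm x + wasserstein (real \<eta>) \<rho> ?\<delta>0)
        \<le> c * (norm x + wasserstein (real \<eta>) \<rho> ?\<delta>0)"
      using c0 that(3) by (intro mult_right_mono) (auto simp: c_def)
    ultimately show ?thesis using \<Lambda> by (simp add: c_def)
  qed
  have growth: "norm (b s x \<rho>) \<le> c * (norm x + wasserstein (real \<eta>) \<rho> ?\<delta>0) + c"
      "norm (\<sigma> s x \<rho>) \<le> c * (norm x + wasserstein (real \<eta>) \<rho> ?\<delta>0) + c"
      "norm (b' s x \<rho>) \<le> c * (norm x + wasserstein (real \<eta>) \<rho> ?\<delta>0) + c"
      "norm (\<sigma>' s x \<rho>) \<le> c * (norm x + wasserstein (real \<eta>) \<rho> ?\<delta>0) + c"
    if s: "s \<in> {0..T}" and \<rho>: "\<rho> \<in> wasserstein_space (real \<eta>)" for s x \<rho>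
  proof -
    have z: "norm (b s 0 ?\<delta>0) \<le> c0" "norm (\<sigma> s 0 ?\<delta>0) \<le> c0" "norm (b' s 0 ?\<delta>0) \<le> c0" "norm (\<sigma>' s 0 ?\<delta>0)
        \<le> c0"
      using c0(2)[OF s, of 0, unfolded norm_zero add_0_right mult_1_right] norm_ge_zero[of "b s 0 ?\<delta>0"]
        norm_ge_zero[of "\<sigma> s 0 ?\<delta>0"]
        norm_ge_zero[of "b' s 0 ?\<delta>0"] norm_ge_zero[of "\<sigma>' s 0 ?\<delta>0"] by linarith+
    note l = lip[OF s \<rho> \<delta>0(2), of x 0]
    \<comment> \<open>Nonnegativity of the sum of norm and distance is read off from the Lipschitz
      bound, which dominates a norm.\<close>
    have "0 \<le> \<Lambda> * (norm (x - 0) + wasserstein (real \<eta>) \<rho> ?\<delta>0)"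
      using order_trans[OF norm_ge_zero l(1)] .
    then have w: "0 \<le> norm x + wasserstein (real \<eta>) \<rho> ?\<delta>0"
      using \<Lambda> by (simp add: zero_le_mult_iff)
    show "norm (b s x \<rho>) \<le> c * (norm x + wasserstein (real \<eta>) \<rho> ?\<delta>0) + c" by (rule grow[OF l(1) z(1) w])
    show "norm (\<sigma> s x \<rho>) \<le> c * (norm x + wasserstein (real \<eta>) \<rho> ?\<delta>0) + c" by (rule grow[OF l(2) z(2) w])
    show "norm (b' s x \<rho>) \<le> c * (norm x + wasserstein (real \<eta>) \<rho> ?\<delta>0) + c"
        by (rule grow[OF l(3) z(3) w])
    show "norm (\<sigma>' s x \<rho>) \<le> c * (norm x + wasserstein (real \<eta>) \<rho> ?\<delta>0) + c"
        by (rule grow[OF l(4) z(4) w])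
  qed
  show ?thesis
  proof
    fix R0 :: real
    \<comment> \<open>The prescribed bound is arbitrary and may be negative, while the moment lemma
      asks for a nonnegative one.\<close>
    define R where "R = max R0 0"
    have R: "0 \<le> R" by (simp add: R_def)
    obtain H1 where H1: "0 \<le> H1" "\<And>X0 X t. X0 \<in> borel_measurable M \<Longrightarrow>
        (\<integral>\<^sup>+\<omega>. ennreal (norm (X0 \<omega>) powr p) \<partial>M) \<le> ennreal R \<Longrightarrow>
      strong_Lp_solution M T F B p Kb K\<sigma> b \<sigma> X0 X \<Longrightarrow> t \<in> {0..T} \<Longrightarrow>
      (\<integral>\<^sup>+\<omega>. ennreal (norm (X t \<omega>) powr p) \<partial>M) \<le> ennreal H1"
      by (rule solution_moment_bound[OF p(1) \<eta> R adm(1,2) kb(1) \<kappa>\<nu>(1) k\<sigma>(1) \<kappa>\<nu>(2) c growth(1,2)])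
        (assumption | rule that)+
    obtain H2 where H2: "0 \<le> H2" "\<And>X0 X t. X0 \<in> borel_measurable M \<Longrightarrow>
        (\<integral>\<^sup>+\<omega>. ennreal (norm (X0 \<omega>) powr p) \<partial>M) \<le> ennreal R \<Longrightarrow>
      strong_Lp_solution M T F B p Kb' K\<sigma>' b' \<sigma>' X0 X \<Longrightarrow> t \<in> {0..T} \<Longrightarrow>
      (\<integral>\<^sup>+\<omega>. ennreal (norm (X t \<omega>) powr p) \<partial>M) \<le> ennreal H2"
      by (rule solution_moment_bound[OF p(1) \<eta> R adm'(1,2) kb(2) \<kappa>\<nu>(1) k\<sigma>(2) \<kappa>\<nu>(2) c growth(3,4)])
        (assumption | rule that)+
    define H where "H = max H1 H2"
    have H: "0 \<le> H" using H1 by (simp add: H_def le_max_iff_disj)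
    obtain C where C: "0 \<le> C" and diff: "\<And>X0 X0' X X' \<beta> \<kappa>' \<nu>' t. X0 \<in> borel_measurable M \<Longrightarrow>
        X0' \<in> borel_measurable M \<Longrightarrow>
      (\<integral>\<^sup>+\<omega>. ennreal (norm (X0 \<omega> - X0' \<omega>) powr p) \<partial>M) < \<infinity> \<Longrightarrow>
      strong_Lp_solution M T F B p Kb K\<sigma> b \<sigma> X0 X \<Longrightarrow> strong_Lp_solution M T F B p Kb' K\<sigma>' b' \<sigma>' X0' X' \<Longrightarrow>
      \<forall>s\<in>{0..T}. (\<integral>\<^sup>+\<omega>. ennreal (norm (X s \<omega>) powr p) \<partial>M) \<le> ennreal H \<Longrightarrow>
      \<forall>s\<in>{0..T}. (\<integral>\<^sup>+\<omega>. ennreal (norm (X' s \<omega>) powr p) \<partial>M) \<le> ennreal H \<Longrightarrow>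
      0 \<le> \<beta> \<Longrightarrow> \<forall>s\<in>{0..T}. \<forall>x. \<forall>\<rho>\<in>wasserstein_space (real \<eta>). norm (b s x \<rho> - b' s x \<rho>) \<le> \<beta> \<and>
          norm (\<sigma> s x \<rho> - \<sigma>' s x \<rho>) \<le> \<beta> \<Longrightarrow>
      0 \<le> \<kappa>' \<Longrightarrow> \<forall>t\<in>{0..T}. (\<integral>\<^sup>+s\<in>{0..t}. ennreal (\<bar>Kb s t - Kb' s t\<bar> powr (p / (p - 1))) \<partial>lborel)
          \<le> ennreal \<kappa>' \<Longrightarrow>
      0 \<le> \<nu>' \<Longrightarrow> \<forall>t\<in>{0..T}. (\<integral>\<^sup>+s\<in>{0..t}. ennreal (\<bar>K\<sigma> s t - K\<sigma>' s t\<bar> powr (2 * (p / (p - 2)))) \<partial>lborel)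
          \<le> ennreal \<nu>' \<Longrightarrow>
      t \<in> {0..T} \<Longrightarrow>
      (\<integral>\<^sup>+\<omega>. ennreal (norm (X t \<omega> - X' t \<omega>) powr p) \<partial>M)
        \<le> ennreal C * ((\<integral>\<^sup>+\<omega>. ennreal (norm (X0 \<omega> - X0' \<omega>) powr p) \<partial>M)
            + ennreal (\<beta> powr p + \<kappa>' powr (p - 1) + \<nu>' powr ((p - 2) / 2)))"
      by (rule solution_difference_bound[OF p(1) \<eta> H adm(1,2) adm'(1,2) kb(1) \<kappa>\<nu>(1) k\<sigma>(1) \<kappa>\<nu>(2) c
        less_imp_le[OF \<Lambda>] growth(3,4) lip(1,2)]) (assumption | rule that)+
    \<comment> \<open>The factor \<open>2 powr p + 1\<close> pays for splitting the common
      coefficient bound into its drift and diffusion parts; the final 1 makes the constant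
      positive.\<close>
    define C' where "C' = C * (2 powr p + 1) + 1"
    have C': "0 < C'" using C by (simp add: C'_def add_nonneg_pos)
    show "\<exists>C>0. \<forall>X0 X0' X X'.
           X0 \<in> borel_measurable (F 0) \<longrightarrow> X0' \<in> borel_measurable (F 0) \<longrightarrow>
           integrable M (\<lambda>\<omega>. norm (X0 \<omega>) powr p) \<longrightarrow>
           integrable M (\<lambda>\<omega>. norm (X0' \<omega>) powr p) \<longrightarrow>
           (\<integral>\<omega>. norm (X0 \<omega>) powr p \<partial>M) \<le> R0 \<longrightarrow>
           (\<integral>\<omega>. norm (X0' \<omega>) powr p \<partial>M) \<le> R0 \<longrightarrow>
           strong_Lp_solution M T F B p Kb K\<sigma> b \<sigma> X0 X \<longrightarrow>
           strong_Lp_solution M T F B p Kb' K\<sigma>' b' \<sigma>' X0' X' \<longrightarrow>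
           (SUP t\<in>{0..T}. \<integral>\<^sup>+\<omega>. ennreal (norm (X t \<omega> - X' t \<omega>) powr p) \<partial>M)
             \<le> ennreal C *
                ((\<integral>\<^sup>+\<omega>. ennreal (norm (X0 \<omega> - X0' \<omega>) powr p) \<partial>M)
                 + ennreal_powr (coeff_sup_norm T \<eta> (\<lambda>t x \<rho>. b t x \<rho> - b' t x \<rho>)) p
                 + ennreal_powr (coeff_sup_norm T \<eta> (\<lambda>t x \<rho>. \<sigma> t x \<rho> - \<sigma>' t x \<rho>)) p
                 + ennreal_powr (kernel_norm T q (\<lambda>s t. Kb s t - Kb' s t)) p
                 + ennreal_powr (kernel_norm T (2 * q') (\<lambda>s t. K\<sigma> s t - K\<sigma>' s t)) p)"
    proof (intro exI[of _ C'] conjI C' allI impI SUP_least)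
      fix X0 X0' :: "'w \<Rightarrow> real ^ 'd" and X X' t
      assume X0: "X0 \<in> borel_measurable (F 0)" "integrable M (\<lambda>\<omega>. norm (X0 \<omega>) powr p)" "(\<integral>\<omega>. norm (X0 \<omega>)
          powr p \<partial>M) \<le> R0"
        and X0': "X0' \<in> borel_measurable (F 0)" "integrable M (\<lambda>\<omega>. norm (X0' \<omega>) powr p)" "(\<integral>\<omega>. norm (X0'
            \<omega>) powr p \<partial>M) \<le> R0"
        and sol: "strong_Lp_solution M T F B p Kb K\<sigma> b \<sigma> X0 X"
            and sol': "strong_Lp_solution M T F B p Kb' K\<sigma>' b' \<sigma>' X0' X'"
        and t: "t \<in> {0..T}"
      have z: "0 \<in> {0..T}" using T0 by simp
      note mX0 = measurable_F_M[OF z X0(1)] and mX0' = measurable_F_M[OF z X0'(1)]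
      have mom: "(\<integral>\<^sup>+\<omega>. ennreal (norm (U \<omega>) powr p) \<partial>M) \<le> ennreal R"
        if "integrable M (\<lambda>\<omega>. norm (U \<omega>) powr p)" "(\<integral>\<omega>. norm (U \<omega>) powr p \<partial>M) \<le> R0"
            for U :: "'w \<Rightarrow> real ^ 'd"
        using that by (subst nn_integral_eq_integral) (auto simp: R_def intro!: ennreal_leI)
      note m0 = mom[OF X0(2,3)] and m0' = mom[OF X0'(2,3)]
      have f0: "(\<integral>\<^sup>+\<omega>. ennreal (norm (X0 \<omega>) powr p) \<partial>M) < \<infinity>" "(\<integral>\<^sup>+\<omega>. ennreal (norm (X0' \<omega>) powr p) \<partial>M) <
          \<infinity>"
        using order.strict_trans1[OF m0, of \<infinity>] order.strict_trans1[OF m0', of \<infinity>] by simp_all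
      let ?e = "\<integral>\<^sup>+\<omega>. ennreal (norm (X0 \<omega> - X0' \<omega>) powr p) \<partial>M"
      have e: "?e < \<infinity>"
        by (rule order.strict_trans1[OF law_distance_le(2)[OF mX0 f0(1) mX0' f0(2) \<eta>]])
          (use f0 in \<open>simp add: ennreal_mult_less_top\<close>)
      have XH: "\<forall>s\<in>{0..T}. (\<integral>\<^sup>+\<omega>. ennreal (norm (X s \<omega>) powr p) \<partial>M) \<le> ennreal H"
        using H1(2)[OF mX0 m0 sol] by (auto simp: H_def intro!: order_trans[OF _ ennreal_leI[OF
          max.cobounded1]])
      have XH': "\<forall>s\<in>{0..T}. (\<integral>\<^sup>+\<omega>. ennreal (norm (X' s \<omega>) powr p) \<partial>M) \<le> ennreal H"
        using H2(2)[OF mX0' m0' sol'] by (auto simp: H_def intro!: order_trans[OF _ ennreal_leI[OF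
          max.cobounded2]])
      let ?nb = "coeff_sup_norm T \<eta> (\<lambda>t x \<rho>. b t x \<rho> - b' t x \<rho>)" and ?ns
          = "coeff_sup_norm T \<eta> (\<lambda>t x \<rho>. \<sigma> t x \<rho> - \<sigma>' t x \<rho>)"
      let ?Sb = "SUP t\<in>{0..T}. \<integral>\<^sup>+s\<in>{0..t}. ennreal (\<bar>Kb s t - Kb' s t\<bar> powr q) \<partial>lborel"
      let ?Ss = "SUP t\<in>{0..T}. \<integral>\<^sup>+s\<in>{0..t}. ennreal (\<bar>K\<sigma> s t - K\<sigma>' s t\<bar> powr (2 * q')) \<partial>lborel"
      let ?kb = "ennreal_powr (kernel_norm T q (\<lambda>s t. Kb s t - Kb' s t)) p" and ?ks
          = "ennreal_powr (kernel_norm T (2 * q') (\<lambda>s t. K\<sigma> s t - K\<sigma>' s t)) p"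
      show "(\<integral>\<^sup>+\<omega>. ennreal (norm (X t \<omega> - X' t \<omega>) powr p) \<partial>M)
          \<le> ennreal C' * (?e + ennreal_powr ?nb p + ennreal_powr ?ns p + ?kb + ?ks)"
      proof (cases "?nb = \<infinity> \<or> ?ns = \<infinity> \<or> ?Sb = \<infinity> \<or> ?Ss = \<infinity>")
        \<comment> \<open>If one of the norms is infinite, then so is the right-hand side, because
          its factor \<open>C'\<close> is positive. Otherwise all norms are real numbers.\<close>
        case True
        then have "ennreal_powr ?nb p = \<infinity> \<or> ennreal_powr ?ns p = \<infinity> \<or> ?kb = \<infinity> \<or> ?ks = \<infinity>"
          using kernel_norm_infinite[where T = T and a = q and h = "\<lambda>s t. Kb s t - Kb' s t" and p
            = p] kernel_norm_infinite[where T = T and a = "2 * q'" and h = "\<lambda>s t. K\<sigma> s t - K\<sigma>' s t"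
                and p = p]
          by (auto simp: ennreal_powr_def)
        then have "ennreal C' * (?e + ennreal_powr ?nb p + ennreal_powr ?ns p + ?kb + ?ks) = \<infinity>"
          using C' by (auto simp: ennreal_mult_eq_top_iff)
        then show ?thesis by simp
      next
        case False
        then obtain \<beta>1 \<beta>2 \<kappa>' \<nu>' where nb: "?nb = ennreal \<beta>1" "0 \<le> \<beta>1" and ns: "?ns = ennreal \<beta>2" "0
            \<le> \<beta>2"
          and Sb: "?Sb = ennreal \<kappa>'" "0 \<le> \<kappa>'" and Ss: "?Ss = ennreal \<nu>'" "0 \<le> \<nu>'"
          by (cases ?nb; cases ?ns; cases ?Sb; cases ?Ss) auto
        \<comment> \<open>The difference estimate takes one bound for both coefficients; the sum of
          the two suprema serves and is separated again at the end.\<close>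
        have d: "\<forall>s\<in>{0..T}. \<forall>x. \<forall>\<rho>\<in>wasserstein_space (real \<eta>). norm (b s x \<rho> - b' s x \<rho>) \<le> \<beta>1 + \<beta>2 \<and>
            norm (\<sigma> s x \<rho> - \<sigma>' s x \<rho>) \<le> \<beta>1 + \<beta>2"
        proof (intro ballI allI)
          fix s x and \<rho> :: "(real ^ 'd) measure" assume s: "s \<in> {0..T}"
              and \<rho>: "\<rho> \<in> wasserstein_space (real \<eta>)"
          have "ennreal (norm (b s x \<rho> - b' s x \<rho>)) \<le> ennreal \<beta>1" "ennreal (norm (\<sigma> s x \<rho> - \<sigma>' s x \<rho>))
              \<le> ennreal \<beta>2"
            using coeff_sup_norm_upper[OF s \<rho>, where f = "\<lambda>t x \<rho>. b t x \<rho> - b' t x \<rho>" and x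
              = x] coeff_sup_norm_upper[OF s \<rho>, where f = "\<lambda>t x \<rho>. \<sigma> t x \<rho> - \<sigma>' t x \<rho>" and x = x]
            unfolding nb ns by simp_all
          then show "norm (b s x \<rho> - b' s x \<rho>) \<le> \<beta>1 + \<beta>2 \<and> norm (\<sigma> s x \<rho> - \<sigma>' s x \<rho>) \<le> \<beta>1 + \<beta>2"
            using nb ns by (simp add: ennreal_le_iff)
        qed
        have k1: "\<forall>t\<in>{0..T}. (\<integral>\<^sup>+s\<in>{0..t}. ennreal (\<bar>Kb s t - Kb' s t\<bar> powr (p / (p - 1))) \<partial>lborel)
            \<le> ennreal \<kappa>'"
          unfolding Sb(1)[symmetric] assms(9)[symmetric] by (intro ballI SUP_upper)
        have k2: "\<forall>t\<in>{0..T}. (\<integral>\<^sup>+s\<in>{0..t}. ennreal (\<bar>K\<sigma> s t - K\<sigma>' s t\<bar> powr (2 * (p / (p - 2))))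
            \<partial>lborel) \<le> ennreal \<nu>'"
          unfolding Ss(1)[symmetric] assms(10)[symmetric] by (intro ballI SUP_upper)
        \<comment> \<open>Since \<kappa>' is the supremum before the root is taken, the p-th power
          of the kernel norm is \<kappa>' to the power p / q = p - 1, which is the exponent in the
          difference estimate. The diffusion kernel is treated alike with p / (2 q') = (p - 2) /
          2.\<close>
        have kb: "?kb = ennreal (\<kappa>' powr (p - 1))"
          using ennreal_powr_kernel_norm[OF q(1) Sb, where p = p] unfolding q(3) .
        have ks: "?ks = ennreal (\<nu>' powr ((p - 2) / 2))"
          using ennreal_powr_kernel_norm[OF q'(1) Ss, where p = p] unfolding q'(3) .
        have pb: "ennreal_powr ?nb p = ennreal (\<beta>1 powr p)" "ennreal_powr ?ns p = ennreal (\<beta>2 powr p)"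
          using nb ns by (simp_all add: ennreal_powr_def)
        obtain x where x: "?e = ennreal x" "0 \<le> x" using e by (cases ?e) auto
        have "(\<integral>\<^sup>+\<omega>. ennreal (norm (X t \<omega> - X' t \<omega>) powr p) \<partial>M)
            \<le> ennreal C * (?e + ennreal ((\<beta>1 + \<beta>2) powr p + \<kappa>' powr (p - 1) + \<nu>' powr ((p - 2) / 2)))"
          using nb(2) ns(2) by (intro diff[OF mX0 mX0' e sol sol' XH XH' _ d Sb(2) k1 Ss(2) k2 t]) simp
        also have "\<dots> = ennreal (C * (x + ((\<beta>1 + \<beta>2) powr p + \<kappa>' powr (p - 1) + \<nu>' powr ((p - 2) / 2))))"
          unfolding x(1) using C x(2) by (simp add: ennreal_mult[symmetric] ennreal_plus[symmetric] del:
            ennreal_plus)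
        also have "\<dots> \<le> ennreal (C' * (x + \<beta>1 powr p + \<beta>2 powr p + \<kappa>' powr (p - 1) + \<nu>' powr ((p - 2) /
            2)))"
        proof (rule ennreal_leI)
          let ?m = "2 powr p + 1 :: real" and ?r
              = "x + \<beta>1 powr p + \<beta>2 powr p + \<kappa>' powr (p - 1) + \<nu>' powr ((p - 2) / 2)"
          have m: "1 \<le> ?m" "2 powr p \<le> ?m" by simp_all
          have le: "u \<le> ?m * u" if "0 \<le> u" for u using mult_right_mono[OF m(1) that] by simp
          have "(\<beta>1 + \<beta>2) powr p \<le> 2 powr p * (\<beta>1 powr p + \<beta>2 powr p)"
            using nb ns p by (intro powr_add_le) auto
          also have "\<dots> \<le> ?m * (\<beta>1 powr p + \<beta>2 powr p)" by (intro mult_right_mono m) auto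
          finally have "x + ((\<beta>1 + \<beta>2) powr p + \<kappa>' powr (p - 1) + \<nu>' powr ((p - 2) / 2))
              \<le> ?m * x + (?m * (\<beta>1 powr p + \<beta>2 powr p) + ?m * \<kappa>' powr (p - 1) + ?m * \<nu>' powr ((p - 2) /
                  2))"
            using x(2) by (intro add_mono le) auto
          also have "\<dots> = ?m * ?r" by (simp add: distrib_left)
          finally have "C * (x + ((\<beta>1 + \<beta>2) powr p + \<kappa>' powr (p - 1) + \<nu>' powr ((p - 2) / 2)))
              \<le> C * (?m * ?r)"
            using C by (rule mult_left_mono)
          also have "\<dots> \<le> C' * ?r"
            unfolding C'_def mult.assoc[symmetric] using x(2)
              by (intro mult_right_mono add_nonneg_nonneg) auto
          finally show "C * (x + ((\<beta>1 + \<beta>2) powr p + \<kappa>' powr (p - 1) + \<nu>' powr ((p - 2) / 2)))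
              \<le> C' * ?r" .
        qed
        also have "\<dots> = ennreal C' * (?e + ennreal_powr ?nb p + ennreal_powr ?ns p + ?kb + ?ks)"
          unfolding x(1) pb kb ks using C' x(2)
          by (simp add: ennreal_mult[symmetric] ennreal_plus[symmetric] del: ennreal_plus)
        finally show ?thesis .
      qed
    qed
  qed
qed

end
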